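(* Let $n\ge 2$, let $U\subset\mathbb C^n$ be a domain and let $W$ be an $(n+2)$-web of codimension $1$ on $U$. Then there exists a unique projective connection $\Pi_W$ on $U$ compatible with $W$. Moreover, the following assertions are equivalent: (i) $W$ is linearizable; (ii) $\Pi_W$ is flat; (iii) the curvature $\mathfrak C(W)\in \Omega^2_U\otimes \mathfrak{sl}_{n+1}(\mathbb C)$ of $\Pi_W$ is identically zero.
   Context: Everything is holomorphic (complex analytic). "Domain" means connected and simply connected open subset, with coordinates $x^1,\dots,x^n$. Webs. A $d$-web of codimension 1 on $U$ is an ordered $d$-tuple $W=(\mathcal F_1,\dots,\mathcal F_d)$ of regular (non-singular) holomorphic foliations of codimension 1 on $U$ whose tangent spaces are in general position at every point: if $\mathcal F_i$ is defined by the nowhere vanishing integrable 1-form $\omega_i$, then at every point any $\min(n,d)$ of the $\omega_i$ are linearly independent. $W$ is linear if all leaves of its foliations are (open pieces of) affine hyperplanes of $\mathbb C^n$. $W$ is linearizable if there are a point $m\in U$ and a germ of biholomorphism $\varphi:(U,m)\to(\mathbb C^n,\varphi(m))$ such that $\varphi_*(W)$ is a germ of linear web. Projective connections. A geodesic curve of a holomorphic affine connection $\nabla$ on $T_U$ is a curve admitting locally a parametrization $c(t)$ with $\nabla_{dc/dt}(dc/dt)=0$. Two affine connections are projectively equivalent if they have the same geodesic curves; a projective connection $\Pi$ on $U$ is a projective equivalence class $[\nabla]$ of affine connections on $U$. A submanifold $V\subset U$ is totally geodesic for $\Pi=[\nabla]$ if for every $v\in V$ and every tangent direction $L\in\mathbb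 P T_{V,v}$ the germ at $v$ of the geodesic curve of $\nabla$ tangent to $L$ is contained in $V$ (independent of the representative $\nabla$). $\Pi$ is compatible with $W$ if all leaves of all foliations of $W$ are totally geodesic for $\Pi$. $\Pi$ is flat (integrable) if locally it is equivalent, by a biholomorphism, to the projective connection on $\mathbb C^n$ represented by the affine connection with zero Christoffel symbols (whose geodesics are the straight lines). Thomas coefficients. In coordinates $x^1,\dots,x^n$, $\Pi$ has a unique representative that is torsion-free and trace-free; its Christoffel symbols are the Thomas coefficients $\Pi^k_{ij}$. If $\Gamma^k_{ij}$ are the Christoffel symbols of any torsion-free representative, $\Pi^k_{ij}=\Gamma^k_{ij}-\frac1{n+1}\big(\delta^k_i\sum_\ell\Gamma^\ell_{\ell j}+\delta^k_j\sum_\ell\Gamma^\ell_{i\ell}\big)$; they satisfy $\Pi^k_{ij}=\Pi^k_{ji}$ and $\sum_\ell\Pi^\ell_{\ell j}=0$. Curvature. The curvature of $\Pi$ is the curvature $d\omega+\omega\wedge\omega$ of the normal torsion-free projective Cartan connection associated with $\Pi$. In the coordinates $x^i$ (standard gauge) this Cartan connection is the $\mathfrak{sl}_{n+1}(\mathbb C)$-valued 1-form $$\omega=\begin{pmatrix}0&\omega_i\\ dx^k&\omega^k_i\end{pmatrix},\qquad \omega^k_i=\sum_j\Pi^k_{ij}\,dx^j,\qquad \omega_i=\frac1{1-n}\sum_j\Pi_{ij}\,dx^j,$$ where $\Pi_{jk}=\sum_m\frac{\partial \Pi^m_{jk}}{\partial x^m}-\sum_{m,s}\Pi^s_{jm}\Pi^m_{sk}$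 ($k$ is the row index, $i$ the column index). $\mathfrak C(W)$ denotes the curvature of $\Pi_W$. *)

theory Defs
  imports "HOL-Analysis.Analysis"
begin

section \<open>Holomorphic functions and maps on open subsets of complex n-space\<close>

text \<open>Complex differentiability at every point of an open set, i.e. a real Frechet derivative
  that is complex linear.\<close>

definition holo_fun :: "(complex^'n \<Rightarrow> complex) \<Rightarrow> (complex^'n) set \<Rightarrow> bool" where
  "holo_fun f S \<longleftrightarrow>
     (\<forall>x\<in>S. \<exists>f'. (f has_derivative f') (at x) \<and> (\<forall>a v. f' (a *s v) = a * f' v))"

definition holo_map :: "(complex^'n \<Rightarrow> complex^'m) \<Rightarrow> (complex^'n) set \<Rightarrow> bool" where
  "holo_map f S \<longleftrightarrow> (\<forall>k. holo_fun (\<lambda>x. f x $ k) S)"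

definition partial :: "'n \<Rightarrow> (complex^'n \<Rightarrow> complex) \<Rightarrow> complex^'n \<Rightarrow> complex" where
  "partial i f x = deriv (\<lambda>z. f (x + axis i z)) 0"

definition jacobian :: "(complex^'n \<Rightarrow> complex^'m) \<Rightarrow> complex^'n \<Rightarrow> complex^'n^'m" where
  "jacobian f x = (\<chi> k i. partial i (\<lambda>y. f y $ k) x)"

definition biholomorphism ::
    "(complex^'n) set \<Rightarrow> (complex^'n \<Rightarrow> complex^'n) \<Rightarrow> (complex^'n) set \<Rightarrow> bool" where
  "biholomorphism V \<phi> V' \<longleftrightarrow> open V \<and> open V' \<and> bij_betw \<phi> V V' \<and>
     holo_map \<phi> V \<and> holo_map (inv_into V \<phi>) V'"

definition complex_domain :: "(complex^'n) set \<Rightarrow> bool" where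
  "complex_domain U \<longleftrightarrow> open U \<and> U \<noteq> {} \<and> connected U \<and> simply_connected U"


section \<open>Foliations of codimension one and webs\<close>

text \<open>A foliation is encoded by its field of tangent hyperplanes; only the values on the ambient
  open set matter. A cotangent vector is identified with its vector of components.\<close>

type_synonym 'n foliation = "complex^'n \<Rightarrow> (complex^'n) set"

definition covector_kernel :: "complex^'n \<Rightarrow> (complex^'n) set" where
  "covector_kernel a = {v. (\<Sum>i\<in>UNIV. a $ i * v $ i) = 0}"

definition differential :: "(complex^'n \<Rightarrow> complex) \<Rightarrow> complex^'n \<Rightarrow> complex^'n" where
  "differential u x = (\<chi> i. partial i u x)"

definition distinguished ::
    "(complex^'n) set \<Rightarrow> 'n foliation \<Rightarrow> (complex^'n) set \<Rightarrow> (complex^'n \<Rightarrow> complex) \<Rightarrow> bool" where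
  "distinguished U F V u \<longleftrightarrow> open V \<and> V \<subseteq> U \<and> holo_fun u V \<and>
     (\<forall>x\<in>V. differential u x \<noteq> 0 \<and> F x = covector_kernel (differential u x))"

text \<open>A regular holomorphic foliation of codimension one, given by an atlas of submersions; on
  overlaps the submersions are compatible because their differentials have the same kernel.\<close>

definition foliation :: "(complex^'n) set \<Rightarrow> 'n foliation \<Rightarrow> bool" where
  "foliation U F \<longleftrightarrow> (\<forall>p\<in>U. \<exists>V u. p \<in> V \<and> distinguished U F V u)"

text \<open>Leaves are the connected components for the leaf topology, in which the level sets of the
  distinguished submersions are open. This topology is finer than the subspace topology, as a
  leaf need not be embedded.\<close>

definition leaf_topology :: "(complex^'n) set \<Rightarrow> 'n foliation \<Rightarrow> (complex^'n) topology" where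
  "leaf_topology U F =
     topology_generated_by {{x\<in>V. u x = c} | V u c. distinguished U F V u}"

definition leaves :: "(complex^'n) set \<Rightarrow> 'n foliation \<Rightarrow> (complex^'n) set set" where
  "leaves U F = connected_components_of (leaf_topology U F)"

text \<open>A d-web is the tuple \<open>W 0, \<dots>, W (d - 1)\<close>. In the definition, \<open>\<alpha> i\<close> is the value at \<open>x\<close> of
  a form defining the foliation \<open>W i\<close>.\<close>

definition web :: "nat \<Rightarrow> (complex^'n) set \<Rightarrow> (nat \<Rightarrow> 'n foliation) \<Rightarrow> bool" where
  "web d U W \<longleftrightarrow> (\<forall>i<d. foliation U (W i)) \<and>
     (\<forall>x\<in>U. \<forall>\<alpha>. (\<forall>i<d. \<alpha> i \<noteq> 0 \<and> W i x = covector_kernel (\<alpha> i)) \<longrightarrow>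
        (\<forall>I \<subseteq> {..<d}. card I = min CARD('n) d \<longrightarrow> inj_on \<alpha> I \<and> vec.independent (\<alpha> ` I)))"

definition linear_web :: "nat \<Rightarrow> (complex^'n) set \<Rightarrow> (nat \<Rightarrow> 'n foliation) \<Rightarrow> bool" where
  "linear_web d U W \<longleftrightarrow> (\<forall>i<d. \<forall>L\<in>leaves U (W i).
     \<exists>a b. a \<noteq> 0 \<and> openin (top_of_set {x. (\<Sum>j\<in>UNIV. a $ j * x $ j) = b}) L)"

definition push_foliation ::
    "(complex^'n) set \<Rightarrow> (complex^'n \<Rightarrow> complex^'n) \<Rightarrow> 'n foliation \<Rightarrow> 'n foliation" where
  "push_foliation V \<phi> F y =
     (let x = inv_into V \<phi> y in (\<lambda>v. jacobian \<phi> x *v v) ` F x)"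

definition linearizable :: "nat \<Rightarrow> (complex^'n) set \<Rightarrow> (nat \<Rightarrow> 'n foliation) \<Rightarrow> bool" where
  "linearizable d U W \<longleftrightarrow> (\<exists>m\<in>U. \<exists>V \<phi>. m \<in> V \<and> V \<subseteq> U \<and> biholomorphism V \<phi> (\<phi> ` V) \<and>
     linear_web d (\<phi> ` V) (\<lambda>i. push_foliation V \<phi> (W i)))"


section \<open>Affine and projective connections\<close>

text \<open>An affine connection is encoded by its Christoffel symbols: \<open>\<Gamma> x k i j\<close> is the k-th component
  at \<open>x\<close> of the covariant derivative of the j-th coordinate field along the i-th one. Torsion is
  allowed.\<close>

type_synonym 'n christoffel = "complex^'n \<Rightarrow> 'n \<Rightarrow> 'n \<Rightarrow> 'n \<Rightarrow> complex"

definition affine_connection :: "(complex^'n) set \<Rightarrow> 'n christoffel \<Rightarrow> bool" where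
  "affine_connection U \<Gamma> \<longleftrightarrow> (\<forall>k i j. holo_fun (\<lambda>x. \<Gamma> x k i j) U)"

definition velocity :: "(complex \<Rightarrow> complex^'n) \<Rightarrow> complex \<Rightarrow> complex^'n" where
  "velocity c t = (\<chi> k. deriv (\<lambda>s. c s $ k) t)"

text \<open>Immersed complex curves with affine parametrization.\<close>

definition affine_geodesic ::
    "(complex^'n) set \<Rightarrow> 'n christoffel \<Rightarrow> complex set \<Rightarrow> (complex \<Rightarrow> complex^'n) \<Rightarrow> bool" where
  "affine_geodesic U \<Gamma> D c \<longleftrightarrow> open D \<and> c ` D \<subseteq> U \<and> (\<forall>k. (\<lambda>t. c t $ k) holomorphic_on D) \<and>
     (\<forall>t\<in>D. velocity c t \<noteq> 0 \<and>
        (\<forall>k. velocity (velocity c) t $ k +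
           (\<Sum>i\<in>UNIV. \<Sum>j\<in>UNIV. \<Gamma> (c t) k i j * velocity c t $ i * velocity c t $ j) = 0))"

text \<open>Unparametrized geodesics: connected embedded complex curves that admit locally an affine
  parametrization.\<close>

definition geodesic_curve ::
    "(complex^'n) set \<Rightarrow> 'n christoffel \<Rightarrow> (complex^'n) set \<Rightarrow> bool" where
  "geodesic_curve U \<Gamma> C \<longleftrightarrow> C \<noteq> {} \<and> connected C \<and> C \<subseteq> U \<and>
     (\<forall>p\<in>C. \<exists>W D c g. open W \<and> p \<in> W \<and> affine_geodesic U \<Gamma> D c \<and> homeomorphism D (C \<inter> W) c g)"

definition proj_equivalent ::
    "(complex^'n) set \<Rightarrow> 'n christoffel \<Rightarrow> 'n christoffel \<Rightarrow> bool" where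
  "proj_equivalent U \<Gamma> \<Gamma>' \<longleftrightarrow> (\<forall>C. geodesic_curve U \<Gamma> C \<longleftrightarrow> geodesic_curve U \<Gamma>' C)"

definition proj_rel :: "(complex^'n) set \<Rightarrow> ('n christoffel \<times> 'n christoffel) set" where
  "proj_rel U = {(\<Gamma>, \<Gamma>'). affine_connection U \<Gamma> \<and> affine_connection U \<Gamma>' \<and> proj_equivalent U \<Gamma> \<Gamma>'}"

lemma equiv_proj_rel: "equiv {\<Gamma>. affine_connection U \<Gamma>} (proj_rel U)"
  by (auto simp: equiv_def refl_on_def sym_def trans_def proj_rel_def proj_equivalent_def)

type_synonym 'n projective_connection = "'n christoffel set"

definition projective_connections :: "(complex^'n) set \<Rightarrow> 'n projective_connection set" where
  "projective_connections U = {\<Gamma>. affine_connection U \<Gamma>} // proj_rel U"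

text \<open>Here \<open>M\<close> is an immersed submanifold of \<open>U\<close>, with its intrinsic topology, and \<open>T v\<close> is its
  tangent space at \<open>v\<close>. The germ of a geodesic lies in \<open>M\<close> if it lies in every intrinsic
  neighbourhood of the base point; for an embedded \<open>M\<close> this is plain inclusion in the
  carrier of \<open>M\<close>.\<close>

definition totally_geodesic ::
    "(complex^'n) set \<Rightarrow> 'n christoffel \<Rightarrow> (complex^'n) topology \<Rightarrow>
     (complex^'n \<Rightarrow> (complex^'n) set) \<Rightarrow> bool" where
  "totally_geodesic U \<Gamma> M T \<longleftrightarrow>
     (\<forall>v\<in>topspace M. \<forall>D c t.
        affine_geodesic U \<Gamma> D c \<and> t \<in> D \<and> c t = v \<and> velocity c t \<in> T v \<longrightarrow>
        (\<forall>P. openin M P \<and> v \<in> P \<longrightarrow> (\<forall>\<^sub>F s in nhds t. c s \<in> P)))"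

definition compatible ::
    "nat \<Rightarrow> (complex^'n) set \<Rightarrow> 'n projective_connection \<Rightarrow> (nat \<Rightarrow> 'n foliation) \<Rightarrow> bool" where
  "compatible d U \<PP> W \<longleftrightarrow> (\<forall>\<Gamma>\<in>\<PP>. \<forall>i<d. \<forall>L\<in>leaves U (W i).
     totally_geodesic U \<Gamma> (subtopology (leaf_topology U (W i)) L) (W i))"

definition web_connection ::
    "nat \<Rightarrow> (complex^'n) set \<Rightarrow> (nat \<Rightarrow> 'n foliation) \<Rightarrow> 'n projective_connection" where
  "web_connection d U W = (THE \<PP>. \<PP> \<in> projective_connections U \<and> compatible d U \<PP> W)"

text \<open>Transformation law of the Christoffel symbols under a local biholomorphism.\<close>

definition pullback_connection ::
    "(complex^'n \<Rightarrow> complex^'n) \<Rightarrow> 'n christoffel \<Rightarrow> 'n christoffel" where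
  "pullback_connection \<phi> \<Gamma> x k i j =
     (\<Sum>c\<in>UNIV. matrix_inv (jacobian \<phi> x) $ k $ c *
        (partial i (partial j (\<lambda>y. \<phi> y $ c)) x +
         (\<Sum>a\<in>UNIV. \<Sum>b\<in>UNIV. \<Gamma> (\<phi> x) c a b * jacobian \<phi> x $ a $ i * jacobian \<phi> x $ b $ j)))"

definition proj_flat :: "(complex^'n) set \<Rightarrow> 'n projective_connection \<Rightarrow> bool" where
  "proj_flat U \<PP> \<longleftrightarrow> (\<forall>p\<in>U. \<exists>V \<phi>. p \<in> V \<and> V \<subseteq> U \<and> biholomorphism V \<phi> (\<phi> ` V) \<and>
     (\<forall>\<Gamma>\<in>\<PP>. proj_equivalent V \<Gamma> (pullback_connection \<phi> (\<lambda>_ _ _ _. 0))))"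


section \<open>Thomas coefficients and the normal Cartan connection\<close>

text \<open>The torsion-free and trace-free representative is unique on \<open>U\<close>; it is set to zero
  elsewhere so that it is unique as a total function.\<close>

definition thomas :: "(complex^'n) set \<Rightarrow> 'n projective_connection \<Rightarrow> 'n christoffel" where
  "thomas U \<PP> = (THE \<Gamma>. \<Gamma> \<in> \<PP> \<and>
     (\<forall>x\<in>U. \<forall>k i j. \<Gamma> x k i j = \<Gamma> x k j i) \<and>
     (\<forall>x\<in>U. \<forall>j. (\<Sum>l\<in>UNIV. \<Gamma> x l l j) = 0) \<and>
     (\<forall>x k i j. x \<notin> U \<longrightarrow> \<Gamma> x k i j = 0))"

definition thomas_ricci :: "'n christoffel \<Rightarrow> complex^'n \<Rightarrow> 'n \<Rightarrow> 'n \<Rightarrow> complex" where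
  "thomas_ricci P x j k =
     (\<Sum>m\<in>UNIV. partial m (\<lambda>y. P y m j k) x) -
     (\<Sum>m\<in>UNIV. \<Sum>s\<in>UNIV. P x s j m * P x m s k)"

text \<open>\<open>cartan_form P x j\<close> is the coefficient of the j-th coordinate differential in the
  matrix-valued form. The n + 1 rows and columns are indexed by \<open>'n option\<close>, the first one
  being \<open>None\<close>.\<close>

definition cartan_form ::
    "'n::finite christoffel \<Rightarrow> complex^'n \<Rightarrow> 'n \<Rightarrow> complex^('n option)^('n option)" where
  "cartan_form P x j = (\<chi> r c.
     case r of
       None \<Rightarrow> (case c of None \<Rightarrow> 0
                | Some i \<Rightarrow> 1 / (1 - of_nat CARD('n)) * thomas_ricci P x i j)
     | Some k \<Rightarrow> (case c of None \<Rightarrow> (if k = j then 1 else 0)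
                | Some i \<Rightarrow> P x k i j))"

text \<open>The value of the curvature 2-form \<open>d\<omega> + \<omega> \<and> \<omega>\<close> on the j-th and k-th coordinate fields.\<close>

definition curvature ::
    "(complex^'n::finite) set \<Rightarrow> 'n projective_connection \<Rightarrow> complex^'n \<Rightarrow> 'n \<Rightarrow> 'n \<Rightarrow>
     complex^('n option)^('n option)" where
  "curvature U \<PP> x j k =
     (let \<omega> = cartan_form (thomas U \<PP>) in
       (\<chi> r c. partial j (\<lambda>y. \<omega> y k $ r $ c) x - partial k (\<lambda>y. \<omega> y j $ r $ c) x) +
       (\<omega> x j ** \<omega> x k - \<omega> x k ** \<omega> x j))"

end

theory Submission
  imports Defs "HOL-Complex_Analysis.Conformal_Mappings"
begin

text \<open>Write \<open>n = CARD('n)\<close>. The whole statement is reduced to a pointwise condition. Let a foliation be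
given near \<open>x\<close> by the level sets of \<open>u\<close>. A geodesic that starts tangent to a leaf stays in it exactly
if the second derivative of \<open>u\<close> along it keeps vanishing, and the geodesic equation turns this into
\<open>Hess u(v, v) = du(\<Gamma>(v, v))\<close> for all \<open>v\<close> with \<open>du(v) = 0\<close>. This is the predicate \<open>tangency\<close>, and
\<open>totally_geodesic_of_tangency\<close> and \<open>tangency_of_totally_geodesic\<close> show that it is equivalent to the
leaves being totally geodesic. It involves the connection only through the quadratic map
\<open>v \<mapsto> \<Gamma>(v, v)\<close> up to multiples of \<open>v\<close>, which is the same datum as the projective class
(\<open>proj_equivalent_iff_similar\<close>).

Existence and uniqueness are then linear algebra at a point. In a frame dual to \<open>n\<close> of the \<open>n + 2\<close>
conormals the other two become covectors all of whose entries and \<open>2 \<times> 2\<close> minors are nonzero. The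
first \<open>n\<close> conditions fix the components \<open>\<Gamma>\<^sup>k\<^sub>l\<^sub>m\<close> with \<open>k\<close> different from \<open>l\<close> and \<open>m\<close>, and the last two
give for every pair \<open>l \<noteq> m\<close> a regular \<open>2 \<times> 2\<close> system for the mixed components in terms of the diagonal
ones, which are the projective freedom (\<open>coord_unique\<close>, \<open>web_B_extra\<close>). The solution is
holomorphic in \<open>x\<close>. It becomes unique, hence globally defined, once it is made symmetric and
trace free; this yields the Thomas symbol \<open>web_symbol\<close>.

For the equivalences, a chart \<open>\<phi>\<close> straightens the leaves iff the zero symbol satisfies the tangency
condition for the image web (\<open>tangency_of_linear_leaves\<close>, \<open>linear_leaves_of_tangency\<close>), iff the flat
connection pulled back by \<open>\<phi>\<close> satisfies it for \<open>W\<close> (\<open>tangency_transport\<close>), iff by uniqueness \<open>\<phi>\<close> carries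
\<open>\<Pi>\<^sub>W\<close> to the flat projective connection. So linearizable means flat near some point, and flat means the
same near every point.

Finally, the Cartan form is, up to transposition, the connection form of the linear system
\<open>\<partial>\<^sub>i \<partial>\<^sub>j F = \<Sum>\<^sub>k P\<^sup>k\<^sub>i\<^sub>j \<partial>\<^sub>k F + \<rho>\<^sub>i\<^sub>j F\<close> for one function \<open>F\<close>, and its curvature vanishes iff the system is
integrable. If it is, then there are \<open>n + 1\<close> independent solutions and their quotients are flat
coordinates (\<open>flat_coordinates\<close>). If \<open>\<phi>\<close> is a flat chart, then a suitable power \<open>f\<close> of its Jacobian
determinant and the products \<open>f \<phi>\<^sup>a\<close> solve such a system with some \<open>\<rho>\<close>; integrability then forces \<open>\<rho>\<close> to
be the normalized one, where \<open>n \<ge> 2\<close> enters (\<open>curvature_of_flat\<close>). The curvature is holomorphic, so it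
vanishes on the connected set \<open>U\<close> as soon as it vanishes near one point, which leads from a single
linearizing chart to flatness everywhere.\<close>

section \<open>Calculus of functions of several complex variables\<close>

definition pairing :: "complex^'n \<Rightarrow> complex^'n \<Rightarrow> complex" where
  "pairing a v = (\<Sum>i\<in>UNIV. a $ i * v $ i)"

lemma covector_kernel_iff: "v \<in> covector_kernel a \<longleftrightarrow> pairing a v = 0"
  by (simp add: covector_kernel_def pairing_def)

lemma pairing_simps [simp]:
  "pairing (a + b) v = pairing a v + pairing b v"
  "pairing a (v + w) = pairing a v + pairing a w"
  "pairing (a - b) v = pairing a v - pairing b v"
  "pairing a (v - w) = pairing a v - pairing a w"
  "pairing (- a) v = - pairing a v"
  "pairing a (- v) = - pairing a v"
  "pairing (c *s a) v = c * pairing a v"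
  "pairing a (c *s v) = c * pairing a v"
  "pairing 0 v = 0" "pairing a 0 = 0"
  by (simp_all add: pairing_def algebra_simps sum.distrib sum_subtractf sum_negf sum_distrib_left)

lemma pairing_sum_left: "pairing (\<Sum>k\<in>A. f k) v = (\<Sum>k\<in>A. pairing (f k) v)"
  by (induction A rule: infinite_finite_induct) auto

lemma pairing_sum_right: "pairing a (\<Sum>k\<in>A. f k) = (\<Sum>k\<in>A. pairing a (f k))"
  by (induction A rule: infinite_finite_induct) auto

lemma pairing_axis [simp]: "pairing a (axis i z) = a $ i * z" "pairing (axis i z) a = z * a $ i"
  by (simp_all add: pairing_def axis_def if_distrib if_distribR cong: if_cong)

lemma norm_scale_vec [simp]: "norm (z *s (v :: complex^'n)) = cmod z * norm v"
  by (simp add: norm_vec_def norm_mult L2_set_right_distrib)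

lemma scaleR_vec_eq: "r *\<^sub>R (v :: complex^'n) = of_real r *s v"
  by (simp add: vec_eq_iff scaleR_conv_of_real[where 'a = complex])

lemma norm_vec_le_sum: "norm (x :: complex^'n) \<le> (\<Sum>i\<in>UNIV. norm (x $ i))"
  unfolding norm_vec_def by (rule L2_set_le_sum) auto

lemma norm_comp_le: "norm (x $ i) \<le> norm (x :: complex^'n)"
  by (rule Finite_Cartesian_Product.norm_nth_le)

lemma has_derivative_vecI:
  fixes f :: "'a::real_normed_vector \<Rightarrow> complex^'m"
  assumes "\<And>k. ((\<lambda>x. f x $ k) has_derivative (\<lambda>h. f' h $ k)) (at x within S)"
  shows "(f has_derivative f') (at x within S)"
  unfolding has_derivative_componentwise_within[of f f']
proof
  fix b :: "complex^'m" assume "b \<in> Basis"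
  then obtain k c where "b = axis k c" by (auto simp: Basis_vec_def)
  then show "((\<lambda>x. f x \<bullet> b) has_derivative (\<lambda>x. f' x \<bullet> b)) (at x within S)"
    using has_derivative_inner_left[OF assms[of k], of c] by (simp add: inner_axis)
qed

definition has_grad :: "(complex^'n \<Rightarrow> complex) \<Rightarrow> complex^'n \<Rightarrow> complex^'n \<Rightarrow> bool" where
  "has_grad f a x \<longleftrightarrow> (f has_derivative pairing a) (at x)"

definition cdiff_at :: "(complex^'n \<Rightarrow> complex) \<Rightarrow> complex^'n \<Rightarrow> bool" where
  "cdiff_at f x \<longleftrightarrow> (\<exists>a. has_grad f a x)"

lemma has_derivative_curve:
  fixes c :: "complex \<Rightarrow> complex^'n"
  assumes "\<And>k. ((\<lambda>s. c s $ k) has_field_derivative w $ k) (at t)"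
  shows "(c has_derivative (\<lambda>h. h *s w)) (at t)"
  by (rule has_derivative_vecI) (use assms in \<open>simp add: has_field_derivative_def mult_commute_abs\<close>)

lemma has_grad_curve:
  assumes "has_grad f a (c t)" "\<And>k. ((\<lambda>s. c s $ k) has_field_derivative w $ k) (at t)"
  shows "((\<lambda>s. f (c s)) has_field_derivative pairing a w) (at t)"
proof -
  have "((\<lambda>s. f (c s)) has_derivative (\<lambda>h. pairing a (h *s w))) (at t)"
    using has_derivative_compose[OF has_derivative_curve[OF assms(2)]] assms(1)
    unfolding has_grad_def by blast
  then show ?thesis by (simp add: has_field_derivative_def mult_commute_abs)
qed

lemma has_grad_line:
  assumes "has_grad f a (x + z *s v)"
  shows "((\<lambda>z. f (x + z *s v)) has_field_derivative pairing a v) (at z)"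
  by (rule has_grad_curve[where c = "\<lambda>z. x + z *s v", OF assms])
     (auto intro!: derivative_eq_intros)

lemma scale_axis [simp]: "z *s axis i w = axis i (z * w :: complex)"
  by (simp add: vec_eq_iff axis_def)

lemma axis_zero [simp]: "axis i 0 = (0 :: complex^'n)"
  by (simp add: vec_eq_iff axis_def)

lemma partial_has_grad:
  assumes "has_grad f a x"
  shows "partial i f x = a $ i"
proof -
  have "((\<lambda>z. f (x + z *s axis i 1)) has_field_derivative pairing a (axis i 1)) (at 0)"
    using assms by (intro has_grad_line) simp
  then show ?thesis
    unfolding partial_def by (simp add: DERIV_imp_deriv)
qed

lemma differential_has_grad: "has_grad f a x \<Longrightarrow> differential f x = a"
  by (simp add: differential_def partial_has_grad vec_eq_iff)

lemma cdiff_at_iff: "cdiff_at f x \<longleftrightarrow> has_grad f (differential f x) x"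
  using differential_has_grad unfolding cdiff_at_def by blast

lemma differential_nth [simp]: "differential f x $ i = partial i f x"
  by (simp add: differential_def)

lemma vec_sum_axis: "v = (\<Sum>i\<in>UNIV. v $ i *s axis i (1::complex))"
  by (rule basis_expansion[symmetric])

lemma holo_fun_iff: "holo_fun f S \<longleftrightarrow> (\<forall>x\<in>S. cdiff_at f x)"
proof -
  have "(\<exists>f'. (f has_derivative f') (at x) \<and> (\<forall>a v. f' (a *s v) = a * f' v)) \<longleftrightarrow> cdiff_at f x" for x
  proof
    assume "\<exists>f'. (f has_derivative f') (at x) \<and> (\<forall>a v. f' (a *s v) = a * f' v)"
    then obtain f' where f': "(f has_derivative f') (at x)" "\<And>a v. f' (a *s v) = a * f' v" by blast
    then interpret linear f' by (simp add: has_derivative_def bounded_linear.linear)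
    have "f' = pairing (\<chi> i. f' (axis i 1))"
    proof
      fix v
      have "f' v = f' (\<Sum>i\<in>UNIV. v $ i *s axis i 1)" by (simp only: basis_expansion)
      also have "\<dots> = pairing (\<chi> i. f' (axis i 1)) v"
        by (simp add: sum f'(2) pairing_def mult.commute del: scale_axis)
      finally show "f' v = pairing (\<chi> i. f' (axis i 1)) v" .
    qed
    then show "cdiff_at f x" using f'(1) unfolding cdiff_at_def has_grad_def by metis
  next
    assume "cdiff_at f x"
    then show "\<exists>f'. (f has_derivative f') (at x) \<and> (\<forall>a v. f' (a *s v) = a * f' v)"
      unfolding cdiff_at_def has_grad_def using pairing_simps(8) by blast
  qed
  then show ?thesis by (simp add: holo_fun_def)
qed

lemma holo_funD: "holo_fun f S \<Longrightarrow> x \<in> S \<Longrightarrow> cdiff_at f x"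
  by (simp add: holo_fun_iff)

lemma holo_fun_subset: "holo_fun f S \<Longrightarrow> T \<subseteq> S \<Longrightarrow> holo_fun f T"
  by (auto simp: holo_fun_iff)

subsection \<open>Differentiation rules\<close>

lemma has_grad_const: "has_grad (\<lambda>x. c) 0 x"
  unfolding has_grad_def by (rule has_derivative_eq_rhs[OF has_derivative_const]) auto

lemma has_grad_coord: "has_grad (\<lambda>x. x $ k) (axis k 1) x"
  unfolding has_grad_def
  by (rule has_derivative_eq_rhs[OF bounded_linear_imp_has_derivative[OF bounded_linear_vec_nth]]) auto

lemma has_grad_add: "has_grad f a x \<Longrightarrow> has_grad g b x \<Longrightarrow> has_grad (\<lambda>x. f x + g x) (a + b) x"
  unfolding has_grad_def by (rule has_derivative_eq_rhs[OF has_derivative_add]) auto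

lemma has_grad_diff: "has_grad f a x \<Longrightarrow> has_grad g b x \<Longrightarrow> has_grad (\<lambda>x. f x - g x) (a - b) x"
  unfolding has_grad_def by (rule has_derivative_eq_rhs[OF has_derivative_diff]) auto

lemma has_grad_minus: "has_grad f a x \<Longrightarrow> has_grad (\<lambda>x. - f x) (- a) x"
  unfolding has_grad_def by (rule has_derivative_eq_rhs[OF has_derivative_minus]) auto

lemma has_grad_mult:
  "has_grad f a x \<Longrightarrow> has_grad g b x \<Longrightarrow> has_grad (\<lambda>x. f x * g x) (f x *s b + g x *s a) x"
  unfolding has_grad_def by (rule has_derivative_eq_rhs[OF has_derivative_mult]) auto

lemma has_grad_chain1:
  "has_grad f a x \<Longrightarrow> (g has_field_derivative d) (at (f x)) \<Longrightarrow> has_grad (\<lambda>x. g (f x)) (d *s a) x"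
  unfolding has_grad_def has_field_derivative_def
  using has_derivative_compose[of f "pairing a" x UNIV g "(*) d"]
  by (simp add: has_derivative_eq_rhs[of _ _ _ "pairing (d *s a)"] fun_eq_iff)

lemma has_grad_compose:
  assumes "has_grad g a (\<Phi> x)" "\<And>k. has_grad (\<lambda>x. \<Phi> x $ k) (J k) x"
  shows "has_grad (\<lambda>x. g (\<Phi> x)) (\<Sum>k\<in>UNIV. a $ k *s J k) x"
proof -
  have "(\<Phi> has_derivative (\<lambda>h. \<chi> k. pairing (J k) h)) (at x)"
    using assms(2) by (intro has_derivative_vecI) (simp add: has_grad_def[abs_def] eta_contract_eq)
  from has_derivative_compose[OF this assms(1)[unfolded has_grad_def]] show ?thesis
    unfolding has_grad_def
    by (rule has_derivative_eq_rhs) (auto simp: pairing_sum_left fun_eq_iff, simp add: pairing_def)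
qed

lemma has_grad_transform:
  assumes "has_grad f a x" "open S" "x \<in> S" "\<And>y. y \<in> S \<Longrightarrow> f y = g y"
  shows "has_grad g a x"
  using assms has_derivative_transform_within_open unfolding has_grad_def by blast

lemma cdiff_const [simp]: "cdiff_at (\<lambda>x. c) x" using has_grad_const cdiff_at_def by blast
lemma cdiff_coord [simp]: "cdiff_at (\<lambda>x. x $ k) x" using has_grad_coord cdiff_at_def by blast
lemma cdiff_add [simp]: "cdiff_at f x \<Longrightarrow> cdiff_at g x \<Longrightarrow> cdiff_at (\<lambda>x. f x + g x) x"
  using has_grad_add unfolding cdiff_at_def by blast
lemma cdiff_diff [simp]: "cdiff_at f x \<Longrightarrow> cdiff_at g x \<Longrightarrow> cdiff_at (\<lambda>x. f x - g x) x"
  using has_grad_diff unfolding cdiff_at_def by blast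
lemma cdiff_minus [simp]: "cdiff_at f x \<Longrightarrow> cdiff_at (\<lambda>x. - f x) x"
  using has_grad_minus unfolding cdiff_at_def by blast
lemma cdiff_mult [simp]: "cdiff_at f x \<Longrightarrow> cdiff_at g x \<Longrightarrow> cdiff_at (\<lambda>x. f x * g x) x"
  using has_grad_mult unfolding cdiff_at_def by blast
lemma cdiff_sum [simp]: "(\<And>k. k \<in> A \<Longrightarrow> cdiff_at (f k) x) \<Longrightarrow> cdiff_at (\<lambda>x. \<Sum>k\<in>A. f k x) x"
  by (induction A rule: infinite_finite_induct) auto
lemma cdiff_prod [simp]: "(\<And>k. k \<in> A \<Longrightarrow> cdiff_at (f k) x) \<Longrightarrow> cdiff_at (\<lambda>x. \<Prod>k\<in>A. f k x) x"
  by (induction A rule: infinite_finite_induct) auto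
lemma cdiff_divide [simp]:
  assumes "cdiff_at f x" "cdiff_at g x" "g x \<noteq> 0"
  shows "cdiff_at (\<lambda>x. f x / g x) x"
proof -
  obtain b where "has_grad g b x" using assms cdiff_at_def by blast
  then have "has_grad (\<lambda>x. inverse (g x)) (- (inverse (g x ^ 2)) *s b) x"
    using assms(3) by (intro has_grad_chain1) (auto intro!: derivative_eq_intros simp: power2_eq_square)
  then have "cdiff_at (\<lambda>x. inverse (g x)) x" using cdiff_at_def by blast
  then show ?thesis using assms by (simp add: divide_inverse)
qed
lemma cdiff_compose:
  assumes "cdiff_at g (\<Phi> x)" "\<And>k. cdiff_at (\<lambda>x. \<Phi> x $ k) x"
  shows "cdiff_at (\<lambda>x. g (\<Phi> x)) x"
proof -
  have "has_grad (\<lambda>x. g (\<Phi> x)) (\<Sum>k\<in>UNIV. differential g (\<Phi> x) $ k *s differential (\<lambda>x. \<Phi> x $ k) x) x"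
    using assms by (intro has_grad_compose) (auto simp: cdiff_at_iff)
  then show ?thesis unfolding cdiff_at_def by blast
qed
lemma cdiff_transform:
  assumes "cdiff_at f x" "open S" "x \<in> S" "\<And>y. y \<in> S \<Longrightarrow> f y = g y"
  shows "cdiff_at g x"
  using assms has_grad_transform unfolding cdiff_at_def by blast

lemma partial_const [simp]: "partial i (\<lambda>x. c) x = 0"
  by (simp add: partial_has_grad[OF has_grad_const])
lemma partial_coord [simp]: "partial i (\<lambda>x. x $ k) x = (if i = k then 1 else 0)"
  by (simp add: partial_has_grad[OF has_grad_coord] axis_def)
lemma partial_add:
  "cdiff_at f x \<Longrightarrow> cdiff_at g x \<Longrightarrow> partial i (\<lambda>x. f x + g x) x = partial i f x + partial i g x"
  unfolding cdiff_at_iff by (drule (1) has_grad_add, drule partial_has_grad[where i = i]) simp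
lemma partial_diff:
  "cdiff_at f x \<Longrightarrow> cdiff_at g x \<Longrightarrow> partial i (\<lambda>x. f x - g x) x = partial i f x - partial i g x"
  unfolding cdiff_at_iff by (drule (1) has_grad_diff, drule partial_has_grad[where i = i]) simp
lemma partial_minus: "cdiff_at f x \<Longrightarrow> partial i (\<lambda>x. - f x) x = - partial i f x"
  unfolding cdiff_at_iff by (drule has_grad_minus, drule partial_has_grad[where i = i]) simp
lemma partial_mult:
  "cdiff_at f x \<Longrightarrow> cdiff_at g x \<Longrightarrow>
   partial i (\<lambda>x. f x * g x) x = f x * partial i g x + g x * partial i f x"
  unfolding cdiff_at_iff by (drule (1) has_grad_mult, drule partial_has_grad[where i = i]) simp
lemma partial_sum:
  "(\<And>k. k \<in> A \<Longrightarrow> cdiff_at (f k) x) \<Longrightarrow>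
   partial i (\<lambda>x. \<Sum>k\<in>A. f k x) x = (\<Sum>k\<in>A. partial i (f k) x)"
  by (induction A rule: infinite_finite_induct) (auto simp: partial_add)
lemma partial_compose:
  assumes "cdiff_at g (\<Phi> x)" "\<And>k. cdiff_at (\<lambda>x. \<Phi> x $ k) x"
  shows "partial i (\<lambda>x. g (\<Phi> x)) x = (\<Sum>k\<in>UNIV. partial k g (\<Phi> x) * partial i (\<lambda>x. \<Phi> x $ k) x)"
  using partial_has_grad[OF has_grad_compose[of g _ \<Phi> x "\<lambda>k. differential (\<lambda>x. \<Phi> x $ k) x"]] assms
  by (simp add: cdiff_at_iff)

lemma partial_cong:
  assumes "open S" "x \<in> S" "\<And>y. y \<in> S \<Longrightarrow> f y = g y"
  shows "partial i f x = partial i g x"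
proof -
  have "isCont (\<lambda>z. x + z *s axis i (1::complex)) 0"
    by (intro has_derivative_continuous[OF has_derivative_curve[where w = "axis i 1"]])
       (auto intro!: derivative_eq_intros simp del: scale_axis)
  then have "((\<lambda>z. x + z *s axis i 1) \<longlongrightarrow> x) (nhds (0::complex))"
    using tendsto_nhds_iff[of "\<lambda>z. x + z *s axis i 1" x 0] by (simp add: isCont_def)
  then have "\<forall>\<^sub>F z in nhds 0. x + z *s axis i 1 \<in> S"
    using assms(1,2) by (rule topological_tendstoD)
  then show ?thesis
    unfolding partial_def by (intro deriv_cong_ev) (auto elim!: eventually_mono simp: assms(3))
qed

lemma holo_fun_cong:
  assumes "open S" "\<And>y. y \<in> S \<Longrightarrow> f y = g y"
  shows "holo_fun f S \<longleftrightarrow> holo_fun g S"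
  using cdiff_transform[of f _ S g] cdiff_transform[of g _ S f] assms by (auto simp: holo_fun_iff)

lemma cdiff_continuous: "cdiff_at f x \<Longrightarrow> isCont f x"
  unfolding cdiff_at_def has_grad_def using has_derivative_continuous by blast

lemma holo_fun_continuous: "holo_fun f S \<Longrightarrow> continuous_on S f"
  by (rule continuous_at_imp_continuous_on) (auto simp: holo_fun_iff intro: cdiff_continuous)

lemma holo_map_continuous: "holo_map \<phi> S \<Longrightarrow> continuous_on S \<phi>"
  using continuous_on_vec_lambda[of S "\<lambda>k x. \<phi> x $ k"]
  by (auto simp: holo_map_def intro: holo_fun_continuous)

lemma holo_mapD: "holo_map \<phi> S \<Longrightarrow> x \<in> S \<Longrightarrow> cdiff_at (\<lambda>y. \<phi> y $ k) x"
  by (simp add: holo_map_def holo_fun_iff)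

lemma curve_deriv:
  assumes "cdiff_at f (c t)" "\<And>k. ((\<lambda>s. c s $ k) has_field_derivative w $ k) (at t)"
  shows "((\<lambda>s. f (c s)) has_field_derivative pairing (differential f (c t)) w) (at t)"
  using assms by (intro has_grad_curve) (auto simp: cdiff_at_iff)

section \<open>Cauchy estimates and their consequences\<close>

lemma norm_axis_complex [simp]: "norm (axis i z) = cmod z"
  by (simp add: norm_vec_def L2_set_def axis_def if_distrib[of norm] if_distrib[of "\<lambda>x. x\<^sup>2"] cong: if_cong)

lemma differential_diff:
  "cdiff_at f x \<Longrightarrow> cdiff_at g x \<Longrightarrow> differential (\<lambda>x. f x - g x) x = differential f x - differential g x"
  by (simp add: vec_eq_iff partial_diff)

lemma holo_line:
  assumes "holo_fun f S" "\<And>z. z \<in> T \<Longrightarrow> x + z *s v \<in> S"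
  shows "(\<lambda>z. f (x + z *s v)) holomorphic_on T"
    and "\<And>z. z \<in> T \<Longrightarrow> deriv (\<lambda>z. f (x + z *s v)) z = pairing (differential f (x + z *s v)) v"
proof -
  have *: "((\<lambda>z. f (x + z *s v)) has_field_derivative pairing (differential f (x + z *s v)) v) (at z)"
    if "z \<in> T" for z
    using assms that by (intro has_grad_line) (auto simp: holo_fun_iff cdiff_at_iff)
  show "(\<lambda>z. f (x + z *s v)) holomorphic_on T"
    using * by (metis DERIV_subset holomorphic_on_def field_differentiable_def subset_UNIV)
  show "\<And>z. z \<in> T \<Longrightarrow> deriv (\<lambda>z. f (x + z *s v)) z = pairing (differential f (x + z *s v)) v"
    using * DERIV_imp_deriv by blast
qed

lemma higher_deriv_bound_line:
  assumes "holo_fun f S" "ball x r \<subseteq> S" "0 < r" "\<And>y. y \<in> ball x r \<Longrightarrow> cmod (f y) \<le> M" "v \<noteq> 0"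
  shows "cmod ((deriv ^^ k) (\<lambda>z. f (x + z *s v)) 0) \<le> fact k * M / (r / (2 * norm v)) ^ k"
proof (rule Cauchy_inequality)
  let ?R = "r / (2 * norm v)"
  have in_ball: "x + z *s v \<in> ball x r" if "cmod z \<le> ?R" for z
  proof -
    have "cmod z * norm v \<le> r / 2" using that assms(5) by (simp add: field_simps)
    then show ?thesis using assms(3) by (simp add: dist_norm)
  qed
  have hol: "(\<lambda>z. f (x + z *s v)) holomorphic_on cball 0 ?R"
    using in_ball assms(2) by (intro holo_line[OF assms(1)]) auto
  then show "(\<lambda>z. f (x + z *s v)) holomorphic_on ball 0 ?R"
    by (rule holomorphic_on_subset) auto
  show "continuous_on (cball 0 ?R) (\<lambda>z. f (x + z *s v))"
    using hol by (rule holomorphic_on_imp_continuous_on)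
  show "0 < ?R" using assms by simp
  show "cmod (f (x + z *s v)) \<le> M" if "cmod (0 - z) = ?R" for z
    using in_ball[of z] that assms(4) by auto
qed

text \<open>Cauchy's inequality on the complex line through \<open>x\<close> in direction \<open>v\<close>. The radius is halved to keep
  the closed disc inside the ball, whence the factor 2.\<close>

lemma grad_bound:
  assumes "holo_fun f S" "ball x r \<subseteq> S" "0 < r" "\<And>y. y \<in> ball x r \<Longrightarrow> cmod (f y) \<le> M"
  shows "cmod (pairing (differential f x) v) \<le> 2 * M / r * norm v"
proof (cases "v = 0")
  case False
  have "x \<in> S" using assms(2,3) by auto
  then have "deriv (\<lambda>z. f (x + z *s v)) 0 = pairing (differential f x) v"
    using holo_line(2)[OF assms(1), of "{0}" x v 0] by simp
  then show ?thesis using higher_deriv_bound_line[OF assms False, of 1] by (simp add: field_simps)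
qed simp

lemma holo_fun_diff: "holo_fun f S \<Longrightarrow> holo_fun g S \<Longrightarrow> holo_fun (\<lambda>x. f x - g x) S"
  by (simp add: holo_fun_iff)

lemma holo_lipschitz:
  assumes "holo_fun f S" "ball x0 (2 * r) \<subseteq> S" "0 < r" "\<And>y. y \<in> ball x0 (2 * r) \<Longrightarrow> cmod (f y) \<le> M"
    "x \<in> ball x0 r" "y \<in> ball x0 r"
  shows "cmod (f x - f y) \<le> 2 * M / r * norm (x - y)"
proof (rule differentiable_bound[of "ball x0 r" f "\<lambda>x. pairing (differential f x)"])
  fix z assume z: "z \<in> ball x0 r"
  have b: "ball z r \<subseteq> ball x0 (2 * r)"
  proof
    fix w assume "w \<in> ball z r" then show "w \<in> ball x0 (2 * r)"
      using z dist_triangle[of x0 w z] by auto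
  qed
  have "z \<in> S" using z b assms(2,3) by (meson centre_in_ball subsetD)
  then show "(f has_derivative pairing (differential f z)) (at z within ball x0 r)"
    using assms(1) by (auto simp: holo_fun_iff cdiff_at_iff has_grad_def intro: has_derivative_at_withinI)
  show "onorm (pairing (differential f z)) \<le> 2 * M / r"
    using assms b by (intro onorm_le grad_bound[OF assms(1)]) auto
qed (use assms in auto)

text \<open>By the Cauchy estimate the differentials converge locally uniformly along with the functions, so
  limit and derivative can be interchanged.\<close>

lemma holo_uniform_limit_aux:
  assumes "open S" "\<And>n. holo_fun (f n) S" "uniform_limit S f g sequentially" "x \<in> S"
  shows "\<exists>A. has_grad g A x \<and> (\<forall>i. (\<lambda>n. partial i (f n) x) \<longlonglongrightarrow> A $ i)"
proof -
  obtain r where r: "r > 0" "ball x (2 * r) \<subseteq> S"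
    using assms(1,4) by (metis openE field_sum_of_halves mult_2 half_gt_zero)
  let ?B = "ball x r"
  have sub: "ball y r \<subseteq> S" if "y \<in> ?B" for y
  proof
    fix w assume "w \<in> ball y r" then show "w \<in> S"
      using that dist_triangle[of x w y] r(2) by auto
  qed
  have yS: "y \<in> S" if "y \<in> ?B" for y using sub[OF that] r(1) by auto
  have cauchy: "\<exists>N. \<forall>m\<ge>N. \<forall>n\<ge>N. \<forall>y\<in>?B. \<forall>v.
      cmod (pairing (differential (f n) y - differential (f m) y) v) \<le> e * norm v" if "e > 0" for e
  proof -
    have "e * r / 4 > 0" using that r by simp
    then obtain N where N: "\<And>n y. n \<ge> N \<Longrightarrow> y \<in> S \<Longrightarrow> dist (f n y) (g y) < e * r / 4"
      using assms(3) unfolding uniform_limit_iff eventually_sequentially by meson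
    have "cmod (pairing (differential (f n) y - differential (f m) y) v) \<le> e * norm v"
      if "m \<ge> N" "n \<ge> N" "y \<in> ?B" for m n y v
    proof -
      have "cmod (f n w - f m w) \<le> e * r / 2" if "w \<in> ball y r" for w
        using N[of n w] N[of m w] dist_triangle2[of "f n w" "f m w" "g w"] sub[OF \<open>y \<in> ?B\<close>] that
          \<open>m \<ge> N\<close> \<open>n \<ge> N\<close> by (auto simp: dist_norm)
      from grad_bound[OF holo_fun_diff[OF assms(2) assms(2)] sub[OF that(3)] r(1) this, of v]
      show ?thesis using r(1) assms(2) yS[OF that(3)] by (simp add: differential_diff holo_funD[of _ S])
    qed
    then show ?thesis by blast
  qed
  define A where "A y = (\<chi> i. lim (\<lambda>n. partial i (f n) y))" for y
  have conv: "(\<lambda>n. partial i (f n) y) \<longlonglongrightarrow> A y $ i" if y: "y \<in> ?B" for y i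
  proof -
    have "Cauchy (\<lambda>n. partial i (f n) y)"
    proof (rule metric_CauchyI)
      fix e :: real assume "e > 0"
      then obtain N where N: "\<And>m n v. m \<ge> N \<Longrightarrow> n \<ge> N \<Longrightarrow>
         cmod (pairing (differential (f n) y - differential (f m) y) v) \<le> e/2 * norm v"
        using cauchy[of "e/2"] y by (metis half_gt_zero)
      show "\<exists>M. \<forall>m\<ge>M. \<forall>n\<ge>M. dist (partial i (f m) y) (partial i (f n) y) < e"
      proof (intro exI allI impI)
        fix m n assume mn: "N \<le> m" "N \<le> n"
        have "norm (axis i (1::complex)) = 1" by (simp add: norm_axis_complex)
        then show "dist (partial i (f m) y) (partial i (f n) y) < e"
          using N[OF mn(2) mn(1), of "axis i 1"] \<open>e > 0\<close> by (simp add: dist_norm)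
      qed
    qed
    then show ?thesis by (simp add: A_def Cauchy_convergent_iff flip: convergent_LIMSEQ_iff)
  qed
  have convp: "(\<lambda>n. pairing (differential (f n) y) v) \<longlonglongrightarrow> pairing (A y) v" if "y \<in> ?B" for y v
    unfolding pairing_def by (auto intro!: tendsto_intros conv that)
  have "\<exists>g0. \<forall>y\<in>?B. (\<lambda>n. f n y) \<longlonglongrightarrow> g0 y \<and> (g0 has_derivative pairing (A y)) (at y within ?B)"
  proof (rule has_derivative_sequence)
    show "(f n has_derivative pairing (differential (f n) y)) (at y within ?B)" if "y \<in> ?B" for n y
      using assms(2)[of n] yS[OF that]
      by (auto simp: holo_fun_iff cdiff_at_iff has_grad_def intro: has_derivative_at_withinI)
    show "(\<lambda>n. f n x) \<longlonglongrightarrow> g x" using tendsto_uniform_limitI[OF assms(3,4)] .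
    show "x \<in> ?B" using r by simp
    fix e :: real assume "e > 0"
    then obtain N where N: "\<And>m n y v. m \<ge> N \<Longrightarrow> n \<ge> N \<Longrightarrow> y \<in> ?B \<Longrightarrow>
         cmod (pairing (differential (f n) y - differential (f m) y) v) \<le> e * norm v"
      using cauchy[of e] by blast
    have "cmod (pairing (differential (f n) y) v - pairing (A y) v) \<le> e * norm v"
      if "n \<ge> N" "y \<in> ?B" for n y v
    proof (rule Lim_bounded)
      show "(\<lambda>m. cmod (pairing (differential (f n) y) v - pairing (differential (f m) y) v))
           \<longlonglongrightarrow> cmod (pairing (differential (f n) y) v - pairing (A y) v)"
        by (intro tendsto_intros convp that)
      show "\<forall>m\<ge>N. cmod (pairing (differential (f n) y) v - pairing (differential (f m) y) v) \<le> e * norm v"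
        using N that by (metis pairing_simps(3))
    qed
    then show "\<forall>\<^sub>F n in sequentially. \<forall>y\<in>?B. \<forall>h. cmod (pairing (differential (f n) y) h - pairing (A y) h) \<le> e * norm h"
      unfolding eventually_sequentially by blast
  qed simp
  then obtain g0 where g0: "\<And>y. y \<in> ?B \<Longrightarrow> (\<lambda>n. f n y) \<longlonglongrightarrow> g0 y"
    "\<And>y. y \<in> ?B \<Longrightarrow> (g0 has_derivative pairing (A y)) (at y within ?B)" by blast
  have "g0 y = g y" if "y \<in> ?B" for y
    using g0(1)[OF that] tendsto_uniform_limitI[OF assms(3) yS[OF that]] LIMSEQ_unique by blast
  moreover have "has_grad g0 (A x) x"
    using g0(2)[of x] r(1) unfolding has_grad_def by (simp add: at_within_open[of x ?B])
  ultimately have "has_grad g (A x) x"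
    using has_grad_transform[of g0 "A x" x ?B g] r(1) by auto
  then show ?thesis using conv[of x] r(1) by auto
qed

text \<open>Weierstrass: holomorphy survives uniform limits, and the derivatives converge too.\<close>

lemma holo_uniform_limit:
  assumes "open S" "\<And>n. holo_fun (f n) S" "uniform_limit S f g sequentially"
  shows "holo_fun g S" and "\<And>x i. x \<in> S \<Longrightarrow> (\<lambda>n. partial i (f n) x) \<longlonglongrightarrow> partial i g x"
  using holo_uniform_limit_aux[OF assms] partial_has_grad[of g]
  unfolding holo_fun_iff cdiff_at_def by metis+

text \<open>The difference quotients along a coordinate axis converge locally uniformly, so that
  the previous result applies to them.\<close>

lemma holo_partial_aux:
  assumes "open S" "holo_fun f S" "x0 \<in> S"
  obtains r h where "r > 0" "ball x0 r \<subseteq> S" "\<And>n. h n \<noteq> 0" "h \<longlonglongrightarrow> (0::complex)"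
    "\<And>n y. y \<in> ball x0 r \<Longrightarrow> y + axis j (h n) \<in> S"
    "uniform_limit (ball x0 r) (\<lambda>n y. (f (y + axis j (h n)) - f y) / h n) (partial j f) sequentially"
proof -
  obtain r0 where r0: "r0 > 0" "cball x0 r0 \<subseteq> S"
    using assms(1,3) open_contains_cball by blast
  define r where "r = r0 / 4"
  have r: "r > 0" "cball x0 (4 * r) \<subseteq> S" using r0 by (auto simp: r_def)
  have "compact (f ` cball x0 (4 * r))"
    by (intro compact_continuous_image continuous_on_subset[OF holo_fun_continuous[OF assms(2)] r(2)]) simp
  then obtain M where M: "\<And>y. y \<in> cball x0 (4 * r) \<Longrightarrow> cmod (f y) \<le> M"
    by (meson bounded_iff compact_imp_bounded image_eqI)
  have M0: "M \<ge> 0" using M[of x0] r(1) norm_ge_zero[of "f x0"] by (simp del: norm_ge_zero)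
  define h where "h n = complex_of_real (r / real (Suc n))" for n
  have h0: "h n \<noteq> 0" for n using r(1) by (simp add: h_def del: of_nat_Suc)
  have hr: "cmod (h n) \<le> r" for n
    using r(1) unfolding h_def norm_of_real by (simp add: field_simps)
  have hlim: "h \<longlonglongrightarrow> 0"
    unfolding h_def using tendsto_of_real[OF LIMSEQ_Suc[OF lim_const_over_n[of r]], where 'a = complex] by simp
  let ?e = "axis j (1::complex)"
  have ne: "norm ?e = 1" by (simp add: norm_axis_complex)
  have inS: "y + z *s ?e \<in> ball x0 (3*r)" if "y \<in> ball x0 r" "cmod z \<le> 2 * r" for y z
  proof -
    have "dist x0 (y + z *s ?e) \<le> dist x0 y + cmod z"
      using dist_triangle[of x0 "y + z *s ?e" y] ne by (simp add: dist_norm)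
    then show ?thesis using that by simp
  qed
  have S3: "ball x0 (3*r) \<subseteq> S" using r by (auto intro!: subsetD[OF r(2)])
  define B where "B = 8 * M / r\<^sup>2"
  have est: "cmod ((f (y + axis j z) - f y) / z - partial j f y) \<le> B * cmod z"
    if y: "y \<in> ball x0 r" and z: "z \<noteq> 0" "cmod z \<le> r" for y z
  proof -
    let ?\<phi> = "\<lambda>z. f (y + z *s ?e)"
    have hol: "?\<phi> holomorphic_on ball 0 (2 * r)"
      using inS[OF y] S3 by (intro holo_line(1)[OF assms(2)]) auto
    have hd: "((deriv ^^ i) ?\<phi> has_field_derivative (deriv ^^ Suc i) ?\<phi> w) (at w within cball 0 r)"
      if "w \<in> cball 0 r" for i w
    proof -
      have "(deriv ^^ i) ?\<phi> holomorphic_on ball 0 (2 * r)"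
        by (intro holomorphic_higher_deriv hol) simp
      then have "((deriv ^^ i) ?\<phi> has_field_derivative (deriv ^^ Suc i) ?\<phi> w) (at w)"
        using that r(1) by (auto intro!: holomorphic_derivI)
      then show ?thesis by (rule has_field_derivative_at_within)
    qed
    have bd: "cmod ((deriv ^^ Suc 1) ?\<phi> w) \<le> B" if "w \<in> cball 0 r" for w
    proof -
      have b: "ball (y + w *s ?e) r \<subseteq> cball x0 (4 * r)"
      proof
        fix u assume u: "u \<in> ball (y + w *s ?e) r"
        have "dist x0 (y + w *s ?e) \<le> dist x0 y + cmod w"
          using dist_triangle[of x0 "y + w *s ?e" y] ne by (simp add: dist_norm)
        then show "u \<in> cball x0 (4 * r)"
          using u y that dist_triangle[of x0 u "y + w *s ?e"] r(1) by simp
      qed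
      have "cmod ((deriv ^^ 2) (\<lambda>z. f (y + w *s ?e + z *s ?e)) 0) \<le> fact 2 * M / (r / (2 * norm ?e)) ^ 2"
        using b r by (intro higher_deriv_bound_line[OF assms(2)] M) auto
      also have "(deriv ^^ 2) (\<lambda>z. f (y + w *s ?e + z *s ?e)) 0 = (deriv ^^ 2) ?\<phi> w"
      proof -
        have *: "(\<lambda>z. f (y + w *s ?e + z *s ?e)) = (\<lambda>z. ?\<phi> (w + z))"
          by (simp add: vector_sadd_rdistrib add.assoc del: scale_axis)
        show ?thesis unfolding * using higher_deriv_shift_0[of 2 ?\<phi> w] by (simp add: o_def)
      qed
      also have "fact 2 * M / (r / (2 * norm ?e)) ^ 2 = B"
        by (simp add: ne B_def power2_eq_square field_simps)
      finally show ?thesis by (simp add: numeral_2_eq_2)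
    qed
    have "cmod ((deriv ^^ 0) ?\<phi> z - (\<Sum>i\<le>1. (deriv ^^ i) ?\<phi> 0 * (z - 0) ^ i / fact i))
        \<le> B * cmod (z - 0) ^ Suc 1 / fact 1"
      by (rule complex_Taylor[where S = "cball 0 r"]) (use hd bd r z in auto)
    moreover have "deriv ?\<phi> 0 = partial j f y"
      unfolding partial_def by simp
    ultimately have "cmod (f (y + z *s ?e) - f y - partial j f y * z) \<le> B * cmod z * cmod z"
      by (simp add: diff_diff_eq power2_eq_square mult.assoc)
    moreover have "(f (y + axis j z) - f y) / z - partial j f y = (f (y + z *s ?e) - f y - partial j f y * z) / z"
      using z by (simp add: field_simps)
    ultimately show ?thesis using z by (simp add: norm_divide divide_le_eq)
  qed
  show thesis
  proof
    show "r > 0" by fact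
    show "ball x0 r \<subseteq> S" using r by (auto intro!: subsetD[OF r(2)])
    show "h n \<noteq> 0" for n by (rule h0)
    show "h \<longlonglongrightarrow> 0" by (rule hlim)
    show "y + axis j (h n) \<in> S" if "y \<in> ball x0 r" for n y
      using inS[OF that, of "h n"] hr[of n] r(1) S3 by (auto)
    show "uniform_limit (ball x0 r) (\<lambda>n y. (f (y + axis j (h n)) - f y) / h n) (partial j f) sequentially"
    proof (rule uniform_limitI)
      fix e :: real assume "e > 0"
      have "(\<lambda>n. B * cmod (h n)) \<longlonglongrightarrow> B * cmod 0" by (intro tendsto_intros hlim)
      then have "\<forall>\<^sub>F n in sequentially. B * cmod (h n) < e"
        using \<open>e > 0\<close> by (auto intro: order_tendstoD)
      then show "\<forall>\<^sub>F n in sequentially. \<forall>y\<in>ball x0 r. dist ((f (y + axis j (h n)) - f y) / h n) (partial j f y) < e"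
        by (rule eventually_mono) (use le_less_trans[OF est[OF _ h0 hr]] in \<open>auto simp: dist_norm\<close>)
    qed
  qed
qed

lemma has_grad_shift: "has_grad f a (x + w) \<Longrightarrow> has_grad (\<lambda>y. f (y + w)) a x"
  unfolding has_grad_def
  using has_derivative_compose[of "\<lambda>y. y + w" "\<lambda>h. h" x UNIV f "pairing a"]
  by (simp add: has_derivative_add_const)

lemma difference_quotient_grad:
  assumes "cdiff_at f y" "cdiff_at f (y + w)"
  shows "cdiff_at (\<lambda>y. (f (y + w) - f y) / h) y"
    and "partial i (\<lambda>y. (f (y + w) - f y) / h) y = (partial i f (y + w) - partial i f y) / h"
proof -
  have "has_grad (\<lambda>y. f (y + w)) (differential f (y + w)) y"
    using assms(2) by (intro has_grad_shift) (simp add: cdiff_at_iff)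
  moreover have "has_grad f (differential f y) y" using assms(1) by (simp add: cdiff_at_iff)
  ultimately have "has_grad (\<lambda>y. (f (y + w) - f y) * (1/h))
      ((f (y + w) - f y) *s 0 + (1/h) *s (differential f (y + w) - differential f y)) y"
    by (intro has_grad_mult has_grad_diff has_grad_const)
  then have *: "has_grad (\<lambda>y. (f (y + w) - f y) / h) ((1/h) *s (differential f (y + w) - differential f y)) y"
    by simp
  show "cdiff_at (\<lambda>y. (f (y + w) - f y) / h) y"
    using * cdiff_at_def by blast
  show "partial i (\<lambda>y. (f (y + w) - f y) / h) y = (partial i f (y + w) - partial i f y) / h"
    using partial_has_grad[OF *, of i] by (simp add: diff_divide_distrib)
qed

lemma holo_partial:
  assumes "open S" "holo_fun f S"
  shows "holo_fun (partial j f) S"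
  unfolding holo_fun_iff
proof
  fix x0 assume x0: "x0 \<in> S"
  obtain r h where *: "r > 0" "ball x0 r \<subseteq> S" "\<And>n. h n \<noteq> 0" "h \<longlonglongrightarrow> (0::complex)"
    "\<And>n y. y \<in> ball x0 r \<Longrightarrow> y + axis j (h n) \<in> S"
    "uniform_limit (ball x0 r) (\<lambda>n y. (f (y + axis j (h n)) - f y) / h n) (partial j f) sequentially"
    by (rule holo_partial_aux[OF assms x0]) blast
  have "holo_fun (partial j f) (ball x0 r)"
    using * by (intro holo_uniform_limit(1)[OF _ _ *(6)])
      (auto simp: holo_fun_iff intro!: difference_quotient_grad holo_funD[OF assms(2)])
  then show "cdiff_at (partial j f) x0" using *(1) by (simp add: holo_fun_iff)
qed

text \<open>Difference quotients in direction \<open>j\<close> commute with \<open>\<partial>\<^sub>i\<close>, and they converge uniformly to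
  \<open>\<partial>\<^sub>j f\<close>; so both mixed derivatives are the limit of the same sequence.\<close>

lemma partial_commute:
  assumes "open S" "holo_fun f S" "x0 \<in> S"
  shows "partial i (partial j f) x0 = partial j (partial i f) x0"
proof -
  obtain r h where *: "r > 0" "ball x0 r \<subseteq> S" "\<And>n. h n \<noteq> 0" "h \<longlonglongrightarrow> (0::complex)"
    "\<And>n y. y \<in> ball x0 r \<Longrightarrow> y + axis j (h n) \<in> S"
    "uniform_limit (ball x0 r) (\<lambda>n y. (f (y + axis j (h n)) - f y) / h n) (partial j f) sequentially"
    by (rule holo_partial_aux[OF assms]) blast
  have "(\<lambda>n. partial i (\<lambda>y. (f (y + axis j (h n)) - f y) / h n) x0) \<longlonglongrightarrow> partial i (partial j f) x0"
    using * by (intro holo_uniform_limit(2)[OF _ _ *(6)])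
      (auto simp: holo_fun_iff intro!: difference_quotient_grad holo_funD[OF assms(2)])
  moreover have "partial i (\<lambda>y. (f (y + axis j (h n)) - f y) / h n) x0
      = (partial i f (x0 + axis j (h n)) - partial i f x0) / h n" for n
    using *(1,5) by (intro difference_quotient_grad holo_funD[OF assms(2)]) (auto simp: assms(3))
  ultimately have l1: "(\<lambda>n. (partial i f (x0 + axis j (h n)) - partial i f x0) / h n) \<longlonglongrightarrow> partial i (partial j f) x0"
    by simp
  have "((\<lambda>z. partial i f (x0 + z *s axis j 1)) has_field_derivative
      pairing (differential (partial i f) x0) (axis j 1)) (at 0)"
    using holo_funD[OF holo_partial[OF assms(1,2)] assms(3)]
    by (intro has_grad_line) (simp add: cdiff_at_iff)
  then have "((\<lambda>z. (partial i f (x0 + z *s axis j 1) - partial i f x0) / z) \<longlongrightarrow> partial j (partial i f) x0) (at 0)"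
    by (simp add: DERIV_def)
  moreover have "filterlim h (at 0) sequentially"
    using *(3,4) by (simp add: filterlim_at)
  ultimately have "(\<lambda>n. (partial i f (x0 + h n *s axis j 1) - partial i f x0) / h n) \<longlonglongrightarrow> partial j (partial i f) x0"
    by (rule filterlim_compose)
  then have "(\<lambda>n. (partial i f (x0 + axis j (h n)) - partial i f x0) / h n) \<longlonglongrightarrow> partial j (partial i f) x0"
    by simp
  then show ?thesis using l1 LIMSEQ_unique by blast
qed

lemma continuous_line: "continuous_on A (\<lambda>t. x + t *s (v :: complex^'n))"
proof -
  have "continuous_on A (\<lambda>t. \<chi> i. x $ i + t * v $ i)" by (intro continuous_intros)
  also have "(\<lambda>t. \<chi> i. x $ i + t * v $ i) = (\<lambda>t. x + t *s v)" by (simp add: fun_eq_iff vec_eq_iff)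
  finally show ?thesis .
qed

lemma line_param:
  fixes x0 z y :: "complex^'n"
  assumes "convex B" "open B" "z \<in> B" "y \<in> B"
  defines "T \<equiv> {t. z + t *s (y - z) \<in> B}"
  shows "convex T" "open T" "0 \<in> T" "1 \<in> T"
proof -
  have lin: "linear (\<lambda>t. t *s (y - z))"
    by (rule linearI) (auto simp: vector_sadd_rdistrib vec_eq_iff scaleR_conv_of_real[where 'a = complex] algebra_simps)
  have T: "T = (\<lambda>t. t *s (y - z)) -` ((\<lambda>w. - z + w) ` B)"
    unfolding T_def by (auto simp: image_iff) (metis add.commute diff_add_cancel uminus_add_conv_diff add_diff_cancel_left')
  show "convex T" unfolding T
    by (intro convex_linear_vimage[OF lin] convex_translation assms)
  have "open ((\<lambda>t. z + t *s (y - z)) -` B)"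
    by (rule open_vimage[OF assms(2) continuous_line])
  then show "open T" by (simp add: T_def vimage_def)
  show "0 \<in> T" "1 \<in> T" using assms by (auto simp: T_def)
qed

text \<open>Identity theorem: along complex lines it is the one-variable theorem, hence the interior of
  the zero set is closed.\<close>

lemma holo_identity:
  assumes "open S" "connected S" "holo_fun f S" "open A" "A \<subseteq> S" "A \<noteq> {}"
    and "\<And>x. x \<in> A \<Longrightarrow> f x = 0" and "x \<in> S"
  shows "f x = 0"
proof -
  define Z where "Z = interior {x\<in>S. f x = 0}"
  have ball0: "f y = 0" if "ball x r \<subseteq> S" "z \<in> Z" "z \<in> ball x r" "y \<in> ball x r" for x r z y
  proof -
    define T where "T = {t. z + t *s (y - z) \<in> ball x r}"
    note T = line_param[of "ball x r" z y, folded T_def, OF _ _ that(3,4)]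
    let ?\<phi> = "\<lambda>t. f (z + t *s (y - z))"
    have hol: "?\<phi> holomorphic_on T"
      using that(1) by (intro holo_line(1)[OF assms(3)]) (auto simp: T_def)
    obtain e where e: "e > 0" "ball z e \<subseteq> {x\<in>S. f x = 0}"
      using \<open>z \<in> Z\<close> by (auto simp: Z_def mem_interior)
    define T' where "T' = {t. z + t *s (y - z) \<in> ball z e \<inter> ball x r}"
    have T'o: "open T'"
    proof -
      have "T' = T \<inter> (\<lambda>t. z + t *s (y - z)) -` ball z e" by (auto simp: T'_def T_def)
      moreover have "open ((\<lambda>t. z + t *s (y - z)) -` ball z e)"
      proof (rule open_vimage)
        show "continuous_on UNIV (\<lambda>t. z + t *s (y - z))"
          by (rule continuous_line)
      qed simp
      ultimately show ?thesis using T by auto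
    qed
    have "0 \<in> T'" using that e by (auto simp: T'_def)
    then have T'ne: "T' \<noteq> {}" by blast
    have "?\<phi> 1 = (\<lambda>_. 0) 1"
    proof (rule analytic_continuation_open[where s = T' and s' = T and f = ?\<phi> and g = "\<lambda>_. 0"])
      show "connected T" using T by (simp add: convex_connected)
      show "?\<phi> t = 0" if "t \<in> T'" for t using that e by (auto simp: T'_def)
    qed (use T T'o T'ne hol e that in \<open>auto simp: T'_def T_def\<close>)
    then show ?thesis by simp
  qed
  have "closedin (top_of_set S) Z"
    unfolding closedin_limpt
  proof (intro conjI allI impI)
    show "Z \<subseteq> S" unfolding Z_def using interior_subset by blast
    fix x assume x: "x islimpt Z \<and> x \<in> S"
    then obtain r where r: "r > 0" "ball x r \<subseteq> S" using assms(1) openE by blast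
    then obtain z where z: "z \<in> Z" "z \<in> ball x r"
      using x by (metis dist_commute islimpt_approachable mem_ball)
    have "ball x r \<subseteq> {x\<in>S. f x = 0}" using ball0[OF r(2) z] r(2) by auto
    then show "x \<in> Z" unfolding Z_def using r(1) by (meson mem_interior)
  qed
  moreover have "openin (top_of_set S) Z"
    unfolding Z_def by (rule open_subset) (use interior_subset in auto)
  moreover have "Z \<noteq> {}"
    using assms(4-7) interior_maximal[of A "{x\<in>S. f x = 0}"] unfolding Z_def by blast
  ultimately have "Z = S" using assms(2) by (metis connected_clopen)
  then show ?thesis using assms(8) interior_subset unfolding Z_def by blast
qed

section \<open>Holomorphic differential equations\<close>

text \<open>Existence for autonomous systems, by Picard iteration on a small disc. One complex time
  variable suffices, so primitives of holomorphic functions take the place of integrals.\<close>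

lemma holo_ode_exists:
  fixes F :: "complex^'m \<Rightarrow> complex^'m"
  assumes "open S" "holo_map F S" "x0 \<in> S"
  obtains r c where "r > 0" "c 0 = x0" "\<And>t. t \<in> ball 0 r \<Longrightarrow> c t \<in> S"
    "\<And>t k. t \<in> ball 0 r \<Longrightarrow> ((\<lambda>s. c s $ k) has_field_derivative F (c t) $ k) (at t)"
proof -
  obtain r1 where r1: "r1 > 0" "cball x0 r1 \<subseteq> S" using assms(1,3) open_contains_cball by blast
  define \<rho> where "\<rho> = r1 / 2"
  have \<rho>: "\<rho> > 0" "ball x0 (2 * \<rho>) \<subseteq> S" using r1 by (auto simp: \<rho>_def intro!: subsetD[OF r1(2)])
  have "compact (F ` cball x0 r1)"
    by (intro compact_continuous_image continuous_on_subset[OF holo_map_continuous[OF assms(2)] r1(2)]) simp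
  then obtain M0 where M0: "\<And>y. y \<in> cball x0 r1 \<Longrightarrow> norm (F y) \<le> M0"
    by (meson bounded_iff compact_imp_bounded image_eqI)
  define M where "M = max M0 1"
  have M1: "M \<ge> 1" by (simp add: M_def)
  have M2: "cmod (F y $ k) \<le> M" if "y \<in> ball x0 (2 * \<rho>)" for y k
  proof -
    have "norm (F y) \<le> M0" using M0[of y] that by (simp add: \<rho>_def)
    then show "cmod (F y $ k) \<le> M" using norm_comp_le[of "F y" k] by (simp add: M_def)
  qed
  note M = M1 M2
  define L where "L = 2 * M / \<rho>"
  have L: "L > 0" using M \<rho> by (simp add: L_def)
  have lip: "cmod (F x $ k - F y $ k) \<le> L * norm (x - y)" if "x \<in> ball x0 \<rho>" "y \<in> ball x0 \<rho>" for x y k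
    unfolding L_def by (rule holo_lipschitz[where S = S]) (use assms(2) \<rho> M(2) that in \<open>auto simp: holo_map_def\<close>)
  define N where "N = real CARD('m)"
  have N: "N > 0" by (simp add: N_def)
  define r where "r = min (\<rho> / (2 * N * M)) (1 / (2 * N * L))"
  have r0: "r > 0" using \<rho> N M L by (simp add: r_def)
  have r_M: "N * (r * M) < \<rho>"
  proof -
    have "r \<le> \<rho> / (2 * N * M)" by (simp add: r_def)
    then have "r * (2 * N * M) \<le> \<rho>" using N M by (simp add: pos_le_divide_eq)
    then show ?thesis using \<rho> by (simp add: algebra_simps)
  qed
  have r_L: "N * (r * L) \<le> 1/2"
  proof -
    have "r \<le> 1 / (2 * N * L)" by (simp add: r_def)
    then have "r * (2 * N * L) \<le> 1" using N L by (simp add: pos_le_divide_eq)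
    then show ?thesis by (simp add: algebra_simps)
  qed
  let ?D = "ball (0::complex) r"
  \<comment> \<open>the primitive that vanishes at \<open>0\<close>, i.e. the path integral from \<open>0\<close>\<close>
  define prim where "prim g = (SOME G. G 0 = 0 \<and> (\<forall>t\<in>?D. (G has_field_derivative g t) (at t)))"
    for g :: "complex \<Rightarrow> complex"
  have prim: "prim g 0 = 0 \<and> (\<forall>t\<in>?D. (prim g has_field_derivative g t) (at t))"
    if hg: "g holomorphic_on ?D" for g
  proof -
    obtain G where G: "\<And>t. t \<in> ?D \<Longrightarrow> (G has_field_derivative g t) (at t within ?D)"
      using holomorphic_convex_primitive'[OF convex_ball open_ball hg] by blast
    have "((\<lambda>t. G t - G 0) has_field_derivative g t) (at t)" if "t \<in> ?D" for t
      using G[OF that] that by (auto simp: at_within_open[of t ?D] intro!: derivative_eq_intros)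
    then have "\<exists>G. G 0 = 0 \<and> (\<forall>t\<in>?D. (G has_field_derivative g t) (at t))"
      by (intro exI[of _ "\<lambda>t. G t - G 0"]) auto
    from someI_ex[OF this] show ?thesis unfolding prim_def .
  qed
  define X where "X = rec_nat (\<lambda>t. x0) (\<lambda>n Y. \<lambda>t. \<chi> k. x0 $ k + prim (\<lambda>s. F (Y s) $ k) t)"
  have X0: "X 0 = (\<lambda>t. x0)" and XS: "X (Suc n) = (\<lambda>t. \<chi> k. x0 $ k + prim (\<lambda>s. F (X n s) $ k) t)" for n
    by (simp_all add: X_def)
  have small: "norm x < \<rho>" if "\<And>k. cmod (x $ k) \<le> r * M" for x :: "complex^'m"
  proof -
    have "norm x \<le> (\<Sum>k\<in>(UNIV::'m set). r * M)" using norm_vec_le_sum[of x] that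
      by (meson order_trans sum_mono)
    then show ?thesis using r_M by (simp add: N_def)
  qed
  have hol_comp: "(\<lambda>s. F (Y s) $ k) holomorphic_on ?D"
    if Y: "\<And>t. t \<in> ?D \<Longrightarrow> Y t \<in> ball x0 \<rho>" "\<And>k. (\<lambda>t. Y t $ k) holomorphic_on ?D" for Y k
  proof -
    have "\<exists>d. ((\<lambda>s. F (Y s) $ k) has_field_derivative d) (at t)" if t: "t \<in> ?D" for t
    proof -
      have "Y t \<in> S" using Y(1)[OF t] \<rho> by auto
      moreover have "((\<lambda>s. Y s $ j) has_field_derivative (\<chi> j. deriv (\<lambda>s. Y s $ j) t) $ j) (at t)" for j
        using Y(2) t by (auto intro!: holomorphic_derivI[of _ ?D])
      ultimately show ?thesis
        using curve_deriv[of "\<lambda>x. F x $ k" Y t] holo_mapD[OF assms(2)] by blast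
    qed
    then show ?thesis by (simp add: holomorphic_on_open)
  qed
  have main: "(\<forall>t\<in>?D. X n t \<in> ball x0 \<rho>) \<and> (\<forall>k. (\<lambda>t. X n t $ k) holomorphic_on ?D)" for n
  proof (induction n)
    case (Suc n)
    have hol: "(\<lambda>s. F (X n s) $ k) holomorphic_on ?D" for k
      using Suc.IH by (intro hol_comp) auto
    have der: "((\<lambda>t. X (Suc n) t $ k) has_field_derivative F (X n t) $ k) (at t)" if "t \<in> ?D" for t k
      using prim[OF hol[of k]] that by (auto simp: XS intro!: derivative_eq_intros)
    have z: "X (Suc n) 0 = x0" using prim[OF hol] by (simp add: XS vec_eq_iff)
    have "cmod (X (Suc n) t $ k - x0 $ k) \<le> r * M" if "t \<in> ?D" for t k
    proof -
      have "cmod (X (Suc n) t $ k - X (Suc n) 0 $ k) \<le> M * norm (t - 0)"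
      proof (rule field_differentiable_bound[of ?D])
        show "((\<lambda>t. X (Suc n) t $ k) has_field_derivative F (X n z) $ k) (at z within ?D)" if "z \<in> ?D" for z
          using der[OF that] by (rule has_field_derivative_at_within)
        show "cmod (F (X n z) $ k) \<le> M" if "z \<in> ?D" for z
          using Suc that \<rho>(1) by (intro M(2)) force
      qed (use that r0 in auto)
      also have "\<dots> \<le> M * r" using that M(1) by (intro mult_left_mono) auto
      finally show ?thesis by (simp add: z mult.commute)
    qed
    then have "norm (X (Suc n) t - x0) < \<rho>" if "t \<in> ?D" for t
      using that by (intro small) simp
    moreover have "(\<lambda>t. X (Suc n) t $ k) holomorphic_on ?D" for k
      unfolding holomorphic_on_open[OF open_ball] using der by blast
    ultimately show ?case by (auto simp: dist_norm norm_minus_commute)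
  qed (use \<rho> in \<open>auto simp: X0\<close>)
  have hol: "(\<lambda>s. F (X n s) $ k) holomorphic_on ?D" for k n
    using main by (intro hol_comp) auto
  have der: "((\<lambda>t. X (Suc n) t $ k) has_field_derivative F (X n t) $ k) (at t)" if "t \<in> ?D" for t k n
    using prim[OF hol[of n k]] that by (auto simp: XS intro!: derivative_eq_intros)
  have z: "X n 0 = x0" for n using prim[OF hol] by (cases n) (simp_all add: X0 XS vec_eq_iff)
  have inS: "X n t \<in> ball x0 \<rho>" if "t \<in> ?D" for n t using main that by blast
  define B where "B = 2 * \<rho>"
  have step: "cmod (X (Suc n) t $ k - X n t $ k) \<le> B * (1/2)^n" if "t \<in> ?D" for n t k
    using that
  proof (induction n arbitrary: t k)
    case 0
    then show ?case
      using norm_comp_le[of "X (Suc 0) t - X 0 t" k] inS[of t "Suc 0"] inS[of t 0]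
        dist_triangle2[of "X (Suc 0) t" "X 0 t" x0] by (simp add: B_def dist_norm norm_minus_commute)
  next
    case (Suc n)
    have "cmod ((X (Suc (Suc n)) t $ k - X (Suc n) t $ k) - (X (Suc (Suc n)) 0 $ k - X (Suc n) 0 $ k))
        \<le> (L * (N * (B * (1/2)^n))) * norm (t - 0)"
    proof (rule field_differentiable_bound[of ?D])
      fix w assume w: "w \<in> ?D"
      show "((\<lambda>t. X (Suc (Suc n)) t $ k - X (Suc n) t $ k) has_field_derivative
         (F (X (Suc n) w) $ k - F (X n w) $ k)) (at w within ?D)"
        by (intro has_field_derivative_at_within[OF DERIV_diff] der w)
      have "cmod (F (X (Suc n) w) $ k - F (X n w) $ k) \<le> L * norm (X (Suc n) w - X n w)"
        by (intro lip inS w)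
      also have "norm (X (Suc n) w - X n w) \<le> (\<Sum>k\<in>(UNIV::'m set). B * (1/2)^n)"
        by (rule order_trans[OF norm_vec_le_sum]) (use Suc.IH[OF w] in \<open>intro sum_mono, simp\<close>)
      finally show "cmod (F (X (Suc n) w) $ k - F (X n w) $ k) \<le> L * (N * (B * (1/2)^n))"
        using L by (simp add: N_def)
    qed (use Suc.prems r0 in auto)
    also have "\<dots> \<le> (L * (N * (B * (1/2)^n))) * r"
      using Suc.prems L N \<rho> by (intro mult_left_mono) (auto simp: B_def)
    also have "\<dots> = (N * (r * L)) * (B * (1/2)^n)" by (simp add: mult_ac)
    also have "\<dots> \<le> 1/2 * (B * (1/2)^n)"
      using \<rho> by (intro mult_right_mono r_L) (auto simp: B_def)
    finally show ?case by (simp add: z)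
  qed
  have "uniformly_convergent_on ?D (\<lambda>n t. X n t $ k)" for k
  proof -
    have "uniformly_convergent_on ?D (\<lambda>n t. \<Sum>i<n. X (Suc i) t $ k - X i t $ k)"
      by (rule Weierstrass_m_test'[where M = "\<lambda>n. B * (1/2)^n"])
         (use step in \<open>auto intro!: summable_mult summable_geometric\<close>)
    moreover have "(\<Sum>i<n. X (Suc i) t $ k - X i t $ k) = X n t $ k - x0 $ k" for n t
      by (induction n) (auto simp: X0)
    ultimately have "uniformly_convergent_on ?D (\<lambda>n t. X n t $ k - x0 $ k)" by simp
    then obtain l where "uniform_limit ?D (\<lambda>n t. X n t $ k - x0 $ k) l sequentially"
      unfolding uniformly_convergent_on_def by blast
    then have "uniform_limit ?D (\<lambda>n t. (X n t $ k - x0 $ k) + x0 $ k) (\<lambda>t. l t + x0 $ k) sequentially"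
      by (intro uniform_limit_add uniform_limit_const)
    then show ?thesis unfolding uniformly_convergent_on_def by auto
  qed
  then obtain l where l: "\<And>k. uniform_limit ?D (\<lambda>n t. X n t $ k) (l k) sequentially"
    unfolding uniformly_convergent_on_def by metis
  define c where "c t = (\<chi> k. l k t)" for t
  have lim: "(\<lambda>n. X n t) \<longlonglongrightarrow> c t" if "t \<in> ?D" for t
    by (rule vec_tendstoI) (use tendsto_uniform_limitI[OF l that] in \<open>simp add: c_def\<close>)
  have cin: "c t \<in> ball x0 (2 * \<rho>)" if "t \<in> ?D" for t
  proof -
    have "c t \<in> cball x0 \<rho>"
      by (rule closed_sequentially[OF closed_cball _ lim[OF that]])
         (use inS[OF that] in \<open>auto intro: less_imp_le\<close>)
    then show ?thesis using \<rho> by auto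
  qed
  show thesis
  proof
    show "r > 0" by fact
    show "c 0 = x0" using lim[of 0] r0 LIMSEQ_unique[of "\<lambda>n. X n 0" "c 0" x0] by (simp add: z)
    show "c t \<in> S" if "t \<in> ?D" for t using cin[OF that] \<rho> by auto
    fix t k assume t: "t \<in> ?D"
    have "uniform_limit ?D (\<lambda>n t. X (Suc n) t $ k) (l k) sequentially"
      using filterlim_compose[OF l[of k] filterlim_Suc] by (simp add: o_def)
    then have "\<exists>g'. \<forall>x\<in>?D. (l k has_field_derivative g' x) (at x) \<and> (\<lambda>n. F (X n x) $ k) \<longlonglongrightarrow> g' x"
    proof (intro has_complex_derivative_uniform_sequence[of ?D "\<lambda>n t. X (Suc n) t $ k"])
      fix x assume "x \<in> ?D"
      then obtain d where "d > 0" "cball x d \<subseteq> ?D" by (meson open_contains_cball open_ball)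
      then show "\<exists>d>0. cball x d \<subseteq> ?D \<and> uniform_limit (cball x d) (\<lambda>n t. X (Suc n) t $ k) (l k) sequentially"
        using \<open>uniform_limit ?D (\<lambda>n t. X (Suc n) t $ k) (l k) sequentially\<close> uniform_limit_on_subset by blast
    qed (use der in auto)
    then obtain d where d: "(l k has_field_derivative d) (at t)" "(\<lambda>n. F (X n t) $ k) \<longlonglongrightarrow> d"
      using t by blast
    have "isCont (\<lambda>x. F x $ k) (c t)"
      using holo_mapD[OF assms(2)] cin[OF t] \<rho> by (intro cdiff_continuous) auto
    then have "(\<lambda>n. F (X n t) $ k) \<longlonglongrightarrow> F (c t) $ k"
      using lim[OF t] by (rule isCont_tendsto_compose)
    then have "d = F (c t) $ k" using d(2) LIMSEQ_unique by blast
    then show "((\<lambda>s. c s $ k) has_field_derivative F (c t) $ k) (at t)" using d(1) by (simp add: c_def)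
  qed
qed

section \<open>Integrable linear systems\<close>

text \<open>The solution operator for \<open>(1 + E) h = g\<close>, where \<open>E\<close> is the Euler field centred at \<open>p\<close>. It allows
  the radial part of a first order system to be integrated on a whole ball at once, with holomorphic
  dependence on all coordinates.\<close>

definition radial_mean :: "complex^'n \<Rightarrow> (complex^'n \<Rightarrow> complex) \<Rightarrow> complex^'n \<Rightarrow> complex" where
  "radial_mean p g x = integral {0..1} (\<lambda>t. g (p + complex_of_real t *s (x - p)))"

lemma in_ball_radial: "x \<in> ball p r \<Longrightarrow> cmod z \<le> 1 \<Longrightarrow> p + z *s (x - p) \<in> ball p r"
proof -
  assume *: "x \<in> ball p r" "cmod z \<le> 1"
  have "dist p (p + z *s (x - p)) = norm (z *s (x - p))"
    by (metis add_diff_cancel_left' dist_norm norm_minus_commute)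
  also have "\<dots> \<le> dist p x"
    using *(2) mult_left_le_one_le[of "norm (x - p)" "cmod z"] by (simp only: norm_scale_vec) (simp add: dist_norm norm_minus_commute)
  finally show ?thesis using *(1) by simp
qed

lemma continuous_radial:
  assumes "continuous_on (ball p r) (g :: complex^'n \<Rightarrow> complex)" "x \<in> ball p r"
  shows "continuous_on {0..1} (\<lambda>t. g (p + complex_of_real t *s (x - p)))"
proof -
  have "continuous_on {0..1} ((\<lambda>z. p + z *s (x - p)) \<circ> complex_of_real)"
    by (rule continuous_on_compose[OF _ continuous_line]) (intro continuous_intros)
  then have *: "continuous_on {0..1} (\<lambda>t. p + complex_of_real t *s (x - p))" by (simp only: o_def)
  have "(\<lambda>t. p + complex_of_real t *s (x - p)) ` {0..1} \<subseteq> ball p r"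
  proof (rule image_subsetI)
    fix t :: real assume "t \<in> {0..1}"
    then show "p + complex_of_real t *s (x - p) \<in> ball p r" by (intro in_ball_radial[OF assms(2)]) simp
  qed
  then show ?thesis by (rule continuous_on_compose2[OF assms(1) *])
qed

lemma radial_mean_bound:
  assumes "holo_fun g (ball p r)" "x \<in> ball p r" "\<And>y. y \<in> ball p r \<Longrightarrow> cmod (g y) \<le> M"
  shows "cmod (radial_mean p g x) \<le> M"
proof -
  have "cmod (radial_mean p g x) \<le> M * (1 - 0)"
    unfolding radial_mean_def
  proof (rule integral_bound)
    show "continuous_on {0..1} (\<lambda>t. g (p + complex_of_real t *s (x - p)))"
      by (rule continuous_radial[OF holo_fun_continuous[OF assms(1)] assms(2)])
    show "cmod (g (p + complex_of_real t *s (x - p))) \<le> M" if "t \<in> {0..1}" for t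
      by (intro assms(3) in_ball_radial[OF assms(2)]) (use that in simp)
  qed simp
  then show ?thesis by simp
qed

lemma radial_mean_diff:
  assumes "holo_fun g (ball p r)" "holo_fun h (ball p r)" "x \<in> ball p r"
  shows "radial_mean p g x - radial_mean p h x = radial_mean p (\<lambda>y. g y - h y) x"
  unfolding radial_mean_def
  by (rule integral_diff[symmetric]; intro integrable_continuous_real continuous_radial[of p r]
      holo_fun_continuous assms)

lemma radial_mean_grad:
  assumes hol: "holo_fun g (ball p r)" and x: "x \<in> ball p r"
  shows "has_grad (radial_mean p g)
    (\<chi> i. integral {0..1} (\<lambda>t. complex_of_real t * partial i g (p + complex_of_real t *s (x - p)))) x"
proof -
  define fx where "fx y t = Blinfun (\<lambda>v. complex_of_real t * pairing (differential g (p + complex_of_real t *s (y - p))) v)"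
    for y and t :: real
  have bl: "bounded_linear (pairing a)" for a :: "complex^'n"
  proof (rule linear_conv_bounded_linear[THEN iffD1], rule linearI)
    show "pairing a (c *\<^sub>R v) = c *\<^sub>R pairing a v" for c v
      by (simp add: scaleR_vec_eq scaleR_conv_of_real)
  qed simp
  have fx: "blinfun_apply (fx y t) v = complex_of_real t * pairing (differential g (p + complex_of_real t *s (y - p))) v" for y t v
    unfolding fx_def by (subst bounded_linear_Blinfun_apply) (auto intro: bounded_linear_const_mult bl)
  have cp: "continuous_on (ball p r) (partial i g)" for i
    by (intro holo_fun_continuous holo_partial hol open_ball)
  have "((\<lambda>x. integral (cbox 0 1) (\<lambda>t. g (p + complex_of_real t *s (x - p)))) has_derivative integral (cbox 0 1) (fx x))
     (at x within ball p r)"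
  proof (rule leibniz_rule[where fx = fx])
    fix y and t :: real assume y: "y \<in> ball p r" and t: "t \<in> cbox 0 1"
    let ?\<Phi> = "\<lambda>y. p + complex_of_real t *s (y - p)"
    have inb: "?\<Phi> y \<in> ball p r" using in_ball_radial[OF y, of "complex_of_real t"] t by simp
    have "has_grad (\<lambda>x. ?\<Phi> x $ k) (complex_of_real t *s axis k 1) y" for k
    proof -
      have "has_grad (\<lambda>x. p $ k + complex_of_real t * (x $ k - p $ k))
         (0 + (complex_of_real t *s (axis k 1 - 0) + (y $ k - p $ k) *s 0)) y"
        by (intro has_grad_add has_grad_const has_grad_mult has_grad_diff has_grad_coord)
      then show ?thesis by (simp add: right_diff_distrib)
    qed
    then have "has_grad (\<lambda>x. g (?\<Phi> x)) (\<Sum>k\<in>UNIV. differential g (?\<Phi> y) $ k *s (complex_of_real t *s axis k 1)) y"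
      by (intro has_grad_compose) (use holo_funD[OF hol inb] in \<open>auto simp: cdiff_at_iff\<close>)
    also have "(\<Sum>k\<in>UNIV. differential g (?\<Phi> y) $ k *s (complex_of_real t *s axis k 1)) = complex_of_real t *s differential g (?\<Phi> y)"
      by (subst (2) vec_sum_axis) (simp add: vec_eq_iff axis_def if_distrib if_distribR mult.commute cong: if_cong)
    finally have "has_grad (\<lambda>x. g (?\<Phi> x)) (complex_of_real t *s differential g (?\<Phi> y)) y" .
    moreover have "pairing (complex_of_real t *s differential g (?\<Phi> y)) = blinfun_apply (fx y t)"
      by (simp add: fun_eq_iff fx)
    ultimately show "((\<lambda>x. g (?\<Phi> x)) has_derivative blinfun_apply (fx y t)) (at y within ball p r)"
      unfolding has_grad_def by (metis has_derivative_at_withinI)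
  next
    fix y assume "y \<in> ball p r"
    then show "(\<lambda>t. g (p + complex_of_real t *s (y - p))) integrable_on cbox 0 1"
      using continuous_radial[OF holo_fun_continuous[OF hol]] by (simp add: integrable_continuous_real)
  next
    have cpair: "continuous_on (ball p r \<times> cbox 0 (1::real)) (\<lambda>z. p + complex_of_real (snd z) *s (fst z - p))"
    proof -
      have "continuous_on (ball p r \<times> cbox 0 (1::real)) (\<lambda>z. \<chi> i. p $ i + complex_of_real (snd z) * (fst z $ i - p $ i))"
        by (intro continuous_intros)
      also have "(\<lambda>z. \<chi> i. p $ i + complex_of_real (snd z) * (fst z $ i - p $ i)) = (\<lambda>z. p + complex_of_real (snd z) *s (fst z - p))"
        by (simp add: fun_eq_iff vec_eq_iff right_diff_distrib)
      finally show ?thesis .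
    qed
    have "continuous_on (ball p r \<times> cbox 0 (1::real)) (\<lambda>z. partial i g (p + complex_of_real (snd z) *s (fst z - p)))" for i
    proof (rule continuous_on_compose2[OF cp cpair], rule image_subsetI)
      fix z :: "(complex^'a) \<times> real" assume "z \<in> ball p r \<times> cbox 0 1"
      then show "p + complex_of_real (snd z) *s (fst z - p) \<in> ball p r"
        by (intro in_ball_radial) auto
    qed
    then show "continuous_on (ball p r \<times> cbox 0 1) (\<lambda>(x, t). fx x t)"
      by (intro continuous_on_blinfun_componentwise)
         (auto simp: fx case_prod_beta pairing_def intro!: continuous_intros)
  qed (use x in auto)
  then have "(radial_mean p g has_derivative integral {0..1} (fx x)) (at x)"
    using x by (simp add: radial_mean_def[abs_def] at_within_open[of x "ball p r"])
  moreover have "blinfun_apply (integral {0..1} (fx x)) = pairing (\<chi> i. integral {0..1} (\<lambda>t. complex_of_real t * partial i g (p + complex_of_real t *s (x - p))))"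
  proof
    fix v
    have intg: "(\<lambda>t. complex_of_real t * partial i g (p + complex_of_real t *s (x - p))) integrable_on {0..1}" for i
      by (intro integrable_continuous_real continuous_intros continuous_radial[OF cp x])
    have fint: "fx x integrable_on {0..1}"
    proof (rule integrable_continuous_real, rule continuous_on_blinfun_componentwise)
      show "continuous_on {0..1} (\<lambda>t. blinfun_apply (fx x t) i)" for i
        unfolding fx pairing_def differential_nth
        by (intro continuous_intros continuous_radial[OF cp x])
    qed
    have "blinfun_apply (integral {0..1} (fx x)) v = integral {0..1} (\<lambda>t. blinfun_apply (fx x t) v)"
      by (rule blinfun_apply_integral[OF fint])
    also have "\<dots> = integral {0..1} (\<lambda>t. \<Sum>i\<in>UNIV. (complex_of_real t * partial i g (p + complex_of_real t *s (x - p))) * v $ i)"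
      by (simp add: fx pairing_def sum_distrib_left mult.assoc)
    also have "\<dots> = (\<Sum>i\<in>UNIV. integral {0..1} (\<lambda>t. complex_of_real t * partial i g (p + complex_of_real t *s (x - p))) * v $ i)"
      by (subst integral_sum) (simp, intro integrable_on_mult_left intg, simp only: integral_mult_left)
    finally show "blinfun_apply (integral {0..1} (fx x)) v = pairing (\<chi> i. integral {0..1} (\<lambda>t. complex_of_real t * partial i g (p + complex_of_real t *s (x - p)))) v"
      by (simp only: pairing_def vec_lambda_beta)
  qed
  ultimately show ?thesis unfolding has_grad_def by (simp only:)
qed

lemma radial_mean_holo: "holo_fun g (ball p r) \<Longrightarrow> holo_fun (radial_mean p g) (ball p r)"
  using radial_mean_grad unfolding holo_fun_iff cdiff_at_def by blast

text \<open>The function \<open>t g(p + t (x - p))\<close> of \<open>t\<close> has as its derivative the integrand of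
  the left side, once the partial derivatives are taken under the integral.\<close>

lemma radial_mean_euler:
  assumes hol: "holo_fun g (ball p r)" and x: "x \<in> ball p r"
  shows "radial_mean p g x + (\<Sum>i\<in>UNIV. (x $ i - p $ i) * partial i (radial_mean p g) x) = g x"
proof -
  let ?c = "\<lambda>t. p + complex_of_real t *s (x - p)"
  have cp: "continuous_on (ball p r) (partial i g)" for i
    by (intro holo_fun_continuous holo_partial hol open_ball)
  have inb: "?c t \<in> ball p r" if "t \<in> {0..1}" for t
    using in_ball_radial[OF x, of "complex_of_real t"] that by auto
  have "((\<lambda>t. complex_of_real t * g (?c t)) has_vector_derivative
       (g (?c t) + complex_of_real t * pairing (differential g (?c t)) (x - p))) (at t within {0..1})"
    if t: "t \<in> {0..1}" for t
  proof -
    have "((\<lambda>z. g (p + z *s (x - p))) has_field_derivative pairing (differential g (?c t)) (x - p)) (at (complex_of_real t))"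
      by (rule has_grad_line) (use holo_funD[OF hol inb[OF t]] in \<open>simp add: cdiff_at_iff\<close>)
    then have "((\<lambda>z. z * g (p + z *s (x - p))) has_field_derivative (g (?c t) + complex_of_real t * pairing (differential g (?c t)) (x - p))) (at (complex_of_real t))"
      by (auto intro!: derivative_eq_intros simp: algebra_simps)
    then show ?thesis
      using has_vector_derivative_real_field[of "\<lambda>z. z * g (p + z *s (x - p))"] has_vector_derivative_at_within by blast
  qed
  then have "((\<lambda>t. g (?c t) + complex_of_real t * pairing (differential g (?c t)) (x - p)) has_integral
      (complex_of_real 1 * g (?c 1) - complex_of_real 0 * g (?c 0))) {0..1}"
    by (intro fundamental_theorem_of_calculus) auto
  then have "integral {0..1} (\<lambda>t. g (?c t) + complex_of_real t * pairing (differential g (?c t)) (x - p)) = g x"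
    by (simp add: integral_unique)
  moreover have "integral {0..1} (\<lambda>t. g (?c t) + complex_of_real t * pairing (differential g (?c t)) (x - p))
    = integral {0..1} (\<lambda>t. g (?c t)) + integral {0..1} (\<lambda>t. \<Sum>i\<in>UNIV. (x $ i - p $ i) * (complex_of_real t * partial i g (?c t)))"
  proof -
    have *: "complex_of_real t * pairing (differential g (?c t)) (x - p)
        = (\<Sum>i\<in>UNIV. (x $ i - p $ i) * (complex_of_real t * partial i g (?c t)))" for t
      by (simp only: pairing_def sum_distrib_left differential_nth vector_minus_component) (simp only: mult_ac)
    show ?thesis unfolding *
      by (intro integral_add integrable_continuous_real continuous_intros continuous_radial[OF _ x]
          holo_fun_continuous[OF hol] cp)
  qed
  moreover have "integral {0..1} (\<lambda>t. \<Sum>i\<in>UNIV. (x $ i - p $ i) * (complex_of_real t * partial i g (?c t)))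
    = (\<Sum>i\<in>UNIV. (x $ i - p $ i) * integral {0..1} (\<lambda>t. complex_of_real t * partial i g (?c t)))"
    by (subst integral_sum)
       (simp, intro integrable_on_mult_right integrable_continuous_real continuous_intros continuous_radial[OF _ x] cp,
        simp only: integral_mult_right)
  ultimately show ?thesis
    using partial_has_grad[OF radial_mean_grad[OF assms]] by (simp add: radial_mean_def)
qed

subsection \<open>Frobenius theorem for linear systems\<close>

text \<open>The entries of \<open>dA - A \<and> A\<close>, the obstruction to \<open>\<partial>\<^sub>i \<partial>\<^sub>j X = \<partial>\<^sub>j \<partial>\<^sub>i X\<close> for solutions of
  \<open>\<partial>\<^sub>j X = A\<^sub>j X\<close>.\<close>

definition sys_curv :: "('n \<Rightarrow> 'm::finite \<Rightarrow> 'm \<Rightarrow> complex^'n \<Rightarrow> complex) \<Rightarrow> 'n \<Rightarrow> 'n \<Rightarrow> 'm \<Rightarrow> 'm \<Rightarrow> complex^'n \<Rightarrow> complex" where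
  "sys_curv A i j k l x = partial i (A j k l) x - partial j (A i k l) x +
     (\<Sum>m\<in>UNIV. A j k m x * A i m l x - A i k m x * A j m l x)"

definition sys_defect :: "('n \<Rightarrow> 'm::finite \<Rightarrow> 'm \<Rightarrow> complex^'n \<Rightarrow> complex) \<Rightarrow> (complex^'n \<Rightarrow> complex^'m) \<Rightarrow> 'n \<Rightarrow> 'm \<Rightarrow> complex^'n \<Rightarrow> complex" where
  "sys_defect A X j k x = partial j (\<lambda>y. X y $ k) x - (\<Sum>l\<in>UNIV. A j k l x * X x $ l)"

text \<open>Commuting the second derivatives of \<open>X\<close> expresses the rotation of the defect through the curvature
  and through the defect itself. With vanishing curvature this is a homogeneous system for the defect.\<close>

lemma sys_defect_commute:
  assumes "open V" "x \<in> V" "\<And>j k l. holo_fun (A j k l) V" "holo_map X V"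
  shows "partial j (sys_defect A X i k) x - partial i (sys_defect A X j k) x =
    (\<Sum>l\<in>UNIV. sys_curv A i j k l x * X x $ l) +
    (\<Sum>l\<in>UNIV. A j k l x * sys_defect A X i l x - A i k l x * sys_defect A X j l x)"
proof -
  have hX: "holo_fun (\<lambda>y. X y $ k) V" for k using assms(4) by (simp add: holo_map_def)
  have c1: "cdiff_at (A j k l) x" for j k l using assms(2,3) holo_funD by blast
  have c2: "cdiff_at (\<lambda>y. X y $ k) x" for k using assms(2) hX holo_funD by blast
  have c3: "cdiff_at (partial j (\<lambda>y. X y $ k)) x" for j k
    using holo_partial[OF assms(1) hX] assms(2) holo_funD by blast
  have pd: "partial j (sys_defect A X i k) x = partial j (partial i (\<lambda>y. X y $ k)) x -
      (\<Sum>l\<in>UNIV. A i k l x * partial j (\<lambda>y. X y $ l) x + X x $ l * partial j (A i k l) x)" for i j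
    unfolding sys_defect_def[abs_def]
    by (simp add: partial_diff partial_sum partial_mult c1 c2 c3)
  have ds: "(\<Sum>l\<in>UNIV. \<Sum>m\<in>UNIV. (A j k m x * A i m l x - A i k m x * A j m l x) * X x $ l) =
     (\<Sum>l\<in>UNIV. A j k l x * (\<Sum>m\<in>UNIV. A i l m x * X x $ m) - A i k l x * (\<Sum>m\<in>UNIV. A j l m x * X x $ m))"
    by (subst sum.swap) (simp add: sum_distrib_left sum_subtractf algebra_simps)
  have "(\<Sum>l\<in>UNIV. sys_curv A i j k l x * X x $ l) +
    (\<Sum>l\<in>UNIV. A j k l x * sys_defect A X i l x - A i k l x * sys_defect A X j l x) =
    (\<Sum>l\<in>UNIV. (partial i (A j k l) x - partial j (A i k l) x) * X x $ l +
        (A j k l x * partial i (\<lambda>y. X y $ l) x - A i k l x * partial j (\<lambda>y. X y $ l) x))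
    + (\<Sum>l\<in>UNIV. \<Sum>m\<in>UNIV. (A j k m x * A i m l x - A i k m x * A j m l x) * X x $ l)
    - (\<Sum>l\<in>UNIV. A j k l x * (\<Sum>m\<in>UNIV. A i l m x * X x $ m) - A i k l x * (\<Sum>m\<in>UNIV. A j l m x * X x $ m))"
    unfolding sys_curv_def sys_defect_def
    by (simp add: distrib_right right_diff_distrib sum.distrib sum_subtractf sum_distrib_right sum_distrib_left algebra_simps)
  also have "\<dots> = partial j (sys_defect A X i k) x - partial i (sys_defect A X j k) x"
    unfolding ds pd using partial_commute[OF assms(1) hX assms(2), of i j k]
    by (simp add: algebra_simps sum.distrib sum_subtractf)
  finally show ?thesis by simp
qed

text \<open>Each row of the curvature is a linear relation between the values of any solution.\<close>

lemma linear_system_integrability: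
  assumes "open V" "x \<in> V" "\<And>j k l. holo_fun (A j k l) V" "holo_map X V"
    and "\<And>y j k. y \<in> V \<Longrightarrow> partial j (\<lambda>y. X y $ k) y = (\<Sum>l\<in>UNIV. A j k l y * X y $ l)"
  shows "(\<Sum>l\<in>UNIV. sys_curv A i j k l x * X x $ l) = 0"
proof -
  have d: "sys_defect A X j k y = 0" if "y \<in> V" for j k y
    using assms(5)[OF that] by (simp add: sys_defect_def)
  have "partial j (sys_defect A X i k) x = 0" for i j
    using partial_cong[OF assms(1,2), of "sys_defect A X i k" "\<lambda>_. 0"] d by simp
  then show ?thesis using sys_defect_commute[where A = A and i = i and j = j and k = k, OF assms(1-4)] d[OF assms(2)] by simp
qed

lemma sum_scaled_bound:
  fixes f :: "'i::finite \<Rightarrow> complex"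
  assumes "\<And>i. cmod (f i) \<le> C"
  shows "cmod (\<Sum>i\<in>UNIV. f i) \<le> real CARD('i) * C"
proof -
  have "cmod (\<Sum>i\<in>UNIV. f i) \<le> (\<Sum>i\<in>(UNIV :: 'i set). C)"
    by (rule sum_norm_le) (use assms in simp)
  then show ?thesis by simp
qed

text \<open>A contraction argument for linear equations: a bound that can always be halved is zero. It
  replaces Gronwall's inequality.\<close>

lemma halving_zero:
  assumes "C \<ge> 0" "\<And>a. P a \<Longrightarrow> cmod (f a) \<le> C"
    "\<And>C. C \<ge> 0 \<Longrightarrow> (\<And>a. P a \<Longrightarrow> cmod (f a) \<le> C) \<Longrightarrow> (\<And>a. P a \<Longrightarrow> cmod (f a) \<le> C / 2)"
    and "P a"
  shows "f a = 0"
proof -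
  have bd: "\<forall>a. P a \<longrightarrow> cmod (f a) \<le> C * (1/2)^n" for n
  proof (induction n)
    case (Suc n)
    then show ?case using assms(3)[of "C * (1/2)^n"] assms(1) by simp
  qed (use assms in simp)
  have "(\<lambda>n. C * (1/2)^n) \<longlonglongrightarrow> C * 0"
    by (intro tendsto_mult tendsto_const LIMSEQ_power_zero) simp
  then have "cmod (f a) \<le> C * 0"
    by (rule LIMSEQ_le_const) (use bd assms(4) in blast)
  then show ?thesis by simp
qed

text \<open>Radial Picard iteration yields a solution along every line through \<open>p\<close>; by flatness the
  defect satisfies a homogeneous equation along these lines, so it vanishes.\<close>

theorem frobenius_linear:
  fixes A :: "'n::finite \<Rightarrow> 'm::finite \<Rightarrow> 'm \<Rightarrow> complex^'n \<Rightarrow> complex"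
  assumes "open U" "p \<in> U" and holA: "\<And>j k l. holo_fun (A j k l) U"
    and flat: "\<And>x i j k l. x \<in> U \<Longrightarrow> sys_curv A i j k l x = 0"
  obtains r where "r > 0" "ball p r \<subseteq> U"
    "\<And>b :: complex^'m. \<exists>X. holo_map X (ball p r) \<and> X p = b \<and>
       (\<forall>x\<in>ball p r. \<forall>j k. partial j (\<lambda>y. X y $ k) x = (\<Sum>l\<in>UNIV. A j k l x * X x $ l))"
proof -
  obtain r0 where r0: "r0 > 0" "cball p r0 \<subseteq> U" using assms(1,2) open_contains_cball by blast
  have "\<exists>K. \<forall>y\<in>cball p r0. cmod (A j k l y) \<le> K" for j k l
  proof -
    have "compact (A j k l ` cball p r0)"
      by (intro compact_continuous_image continuous_on_subset[OF holo_fun_continuous[OF holA] r0(2)]) simp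
    then show ?thesis by (meson bounded_iff compact_imp_bounded image_eqI)
  qed
  then obtain K0 where K0: "\<And>j k l y. y \<in> cball p r0 \<Longrightarrow> cmod (A j k l y) \<le> K0 j k l" by metis
  define K where "K = 1 + (\<Sum>j\<in>UNIV. \<Sum>k\<in>UNIV. \<Sum>l\<in>UNIV. \<bar>K0 j k l\<bar>)"
  have K1: "K > 0" unfolding K_def by (intro add_pos_nonneg sum_nonneg) auto
  have K: "cmod (A j k l y) \<le> K" if "y \<in> cball p r0" for j k l y
  proof -
    have "\<bar>K0 j k l\<bar> \<le> (\<Sum>l\<in>UNIV. \<bar>K0 j k l\<bar>)" by (rule member_le_sum) auto
    also have "\<dots> \<le> (\<Sum>k\<in>UNIV. \<Sum>l\<in>UNIV. \<bar>K0 j k l\<bar>)"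
      by (rule member_le_sum[of k UNIV "\<lambda>k. \<Sum>l\<in>UNIV. \<bar>K0 j k l\<bar>"]) (auto intro: sum_nonneg)
    also have "\<dots> \<le> (\<Sum>j\<in>UNIV. \<Sum>k\<in>UNIV. \<Sum>l\<in>UNIV. \<bar>K0 j k l\<bar>)"
      by (rule member_le_sum[of j UNIV "\<lambda>j. \<Sum>k\<in>UNIV. \<Sum>l\<in>UNIV. \<bar>K0 j k l\<bar>"]) (auto intro!: sum_nonneg)
    finally show ?thesis using K0[OF that, of j k l] by (simp add: K_def)
  qed
  define n where "n = real CARD('n)"
  define m where "m = real CARD('m)"
  have nm: "n > 0" "m > 0" by (simp_all add: n_def m_def)
  define r where "r = min r0 (1 / (2 * n * m * K))"
  have r: "r > 0" "r \<le> r0" using r0 nm K1 by (simp_all add: r_def)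
  have small: "n * (r * (m * (K * C))) \<le> C / 2" if "C \<ge> 0" for C
  proof -
    have "r \<le> 1 / (2 * n * m * K)" by (simp add: r_def)
    then have "r * (2 * n * m * K) \<le> 1" using nm K1 by (simp add: pos_le_divide_eq)
    then have "(r * (2 * n * m * K)) * C \<le> 1 * C" using that by (rule mult_right_mono)
    then show ?thesis by (simp add: algebra_simps)
  qed
  let ?D = "ball p r"
  have DU: "?D \<subseteq> U" using r0 r by (auto intro!: subsetD[OF r0(2)])
  have hA: "holo_fun (A j k l) ?D" for j k l using holA DU by (rule holo_fun_subset)
  have KD: "cmod (A j k l y) \<le> K" if "y \<in> ?D" for j k l y using that r by (intro K) auto
  have wD: "cmod (x $ j - p $ j) \<le> r" if "x \<in> ?D" for x j
    using norm_comp_le[of "x - p" j] that by (simp add: dist_norm norm_minus_commute)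
  have row_holo: "holo_fun (\<lambda>y. \<Sum>l\<in>UNIV. A j k l y * G y $ l) ?D" if "holo_map G ?D" for G :: "complex^'n \<Rightarrow> complex^'m" and j k
    using hA that by (auto simp: holo_fun_iff holo_map_def)
  have row_bound: "cmod (\<Sum>l\<in>UNIV. A j k l y * G l) \<le> m * (K * C)"
    if "y \<in> ?D" "\<And>l. cmod (G l) \<le> C" "C \<ge> 0" for y G C j k
    unfolding m_def by (rule sum_scaled_bound) (use that K1 KD in \<open>auto simp: norm_mult intro!: mult_mono\<close>)
  \<comment> \<open>the integral of \<open>\<Sum>\<^sub>j A\<^sub>j G dx\<^sub>j\<close> along the segment from \<open>p\<close> to \<open>x\<close>\<close>
  define T where "T G k x = (\<Sum>j\<in>UNIV. (x $ j - p $ j) * radial_mean p (\<lambda>y. \<Sum>l\<in>UNIV. A j k l y * G y $ l) x)"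
    for G :: "complex^'n \<Rightarrow> complex^'m" and k x
  have T_bound: "cmod (T G k x) \<le> C / 2"
    if "holo_map G ?D" "x \<in> ?D" "\<And>y l. y \<in> ?D \<Longrightarrow> cmod (G y $ l) \<le> C" "C \<ge> 0" for G k x C
  proof -
    have "cmod (T G k x) \<le> n * (r * (m * (K * C)))"
      unfolding T_def n_def
    proof (rule sum_scaled_bound)
      show "cmod ((x $ j - p $ j) * radial_mean p (\<lambda>y. \<Sum>l\<in>UNIV. A j k l y * G y $ l) x) \<le> r * (m * (K * C))" for j
        unfolding norm_mult
        using wD[OF that(2), of j] radial_mean_bound[OF row_holo[OF that(1)] that(2) row_bound[OF _ that(3,4)]] r
        by (intro mult_mono) auto
    qed
    then show ?thesis using small[OF that(4)] by linarith
  qed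
  have T_diff: "T G k x - T H k x = T (\<lambda>y. G y - H y) k x"
    if "holo_map G ?D" "holo_map H ?D" "x \<in> ?D" for G H k x
    unfolding T_def sum_subtractf[symmetric] right_diff_distrib[symmetric]
      radial_mean_diff[OF row_holo[OF that(1)] row_holo[OF that(2)] that(3)]
    by (simp only: vector_minus_component right_diff_distrib)
  have T_holo: "holo_fun (T G k) ?D" if "holo_map G ?D" for G k
    unfolding T_def[abs_def] using radial_mean_holo[OF row_holo[OF that]]
    by (auto simp: holo_fun_iff)
  have T_euler: "(\<Sum>i\<in>UNIV. (x $ i - p $ i) * partial i (T G k) x)
      = (\<Sum>j\<in>UNIV. (x $ j - p $ j) * (\<Sum>l\<in>UNIV. A j k l x * G x $ l))"
    if "holo_map G ?D" "x \<in> ?D" for G k x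
  proof -
    let ?R = "\<lambda>j. radial_mean p (\<lambda>y. \<Sum>l\<in>UNIV. A j k l y * G y $ l)"
    have c: "cdiff_at (?R j) x" for j
      using radial_mean_holo[OF row_holo[OF that(1)]] that(2) holo_funD by blast
    have "partial i (T G k) x = (\<Sum>j\<in>UNIV. (x $ j - p $ j) * partial i (?R j) x + ?R j x * (if i = j then 1 else 0))" for i
      unfolding T_def[abs_def] by (simp add: partial_sum partial_mult partial_diff c)
    also have "\<dots> i = (\<Sum>j\<in>UNIV. (x $ j - p $ j) * partial i (?R j) x) + ?R i x" for i
      by (simp only: sum.distrib) (simp add: if_distrib cong: if_cong)
    finally have "(\<Sum>i\<in>UNIV. (x $ i - p $ i) * partial i (T G k) x) =
       (\<Sum>i\<in>UNIV. (x $ i - p $ i) * ?R i x) + (\<Sum>i\<in>UNIV. \<Sum>j\<in>UNIV. (x $ i - p $ i) * ((x $ j - p $ j) * partial i (?R j) x))"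
      by (simp add: distrib_left sum.distrib sum_distrib_left)
    also have "(\<Sum>i\<in>UNIV. \<Sum>j\<in>UNIV. (x $ i - p $ i) * ((x $ j - p $ j) * partial i (?R j) x)) =
       (\<Sum>j\<in>UNIV. (x $ j - p $ j) * (\<Sum>i\<in>UNIV. (x $ i - p $ i) * partial i (?R j) x))"
      by (subst sum.swap) (simp add: sum_distrib_left mult.left_commute)
    also have "(\<Sum>i\<in>UNIV. (x $ i - p $ i) * ?R i x) + \<dots> =
       (\<Sum>j\<in>UNIV. (x $ j - p $ j) * (?R j x + (\<Sum>i\<in>UNIV. (x $ i - p $ i) * partial i (?R j) x)))"
      by (simp add: distrib_left sum.distrib)
    also have "\<dots> = (\<Sum>j\<in>UNIV. (x $ j - p $ j) * (\<Sum>l\<in>UNIV. A j k l x * G x $ l))"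
      by (simp only: radial_mean_euler[OF row_holo[OF that(1)] that(2)])
    finally show ?thesis .
  qed
  have "\<exists>X. holo_map X ?D \<and> X p = b \<and>
       (\<forall>x\<in>?D. \<forall>j k. partial j (\<lambda>y. X y $ k) x = (\<Sum>l\<in>UNIV. A j k l x * X x $ l))" for b :: "complex^'m"
  proof -
    define Z where "Z = rec_nat (\<lambda>x. b) (\<lambda>n Y. \<lambda>x. \<chi> k. b $ k + T Y k x)"
    have Z0: "Z 0 = (\<lambda>x. b)" and ZS: "Z (Suc N) = (\<lambda>x. \<chi> k. b $ k + T (Z N) k x)" for N
      by (simp_all add: Z_def)
    have Zh: "holo_map (Z N) ?D" for N
    proof (induction N)
      case (Suc N)
      then show ?case using T_holo by (auto simp: holo_map_def ZS holo_fun_iff)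
    qed (auto simp: Z0 holo_map_def holo_fun_iff)
    have Zp: "Z N p = b" for N by (cases N) (simp_all add: Z0 ZS T_def vec_eq_iff)
    have step: "cmod (Z (Suc N) x $ k - Z N x $ k) \<le> norm b * (1/2)^N" if "x \<in> ?D" for N x k
      using that
    proof (induction N arbitrary: x k)
      case 0
      have "cmod (T (Z 0) k x) \<le> norm b / 2"
        using T_bound[OF Zh[of 0] 0, of "norm b"] norm_comp_le[of b] by (simp add: Z0)
      then show ?case using norm_ge_zero[of b] by (simp add: ZS Z0 del: norm_ge_zero)
    next
      case (Suc N)
      have hd: "holo_map (\<lambda>y. Z (Suc N) y - Z N y) ?D"
        using Zh[of "Suc N"] Zh[of N] by (auto simp: holo_map_def holo_fun_iff)
      have "cmod (T (\<lambda>y. Z (Suc N) y - Z N y) k x) \<le> (norm b * (1/2)^N) / 2"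
        by (rule T_bound[OF hd Suc.prems]) (use Suc.IH in auto)
      moreover have "Z (Suc (Suc N)) x $ k - Z (Suc N) x $ k = T (Z (Suc N)) k x - T (Z N) k x"
        unfolding ZS[of "Suc N"] by (simp add: ZS[of N])
      ultimately show ?case
        using T_diff[OF Zh[of "Suc N"] Zh[of N] Suc.prems, of k] by simp
    qed
    have "uniformly_convergent_on ?D (\<lambda>N x. Z N x $ k)" for k
    proof -
      have "uniformly_convergent_on ?D (\<lambda>N x. \<Sum>i<N. Z (Suc i) x $ k - Z i x $ k)"
        by (rule Weierstrass_m_test'[where M = "\<lambda>N. norm b * (1/2)^N"])
           (use step in \<open>auto intro!: summable_mult summable_geometric\<close>)
      moreover have "(\<Sum>i<N. Z (Suc i) x $ k - Z i x $ k) = Z N x $ k - b $ k" for N x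
        by (induction N) (auto simp: Z0)
      ultimately have "uniformly_convergent_on ?D (\<lambda>N x. Z N x $ k - b $ k)" by simp
      then obtain l where "uniform_limit ?D (\<lambda>N x. Z N x $ k - b $ k) l sequentially"
        unfolding uniformly_convergent_on_def by blast
      then have "uniform_limit ?D (\<lambda>N x. (Z N x $ k - b $ k) + b $ k) (\<lambda>x. l x + b $ k) sequentially"
        by (intro uniform_limit_add uniform_limit_const)
      then show ?thesis unfolding uniformly_convergent_on_def by auto
    qed
    then obtain l where l: "\<And>k. uniform_limit ?D (\<lambda>N x. Z N x $ k) (l k) sequentially"
      unfolding uniformly_convergent_on_def by metis
    define X where "X x = (\<chi> k. l k x)" for x
    have Zh': "holo_fun (\<lambda>x. Z N x $ k) ?D" for N k using Zh by (simp add: holo_map_def)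
    have lh: "holo_fun (l k) ?D" for k by (rule holo_uniform_limit(1)[OF open_ball Zh' l])
    have lp: "(\<lambda>N. partial i (\<lambda>x. Z N x $ k) x) \<longlonglongrightarrow> partial i (l k) x" if "x \<in> ?D" for x i k
      by (rule holo_uniform_limit(2)[OF open_ball Zh' l that])
    have lim: "(\<lambda>N. Z N x $ k) \<longlonglongrightarrow> l k x" if "x \<in> ?D" for x k
      by (rule tendsto_uniform_limitI[OF l that])
    have Xh: "holo_map X ?D" using lh by (simp add: holo_map_def X_def)
    have Xk: "(\<lambda>y. X y $ k) = l k" for k by (simp add: X_def)
    have Xp: "X p = b"
      using lim[of p] r by (auto simp: X_def Zp vec_eq_iff LIMSEQ_const_iff)
    \<comment> \<open>the limit solves the system in the radial direction\<close>
    have euler: "(\<Sum>i\<in>UNIV. (x $ i - p $ i) * partial i (l k) x)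
        = (\<Sum>j\<in>UNIV. (x $ j - p $ j) * (\<Sum>l'\<in>UNIV. A j k l' x * l l' x))" if x: "x \<in> ?D" for x k
    proof (rule LIMSEQ_unique)
      show "(\<lambda>N. \<Sum>i\<in>UNIV. (x $ i - p $ i) * partial i (\<lambda>x. Z (Suc N) x $ k) x)
         \<longlonglongrightarrow> (\<Sum>i\<in>UNIV. (x $ i - p $ i) * partial i (l k) x)"
        by (intro tendsto_intros LIMSEQ_Suc lp x)
      have "partial i (\<lambda>x. Z (Suc N) x $ k) x = partial i (T (Z N) k) x" for N i
        using holo_funD[OF T_holo[OF Zh] x] by (simp add: ZS partial_add)
      then have "(\<Sum>i\<in>UNIV. (x $ i - p $ i) * partial i (\<lambda>x. Z (Suc N) x $ k) x)
          = (\<Sum>j\<in>UNIV. (x $ j - p $ j) * (\<Sum>l'\<in>UNIV. A j k l' x * Z N x $ l'))" for N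
        using T_euler[OF Zh[of N] x, where k = k] by simp
      then show "(\<lambda>N. \<Sum>i\<in>UNIV. (x $ i - p $ i) * partial i (\<lambda>x. Z (Suc N) x $ k) x)
         \<longlonglongrightarrow> (\<Sum>j\<in>UNIV. (x $ j - p $ j) * (\<Sum>l'\<in>UNIV. A j k l' x * l l' x))"
        by (simp only:) (intro tendsto_intros lim x)
    qed
    let ?Y = "sys_defect A X"
    have Yh: "holo_fun (?Y j k) ?D" for j k
      unfolding sys_defect_def[abs_def] holo_fun_iff Xk
      using holo_funD[OF holo_partial[OF open_ball lh]] holo_funD[OF hA] holo_funD[OF lh]
      by (auto simp: X_def)
    have radial: "(\<Sum>i\<in>UNIV. (x $ i - p $ i) * ?Y i k x) = 0" if "x \<in> ?D" for x k
      using euler[OF that, of k] unfolding sys_defect_def Xk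
      by (simp add: right_diff_distrib sum_subtractf X_def)
    \<comment> \<open>differentiating the radial relation and exchanging indices with the help of flatness\<close>
    have Yeq: "?Y j k x + (\<Sum>i\<in>UNIV. (x $ i - p $ i) * partial i (?Y j k) x) =
        (\<Sum>i\<in>UNIV. (x $ i - p $ i) * (\<Sum>l\<in>UNIV. A i k l x * ?Y j l x))" if x: "x \<in> ?D" for x j k
    proof -
      have c: "cdiff_at (?Y i k) x" for i k using holo_funD[OF Yh x] .
      have "partial j (\<lambda>x. \<Sum>i\<in>UNIV. (x $ i - p $ i) * ?Y i k x) x = 0"
        using partial_cong[OF open_ball x, of "\<lambda>x. \<Sum>i\<in>UNIV. (x $ i - p $ i) * ?Y i k x" "\<lambda>_. 0"] radial by simp
      then have "(\<Sum>i\<in>UNIV. (x $ i - p $ i) * partial j (?Y i k) x + ?Y i k x * (if j = i then 1 else 0)) = 0"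
        by (simp add: partial_sum partial_mult partial_diff c)
      then have e1: "?Y j k x + (\<Sum>i\<in>UNIV. (x $ i - p $ i) * partial j (?Y i k) x) = 0"
        by (simp only: sum.distrib) (simp add: if_distrib add.commute cong: if_cong)
      have "partial j (?Y i k) x = partial i (?Y j k) x +
           ((\<Sum>l\<in>UNIV. A j k l x * ?Y i l x) - (\<Sum>l\<in>UNIV. A i k l x * ?Y j l x))" for i
        using sys_defect_commute[where A = A and i = i and j = j and k = k, OF open_ball x hA Xh] flat[of x] x DU
        by (simp add: sum_subtractf algebra_simps subset_iff)
      then have "(\<Sum>i\<in>UNIV. (x $ i - p $ i) * partial j (?Y i k) x) =
         (\<Sum>i\<in>UNIV. (x $ i - p $ i) * partial i (?Y j k) x)
         + (\<Sum>i\<in>UNIV. (x $ i - p $ i) * (\<Sum>l\<in>UNIV. A j k l x * ?Y i l x))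
         - (\<Sum>i\<in>UNIV. (x $ i - p $ i) * (\<Sum>l\<in>UNIV. A i k l x * ?Y j l x))"
        by (simp add: distrib_left right_diff_distrib sum.distrib sum_subtractf)
      also have "(\<Sum>i\<in>UNIV. (x $ i - p $ i) * (\<Sum>l\<in>UNIV. A j k l x * ?Y i l x)) =
         (\<Sum>l\<in>UNIV. A j k l x * (\<Sum>i\<in>UNIV. (x $ i - p $ i) * ?Y i l x))"
        unfolding sum_distrib_left by (subst sum.swap) (simp add: mult.left_commute)
      also have "\<dots> = 0" by (simp add: radial[OF x])
      finally have e2: "(\<Sum>i\<in>UNIV. (x $ i - p $ i) * partial j (?Y i k) x) =
         (\<Sum>i\<in>UNIV. (x $ i - p $ i) * partial i (?Y j k) x) + 0
         - (\<Sum>i\<in>UNIV. (x $ i - p $ i) * (\<Sum>l\<in>UNIV. A i k l x * ?Y j l x))" .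
      have "s1 = s2 + 0 - s3 \<Longrightarrow> a + s1 = 0 \<Longrightarrow> a + s2 = s3" for a s1 s2 s3 :: complex
        by (metis add_0_right add_diff_eq eq_iff_diff_eq_0)
      from this[OF e2 e1] show ?thesis .
    qed
    have Y0: "?Y j k x = 0" if x: "x \<in> ?D" for x j k
    proof -
      define w where "w = x - p"
      define f where "f = (\<lambda>(z, k). z * ?Y j k (p + z *s w))"
      have inD: "p + z *s w \<in> ?D" if "cmod z \<le> 1" for z
        unfolding w_def by (rule in_ball_radial[OF x that])
      have comp: "(p + z *s w) $ i - p $ i = z * w $ i" for z i by simp
      have der: "((\<lambda>z. f (z, k)) has_field_derivative (\<Sum>i\<in>UNIV. w $ i * (\<Sum>l\<in>UNIV. A i k l (p + z *s w) * f (z, l)))) (at z)"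
        if z: "cmod z \<le> 1" for z k
      proof -
        let ?q = "p + z *s w"
        have "((\<lambda>z. ?Y j k (p + z *s w)) has_field_derivative pairing (differential (?Y j k) ?q) w) (at z)"
          by (rule has_grad_line) (use holo_funD[OF Yh inD[OF z]] in \<open>simp add: cdiff_at_iff\<close>)
        then have "((\<lambda>z. f (z, k)) has_field_derivative (?Y j k ?q + z * pairing (differential (?Y j k) ?q) w)) (at z)"
          unfolding f_def by (auto intro!: derivative_eq_intros simp: mult.commute)
        also have "?Y j k ?q + z * pairing (differential (?Y j k) ?q) w
           = ?Y j k ?q + (\<Sum>i\<in>UNIV. (?q $ i - p $ i) * partial i (?Y j k) ?q)"
          unfolding comp by (simp add: pairing_def sum_distrib_left mult_ac)
        also have "\<dots> = (\<Sum>i\<in>UNIV. w $ i * (\<Sum>l\<in>UNIV. A i k l ?q * f (z, l)))"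
          unfolding Yeq[OF inD[OF z]] unfolding comp f_def by (simp add: sum_distrib_left mult_ac)
        finally show ?thesis .
      qed
      have "compact ((\<lambda>z. f (z, k)) ` cball 0 1)" for k
        by (intro compact_continuous_image continuous_at_imp_continuous_on ballI DERIV_isCont[OF der]) auto
      then have "\<exists>C. \<forall>z\<in>cball 0 1. cmod (f (z, k)) \<le> C" for k
        by (meson bounded_iff compact_imp_bounded image_eqI)
      then obtain C where C: "\<And>k z. z \<in> cball 0 1 \<Longrightarrow> cmod (f (z, k)) \<le> C k" by metis
      have "f (1, k) = 0"
      proof (rule halving_zero[where P = "\<lambda>a :: complex \<times> 'm. cmod (fst a) \<le> 1" and C = "\<Sum>k\<in>UNIV. \<bar>C k\<bar>"])
        show "(\<Sum>k\<in>UNIV. \<bar>C k\<bar>) \<ge> 0" by (intro sum_nonneg) simp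
        show "cmod (f a) \<le> (\<Sum>k\<in>UNIV. \<bar>C k\<bar>)" if "cmod (fst a) \<le> 1" for a :: "complex \<times> 'm"
        proof -
          have "\<bar>C (snd a)\<bar> \<le> (\<Sum>k\<in>UNIV. \<bar>C k\<bar>)" by (rule member_le_sum) auto
          then show ?thesis using C[of "fst a" "snd a"] that by simp
        qed
        fix B :: real and a :: "complex \<times> 'm" assume B: "B \<ge> 0" "\<And>a. cmod (fst a) \<le> 1 \<Longrightarrow> cmod (f a) \<le> B" and a: "cmod (fst a) \<le> 1"
        have "cmod (f (fst a, snd a) - f (0, snd a)) \<le> (n * (r * (m * (K * B)))) * norm (fst a - 0)"
        proof (rule field_differentiable_bound[of "cball 0 1"])
          fix z :: complex assume z: "z \<in> cball 0 1"
          show "((\<lambda>z. f (z, snd a)) has_field_derivative (\<Sum>i\<in>UNIV. w $ i * (\<Sum>l\<in>UNIV. A i (snd a) l (p + z *s w) * f (z, l)))) (at z within cball 0 1)"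
            by (rule has_field_derivative_at_within[OF der]) (use z in simp)
          show "cmod (\<Sum>i\<in>UNIV. w $ i * (\<Sum>l\<in>UNIV. A i (snd a) l (p + z *s w) * f (z, l))) \<le> n * (r * (m * (K * B)))"
            unfolding n_def
          proof (rule sum_scaled_bound)
            show "cmod (w $ i * (\<Sum>l\<in>UNIV. A i (snd a) l (p + z *s w) * f (z, l))) \<le> r * (m * (K * B))" for i
              unfolding norm_mult
              using wD[OF x, of i] row_bound[OF inD[of z], of "\<lambda>l. f (z, l)" B] B z r
              by (intro mult_mono) (auto simp: w_def)
          qed
        qed (use a in auto)
        also have "\<dots> \<le> n * (r * (m * (K * B)))"
          using a nm r K1 B by (intro mult_right_le_one_le) auto
        also have "\<dots> \<le> B / 2" by (rule small[OF B(1)])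
        finally show "cmod (f a) \<le> B / 2" by (simp add: f_def case_prod_beta)
      qed simp
      then show ?thesis by (simp add: f_def w_def)
    qed
    show ?thesis
      using Xh Xp Y0 unfolding sys_defect_def by (intro exI[of _ X]) auto
  qed
  then show thesis using that[OF r(1) DU] by blast
qed

section \<open>Holomorphic maps and their Jacobians\<close>

lemma jacobian_nth [simp]: "jacobian \<phi> x $ k $ i = partial i (\<lambda>y. \<phi> y $ k) x"
  by (simp add: jacobian_def)

lemma jacobian_mult_nth: "(jacobian \<phi> x *v v) $ k = pairing (differential (\<lambda>y. \<phi> y $ k) x) v"
  by (simp add: matrix_vector_mult_def pairing_def)

lemma holo_map_has_derivative:
  assumes "holo_map \<phi> S" "x \<in> S"
  shows "(\<phi> has_derivative (*v) (jacobian \<phi> x)) (at x)"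
proof (rule has_derivative_vecI)
  show "((\<lambda>x. \<phi> x $ k) has_derivative (\<lambda>h. (jacobian \<phi> x *v h) $ k)) (at x)" for k
    using holo_mapD[OF assms, of k] unfolding cdiff_at_iff has_grad_def jacobian_mult_nth by simp
qed

lemma bounded_linear_mult_vec: "bounded_linear ((*v) (A :: complex^'n^'m))"
  by (rule linear_conv_bounded_linear[THEN iffD1], rule linearI)
     (simp_all add: matrix_vector_right_distrib scaleR_vec_eq vector_scalar_commute)

lemma mult_vec_scale: "A *v (c *s v) = c *s (A *v (v :: complex^'n))"
  by (simp add: vector_scalar_commute)

text \<open>The derivative of the real inverse function is the inverse of a complex linear map, hence complex
  linear.\<close>

lemma holo_inverse_function:
  fixes \<phi> :: "complex^'n \<Rightarrow> complex^'n"
  assumes "open U" "holo_map \<phi> U" "p \<in> U" "jacobian \<phi> p = mat 1"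
  obtains V where "p \<in> V" "V \<subseteq> U" "biholomorphism V \<phi> (\<phi> ` V)"
proof -
  define f' where "f' x = Blinfun ((*v) (jacobian \<phi> x))" for x
  have f': "blinfun_apply (f' x) = (*v) (jacobian \<phi> x)" for x
    unfolding f'_def by (rule bounded_linear_Blinfun_apply[OF bounded_linear_mult_vec])
  have "continuous_on U f'"
  proof (rule continuous_on_blinfun_componentwise)
    fix i :: "complex^'n"
    have "continuous_on U (partial j (\<lambda>y. \<phi> y $ k))" for j k
      using assms(1,2) by (auto simp: holo_map_def intro!: holo_fun_continuous holo_partial)
    then have "continuous_on U (\<lambda>x. \<chi> k. \<Sum>j\<in>UNIV. partial j (\<lambda>y. \<phi> y $ k) x * i $ j)"
      by (intro continuous_intros)
    then show "continuous_on U (\<lambda>x. blinfun_apply (f' x) i)"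
      unfolding f' by (simp add: matrix_vector_mult_def)
  qed
  moreover have "id_blinfun o\<^sub>L f' p = id_blinfun"
    by (rule blinfun_eqI) (simp add: f' assms(4))
  moreover have "(\<phi> has_derivative blinfun_apply (f' x)) (at x)" if "x \<in> U" for x
    unfolding f' by (rule holo_map_has_derivative[OF assms(2) that])
  ultimately obtain V V' g g' where V: "open V" "V \<subseteq> U" "p \<in> V" "open V'" "\<phi> p \<in> V'" "homeomorphism V V' \<phi> g"
    "\<And>y. y \<in> V' \<Longrightarrow> (g has_derivative (g' y)) (at y)"
    "\<And>y. y \<in> V' \<Longrightarrow> g' y = inv (blinfun_apply (f' (g y)))"
    "\<And>y. y \<in> V' \<Longrightarrow> bij (blinfun_apply (f' (g y)))"
    using inverse_function_theorem[OF assms(1), of \<phi> f' p id_blinfun] assms(3) by blast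
  have im: "\<phi> ` V = V'" using V(6) by (simp add: homeomorphism_def)
  have bij: "bij_betw \<phi> V V'"
    using V(6) unfolding homeomorphism_def bij_betw_def inj_on_def by metis
  have inv: "inv_into V \<phi> y = g y" if "y \<in> V'" for y
  proof (rule inv_into_f_eq)
    show "inj_on \<phi> V" using bij by (simp add: bij_betw_def)
    show "g y \<in> V" "\<phi> (g y) = y" using V(6) that by (auto simp: homeomorphism_def)
  qed
  have "holo_fun (\<lambda>y. g y $ k) V'" for k
    unfolding holo_fun_def
  proof (intro ballI exI conjI allI)
    fix y assume y: "y \<in> V'"
    show "((\<lambda>y. g y $ k) has_derivative (\<lambda>v. g' y v $ k)) (at y)"
      using bounded_linear.has_derivative[OF bounded_linear_vec_nth V(7)[OF y]] .
    have b: "bij ((*v) (jacobian \<phi> (g y)))" using V(9)[OF y] by (simp add: f')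
    show "g' y (a *s v) $ k = a * g' y v $ k" for a v
    proof -
      have "jacobian \<phi> (g y) *v (a *s inv ((*v) (jacobian \<phi> (g y))) v) = a *s v"
        unfolding mult_vec_scale using b by (simp add: bij_is_surj surj_f_inv_f)
      then have "inv ((*v) (jacobian \<phi> (g y))) (a *s v) = a *s inv ((*v) (jacobian \<phi> (g y))) v"
        using b by (metis bij_inv_eq_iff)
      then show ?thesis using V(8)[OF y] by (simp add: f')
    qed
  qed
  then have "holo_map (inv_into V \<phi>) V'"
    unfolding holo_map_def using holo_fun_cong[OF V(4), of "\<lambda>y. g y $ k" "\<lambda>y. inv_into V \<phi> y $ k" for k] inv by simp
  moreover have "holo_map \<phi> V" using assms(2) V(2) by (auto simp: holo_map_def intro: holo_fun_subset)
  ultimately have "biholomorphism V \<phi> (\<phi> ` V)"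
    unfolding biholomorphism_def im using V bij by simp
  then show thesis using that V by blast
qed

lemma biholo_facts:
  assumes "biholomorphism V \<phi> V'"
  shows "open V" "open V'" "holo_map \<phi> V" "holo_map (inv_into V \<phi>) V'"
    "\<And>x. x \<in> V \<Longrightarrow> \<phi> x \<in> V'" "\<And>x. x \<in> V \<Longrightarrow> inv_into V \<phi> (\<phi> x) = x"
    "\<And>y. y \<in> V' \<Longrightarrow> inv_into V \<phi> y \<in> V" "\<And>y. y \<in> V' \<Longrightarrow> \<phi> (inv_into V \<phi> y) = y"
  using assms unfolding biholomorphism_def bij_betw_def
  by (auto simp: inv_into_into f_inv_into_f)

lemma biholo_jacobian_inverse:
  assumes "biholomorphism V \<phi> V'" "x \<in> V"
  shows "jacobian (inv_into V \<phi>) (\<phi> x) ** jacobian \<phi> x = mat 1"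
    and "jacobian \<phi> x ** jacobian (inv_into V \<phi>) (\<phi> x) = mat 1"
    and "matrix_inv (jacobian \<phi> x) = jacobian (inv_into V \<phi>) (\<phi> x)"
    and "invertible (jacobian \<phi> x)"
proof -
  note b = biholo_facts[OF assms(1)]
  let ?\<psi> = "inv_into V \<phi>"
  have "partial i (\<lambda>y. ?\<psi> (\<phi> y) $ k) x = (\<Sum>l\<in>UNIV. partial l (\<lambda>z. ?\<psi> z $ k) (\<phi> x) * partial i (\<lambda>y. \<phi> y $ l) x)" for i k
    by (rule partial_compose) (use b assms(2) in \<open>auto intro!: holo_mapD\<close>)
  moreover have "partial i (\<lambda>y. ?\<psi> (\<phi> y) $ k) x = (if i = k then 1 else 0)" for i k
    using partial_cong[OF b(1) assms(2), of "\<lambda>y. ?\<psi> (\<phi> y) $ k" "\<lambda>y. y $ k" i] b(6) by simp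
  ultimately show 1: "jacobian ?\<psi> (\<phi> x) ** jacobian \<phi> x = mat 1"
    by (simp add: vec_eq_iff matrix_matrix_mult_def mat_def) (metis (mono_tags, lifting) sum.cong)
  then show 2: "jacobian \<phi> x ** jacobian ?\<psi> (\<phi> x) = mat 1" by (simp add: matrix_left_right_inverse)
  show inv: "invertible (jacobian \<phi> x)" using 1 2 unfolding invertible_def by blast
  have "matrix_inv (jacobian \<phi> x) = matrix_inv (jacobian \<phi> x) ** (jacobian \<phi> x ** jacobian ?\<psi> (\<phi> x))"
    by (simp add: 2)
  also have "\<dots> = jacobian ?\<psi> (\<phi> x)"
    using someI_ex[OF inv[unfolded invertible_def]] by (simp add: matrix_mul_assoc matrix_inv_def)
  finally show "matrix_inv (jacobian \<phi> x) = jacobian ?\<psi> (\<phi> x)" .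
qed

section \<open>Geodesics and projective equivalence\<close>

definition quad_form :: "('n \<Rightarrow> 'n \<Rightarrow> 'n \<Rightarrow> complex) \<Rightarrow> complex^'n \<Rightarrow> complex^'n::finite" where
  "quad_form S v = (\<chi> k. \<Sum>i\<in>UNIV. \<Sum>j\<in>UNIV. S k i j * v $ i * v $ j)"

lemma quad_form_scale: "quad_form S (a *s v) = a\<^sup>2 *s quad_form S v"
  by (simp add: quad_form_def vec_eq_iff sum_distrib_left power2_eq_square mult_ac)

lemma quad_form_zero [simp]: "quad_form S 0 = 0"
  by (simp add: quad_form_def vec_eq_iff)

lemma velocity_eqI:
  "(\<And>k. ((\<lambda>s. c s $ k) has_field_derivative w $ k) (at t)) \<Longrightarrow> velocity c t = w"
  by (simp add: velocity_def vec_eq_iff DERIV_imp_deriv)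

lemma affine_geodesicD:
  assumes "affine_geodesic U \<Gamma> D c" "t \<in> D"
  shows "open D" "c t \<in> U" "velocity c t \<noteq> 0"
    "((\<lambda>s. c s $ k) has_field_derivative velocity c t $ k) (at t)"
    "((\<lambda>s. velocity c s $ k) has_field_derivative - (quad_form (\<Gamma> (c t)) (velocity c t) $ k)) (at t)"
proof -
  have o: "open D" and hol: "\<And>k. (\<lambda>t. c t $ k) holomorphic_on D"
    using assms(1) by (auto simp: affine_geodesic_def)
  show "open D" by (rule o)
  show "c t \<in> U" "velocity c t \<noteq> 0" using assms by (auto simp: affine_geodesic_def)
  show "((\<lambda>s. c s $ k) has_field_derivative velocity c t $ k) (at t)"
    using holomorphic_derivI[OF hol o assms(2)] by (simp add: velocity_def)
  have "(deriv (\<lambda>s. c s $ k)) holomorphic_on D" by (intro holomorphic_deriv hol o)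
  then have "(deriv (\<lambda>s. c s $ k) has_field_derivative deriv (deriv (\<lambda>s. c s $ k)) t) (at t)"
    by (rule holomorphic_derivI[OF _ o assms(2)])
  moreover have "velocity (velocity c) t $ k + quad_form (\<Gamma> (c t)) (velocity c t) $ k = 0"
    using assms by (simp add: affine_geodesic_def quad_form_def)
  ultimately show "((\<lambda>s. velocity c s $ k) has_field_derivative - (quad_form (\<Gamma> (c t)) (velocity c t) $ k)) (at t)"
    by (simp add: velocity_def add_eq_0_iff)
qed

lemma affine_geodesicI:
  assumes "open D" "\<And>t. t \<in> D \<Longrightarrow> c t \<in> U" "\<And>t. t \<in> D \<Longrightarrow> w t \<noteq> 0"
    "\<And>t k. t \<in> D \<Longrightarrow> ((\<lambda>s. c s $ k) has_field_derivative w t $ k) (at t)"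
    "\<And>t k. t \<in> D \<Longrightarrow> ((\<lambda>s. w s $ k) has_field_derivative - (quad_form (\<Gamma> (c t)) (w t) $ k)) (at t)"
  shows "affine_geodesic U \<Gamma> D c" and "\<And>t. t \<in> D \<Longrightarrow> velocity c t = w t"
proof -
  show v: "velocity c t = w t" if "t \<in> D" for t using assms(4)[OF that] by (rule velocity_eqI)
  have "velocity (velocity c) t = - quad_form (\<Gamma> (c t)) (w t)" if t: "t \<in> D" for t
  proof (rule velocity_eqI)
    show "((\<lambda>s. velocity c s $ k) has_field_derivative (- quad_form (\<Gamma> (c t)) (w t)) $ k) (at t)" for k
      using has_field_derivative_transform_within_open[OF assms(5)[OF t, of k] assms(1) t, of "\<lambda>s. velocity c s $ k"] v
      by simp
  qed
  then show "affine_geodesic U \<Gamma> D c"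
    unfolding affine_geodesic_def using assms v
    by (auto simp: holomorphic_on_open quad_form_def intro!: exI)
qed

lemma affine_geodesic_subset:
  assumes "affine_geodesic U \<Gamma> D c" "open D'" "D' \<subseteq> D"
  shows "affine_geodesic U \<Gamma> D' c"
  using assms unfolding affine_geodesic_def by (blast intro: holomorphic_on_subset)

lemma curve_continuous:
  assumes "\<And>k t. t \<in> D \<Longrightarrow> ((\<lambda>s. c s $ k) has_field_derivative w t $ k) (at t)"
  shows "continuous_on D (c :: complex \<Rightarrow> complex^'n)"
proof (rule continuous_at_imp_continuous_on, rule ballI)
  fix t assume t: "t \<in> D"
  have "((\<lambda>s. c s $ k) has_field_derivative w t $ k) (at t)" for k
    using assms t .
  then have "(c has_derivative (\<lambda>h. h *s w t)) (at t)" by (rule has_derivative_curve)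
  then show "isCont c t" by (rule has_derivative_continuous)
qed

text \<open>The second order equation is a first order system on pairs of position and velocity, indexed by the
  sum type of two copies of the coordinates.\<close>

lemma geodesic_exists:
  fixes \<Gamma> :: "'n::finite christoffel"
  assumes "open U" "affine_connection U \<Gamma>" "p \<in> U" "v \<noteq> 0"
  obtains r c where "r > 0" "affine_geodesic U \<Gamma> (ball 0 r) c" "c 0 = p" "velocity c 0 = v"
proof -
  let ?pos = "\<lambda>X :: complex^('n + 'n). \<chi> i. X $ Inl i"
  let ?vel = "\<lambda>X :: complex^('n + 'n). \<chi> i. X $ Inr i"
  define S where "S = {X :: complex^('n+'n). ?pos X \<in> U}"
  define F where "F X = (\<chi> a. case a of Inl i \<Rightarrow> X $ Inr i | Inr k \<Rightarrow> - (quad_form (\<Gamma> (?pos X)) (?vel X) $ k))"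
    for X :: "complex^('n+'n)"
  define X0 where "X0 = (\<chi> a. case a of Inl i \<Rightarrow> p $ i | Inr i \<Rightarrow> v $ i)"
  have "open (?pos -` U)"
    by (rule open_vimage[OF assms(1)]) (intro continuous_intros)
  then have oS: "open S" by (simp add: S_def vimage_def)
  have "holo_fun (\<lambda>X. F X $ a) S" for a
  proof (cases a)
    case (Inl i) then show ?thesis by (simp add: F_def holo_fun_iff)
  next
    case (Inr k)
    have "cdiff_at (\<lambda>X. \<Gamma> (?pos X) k i j) X" if "X \<in> S" for X i j
    proof (rule cdiff_compose[of "\<lambda>x. \<Gamma> x k i j" ?pos X])
      show "cdiff_at (\<lambda>x. \<Gamma> x k i j) (?pos X)"
        using that assms(2) by (auto simp: S_def affine_connection_def holo_fun_iff)
    qed simp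
    then show ?thesis using Inr by (simp add: F_def holo_fun_iff quad_form_def)
  qed
  then have F: "holo_map F S" by (simp add: holo_map_def)
  have X0: "X0 \<in> S" using assms(3) by (simp add: S_def X0_def)
  obtain r0 X where X: "r0 > 0" "X 0 = X0" "\<And>t. t \<in> ball 0 r0 \<Longrightarrow> X t \<in> S"
    "\<And>t k. t \<in> ball 0 r0 \<Longrightarrow> ((\<lambda>s. X s $ k) has_field_derivative F (X t) $ k) (at t)"
    using holo_ode_exists[OF oS F X0] by blast
  obtain k where k: "v $ k \<noteq> 0" using assms(4) by (auto simp: vec_eq_iff)
  have "continuous_on (ball 0 r0) (\<lambda>t. X t $ Inr k)"
  proof (rule continuous_at_imp_continuous_on, rule ballI)
    show "isCont (\<lambda>t. X t $ Inr k) t" if "t \<in> ball 0 r0" for t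
      by (rule DERIV_isCont[OF X(4)[OF that]])
  qed
  moreover have "X 0 $ Inr k \<noteq> 0" using k by (simp add: X(2) X0_def)
  ultimately obtain r1 where r1: "r1 > 0" "\<And>t. t \<in> ball 0 r0 \<Longrightarrow> dist 0 t < r1 \<Longrightarrow> X t $ Inr k \<noteq> 0"
    using continuous_on_avoid[of "ball 0 r0" "\<lambda>t. X t $ Inr k" 0 0] X(1)
    by (metis centre_in_ball)
  define r where "r = min r0 r1"
  let ?c = "\<lambda>t. ?pos (X t)" and ?w = "\<lambda>t. ?vel (X t)"
  have *: "open (ball 0 r)" "\<And>t. t \<in> ball 0 r \<Longrightarrow> ?c t \<in> U" "\<And>t. t \<in> ball 0 r \<Longrightarrow> ?w t \<noteq> 0"
    "\<And>t k. t \<in> ball 0 r \<Longrightarrow> ((\<lambda>s. ?c s $ k) has_field_derivative ?w t $ k) (at t)"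
    "\<And>t k. t \<in> ball 0 r \<Longrightarrow> ((\<lambda>s. ?w s $ k) has_field_derivative - (quad_form (\<Gamma> (?c t)) (?w t) $ k)) (at t)"
  proof -
    fix t :: complex and k assume t: "t \<in> ball 0 r"
    then have t0: "t \<in> ball 0 r0" by (simp add: r_def)
    show "?c t \<in> U" using X(3)[OF t0] by (simp add: S_def)
    show "?w t \<noteq> 0" using r1(2)[OF t0] t by (auto simp: r_def vec_eq_iff)
    show "((\<lambda>s. ?c s $ k) has_field_derivative ?w t $ k) (at t)" using X(4)[OF t0, of "Inl k"] by (simp add: F_def)
    show "((\<lambda>s. ?w s $ k) has_field_derivative - (quad_form (\<Gamma> (?c t)) (?w t) $ k)) (at t)"
      using X(4)[OF t0, of "Inr k"] by (simp add: F_def)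
  qed simp
  have r: "r > 0" using X(1) r1(1) by (simp add: r_def)
  show thesis
  proof (rule that[OF r])
    show "affine_geodesic U \<Gamma> (ball 0 r) ?c" by (rule affine_geodesicI(1)[OF *])
    show "?c 0 = p" by (simp add: X(2) X0_def vec_eq_iff)
    have "velocity ?c 0 = ?w 0" by (rule affine_geodesicI(2)[OF *]) (use r in auto)
    then show "velocity ?c 0 = v" by (simp add: X(2) X0_def vec_eq_iff)
  qed
qed

text \<open>Weyl's criterion for projective equivalence, in a form that does not mention the 1-form of the
  classical version and makes sense for connections with torsion.\<close>

definition proj_similar :: "(complex^'n) set \<Rightarrow> 'n::finite christoffel \<Rightarrow> 'n christoffel \<Rightarrow> bool" where
  "proj_similar V \<Gamma> \<Gamma>' \<longleftrightarrow> (\<forall>x\<in>V. \<forall>v. \<exists>s. quad_form (\<Gamma> x) v - quad_form (\<Gamma>' x) v = s *s v)"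

lemma proj_similar_refl: "proj_similar V \<Gamma> \<Gamma>"
  unfolding proj_similar_def by (metis diff_self vector_smult_lzero)

lemma proj_similar_sym: "proj_similar V \<Gamma> \<Gamma>' \<Longrightarrow> proj_similar V \<Gamma>' \<Gamma>"
  unfolding proj_similar_def by (metis minus_diff_eq vector_sneg_minus1 vector_smult_assoc)

lemma proj_similar_trans: "proj_similar V \<Gamma> \<Gamma>' \<Longrightarrow> proj_similar V \<Gamma>' \<Gamma>'' \<Longrightarrow> proj_similar V \<Gamma> \<Gamma>''"
  unfolding proj_similar_def
proof (intro ballI allI)
  fix x v assume *: "\<forall>x\<in>V. \<forall>v. \<exists>s. quad_form (\<Gamma> x) v - quad_form (\<Gamma>' x) v = s *s v"
    "\<forall>x\<in>V. \<forall>v. \<exists>s. quad_form (\<Gamma>' x) v - quad_form (\<Gamma>'' x) v = s *s v" "x \<in> V"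
  then obtain s s' where "quad_form (\<Gamma> x) v - quad_form (\<Gamma>' x) v = s *s v"
    "quad_form (\<Gamma>' x) v - quad_form (\<Gamma>'' x) v = s' *s v" by meson
  then have "quad_form (\<Gamma> x) v - quad_form (\<Gamma>'' x) v = (s + s') *s v"
    by (simp add: vector_sadd_rdistrib algebra_simps)
  then show "\<exists>s. quad_form (\<Gamma> x) v - quad_form (\<Gamma>'' x) v = s *s v" ..
qed

lemma proj_similar_subset: "proj_similar V \<Gamma> \<Gamma>' \<Longrightarrow> V' \<subseteq> V \<Longrightarrow> proj_similar V' \<Gamma> \<Gamma>'"
  by (auto simp: proj_similar_def)

text \<open>A geodesic of one connection becomes a geodesic of the other after the time change
  \<open>h'' = - \<sigma> h'\<close>, where \<open>\<sigma>\<close> is the factor of proportionality along the curve.\<close>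

lemma geodesic_curve_similar:
  fixes \<Gamma> :: "'n::finite christoffel"
  assumes "affine_connection U \<Gamma>" "affine_connection U \<Gamma>'" "proj_similar U \<Gamma> \<Gamma>'"
    "geodesic_curve U \<Gamma> C"
  shows "geodesic_curve U \<Gamma>' C"
  unfolding geodesic_curve_def
proof (intro conjI ballI)
  show "C \<noteq> {}" "connected C" "C \<subseteq> U" using assms(4) by (auto simp: geodesic_curve_def)
  fix p assume p: "p \<in> C"
  then obtain W D c g where W: "open W" "p \<in> W" "affine_geodesic U \<Gamma> D c" "homeomorphism D (C \<inter> W) c g"
    using assms(4) unfolding geodesic_curve_def by blast
  define w where "w = velocity c"
  define t0 where "t0 = g p"
  have t0: "t0 \<in> D" "c t0 = p" using W(2,4) p by (auto simp: t0_def homeomorphism_def)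
  note geo = affine_geodesicD[OF W(3), folded w_def]
  have oD: "open D" using geo(1)[OF t0(1)] .
  obtain k where k: "w t0 $ k \<noteq> 0" using geo(3)[OF t0(1)] by (auto simp: vec_eq_iff)
  have "continuous_on D (\<lambda>t. w t $ k)"
  proof (rule continuous_at_imp_continuous_on, rule ballI)
    show "isCont (\<lambda>t. w t $ k) t" if "t \<in> D" for t
      by (rule DERIV_isCont[OF geo(5)[OF that]])
  qed
  then obtain r1 where r1: "r1 > 0" "\<And>t. t \<in> D \<Longrightarrow> dist t0 t < r1 \<Longrightarrow> w t $ k \<noteq> 0"
    using continuous_on_avoid[of D "\<lambda>t. w t $ k" t0 0] t0 k by metis
  obtain r2 where r2: "r2 > 0" "ball t0 r2 \<subseteq> D" using oD t0(1) openE by blast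
  define B where "B = ball t0 (min r1 r2)"
  have B: "B \<subseteq> D" "open B" "convex B" "t0 \<in> B" "\<And>t. t \<in> B \<Longrightarrow> w t $ k \<noteq> 0"
    using r1 r2 by (auto simp: B_def)
  define \<sigma> where "\<sigma> t = (quad_form (\<Gamma> (c t)) (w t) - quad_form (\<Gamma>' (c t)) (w t)) $ k / w t $ k" for t
  have \<sigma>: "quad_form (\<Gamma> (c t)) (w t) - quad_form (\<Gamma>' (c t)) (w t) = \<sigma> t *s w t" if t: "t \<in> B" for t
  proof -
    obtain s where s: "quad_form (\<Gamma> (c t)) (w t) - quad_form (\<Gamma>' (c t)) (w t) = s *s w t"
      using assms(3) geo(2)[of t] B(1) t unfolding proj_similar_def by blast
    then show ?thesis using B(5)[OF t] unfolding \<sigma>_def s by simp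
  qed
  have qf_hol: "(\<lambda>t. quad_form (\<Delta> (c t)) (w t) $ k) holomorphic_on B" if "affine_connection U \<Delta>" for \<Delta> :: "'n christoffel"
  proof -
    have d: "\<exists>d. ((\<lambda>t. \<Delta> (c t) k i j) has_field_derivative d) (at t)" if t: "t \<in> B" for t i j
    proof -
      have tD: "t \<in> D" using t B(1) by blast
      have "cdiff_at (\<lambda>x. \<Delta> x k i j) (c t)"
        using \<open>affine_connection U \<Delta>\<close> geo(2)[OF tD] by (auto simp: affine_connection_def holo_fun_iff)
      from curve_deriv[of "\<lambda>x. \<Delta> x k i j" c t "w t", OF this geo(4)[OF tD]] show ?thesis by blast
    qed
    then have "(\<lambda>t. \<Delta> (c t) k i j) holomorphic_on B" for i j
      by (simp add: holomorphic_on_open[OF B(2)])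
    moreover have "(\<lambda>t. w t $ i) holomorphic_on B" for i
      using geo(5) B(1,2) by (auto simp: holomorphic_on_open intro!: exI)
    ultimately show ?thesis unfolding quad_form_def by (auto intro!: holomorphic_intros)
  qed
  have "(\<lambda>t. w t $ k) holomorphic_on B"
    using geo(5) B(1,2) by (auto simp: holomorphic_on_open intro!: exI)
  then have "\<sigma> holomorphic_on B"
    unfolding \<sigma>_def vector_minus_component using B(5) qf_hol assms(1,2) by (intro holomorphic_intros) auto
  then obtain G where G: "\<And>t. t \<in> B \<Longrightarrow> (G has_field_derivative \<sigma> t) (at t)"
    using holomorphic_convex_primitive'[OF B(3,2), of \<sigma>] at_within_open[OF _ B(2)] by metis
  \<comment> \<open>the new time \<open>h\<close> satisfies \<open>h'' = - \<sigma> h'\<close>, and \<open>E = h'\<close>\<close>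
  define E where "E t = exp (- G t)" for t
  have E: "(E has_field_derivative - \<sigma> t * E t) (at t)" if "t \<in> B" for t
    unfolding E_def by (auto intro!: derivative_eq_intros G that)
  have "E holomorphic_on B" using E B(2) by (auto simp: holomorphic_on_open intro!: exI)
  then obtain h where h: "\<And>t. t \<in> B \<Longrightarrow> (h has_field_derivative E t) (at t)"
    using holomorphic_convex_primitive'[OF B(3,2), of E] at_within_open[OF _ B(2)] by metis
  have hhol: "h holomorphic_on B" using h B(2) by (auto simp: holomorphic_on_open intro!: exI)
  have hd: "deriv h t = E t" if "t \<in> B" for t using h[OF that] by (rule DERIV_imp_deriv)
  have En: "E t \<noteq> 0" for t by (simp add: E_def)
  obtain r where r: "r > 0" "ball t0 r \<subseteq> B" "open (h ` ball t0 r)" "inj_on h (ball t0 r)"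
    using has_complex_derivative_locally_invertible[OF hhol B(4,2)] hd[OF B(4)] En by metis
  define B1 where "B1 = ball t0 r"
  note r = r[folded B1_def]
  have B1o: "open B1" by (simp add: B1_def)
  have h1: "h holomorphic_on B1" using hhol r(2) by (rule holomorphic_on_subset)
  obtain k' where k': "k' holomorphic_on h ` B1" "\<And>z. z \<in> B1 \<Longrightarrow> deriv h z * deriv k' (h z) = 1" "\<And>z. z \<in> B1 \<Longrightarrow> k' (h z) = z"
    using holomorphic_has_inverse[OF h1 B1o r(4)] by metis
  have k'B: "k' s \<in> B1" if "s \<in> h ` B1" for s using that k'(3) by auto
  have k'd: "(k' has_field_derivative inverse (E (k' s))) (at s)" if s: "s \<in> h ` B1" for s
  proof -
    obtain z where z: "z \<in> B1" "s = h z" using s by blast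
    have "deriv k' s = inverse (E (k' s))"
      using k'(2)[OF z(1)] k'(3)[OF z(1)] hd[of z] z r(2) En by (auto simp: field_simps)
    then show ?thesis using holomorphic_derivI[OF k'(1) r(3) s] by simp
  qed
  define c2 where "c2 s = c (k' s)" for s
  define w2 where "w2 s = inverse (E (k' s)) *s w (k' s)" for s
  have kD: "k' s \<in> D" "k' s \<in> B" if "s \<in> h ` B1" for s using k'B[OF that] r(2) B(1) by auto
  have "affine_geodesic U \<Gamma>' (h ` B1) c2"
  proof (rule affine_geodesicI(1)[where w = w2])
    fix s assume s: "s \<in> h ` B1"
    let ?z = "k' s"
    show "c2 s \<in> U" unfolding c2_def by (rule geo(2)[OF kD(1)[OF s]])
    show "w2 s \<noteq> 0" unfolding w2_def using geo(3)[OF kD(1)[OF s]] En[of ?z] by (simp add: vector_mul_eq_0)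
    show "((\<lambda>s. c2 s $ i) has_field_derivative w2 s $ i) (at s)" for i
      using DERIV_chain2[OF geo(4)[OF kD(1)[OF s], of i] k'd[OF s]] by (simp add: c2_def w2_def mult.commute)
    have e: "((\<lambda>s. inverse (E (k' s))) has_field_derivative (\<sigma> ?z * (inverse (E ?z))\<^sup>2)) (at s)"
      using DERIV_chain2[OF E[OF kD(2)[OF s]] k'd[OF s]] En[of ?z]
      by (auto intro!: derivative_eq_intros simp: field_simps power2_eq_square)
    have "((\<lambda>s. w2 s $ i) has_field_derivative
       (inverse (E ?z) * (- (quad_form (\<Gamma> (c ?z)) (w ?z) $ i) * inverse (E ?z)) + \<sigma> ?z * (inverse (E ?z))\<^sup>2 * w ?z $ i)) (at s)" for i
      unfolding w2_def vector_smult_component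
      by (rule DERIV_cong[OF DERIV_mult[OF e DERIV_chain2[OF geo(5)[OF kD(1)[OF s]] k'd[OF s]]]]) simp
    moreover have "inverse (E ?z) * (- (quad_form (\<Gamma> (c ?z)) (w ?z) $ i) * inverse (E ?z)) + \<sigma> ?z * (inverse (E ?z))\<^sup>2 * w ?z $ i
       = - (quad_form (\<Gamma>' (c2 s)) (w2 s) $ i)" for i
    proof -
      have "quad_form (\<Gamma> (c ?z)) (w ?z) $ i - quad_form (\<Gamma>' (c ?z)) (w ?z) $ i = \<sigma> ?z * w ?z $ i"
        using arg_cong[OF \<sigma>[OF kD(2)[OF s]], of "\<lambda>v. v $ i"] by simp
      then have "- quad_form (\<Gamma> (c ?z)) (w ?z) $ i + \<sigma> ?z * w ?z $ i = - quad_form (\<Gamma>' (c ?z)) (w ?z) $ i"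
        by (simp add: algebra_simps)
      then have "(inverse (E ?z))\<^sup>2 * (- quad_form (\<Gamma> (c ?z)) (w ?z) $ i + \<sigma> ?z * w ?z $ i)
          = (inverse (E ?z))\<^sup>2 * (- quad_form (\<Gamma>' (c ?z)) (w ?z) $ i)" by simp
      then show ?thesis
        unfolding c2_def w2_def quad_form_scale
        by (simp add: power2_eq_square algebra_simps)
    qed
    ultimately show "((\<lambda>s. w2 s $ i) has_field_derivative - (quad_form (\<Gamma>' (c2 s)) (w2 s) $ i)) (at s)" for i
      by simp
  qed (rule r(3))
  moreover have "\<exists>W'. open W' \<and> p \<in> W' \<and> homeomorphism (h ` B1) (C \<inter> W') c2 (h \<circ> g)"
  proof -
    have BD: "B1 \<subseteq> D" using r(2) B(1) by blast
    have "openin (top_of_set D) B1" using B1o BD by (simp add: open_subset)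
    then have "openin (top_of_set (C \<inter> W)) (c ` B1)"
      using homeomorphism_imp_open_map[OF W(4)] by blast
    then obtain O' where O': "open O'" "c ` B1 = (C \<inter> W) \<inter> O'" by (auto simp: openin_open)
    have h2: "homeomorphism B1 (C \<inter> (W \<inter> O')) c g"
      using homeomorphism_of_subsets[OF W(4) BD _ refl, of "C \<inter> (W \<inter> O')"] O'(2)
      by (metis Int_assoc Int_lower1 homeomorphism_of_subsets W(4) BD)
    have h3: "homeomorphism (h ` B1) B1 k' h"
      unfolding homeomorphism_def using k'(3) holomorphic_on_imp_continuous_on[OF k'(1)] holomorphic_on_imp_continuous_on[OF h1]
      by (auto simp: image_iff)
    have "homeomorphism (h ` B1) (C \<inter> (W \<inter> O')) (c \<circ> k') (h \<circ> g)"
      by (rule homeomorphism_compose[OF h3 h2])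
    moreover have "c \<circ> k' = c2" by (simp add: fun_eq_iff c2_def)
    moreover have "p \<in> O'" using O'(2) t0(2) r(1) by (force simp: B1_def)
    ultimately show ?thesis using W(1,2) O'(1) by (intro exI[of _ "W \<inter> O'"]) auto
  qed
  ultimately show "\<exists>W D c g. open W \<and> p \<in> W \<and> affine_geodesic U \<Gamma>' D c \<and> homeomorphism D (C \<inter> W) c g"
    by blast
qed

text \<open>Conversely, a common geodesic through each tangent direction forces the accelerations to
  differ by a multiple of the velocity.\<close>

lemma similar_of_proj_equivalent:
  fixes \<Gamma> :: "'n::finite christoffel"
  assumes "open U" "affine_connection U \<Gamma>" "affine_connection U \<Gamma>'" "proj_equivalent U \<Gamma> \<Gamma>'"
  shows "proj_similar U \<Gamma> \<Gamma>'"
  unfolding proj_similar_def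
proof (intro ballI allI)
  fix x v assume x: "x \<in> U"
  show "\<exists>s. quad_form (\<Gamma> x) v - quad_form (\<Gamma>' x) v = s *s v"
  proof (cases "v = 0")
    case False
    obtain r c where r: "r > 0" and geo0: "affine_geodesic U \<Gamma> (ball 0 r) c" and c0: "c 0 = x" "velocity c 0 = v"
      using geodesic_exists[OF assms(1,2) x False] by blast
    define w where "w = velocity c"
    note geo = affine_geodesicD[OF geo0, folded w_def]
    obtain k where k: "v $ k \<noteq> 0" using False by (auto simp: vec_eq_iff)
    let ?f = "\<lambda>t. c t $ k"
    have fhol0: "?f holomorphic_on ball 0 r" using geo0 by (simp add: affine_geodesic_def)
    have z0: "(0::complex) \<in> ball 0 r" using r by simp
    have dnz: "deriv ?f 0 \<noteq> 0" using geo(4)[OF z0, of k] c0(2) k by (simp add: w_def DERIV_imp_deriv)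
    obtain r1 where r1: "r1 > 0" "ball (0::complex) r1 \<subseteq> ball 0 r" "inj_on ?f (ball 0 r1)"
      using has_complex_derivative_locally_injective[OF fhol0 z0 open_ball dnz] by blast
    let ?B = "ball (0::complex) r1"
    have fhol: "?f holomorphic_on ?B" using fhol0 r1(2) by (rule holomorphic_on_subset)
    obtain \<gamma> where \<gamma>: "\<gamma> holomorphic_on ?f ` ?B" "\<And>z. z \<in> ?B \<Longrightarrow> \<gamma> (c z $ k) = z"
      using holomorphic_has_inverse[OF fhol open_ball r1(3)] by metis
    have ofB: "open (?f ` ?B)" by (rule open_mapping_thm3[OF fhol open_ball r1(3)])
    have Br: "t \<in> ball 0 r" if "t \<in> ?B" for t using that r1(2) by blast
    have ccont: "continuous_on ?B c"
      by (rule curve_continuous[of ?B c w]) (rule geo(4)[OF Br])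
    have cU: "c t \<in> U" if "t \<in> ?B" for t by (rule geo(2)[OF Br[OF that]])
    have hom: "homeomorphism ?B (c ` ?B) c (\<lambda>y. \<gamma> (y $ k))"
      unfolding homeomorphism_def
    proof (intro conjI ballI)
      show "continuous_on (c ` ?B) (\<lambda>y. \<gamma> (y $ k))"
        by (rule continuous_on_compose2[OF holomorphic_on_imp_continuous_on[OF \<gamma>(1)]])
           (auto intro!: continuous_intros)
    qed (use \<gamma>(2) ccont in \<open>auto simp: image_iff\<close>)
    have "geodesic_curve U \<Gamma> (c ` ?B)"
      unfolding geodesic_curve_def
    proof (intro conjI ballI)
      show "connected (c ` ?B)" by (intro connected_continuous_image ccont convex_connected convex_ball)
      show "c ` ?B \<noteq> {}" using r1(1) by simp
      show "c ` ?B \<subseteq> U" using cU by blast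
      fix p assume p: "p \<in> c ` ?B"
      have "affine_geodesic U \<Gamma> ?B c" by (rule affine_geodesic_subset[OF geo0 open_ball r1(2)])
      then show "\<exists>W D c' g. open W \<and> p \<in> W \<and> affine_geodesic U \<Gamma> D c' \<and> homeomorphism D (c ` ?B \<inter> W) c' g"
        using hom by (intro exI[of _ UNIV] exI[of _ ?B] exI[of _ c] exI[of _ "\<lambda>y. \<gamma> (y $ k)"]) simp
    qed
    then have "geodesic_curve U \<Gamma>' (c ` ?B)" using assms(4) by (simp add: proj_equivalent_def)
    moreover have xC: "x \<in> c ` ?B" using c0(1) r1(1) by force
    ultimately obtain W D c2 g2 where W: "x \<in> W" "affine_geodesic U \<Gamma>' D c2" "homeomorphism D (c ` ?B \<inter> W) c2 g2"
      unfolding geodesic_curve_def by blast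
    define w2 where "w2 = velocity c2"
    note geo2 = affine_geodesicD[OF W(2), folded w2_def]
    define t2 where "t2 = g2 x"
    have t2: "t2 \<in> D" "c2 t2 = x" using W(1,3) xC by (auto simp: t2_def homeomorphism_def)
    have oD: "open D" by (rule geo2(1)[OF t2(1)])
    \<comment> \<open>the time change between the two parametrizations: \<open>c2 = c \<circ> \<eta>\<close>\<close>
    define \<eta> where "\<eta> t = \<gamma> (c2 t $ k)" for t
    have \<eta>B: "\<eta> t \<in> ?B" "c (\<eta> t) = c2 t" "c2 t $ k \<in> ?f ` ?B" if "t \<in> D" for t
    proof -
      have "c2 t \<in> c ` ?B" using W(3) that by (auto simp: homeomorphism_def)
      then obtain z where "z \<in> ?B" "c2 t = c z" by blast
      then show "\<eta> t \<in> ?B" "c (\<eta> t) = c2 t" "c2 t $ k \<in> ?f ` ?B" using \<gamma>(2) by (auto simp: \<eta>_def)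
    qed
    have \<eta>hol: "\<eta> holomorphic_on D"
    proof -
      have "(\<lambda>t. c2 t $ k) holomorphic_on D" using W(2) by (simp add: affine_geodesic_def)
      then have "(\<gamma> \<circ> (\<lambda>t. c2 t $ k)) holomorphic_on D"
        by (rule holomorphic_on_compose_gen[OF _ \<gamma>(1)]) (use \<eta>B(3) in blast)
      then show ?thesis by (simp add: \<eta>_def[abs_def] o_def)
    qed
    have \<eta>d: "(\<eta> has_field_derivative deriv \<eta> t) (at t)" if "t \<in> D" for t
      by (rule holomorphic_derivI[OF \<eta>hol oD that])
    have w2: "w2 t = deriv \<eta> t *s w (\<eta> t)" if t: "t \<in> D" for t
      unfolding w2_def
    proof (rule velocity_eqI)
      fix i
      have "((\<lambda>s. c (\<eta> s) $ i) has_field_derivative w (\<eta> t) $ i * deriv \<eta> t) (at t)"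
        by (rule DERIV_chain2[OF geo(4)[OF Br[OF \<eta>B(1)[OF t]]] \<eta>d[OF t]])
      then show "((\<lambda>s. c2 s $ i) has_field_derivative (deriv \<eta> t *s w (\<eta> t)) $ i) (at t)"
        using has_field_derivative_transform_within_open[OF _ oD t, of "\<lambda>s. c (\<eta> s) $ i" _ "\<lambda>s. c2 s $ i"] \<eta>B(2)
        by (simp add: mult.commute)
    qed
    have "\<eta> t2 = 0" using \<gamma>(2)[of 0] r1(1) c0(1) by (simp add: \<eta>_def t2(2))
    have w0: "w (\<eta> t2) = v" by (simp add: \<open>\<eta> t2 = 0\<close> w_def c0(2))
    have d2: "(deriv \<eta> has_field_derivative deriv (deriv \<eta>) t2) (at t2)"
      by (rule holomorphic_derivI[OF holomorphic_deriv[OF \<eta>hol oD] oD t2(1)])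
    define a where "a = deriv \<eta> t2"
    define b where "b = deriv (deriv \<eta>) t2"
    have a0: "a \<noteq> 0" using geo2(3)[OF t2(1)] w2[OF t2(1)] by (auto simp: a_def)
    have "- (a\<^sup>2 * quad_form (\<Gamma>' x) v $ i) = b * v $ i - a\<^sup>2 * quad_form (\<Gamma> x) v $ i" for i
    proof (rule DERIV_unique)
      have "w2 t2 = a *s v" by (simp add: w2[OF t2(1)] w0 a_def)
      then show "((\<lambda>s. w2 s $ i) has_field_derivative - (a\<^sup>2 * quad_form (\<Gamma>' x) v $ i)) (at t2)"
        using geo2(5)[OF t2(1), of i] by (simp add: t2(2) quad_form_scale)
      have "((\<lambda>s. w (\<eta> s) $ i) has_field_derivative - (quad_form (\<Gamma> x) v $ i) * a) (at t2)"
        using DERIV_chain2[OF geo(5)[OF Br[OF \<eta>B(1)[OF t2(1)]], of i] \<eta>d[OF t2(1)]]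
        by (simp add: w0 \<eta>B(2)[OF t2(1)] t2(2) a_def)
      from DERIV_mult[OF d2 this]
      have "((\<lambda>s. deriv \<eta> s * w (\<eta> s) $ i) has_field_derivative (b * v $ i - a\<^sup>2 * quad_form (\<Gamma> x) v $ i)) (at t2)"
        by (simp add: w0 a_def[symmetric] b_def[symmetric] power2_eq_square algebra_simps)
      then show "((\<lambda>s. w2 s $ i) has_field_derivative (b * v $ i - a\<^sup>2 * quad_form (\<Gamma> x) v $ i)) (at t2)"
        by (rule has_field_derivative_transform_within_open[OF _ oD t2(1)]) (simp add: w2)
    qed
    then have "a\<^sup>2 * (quad_form (\<Gamma> x) v $ i - quad_form (\<Gamma>' x) v $ i) = b * v $ i" for i
      by (simp add: algebra_simps)
    then have "quad_form (\<Gamma> x) v - quad_form (\<Gamma>' x) v = (b / a\<^sup>2) *s v"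
      using a0 by (simp add: vec_eq_iff field_simps)
    then show ?thesis by blast
  qed simp
qed

lemma proj_equivalent_iff_similar:
  fixes \<Gamma> :: "'n::finite christoffel"
  assumes "open U" "affine_connection U \<Gamma>" "affine_connection U \<Gamma>'"
  shows "proj_equivalent U \<Gamma> \<Gamma>' \<longleftrightarrow> proj_similar U \<Gamma> \<Gamma>'"
  using similar_of_proj_equivalent[OF assms] geodesic_curve_similar[OF assms(2,3)]
    geodesic_curve_similar[OF assms(3,2)] proj_similar_sym[of U \<Gamma> \<Gamma>']
  unfolding proj_equivalent_def by blast

subsection \<open>The trace-free representative\<close>

lemma quad_form_diff: "quad_form (\<lambda>k i j. S k i j - T k i j) v = quad_form S v - quad_form T v"
  by (simp add: quad_form_def vec_eq_iff left_diff_distrib sum_subtractf)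

lemma bilinear_axis:
  fixes S :: "'n::finite \<Rightarrow> 'n \<Rightarrow> complex"
  shows
  "(\<Sum>a\<in>UNIV. \<Sum>b\<in>UNIV. S a b * axis i z $ a * axis j w $ b) = S i j * z * (w :: complex)"
proof -
  have *: "(\<Sum>a\<in>UNIV. f a * axis i z $ a) = f i * (z :: complex)" for f :: "'n \<Rightarrow> complex" and i z
  proof -
    have "f a * axis i z $ a = (if a = i then f a * z else 0)" for a by (simp add: axis_def)
    then show ?thesis by simp
  qed
  have "(\<Sum>a\<in>UNIV. \<Sum>b\<in>UNIV. S a b * axis i z $ a * axis j w $ b) = (\<Sum>a\<in>UNIV. S a j * axis i z $ a * w)"
    by (intro sum.cong refl *)
  also have "\<dots> = (\<Sum>a\<in>UNIV. S a j * axis i z $ a) * w"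
    by (rule sum_distrib_right[symmetric])
  also have "(\<Sum>a\<in>UNIV. S a j * axis i z $ a) = S i j * z" by (rule *)
  finally show ?thesis .
qed

lemma quad_form_axis: "quad_form S (axis i 1) $ k = S k i i"
  by (simp add: quad_form_def bilinear_axis)

lemma quad_form_delta:
  "quad_form (\<lambda>k i j. (if k = i then \<theta> j else 0) + (if k = j then \<theta> i else 0)) v = (2 * (\<Sum>i\<in>UNIV. \<theta> i * v $ i)) *s v"
proof -
  have "(\<Sum>i\<in>UNIV. \<Sum>j\<in>UNIV. ((if k = i then \<theta> j else 0) + (if k = j then \<theta> i else 0)) * v $ i * v $ j)
     = (\<Sum>i\<in>UNIV. \<Sum>j\<in>UNIV. (if k = i then \<theta> j * v $ i * v $ j else 0)) + (\<Sum>i\<in>UNIV. \<Sum>j\<in>UNIV. (if k = j then \<theta> i * v $ i * v $ j else 0))" for k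
    by (simp only: sum.distrib[symmetric]) (intro sum.cong refl, simp add: distrib_right)
  moreover have "(\<Sum>i\<in>UNIV. \<Sum>j\<in>UNIV. (if k = i then \<theta> j * v $ i * v $ j else 0)) = (\<Sum>j\<in>UNIV. \<theta> j * v $ j) * v $ k" for k
    by (subst sum.swap) (simp add: sum_distrib_left mult_ac)
  moreover have "(\<Sum>i\<in>UNIV. \<Sum>j\<in>UNIV. (if k = j then \<theta> i * v $ i * v $ j else 0)) = (\<Sum>j\<in>UNIV. \<theta> j * v $ j) * v $ k" for k
    by (simp add: sum_distrib_left mult_ac)
  ultimately show ?thesis by (simp add: quad_form_def vec_eq_iff)
qed

lemma quad_form_two:
  "quad_form S (axis i 1 + axis j t) $ k = S k i i + t * (S k i j + S k j i) + t\<^sup>2 * S k j j"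
proof -
  have "quad_form S (axis i 1 + axis j t) $ k =
     (\<Sum>a\<in>UNIV. \<Sum>b\<in>UNIV. S k a b * axis i 1 $ a * axis i 1 $ b) + (\<Sum>a\<in>UNIV. \<Sum>b\<in>UNIV. S k a b * axis i 1 $ a * axis j t $ b)
     + (\<Sum>a\<in>UNIV. \<Sum>b\<in>UNIV. S k a b * axis j t $ a * axis i 1 $ b) + (\<Sum>a\<in>UNIV. \<Sum>b\<in>UNIV. S k a b * axis j t $ a * axis j t $ b)"
    by (simp add: quad_form_def distrib_left distrib_right sum.distrib)
  then show ?thesis
    unfolding bilinear_axis by (simp add: power2_eq_square algebra_simps)
qed

text \<open>Testing on \<open>e\<^sub>i \<plusminus> e\<^sub>j\<close> determines all components.\<close>

lemma symmetric_parallel: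
  fixes S :: "'n::finite \<Rightarrow> 'n \<Rightarrow> 'n \<Rightarrow> complex"
  assumes sym: "\<And>k i j. S k i j = S k j i" and par: "\<And>v. \<exists>s. quad_form S v = s *s v"
  shows "S k i j = (if k = i then S j j j / 2 else 0) + (if k = j then S i i i / 2 else 0)"
proof -
  have diag: "S k i i = 0" if "k \<noteq> i" for k i
    using par[of "axis i 1"] that quad_form_axis[of S i k] by (auto simp: axis_def)
  have off: "S k i j = 0" if "i \<noteq> j" "k \<noteq> i" "k \<noteq> j" for k i j
    using par[of "axis i 1 + axis j 1"] that quad_form_two[of S i j 1 k] diag[of k i] diag[of k j] sym[of k j i]
    by (auto simp: axis_def)
  have mixed: "S i i j = S j j j / 2" if "i \<noteq> j" for i j
  proof -
    have e: "t * (S i i i + t * (2 * S i i j)) = t * (2 * S j i j) + t\<^sup>2 * S j j j" for t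
    proof -
      obtain s where s: "quad_form S (axis i 1 + axis j t) = s *s (axis i 1 + axis j t)" using par by blast
      have "S i i i + t * (2 * S i i j) = s"
        using quad_form_two[of S i j t i] that diag[of i j] sym[of i j i] unfolding s by (simp add: axis_def)
      moreover have "t * (2 * S j i j) + t\<^sup>2 * S j j j = s * t"
        using quad_form_two[of S i j t j] that diag[of j i] sym[of j j i] unfolding s by (simp add: axis_def)
      ultimately show ?thesis by (simp add: mult.commute)
    qed
    show ?thesis using e[of 1] e[of "-1"] by (simp add: algebra_simps) algebra
  qed
  show ?thesis
  proof (cases "i = j")
    case True then show ?thesis using diag[of k i] by auto
  next
    case False
    then show ?thesis using off[OF False, of k] mixed[OF False] mixed[of j i] sym[of j i j] by auto
  qed
qed

definition trace_free :: "('n::finite \<Rightarrow> 'n \<Rightarrow> 'n \<Rightarrow> complex) \<Rightarrow> bool" where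
  "trace_free S \<longleftrightarrow> (\<forall>k i j. S k i j = S k j i) \<and> (\<forall>j. (\<Sum>l\<in>UNIV. S l l j) = 0)"

lemma trace_delta:
  fixes \<theta> :: "'n::finite \<Rightarrow> complex"
  shows "(\<Sum>l\<in>(UNIV::'n set). (if l = l then \<theta> j else 0) + (if l = j then \<theta> l else 0)) = (of_nat CARD('n) + 1) * \<theta> j"
  by (simp add: sum.distrib distrib_right)

text \<open>A quadratic map with values proportional to its argument is \<open>v \<mapsto> 2 \<theta>(v) v\<close>; its trace is
  \<open>(n + 1) \<theta>\<close>, so trace-freeness kills \<open>\<theta>\<close>.\<close>

lemma trace_free_unique:
  fixes S T :: "'n::finite \<Rightarrow> 'n \<Rightarrow> 'n \<Rightarrow> complex"
  assumes "trace_free S" "trace_free T" "\<And>v. \<exists>s. quad_form S v - quad_form T v = s *s v"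
  shows "S = T"
proof -
  define R where "R k i j = S k i j - T k i j" for k i j
  define \<theta> where "\<theta> j = R j j j / 2" for j
  have R: "R k i j = (if k = i then \<theta> j else 0) + (if k = j then \<theta> i else 0)" for k i j
    unfolding \<theta>_def by (rule symmetric_parallel)
      (use assms in \<open>auto simp: R_def[abs_def] quad_form_diff trace_free_def\<close>)
  have "(\<Sum>l\<in>UNIV. R l l j) = 0" for j using assms(1,2) by (simp add: R_def sum_subtractf trace_free_def)
  then have "(of_nat CARD('n) + 1) * \<theta> j = 0" for j
    unfolding R trace_delta .
  moreover have "(of_nat CARD('n) + 1 :: complex) \<noteq> 0"
    by (metis of_nat_Suc of_nat_neq_0 add.commute)
  ultimately have "R k i j = 0" for k i j by (simp add: R)
  then show ?thesis by (simp add: R_def fun_eq_iff)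
qed

text \<open>Symmetrization followed by removal of the trace, i.e. the formula for the Thomas coefficients.\<close>

definition normalize :: "('n::finite \<Rightarrow> 'n \<Rightarrow> 'n \<Rightarrow> complex) \<Rightarrow> 'n \<Rightarrow> 'n \<Rightarrow> 'n \<Rightarrow> complex" where
  "normalize S k i j = (S k i j + S k j i) / 2 -
     ((if k = i then (\<Sum>l\<in>UNIV. S l l j + S l j l) / (2 * (of_nat CARD('n) + 1)) else 0) +
      (if k = j then (\<Sum>l\<in>UNIV. S l l i + S l i l) / (2 * (of_nat CARD('n) + 1)) else 0))"

lemma normalize_trace_free:
  fixes S :: "'n::finite \<Rightarrow> 'n \<Rightarrow> 'n \<Rightarrow> complex"
  shows "trace_free (normalize S)"
proof -
  have n: "(of_nat CARD('n) + 1 :: complex) \<noteq> 0"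
    by (metis of_nat_Suc of_nat_neq_0 add.commute)
  show ?thesis unfolding trace_free_def
  proof (intro conjI allI)
    show "normalize S k i j = normalize S k j i" for k i j by (simp add: normalize_def)
    define \<theta> where "\<theta> j = (\<Sum>l\<in>UNIV. S l l j + S l j l) / (2 * (of_nat CARD('n) + 1))" for j
    show "(\<Sum>l\<in>UNIV. normalize S l l j) = 0" for j
    proof -
      have "(\<Sum>l\<in>UNIV. normalize S l l j) = (\<Sum>l\<in>UNIV. S l l j + S l j l) / 2 - (of_nat CARD('n) + 1) * \<theta> j"
        unfolding normalize_def \<theta>_def[symmetric] sum_subtractf trace_delta by (simp add: sum_divide_distrib)
      also have "(of_nat CARD('n) + 1) * \<theta> j = (\<Sum>l\<in>UNIV. S l l j + S l j l) / 2"
      proof -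
        have "m \<noteq> 0 \<Longrightarrow> m * (x / (2 * m)) = x / 2" for m x :: complex by simp
        then show ?thesis unfolding \<theta>_def using n by blast
      qed
      finally have "(\<Sum>l\<in>UNIV. normalize S l l j) = (\<Sum>l\<in>UNIV. S l l j + S l j l) / 2 - (\<Sum>l\<in>UNIV. S l l j + S l j l) / 2" .
      then show ?thesis by simp
    qed
  qed
qed

lemma normalize_similar: "\<exists>s. quad_form (normalize S) v - quad_form S v = s *s v"
proof -
  define \<theta> where "\<theta> j = (\<Sum>l\<in>UNIV. S l l j + S l j l) / (2 * (of_nat CARD('a) + 1))" for j
  have "quad_form (\<lambda>k i j. (S k i j + S k j i) / 2) v = quad_form S v"
  proof -
    have "(\<Sum>i\<in>UNIV. \<Sum>j\<in>UNIV. S k j i * v $ i * v $ j) = (\<Sum>i\<in>UNIV. \<Sum>j\<in>UNIV. S k i j * v $ i * v $ j)" for k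
      by (subst sum.swap) (simp add: mult_ac)
    then show ?thesis
      by (simp add: quad_form_def vec_eq_iff add_divide_distrib distrib_right sum.distrib flip: sum_divide_distrib)
  qed
  moreover have "quad_form (normalize S) v = quad_form (\<lambda>k i j. (S k i j + S k j i) / 2) v -
     quad_form (\<lambda>k i j. (if k = i then \<theta> j else 0) + (if k = j then \<theta> i else 0)) v"
    unfolding quad_form_diff[symmetric] normalize_def \<theta>_def ..
  ultimately have "quad_form (normalize S) v - quad_form S v = (- (2 * (\<Sum>i\<in>UNIV. \<theta> i * v $ i))) *s v"
    unfolding quad_form_delta by simp
  then show ?thesis by blast
qed

section \<open>Leaves of a foliation\<close>

lemma distinguishedD:
  assumes "distinguished U F V u"
  shows "open V" "V \<subseteq> U" "holo_fun u V" "\<And>x. x \<in> V \<Longrightarrow> differential u x \<noteq> 0"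
    "\<And>x v. x \<in> V \<Longrightarrow> v \<in> F x \<longleftrightarrow> pairing (differential u x) v = 0"
  using assms by (auto simp: distinguished_def covector_kernel_iff)

lemma distinguished_restrict:
  "distinguished U F V u \<Longrightarrow> open V0 \<Longrightarrow> distinguished U F (V \<inter> V0) u"
  unfolding distinguished_def by (auto intro: holo_fun_subset)

lemma covector_kernel_proportional:
  fixes a b :: "complex^'n"
  assumes "\<And>v. pairing a v = 0 \<Longrightarrow> pairing b v = 0" "a $ p \<noteq> 0"
  shows "b = (b $ p / a $ p) *s a"
proof -
  have "a $ p * b $ i = a $ i * b $ p" for i
    using assms(1)[of "axis i (a $ p) - axis p (a $ i)"] by (simp add: mult.commute)
  then show ?thesis using assms(2) by (simp add: vec_eq_iff field_simps)
qed

lemma covector_kernel_subset_eq: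
  fixes a b :: "complex^'n"
  assumes "\<And>v. pairing a v = 0 \<Longrightarrow> pairing b v = 0" "a \<noteq> 0" "b \<noteq> 0"
  shows "pairing a v = 0 \<longleftrightarrow> pairing b v = 0"
proof -
  obtain p where p: "a $ p \<noteq> 0" using assms(2) by (auto simp: vec_eq_iff)
  define c where "c = b $ p / a $ p"
  have b: "b = c *s a" unfolding c_def by (rule covector_kernel_proportional[OF assms(1) p])
  then have "c \<noteq> 0" using assms(3) by auto
  then show ?thesis unfolding b by simp
qed

definition hess :: "(complex^'n \<Rightarrow> complex) \<Rightarrow> complex^'n \<Rightarrow> complex^'n \<Rightarrow> complex" where
  "hess u x v = (\<Sum>j\<in>UNIV. \<Sum>i\<in>UNIV. partial i (partial j u) x * v $ i * v $ j)"

lemma hess_pairing: "hess u x v = (\<Sum>j\<in>UNIV. pairing (differential (partial j u) x) v * v $ j)"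
  by (simp add: hess_def pairing_def sum_distrib_right)

text \<open>The infinitesimal form, for a symbol \<open>S\<close> at \<open>x\<close>, of the leaves being totally geodesic: the
  second covariant derivative of a distinguished function vanishes on the tangent hyperplane.\<close>

definition tangency :: "(complex^'n) set \<Rightarrow> 'n::finite foliation \<Rightarrow> complex^'n \<Rightarrow> ('n \<Rightarrow> 'n \<Rightarrow> 'n \<Rightarrow> complex) \<Rightarrow> bool" where
  "tangency U F x S \<longleftrightarrow> (\<forall>V u v. distinguished U F V u \<and> x \<in> V \<and> pairing (differential u x) v = 0 \<longrightarrow>
     hess u x v = pairing (differential u x) (quad_form S v))"

text \<open>One distinguished function is enough. Two of them have proportional differentials,
  \<open>du' = \<nu> du\<close>, so \<open>Hess u' = \<nu> Hess u + d\<nu> \<otimes> du\<close> and the extra term vanishes on the tangent hyperplane.\<close>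

lemma tangencyI:
  fixes F :: "'n::finite foliation"
  assumes d: "distinguished U F V u" "x \<in> V"
    and h: "\<And>v. pairing (differential u x) v = 0 \<Longrightarrow> hess u x v = pairing (differential u x) (quad_form S v)"
  shows "tangency U F x S"
  unfolding tangency_def
proof (intro allI impI, elim conjE)
  fix V' u' v assume d': "distinguished U F V' u'" "x \<in> V'" and v: "pairing (differential u' x) v = 0"
  note D = distinguishedD[OF d(1)] and D' = distinguishedD[OF d'(1)]
  obtain p where p: "partial p u x \<noteq> 0" using D(4)[OF d(2)] by (auto simp: vec_eq_iff)
  have hp: "holo_fun (partial j u) V" for j by (rule holo_partial[OF D(1,3)])
  have hp': "holo_fun (partial j u') V'" for j by (rule holo_partial[OF D'(1,3)])
  define N where "N = {y \<in> V \<inter> V'. partial p u y \<noteq> 0}"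
  have "open ((V \<inter> V') \<inter> (partial p u) -` (- {0}))"
    by (rule continuous_open_preimage[OF continuous_on_subset[OF holo_fun_continuous[OF hp]]]) (use D D' in auto)
  then have N: "open N" by (simp add: N_def vimage_def Int_def)
  have xN: "x \<in> N" using d(2) d'(2) p by (simp add: N_def)
  define \<nu> where "\<nu> y = partial p u' y / partial p u y" for y
  have proportional: "partial j u' y = \<nu> y * partial j u y" if y: "y \<in> N" for y j
  proof -
    have yV: "y \<in> V" "y \<in> V'" "differential u y $ p \<noteq> 0" using y by (auto simp: N_def)
    have "differential u' y = (differential u' y $ p / differential u y $ p) *s differential u y"
      by (rule covector_kernel_proportional[OF _ yV(3)]) (use D(5)[OF yV(1)] D'(5)[OF yV(2)] in blast)
    from arg_cong[OF this, of "\<lambda>a. a $ j"] show ?thesis by (simp add: \<nu>_def)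
  qed
  have cl: "cdiff_at \<nu> x" unfolding \<nu>_def[abs_def]
    using holo_funD[OF hp d(2)] holo_funD[OF hp' d'(2)] p by simp
  have second: "partial i (partial j u') x = \<nu> x * partial i (partial j u) x + partial j u x * partial i \<nu> x" for i j
    using partial_cong[OF N xN, of "partial j u'" "\<lambda>y. \<nu> y * partial j u y" i] proportional
      partial_mult[OF cl holo_funD[OF hp d(2)], of i j] by simp
  have du': "pairing (differential u' x) w = \<nu> x * pairing (differential u x) w" for w
    by (simp add: pairing_def proportional[OF xN] sum_distrib_left mult.assoc)
  have "\<nu> x \<noteq> 0"
    using D'(4)[OF d'(2)] proportional[OF xN] by (auto simp: vec_eq_iff)
  then have v0: "pairing (differential u x) v = 0" using v du' by simp
  have "hess u' x v = \<nu> x * hess u x v + pairing (differential u x) v * pairing (differential \<nu> x) v"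
  proof -
    have "hess u' x v = (\<Sum>j\<in>UNIV. \<Sum>i\<in>UNIV. \<nu> x * (partial i (partial j u) x * v $ i * v $ j))
       + (\<Sum>j\<in>UNIV. \<Sum>i\<in>UNIV. (partial j u x * v $ j) * (partial i \<nu> x * v $ i))"
      unfolding hess_def second
      by (simp only: sum.distrib[symmetric]) (intro sum.cong refl, simp add: algebra_simps)
    moreover have "(\<Sum>j\<in>UNIV. \<Sum>i\<in>UNIV. (partial j u x * v $ j) * (partial i \<nu> x * v $ i))
        = pairing (differential u x) v * pairing (differential \<nu> x) v"
      by (simp add: pairing_def sum_product)
    ultimately show ?thesis by (simp add: hess_def sum_distrib_left)
  qed
  then show "hess u' x v = pairing (differential u' x) (quad_form S v)"
    using h[OF v0] v0 du' by simp
qed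

lemma hess_zero [simp]: "hess u x 0 = 0" by (simp add: hess_def)

lemma differential_along_curve:
  assumes "open V" "holo_fun u V" "c t \<in> V"
    "\<And>k. ((\<lambda>s. c s $ k) has_field_derivative w t $ k) (at t)"
    "\<And>k. ((\<lambda>s. w s $ k) has_field_derivative a $ k) (at t)"
  shows "((\<lambda>s. pairing (differential u (c s)) (w s)) has_field_derivative
    (hess u (c t) (w t) + pairing (differential u (c t)) a)) (at t)"
proof -
  have "((\<lambda>s. partial j u (c s)) has_field_derivative pairing (differential (partial j u) (c t)) (w t)) (at t)" for j
    by (rule curve_deriv) (use holo_funD[OF holo_partial[OF assms(1,2)] assms(3)] assms(4) in auto)
  then have "((\<lambda>s. \<Sum>j\<in>UNIV. partial j u (c s) * w s $ j) has_field_derivative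
      (\<Sum>j\<in>UNIV. pairing (differential (partial j u) (c t)) (w t) * w t $ j + a $ j * partial j u (c t))) (at t)"
    by (intro DERIV_sum DERIV_mult assms(5))
  then show ?thesis
    by (simp add: pairing_def[of "differential u _"] hess_pairing sum.distrib mult.commute)
qed

lemma function_along_curve:
  assumes "holo_fun u V" "c t \<in> V" "\<And>k. ((\<lambda>s. c s $ k) has_field_derivative w $ k) (at t)"
  shows "((\<lambda>s. u (c s)) has_field_derivative pairing (differential u (c t)) w) (at t)"
  by (rule curve_deriv) (use holo_funD[OF assms(1,2)] assms(3) in auto)

lemma openin_plaque:
  "distinguished U F V u \<Longrightarrow> openin (leaf_topology U F) {x\<in>V. u x = c}"
  unfolding leaf_topology_def by (rule topology_generated_by_Basis) blast

lemma topspace_leaf: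
  assumes "foliation U F"
  shows "topspace (leaf_topology U F) = U"
  unfolding leaf_topology_def topology_generated_by_topspace
proof
  show "\<Union>{{x \<in> V. u x = c} |V u c. distinguished U F V u} \<subseteq> U"
    by (auto simp: distinguished_def)
  show "U \<subseteq> \<Union>{{x \<in> V. u x = c} |V u c. distinguished U F V u}"
  proof
    fix p assume "p \<in> U"
    then obtain V u where "p \<in> V" "distinguished U F V u" using assms by (auto simp: foliation_def)
    then show "p \<in> \<Union>{{x \<in> V. u x = c} |V u c. distinguished U F V u}" by blast
  qed
qed

text \<open>Curves tangent to the foliation are continuous for the leaf topology, so they stay in one
  leaf.\<close>

lemma tangent_curve_continuous:
  assumes "foliation U F" "open D"
    and c: "\<And>t k. t \<in> D \<Longrightarrow> ((\<lambda>s. c s $ k) has_field_derivative w t $ k) (at t)"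
    and inU: "\<And>t. t \<in> D \<Longrightarrow> c t \<in> U" and tan: "\<And>t. t \<in> D \<Longrightarrow> w t \<in> F (c t)"
  shows "continuous_map (top_of_set D) (leaf_topology U F) c"
  unfolding leaf_topology_def
proof (rule continuous_on_generated_topo)
  have cc: "continuous_on D c" by (rule curve_continuous[of D c w]) (rule c)
  fix P assume "P \<in> {{x \<in> V. u x = c} |V u c. distinguished U F V u}"
  then obtain V u e where P: "P = {x\<in>V. u x = e}" and d: "distinguished U F V u" by blast
  note D = distinguishedD[OF d]
  have "\<exists>r>0. ball t r \<subseteq> c -` P \<inter> D" if t: "t \<in> c -` P \<inter> D" for t
  proof -
    have "open (D \<inter> c -` V)" by (rule continuous_open_preimage[OF cc assms(2) D(1)])
    moreover have "t \<in> D \<inter> c -` V" using t P by auto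
    ultimately obtain r where r: "r > 0" "ball t r \<subseteq> D \<inter> c -` V" using openE by blast
    have "\<exists>e'. \<forall>s\<in>ball t r. u (c s) = e'"
    proof (rule has_field_derivative_zero_constant[OF convex_ball])
      fix s assume s: "s \<in> ball t r"
      then have sD: "s \<in> D" "c s \<in> V" using r by auto
      have "((\<lambda>s. u (c s)) has_field_derivative pairing (differential u (c s)) (w s)) (at s)"
        by (rule function_along_curve[OF D(3) sD(2) c[OF sD(1)]])
      moreover have "pairing (differential u (c s)) (w s) = 0" using D(5)[OF sD(2)] tan[OF sD(1)] by blast
      ultimately show "((\<lambda>s. u (c s)) has_field_derivative 0) (at s within ball t r)"
        by (simp add: has_field_derivative_at_within)
    qed
    then obtain e' where e': "\<And>s. s \<in> ball t r \<Longrightarrow> u (c s) = e'" by blast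
    have "u (c t) = e" using t P by simp
    then have "e' = e" using e'[of t] r(1) by simp
    then have "ball t r \<subseteq> c -` P \<inter> D" using e' r(2) unfolding P by blast
    then show ?thesis using r(1) by blast
  qed
  then have "open (c -` P \<inter> D)" by (simp add: open_contains_ball)
  then show "openin (top_of_set D) (c -` P \<inter> topspace (top_of_set D))"
    by (simp add: open_subset)
next
  show "c ` topspace (top_of_set D) \<subseteq> \<Union>{{x \<in> V. u x = c} |V u c. distinguished U F V u}"
    using inU topspace_leaf[OF assms(1)] by (auto simp: leaf_topology_def topology_generated_by_topspace)
qed

lemma tangent_curve_in_leaf:
  assumes "foliation U F" "open D" "connected D"
    and c: "\<And>t k. t \<in> D \<Longrightarrow> ((\<lambda>s. c s $ k) has_field_derivative w t $ k) (at t)"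
    and inU: "\<And>t. t \<in> D \<Longrightarrow> c t \<in> U" and tan: "\<And>t. t \<in> D \<Longrightarrow> w t \<in> F (c t)"
    and L: "L \<in> leaves U F" "t0 \<in> D" "c t0 \<in> L" "t \<in> D"
  shows "c t \<in> L"
proof -
  have "connectedin (leaf_topology U F) (c ` D)"
    by (rule connectedin_continuous_map_image[OF tangent_curve_continuous[OF assms(1,2) c inU tan]])
       (use assms(3) in \<open>auto simp: connectedin_subtopology\<close>)
  then have "c ` D \<subseteq> L"
    by (rule connected_components_of_maximal[OF L(1)[unfolded leaves_def]])
       (use L in \<open>auto simp: disjnt_def\<close>)
  then show ?thesis using L(4) by blast
qed

lemma leaf_exists:
  assumes "foliation U F" "x \<in> U"
  obtains L where "L \<in> leaves U F" "x \<in> L"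
proof -
  have "x \<in> \<Union>(connected_components_of (leaf_topology U F))"
    using assms by (simp add: Union_connected_components_of topspace_leaf)
  then show thesis using that unfolding leaves_def by blast
qed

lemma leaf_subset: "foliation U F \<Longrightarrow> L \<in> leaves U F \<Longrightarrow> L \<subseteq> U"
  using connected_components_of_subset[of L "leaf_topology U F"] topspace_leaf[of U F] by (simp add: leaves_def)

lemma linear_ode_zero:
  assumes r: "r > 0" and f: "\<And>t. t \<in> ball t0 r \<Longrightarrow> (f has_field_derivative g t * f t) (at t)"
    and g: "isCont g t0" and f0: "f t0 = 0"
  shows "\<exists>r'>0. r' \<le> r \<and> (\<forall>t\<in>ball t0 r'. f t = (0::complex))"
proof -
  define K where "K = cmod (g t0) + 1"
  have K: "K > 0" by (simp add: K_def add_nonneg_pos)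
  obtain d where d: "d > 0" "\<And>t. dist t t0 < d \<Longrightarrow> dist (g t) (g t0) < 1"
    using g zero_less_one unfolding continuous_at_eps_delta by blast
  have gK: "cmod (g t) \<le> K" if "dist t0 t < d" for t
    using d(2)[of t] that norm_triangle_sub[of "g t" "g t0"] by (simp add: K_def dist_norm norm_minus_commute)
  define r' where "r' = min (min (r/2) d) (1 / (2 * K))"
  have r': "r' > 0" "r' < r" "r' \<le> d" using r d K by (auto simp: r'_def)
  have r'': "K * r' \<le> 1/2"
  proof -
    have "r' \<le> 1 / (2 * K)" by (simp add: r'_def)
    then have "r' * (2 * K) \<le> 1" using K by (simp add: pos_le_divide_eq)
    then show ?thesis by (simp add: algebra_simps)
  qed
  have B: "t \<in> ball t0 r" if "t \<in> ball t0 r'" for t using that r' by auto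
  have "compact (f ` cball t0 r')"
    by (intro compact_continuous_image continuous_at_imp_continuous_on ballI DERIV_isCont[OF f]) (use r' in auto)
  then obtain C where C: "\<And>t. t \<in> cball t0 r' \<Longrightarrow> cmod (f t) \<le> C"
    by (meson bounded_iff compact_imp_bounded image_eqI)
  have C0: "C \<ge> 0" using C[of t0] r' norm_ge_zero[of "f t0"] by (simp del: norm_ge_zero add: f0)
  have "f t = 0" if "t \<in> ball t0 r'" for t
  proof (rule halving_zero[where P = "\<lambda>t. t \<in> ball t0 r'" and C = C and f = f])
    show "cmod (f a) \<le> C" if "a \<in> ball t0 r'" for a using C that by auto
    fix C' :: real and a assume C': "C' \<ge> 0" "\<And>a. a \<in> ball t0 r' \<Longrightarrow> cmod (f a) \<le> C'" and a: "a \<in> ball t0 r'"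
    have "cmod (f a - f t0) \<le> (K * C') * norm (a - t0)"
    proof (rule field_differentiable_bound[of "ball t0 r'"])
      fix z assume z: "z \<in> ball t0 r'"
      show "(f has_field_derivative g z * f z) (at z within ball t0 r')"
        by (rule has_field_derivative_at_within[OF f[OF B[OF z]]])
      show "cmod (g z * f z) \<le> K * C'"
        unfolding norm_mult using gK[of z] C'(2)[OF z] z r' K by (intro mult_mono) auto
    qed (use a r' in auto)
    also have "\<dots> \<le> (K * C') * r'"
      using a K C' by (intro mult_left_mono) (auto simp: dist_norm norm_minus_commute)
    also have "\<dots> \<le> 1/2 * C'" using mult_right_mono[OF r'' C'(1)] by (simp add: mult_ac)
    finally show "cmod (f a) \<le> C' / 2" by (simp add: f0)
  qed (use C0 that in auto)
  then show ?thesis using r' by (intro exI[of _ r']) auto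
qed

lemma isCont_curve:
  assumes "cdiff_at f (c t)" "\<And>k. ((\<lambda>s. c s $ k) has_field_derivative w $ k) (at t)"
  shows "isCont (\<lambda>s. f (c s)) t"
  by (rule DERIV_isCont[OF curve_deriv[of f c t w]]) (use assms in auto)

text \<open>The function \<open>du(c')\<close> satisfies a homogeneous linear equation along a geodesic, because the
  quadratic form that vanishes on the tangent hyperplane is divisible by \<open>du\<close>.\<close>

lemma tangent_near:
  fixes \<Gamma> :: "'n::finite christoffel"
  assumes aff: "affine_connection U \<Gamma>" and tg: "\<And>x. x \<in> U \<Longrightarrow> tangency U F x (\<Gamma> x)"
    and d: "distinguished U F V u" and r: "r > 0"
    and c: "\<And>t k. t \<in> ball t0 r \<Longrightarrow> ((\<lambda>s. c s $ k) has_field_derivative w t $ k) (at t)"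
    and w: "\<And>t k. t \<in> ball t0 r \<Longrightarrow> ((\<lambda>s. w s $ k) has_field_derivative - (quad_form (\<Gamma> (c t)) (w t) $ k)) (at t)"
    and inV: "\<And>t. t \<in> ball t0 r \<Longrightarrow> c t \<in> V" and tan: "pairing (differential u (c t0)) (w t0) = 0"
  shows "\<exists>r'>0. r' \<le> r \<and> (\<forall>t\<in>ball t0 r'. pairing (differential u (c t)) (w t) = 0)"
proof -
  note D = distinguishedD[OF d]
  have t0: "t0 \<in> ball t0 r" using r by simp
  obtain p where p: "partial p u (c t0) \<noteq> 0" using D(4)[OF inV[OF t0]] by (auto simp: vec_eq_iff)
  have hp: "holo_fun (partial j u) V" for j by (rule holo_partial[OF D(1,3)])
  have hpp: "holo_fun (partial i (partial j u)) V" for i j by (rule holo_partial[OF D(1) hp])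
  have cpart: "cdiff_at (partial j u) (c t)" "cdiff_at (partial i (partial j u)) (c t)" "cdiff_at (\<lambda>x. \<Gamma> x k i j) (c t)"
    if "t \<in> ball t0 r" for t i j k
    using holo_funD[OF hp inV[OF that]] holo_funD[OF hpp inV[OF that]] aff D(2) inV[OF that]
    by (auto simp: affine_connection_def holo_fun_iff)
  have pcont: "isCont (\<lambda>s. partial j u (c s)) t0" for j
    by (rule isCont_curve[OF cpart(1)[OF t0] c[OF t0]])
  then have "isCont (\<lambda>s. partial p u (c s)) t0" .
  then obtain r1 where r1: "r1 > 0" "\<And>t. dist t0 t < r1 \<Longrightarrow> partial p u (c t) \<noteq> 0"
    using continuous_at_avoid[of t0 "\<lambda>s. partial p u (c s)" 0] p by auto
  define f where "f t = pairing (differential u (c t)) (w t)" for t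
  define q where "q t i j = partial i (partial j u) (c t) - (\<Sum>k\<in>UNIV. partial k u (c t) * \<Gamma> (c t) k i j)" for t i j
  define Q where "Q t v v' = (\<Sum>j\<in>UNIV. \<Sum>i\<in>UNIV. q t i j * v $ i * v' $ j)" for t and v v' :: "complex^'n"
  have Qh: "Q t v v = hess u (c t) v - pairing (differential u (c t)) (quad_form (\<Gamma> (c t)) v)" for t v
  proof -
    have "pairing (differential u (c t)) (quad_form (\<Gamma> (c t)) v)
      = (\<Sum>k\<in>UNIV. \<Sum>i\<in>UNIV. \<Sum>j\<in>UNIV. partial k u (c t) * \<Gamma> (c t) k i j * v $ i * v $ j)"
      by (simp add: pairing_def quad_form_def sum_distrib_left mult_ac)
    also have "\<dots> = (\<Sum>i\<in>UNIV. \<Sum>k\<in>UNIV. \<Sum>j\<in>UNIV. partial k u (c t) * \<Gamma> (c t) k i j * v $ i * v $ j)"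
      by (rule sum.swap)
    also have "\<dots> = (\<Sum>i\<in>UNIV. \<Sum>j\<in>UNIV. \<Sum>k\<in>UNIV. partial k u (c t) * \<Gamma> (c t) k i j * v $ i * v $ j)"
      by (intro sum.cong refl sum.swap)
    also have "\<dots> = (\<Sum>j\<in>UNIV. \<Sum>i\<in>UNIV. \<Sum>k\<in>UNIV. partial k u (c t) * \<Gamma> (c t) k i j * v $ i * v $ j)"
      by (rule sum.swap)
    finally show ?thesis
      by (simp add: Q_def q_def hess_def left_diff_distrib sum_subtractf sum_distrib_right)
  qed
  \<comment> \<open>splitting off the component along \<open>e\<close>, which leaves a vector in the kernel of \<open>du\<close>\<close>
  have Qlin: "Q t (v - s *s e) (v - s *s e) = Q t v v - s * (Q t v e + Q t e v - s * Q t e e)" for t v s e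
    by (simp add: Q_def algebra_simps sum.distrib sum_subtractf sum_distrib_left)
  let ?e = "axis p (1::complex)"
  define g where "g t = (Q t (w t) ?e + Q t ?e (w t) - f t / partial p u (c t) * Q t ?e ?e) / partial p u (c t)" for t
  have der: "(f has_field_derivative Q t (w t) (w t)) (at t)" if "t \<in> ball t0 r" for t
    unfolding Qh f_def
    using differential_along_curve[where c = c and w = w and t = t and a = "- quad_form (\<Gamma> (c t)) (w t)",
        OF D(1,3) inV[OF that] c[OF that]] w[OF that]
    by simp
  have "\<exists>r'>0. r' \<le> min r r1 \<and> (\<forall>t\<in>ball t0 r'. f t = 0)"
  proof (rule linear_ode_zero[where g = g])
    show "min r r1 > 0" using r r1 by simp
    show "f t0 = 0" using tan by (simp add: f_def)
    fix t assume "t \<in> ball t0 (min r r1)"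
    then have t: "t \<in> ball t0 r" and pt: "partial p u (c t) \<noteq> 0" using r1 by auto
    define s where "s = f t / partial p u (c t)"
    have "pairing (differential u (c t)) (w t - s *s ?e) = 0"
      using pt unfolding pairing_simps f_def[symmetric] s_def pairing_axis differential_nth by simp
    then have "Q t (w t - s *s ?e) (w t - s *s ?e) = 0"
      using tg[of "c t"] d inV[OF t] D(2) unfolding tangency_def Qh by auto
    then have "Q t (w t) (w t) = s * (Q t (w t) ?e + Q t ?e (w t) - s * Q t ?e ?e)"
      unfolding Qlin by simp
    also have "\<dots> = g t * f t" using pt by (simp add: g_def s_def)
    finally show "(f has_field_derivative g t * f t) (at t)" using der[OF t] by simp
  next
    have "isCont (\<lambda>s. partial i (partial j u) (c s)) t0" for i j
      by (rule isCont_curve[OF cpart(2)[OF t0] c[OF t0]])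
    moreover have "isCont (\<lambda>s. \<Gamma> (c s) k i j) t0" for k i j
      by (rule isCont_curve[of "\<lambda>x. \<Gamma> x k i j" c t0 "w t0", OF cpart(3)[OF t0] c[OF t0]])
    ultimately have qc: "isCont (\<lambda>s. q s i j) t0" for i j
      unfolding q_def by (intro isCont_diff isCont_sum ballI isCont_mult pcont) auto
    have wc: "isCont (\<lambda>s. w s $ i) t0" for i by (rule DERIV_isCont[OF w[OF t0]])
    have Qc: "isCont (\<lambda>s. Q s (a s) (b s)) t0" if "\<And>i. isCont (\<lambda>s. a s $ i) t0" "\<And>i. isCont (\<lambda>s. b s $ i) t0" for a b
      unfolding Q_def by (intro isCont_sum isCont_mult ballI qc that)
    show "isCont g t0"
      unfolding g_def
      by (intro isCont_divide isCont_diff isCont_add isCont_mult Qc wc pcont ballI DERIV_isCont[OF der[OF t0]] p) auto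
  qed
  then show ?thesis unfolding f_def by auto
qed

text \<open>A geodesic with initial velocity in the leaf remains tangent to the foliation, hence is continuous
  for the leaf topology and stays in the leaf.\<close>

lemma totally_geodesic_of_tangency:
  fixes \<Gamma> :: "'n::finite christoffel"
  assumes "open U" and fol: "foliation U F" and aff: "affine_connection U \<Gamma>"
    and tg: "\<And>x. x \<in> U \<Longrightarrow> tangency U F x (\<Gamma> x)" and L: "L \<in> leaves U F"
  shows "totally_geodesic U \<Gamma> (subtopology (leaf_topology U F) L) F"
  unfolding totally_geodesic_def
proof (intro ballI allI impI, elim conjE)
  fix v D c t0 P
  assume v: "v \<in> topspace (subtopology (leaf_topology U F) L)" and geo0: "affine_geodesic U \<Gamma> D c"
    and t0: "t0 \<in> D" "c t0 = v" "velocity c t0 \<in> F v"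
    and P: "openin (subtopology (leaf_topology U F) L) P" "v \<in> P"
  define w where "w = velocity c"
  note geo = affine_geodesicD[OF geo0, folded w_def]
  have vU: "v \<in> U" and vL: "v \<in> L" using v topspace_leaf[OF fol] by auto
  obtain V u where V: "v \<in> V" "distinguished U F V u" using fol vU by (auto simp: foliation_def)
  note DD = distinguishedD[OF V(2)]
  have "open (D \<inter> c -` V)"
    by (rule continuous_open_preimage[OF curve_continuous[OF geo(4)] geo(1)[OF t0(1)] DD(1)])
  then obtain r where r: "r > 0" "ball t0 r \<subseteq> D \<inter> c -` V" using t0 V(1) openE by (metis IntI vimageI)
  have "\<exists>r'>0. r' \<le> r \<and> (\<forall>t\<in>ball t0 r'. pairing (differential u (c t)) (w t) = 0)"
  proof (rule tangent_near[OF aff tg V(2) r(1)])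
    fix t assume "t \<in> ball t0 r"
    then have "t \<in> D" using r by auto
    then show "((\<lambda>s. c s $ k) has_field_derivative w t $ k) (at t)"
      "((\<lambda>s. w s $ k) has_field_derivative - (quad_form (\<Gamma> (c t)) (w t) $ k)) (at t)" for k
      by (rule geo)+
  qed (use r t0 DD(5)[OF V(1)] in \<open>auto simp: w_def\<close>)
  then obtain r' where r': "r' > 0" "r' \<le> r" "\<And>t. t \<in> ball t0 r' \<Longrightarrow> pairing (differential u (c t)) (w t) = 0"
    by blast
  have sub: "t \<in> D" "c t \<in> V" "c t \<in> U" "w t \<in> F (c t)" if "t \<in> ball t0 r'" for t
  proof -
    have "t \<in> ball t0 r" using that r'(2) by auto
    then show *: "t \<in> D" "c t \<in> V" using r(2) by auto
    then show "c t \<in> U" "w t \<in> F (c t)" using DD(2) DD(5)[of "c t" "w t"] r'(3)[OF that] by auto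
  qed
  have cont: "continuous_map (top_of_set (ball t0 r')) (leaf_topology U F) c"
    by (rule tangent_curve_continuous[OF fol open_ball geo(4)[OF sub(1)] sub(3,4)])
  have inL: "c t \<in> L" if "t \<in> ball t0 r'" for t
    by (rule tangent_curve_in_leaf[OF fol open_ball convex_connected[OF convex_ball] geo(4)[OF sub(1)] sub(3,4) L, of t0 r' t0])
       (use that r' t0 vL in auto)
  obtain O' where O': "openin (leaf_topology U F) O'" "P = O' \<inter> L"
    using P(1) by (auto simp: openin_subtopology)
  have "openin (top_of_set (ball t0 r')) {t \<in> topspace (top_of_set (ball t0 r')). c t \<in> O'}"
    by (rule openin_continuous_map_preimage[OF cont O'(1)])
  then have "open {t \<in> ball t0 r'. c t \<in> O'}" by (simp add: openin_open_eq)
  moreover have "t0 \<in> {t \<in> ball t0 r'. c t \<in> O'}" using r' t0 P(2) O'(2) by auto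
  ultimately have "\<forall>\<^sub>F s in nhds t0. s \<in> {t \<in> ball t0 r'. c t \<in> O'}" by (rule eventually_nhds_in_open)
  then show "\<forall>\<^sub>F s in nhds t0. c s \<in> P" by (rule eventually_mono) (use inL O'(2) in auto)
qed

text \<open>Differentiate \<open>u(c(t)) = const\<close> twice along a geodesic \<open>c\<close> in the leaf with velocity \<open>v\<close> at \<open>x\<close>.\<close>

lemma tangency_of_totally_geodesic:
  fixes \<Gamma> :: "'n::finite christoffel"
  assumes "open U" and fol: "foliation U F" and aff: "affine_connection U \<Gamma>"
    and tot: "\<And>L. L \<in> leaves U F \<Longrightarrow> totally_geodesic U \<Gamma> (subtopology (leaf_topology U F) L) F"
    and x: "x \<in> U"
  shows "tangency U F x (\<Gamma> x)"
  unfolding tangency_def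
proof (intro allI impI, elim conjE)
  fix V u v assume d: "distinguished U F V u" "x \<in> V" and v: "pairing (differential u x) v = 0"
  note D = distinguishedD[OF d(1)]
  show "hess u x v = pairing (differential u x) (quad_form (\<Gamma> x) v)"
  proof (cases "v = 0")
    case False
    obtain r c where r: "r > 0" "affine_geodesic U \<Gamma> (ball 0 r) c" "c 0 = x" "velocity c 0 = v"
      using geodesic_exists[OF assms(1) aff x False] by blast
    define w where "w = velocity c"
    note geo = affine_geodesicD[OF r(2), folded w_def]
    have z: "(0::complex) \<in> ball 0 r" using r by simp
    obtain L where L: "L \<in> leaves U F" "x \<in> L" using leaf_exists[OF fol x] .
    let ?M = "subtopology (leaf_topology U F) L"
    have "openin ?M ({y\<in>V. u y = u x} \<inter> L)"
      using openin_plaque[OF d(1)] by (auto simp: openin_subtopology)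
    moreover have "x \<in> topspace ?M" using x L topspace_leaf[OF fol] by simp
    moreover have "v \<in> F x" using D(5)[OF d(2)] v by blast
    ultimately have "\<forall>\<^sub>F s in nhds 0. c s \<in> {y\<in>V. u y = u x} \<inter> L"
      using tot[OF L(1)] r z d(2) L(2) unfolding totally_geodesic_def by blast
    then obtain A where A: "open A" "0 \<in> A" "\<And>s. s \<in> A \<Longrightarrow> c s \<in> V \<and> u (c s) = u x"
      unfolding eventually_nhds by blast
    define A' where "A' = A \<inter> ball 0 r"
    have A': "open A'" "0 \<in> A'" "\<And>s. s \<in> A' \<Longrightarrow> s \<in> ball 0 r" using A z by (auto simp: A'_def)
    have zero: "pairing (differential u (c s)) (w s) = 0" if s: "s \<in> A'" for s
    proof (rule DERIV_unique)
      show "((\<lambda>s. u (c s)) has_field_derivative pairing (differential u (c s)) (w s)) (at s)"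
        by (rule function_along_curve[OF D(3) _ geo(4)[OF A'(3)[OF s]]]) (use A(3) s in \<open>auto simp: A'_def\<close>)
      have "((\<lambda>s. u x) has_field_derivative 0) (at s)" by simp
      then show "((\<lambda>s. u (c s)) has_field_derivative 0) (at s)"
        by (rule has_field_derivative_transform_within_open[OF _ A'(1) s]) (use A(3) in \<open>auto simp: A'_def\<close>)
    qed
    have "hess u x v + pairing (differential u x) (- quad_form (\<Gamma> x) v) = 0"
    proof (rule DERIV_unique)
      have w0: "w 0 = v" using r by (simp add: w_def)
      show "((\<lambda>s. pairing (differential u (c s)) (w s)) has_field_derivative
         (hess u x v + pairing (differential u x) (- quad_form (\<Gamma> x) v))) (at 0)"
        using differential_along_curve[where c = c and w = w and t = 0 and a = "- quad_form (\<Gamma> x) v", OF D(1,3)] geo(4,5)[OF z] d(2) r(3) w0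
        by simp
      have "((\<lambda>s. 0) has_field_derivative 0) (at (0::complex))" by simp
      then show "((\<lambda>s. pairing (differential u (c s)) (w s)) has_field_derivative 0) (at 0)"
        by (rule has_field_derivative_transform_within_open[OF _ A'(1,2)]) (simp add: zero)
    qed
    then show ?thesis by simp
  qed simp
qed

section \<open>Transport along biholomorphisms\<close>

text \<open>The defining property of the pulled back flat connection: the components of \<open>\<phi>\<close> are affine
  functions for it.\<close>

lemma pullback_flat_jacobian:
  assumes "biholomorphism V \<phi> V'" "x \<in> V"
  shows "(\<Sum>k\<in>UNIV. jacobian \<phi> x $ c $ k * pullback_connection \<phi> (\<lambda>_ _ _ _. 0) x k i j) =
     partial i (partial j (\<lambda>y. \<phi> y $ c)) x"
proof -
  let ?J = "jacobian \<phi> x" and ?K = "matrix_inv (jacobian \<phi> x)"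
  let ?h = "\<lambda>d. partial i (partial j (\<lambda>y. \<phi> y $ d)) x"
  have JK: "?J ** ?K = mat 1" using biholo_jacobian_inverse(2,3)[OF assms] by simp
  have "(\<Sum>k\<in>UNIV. ?J $ c $ k * pullback_connection \<phi> (\<lambda>_ _ _ _. 0) x k i j)
      = (\<Sum>k\<in>UNIV. \<Sum>d\<in>UNIV. ?J $ c $ k * ?K $ k $ d * ?h d)"
    by (simp add: pullback_connection_def sum_distrib_left mult.assoc del: jacobian_nth)
  also have "\<dots> = (\<Sum>d\<in>UNIV. (?J ** ?K) $ c $ d * ?h d)"
    by (subst sum.swap) (simp add: matrix_matrix_mult_def sum_distrib_right del: jacobian_nth)
  also have "\<dots> = ?h c"
    unfolding JK by (simp add: mat_def if_distribR if_distrib cong: if_cong)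
  finally show ?thesis .
qed

lemma pullback_flat_holo:
  assumes "biholomorphism V \<phi> V'"
  shows "affine_connection V (pullback_connection \<phi> (\<lambda>_ _ _ _. 0))"
  unfolding affine_connection_def
proof (intro allI)
  fix k i j
  note b = biholo_facts[OF assms]
  let ?\<psi> = "inv_into V \<phi>"
  have "cdiff_at (\<lambda>x. partial c (\<lambda>y. ?\<psi> y $ k) (\<phi> x)) x" if "x \<in> V" for c x
  proof (rule cdiff_compose[of "partial c (\<lambda>y. ?\<psi> y $ k)" \<phi>])
    have "holo_fun (\<lambda>y. ?\<psi> y $ k) V'" using b(4) by (simp add: holo_map_def)
    from holo_funD[OF holo_partial[OF b(2) this] b(5)[OF that]]
    show "cdiff_at (partial c (\<lambda>y. ?\<psi> y $ k)) (\<phi> x)" .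
    show "cdiff_at (\<lambda>x. \<phi> x $ k) x" for k by (rule holo_mapD[OF b(3) that])
  qed
  moreover have "cdiff_at (partial i (partial j (\<lambda>y. \<phi> y $ c))) x" if "x \<in> V" for c x
    using b(3) holo_funD[OF holo_partial[OF b(1) holo_partial[OF b(1)]] that] by (simp add: holo_map_def)
  ultimately have "holo_fun (\<lambda>x. \<Sum>c\<in>UNIV. partial c (\<lambda>y. ?\<psi> y $ k) (\<phi> x) * partial i (partial j (\<lambda>y. \<phi> y $ c)) x) V"
    by (auto simp: holo_fun_iff intro!: cdiff_sum cdiff_mult)
  then show "holo_fun (\<lambda>x. pullback_connection \<phi> (\<lambda>_ _ _ _. 0) x k i j) V"
    by (rule holo_fun_cong[OF b(1), THEN iffD1, rotated])
       (simp add: pullback_connection_def biholo_jacobian_inverse(3)[OF assms])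
qed

lemma pullback_flat_symmetric:
  assumes "biholomorphism V \<phi> V'" "x \<in> V"
  shows "pullback_connection \<phi> (\<lambda>_ _ _ _. 0) x k i j = pullback_connection \<phi> (\<lambda>_ _ _ _. 0) x k j i"
  using partial_commute[OF biholo_facts(1)[OF assms(1)] _ assms(2), of "\<lambda>y. \<phi> y $ _" i j] biholo_facts(3)[OF assms(1)]
  by (simp add: pullback_connection_def holo_map_def)

lemma jacobian_quad_form_flat:
  assumes "biholomorphism V \<phi> V'" "x \<in> V"
  shows "(jacobian \<phi> x *v quad_form (pullback_connection \<phi> (\<lambda>_ _ _ _. 0) x) v) $ c
    = (\<Sum>i\<in>UNIV. \<Sum>j\<in>UNIV. partial i (partial j (\<lambda>z. \<phi> z $ c)) x * v $ i * v $ j)"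
proof -
  let ?J = "jacobian \<phi> x" and ?G = "pullback_connection \<phi> (\<lambda>_ _ _ _. 0) x"
  have "(?J *v quad_form ?G v) $ c = (\<Sum>k\<in>UNIV. \<Sum>i\<in>UNIV. \<Sum>j\<in>UNIV. ?J $ c $ k * ?G k i j * v $ i * v $ j)"
    by (simp add: matrix_vector_mult_def quad_form_def sum_distrib_left mult.assoc del: jacobian_nth)
  also have "\<dots> = (\<Sum>i\<in>UNIV. \<Sum>k\<in>UNIV. \<Sum>j\<in>UNIV. ?J $ c $ k * ?G k i j * v $ i * v $ j)" by (rule sum.swap)
  also have "\<dots> = (\<Sum>i\<in>UNIV. \<Sum>j\<in>UNIV. \<Sum>k\<in>UNIV. ?J $ c $ k * ?G k i j * v $ i * v $ j)"
    by (intro sum.cong refl sum.swap)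
  also have "\<dots> = (\<Sum>i\<in>UNIV. \<Sum>j\<in>UNIV. (\<Sum>k\<in>UNIV. ?J $ c $ k * ?G k i j) * v $ i * v $ j)"
    by (simp only: sum_distrib_right)
  finally show ?thesis by (simp only: pullback_flat_jacobian[OF assms])
qed

lemma push_distinguished:
  assumes b: "biholomorphism V \<phi> V'" and d: "distinguished U F V1 u" and sub: "V1 \<subseteq> V"
  shows "distinguished V' (push_foliation V \<phi> F) (\<phi> ` V1) (\<lambda>y. u (inv_into V \<phi> y))"
    and "\<And>y v. y \<in> \<phi> ` V1 \<Longrightarrow> pairing (differential (\<lambda>y. u (inv_into V \<phi> y)) y) v
       = pairing (differential u (inv_into V \<phi> y)) (jacobian (inv_into V \<phi>) y *v v)"
proof -
  note B = biholo_facts[OF b] and D = distinguishedD[OF d]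
  let ?\<psi> = "inv_into V \<phi>"
  have im: "\<phi> ` V1 = V' \<inter> ?\<psi> -` V1"
    using sub B by (auto simp: image_iff) (metis)
  have op: "open (\<phi> ` V1)"
    unfolding im by (rule continuous_open_preimage[OF holo_map_continuous[OF B(4)] B(2) D(1)])
  have psi: "?\<psi> y \<in> V1" "y \<in> V'" "?\<psi> y \<in> V" "\<phi> (?\<psi> y) = y" if "y \<in> \<phi> ` V1" for y
    using that im sub B(8) by auto
  have grad: "has_grad (\<lambda>y. u (?\<psi> y)) (\<Sum>k\<in>UNIV. differential u (?\<psi> y) $ k *s differential (\<lambda>y. ?\<psi> y $ k) y) y" if "y \<in> \<phi> ` V1" for y
  proof (rule has_grad_compose)
    show "has_grad u (differential u (?\<psi> y)) (?\<psi> y)"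
      using holo_funD[OF D(3) psi(1)[OF that]] by (simp add: cdiff_at_iff)
    show "has_grad (\<lambda>y. ?\<psi> y $ k) (differential (\<lambda>y. ?\<psi> y $ k) y) y" for k
      using holo_mapD[OF B(4) psi(2)[OF that]] by (simp add: cdiff_at_iff)
  qed
  show p: "pairing (differential (\<lambda>y. u (?\<psi> y)) y) v = pairing (differential u (?\<psi> y)) (jacobian ?\<psi> y *v v)"
    if "y \<in> \<phi> ` V1" for y v
    unfolding differential_has_grad[OF grad[OF that]] pairing_sum_left pairing_simps
    by (simp add: pairing_def[of "differential u _"] jacobian_mult_nth)
  show "distinguished V' (push_foliation V \<phi> F) (\<phi> ` V1) (\<lambda>y. u (?\<psi> y))"
    unfolding distinguished_def
  proof (intro conjI ballI)
    show "open (\<phi> ` V1)" by (rule op)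
    show "\<phi> ` V1 \<subseteq> V'" using psi by blast
    show "holo_fun (\<lambda>y. u (?\<psi> y)) (\<phi> ` V1)" using grad by (auto simp: holo_fun_iff cdiff_at_def)
    fix y assume y: "y \<in> \<phi> ` V1"
    let ?x = "?\<psi> y"
    have JJ: "jacobian ?\<psi> y ** jacobian \<phi> ?x = mat 1" "jacobian \<phi> ?x ** jacobian ?\<psi> y = mat 1"
      using biholo_jacobian_inverse(1,2)[OF b psi(3)[OF y]] by (simp_all add: psi(4)[OF y])
    have inv1: "jacobian ?\<psi> y *v (jacobian \<phi> ?x *v v) = v" "jacobian \<phi> ?x *v (jacobian ?\<psi> y *v v) = v" for v
      by (simp_all add: matrix_vector_mul_assoc JJ)
    show "differential (\<lambda>y. u (?\<psi> y)) y \<noteq> 0"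
    proof
      assume "differential (\<lambda>y. u (?\<psi> y)) y = 0"
      then have "pairing (differential u ?x) v = 0" for v
        using p[OF y, of "jacobian \<phi> ?x *v v"] by (simp add: inv1)
      from this[of "axis _ 1"] show False using D(4)[OF psi(1)[OF y]] by (simp add: vec_eq_iff)
    qed
    show "push_foliation V \<phi> F y = covector_kernel (differential (\<lambda>y. u (?\<psi> y)) y)"
    proof (intro set_eqI iffI)
      fix v assume "v \<in> push_foliation V \<phi> F y"
      then obtain v' where "v' \<in> F ?x" "v = jacobian \<phi> ?x *v v'" by (auto simp: push_foliation_def Let_def)
      then show "v \<in> covector_kernel (differential (\<lambda>y. u (?\<psi> y)) y)"
        using p[OF y, of v] D(5)[OF psi(1)[OF y]] by (simp add: inv1 covector_kernel_iff)
    next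
      fix v assume "v \<in> covector_kernel (differential (\<lambda>y. u (?\<psi> y)) y)"
      then have "jacobian ?\<psi> y *v v \<in> F ?x"
        using p[OF y, of v] D(5)[OF psi(1)[OF y]] by (simp add: covector_kernel_iff)
      then show "v \<in> push_foliation V \<phi> F y"
        unfolding push_foliation_def Let_def using inv1(2)[of v] by (metis imageI)
    qed
  qed
qed

lemma push_foliation_foliation:
  assumes "biholomorphism V \<phi> V'" "V \<subseteq> U" "foliation U F"
  shows "foliation V' (push_foliation V \<phi> F)"
  unfolding foliation_def
proof
  note B = biholo_facts[OF assms(1)]
  fix y assume "y \<in> V'"
  then have x: "inv_into V \<phi> y \<in> V" "\<phi> (inv_into V \<phi> y) = y" by (rule B(7), rule B(8))
  then obtain V1 u where d: "inv_into V \<phi> y \<in> V1" "distinguished U F V1 u"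
    using assms(2,3) unfolding foliation_def by blast
  have "distinguished U F (V1 \<inter> V) u" by (rule distinguished_restrict[OF d(2) B(1)])
  then have "distinguished V' (push_foliation V \<phi> F) (\<phi> ` (V1 \<inter> V)) (\<lambda>y. u (inv_into V \<phi> y))"
    by (rule push_distinguished(1)[OF assms(1)]) simp
  moreover have "\<phi> (inv_into V \<phi> y) \<in> \<phi> ` (V1 \<inter> V)"
    by (rule imageI) (use x(1) d(1) in blast)
  then have "y \<in> \<phi> ` (V1 \<inter> V)" unfolding x(2) .
  ultimately show "\<exists>V1 u. y \<in> V1 \<and> distinguished V' (push_foliation V \<phi> F) V1 u"
    by (intro exI[of _ "\<phi> ` (V1 \<inter> V)"] exI[of _ "\<lambda>y. u (inv_into V \<phi> y)"] conjI)
qed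

text \<open>The tangency condition is invariant: by the chain rule the Hessian of \<open>u = u' \<circ> \<phi>\<close> is that of \<open>u'\<close>
  plus \<open>du'\<close> applied to the second derivative of \<open>\<phi>\<close>, and the latter is the pulled back flat symbol.\<close>

lemma tangency_transport:
  fixes F :: "'n::finite foliation"
  assumes b: "biholomorphism V \<phi> V'" and "V \<subseteq> U" "foliation U F" "x \<in> V"
  shows "tangency V' (push_foliation V \<phi> F) (\<phi> x) (\<lambda>_ _ _. 0) \<longleftrightarrow>
     tangency U F x (pullback_connection \<phi> (\<lambda>_ _ _ _. 0) x)"
proof -
  note B = biholo_facts[OF b]
  let ?\<psi> = "inv_into V \<phi>" and ?G = "pullback_connection \<phi> (\<lambda>_ _ _ _. 0) x"
  let ?F = "push_foliation V \<phi> F"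
  obtain V0 u where "x \<in> V0" "distinguished U F V0 u"
    using assms(2-4) unfolding foliation_def by blast
  define V1 where "V1 = V0 \<inter> V"
  have V1: "x \<in> V1" "V1 \<subseteq> V" and d: "distinguished U F V1 u"
    using \<open>x \<in> V0\<close> assms(4) distinguished_restrict[OF \<open>distinguished U F V0 u\<close> B(1)] by (auto simp: V1_def)
  note D = distinguishedD[OF d]
  define u' where "u' y = u (?\<psi> y)" for y
  have d': "distinguished V' ?F (\<phi> ` V1) u'"
    using push_distinguished(1)[OF b d V1(2)] by (simp add: u'_def[abs_def])
  note D' = distinguishedD[OF d']
  have y: "\<phi> x \<in> \<phi> ` V1" using V1 by blast
  let ?J = "jacobian \<phi> x"
  have ueq: "u z = u' (\<phi> z)" if "z \<in> V1" for z using that V1(2) B(6) by (auto simp: u'_def)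
  have cphi: "cdiff_at (\<lambda>z. \<phi> z $ c) z" if "z \<in> V1" for z c using that V1(2) by (intro holo_mapD[OF B(3)]) auto
  have cpp: "cdiff_at (partial j (\<lambda>z. \<phi> z $ c)) x" for j c
    using B(3) holo_funD[OF holo_partial[OF B(1)] assms(4)] by (simp add: holo_map_def)
  have hp': "holo_fun (partial c u') (\<phi> ` V1)" for c by (rule holo_partial[OF D'(1,3)])
  have first: "partial j u z = (\<Sum>c\<in>UNIV. partial c u' (\<phi> z) * partial j (\<lambda>z. \<phi> z $ c) z)" if z: "z \<in> V1" for z j
  proof -
    have "partial j u z = partial j (\<lambda>z. u' (\<phi> z)) z" by (rule partial_cong[OF D(1) z ueq])
    also have "\<dots> = (\<Sum>c\<in>UNIV. partial c u' (\<phi> z) * partial j (\<lambda>z. \<phi> z $ c) z)"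
      by (rule partial_compose[OF holo_funD[OF D'(3)] cphi[OF z]]) (use z in blast)
    finally show ?thesis .
  qed
  have du: "pairing (differential u x) v = pairing (differential u' (\<phi> x)) (?J *v v)" for v
  proof -
    have "pairing (differential u x) v = (\<Sum>j\<in>UNIV. \<Sum>c\<in>UNIV. partial c u' (\<phi> x) * (partial j (\<lambda>z. \<phi> z $ c) x * v $ j))"
      by (simp add: pairing_def first[OF V1(1)] sum_distrib_right mult.assoc)
    also have "\<dots> = (\<Sum>c\<in>UNIV. \<Sum>j\<in>UNIV. partial c u' (\<phi> x) * (partial j (\<lambda>z. \<phi> z $ c) x * v $ j))" by (rule sum.swap)
    finally show ?thesis by (simp add: pairing_def matrix_vector_mult_def sum_distrib_left)
  qed
  have cc: "cdiff_at (\<lambda>z. partial c u' (\<phi> z)) x" for c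
    by (rule cdiff_compose[of "partial c u'" \<phi>, OF holo_funD[OF hp' y] cphi[OF V1(1)]])
  have second: "partial i (partial j u) x = (\<Sum>c\<in>UNIV.
      partial c u' (\<phi> x) * partial i (partial j (\<lambda>z. \<phi> z $ c)) x +
      partial j (\<lambda>z. \<phi> z $ c) x * (\<Sum>d\<in>UNIV. partial d (partial c u') (\<phi> x) * partial i (\<lambda>z. \<phi> z $ d) x))" for i j
  proof -
    have "partial i (partial j u) x = partial i (\<lambda>z. \<Sum>c\<in>UNIV. partial c u' (\<phi> z) * partial j (\<lambda>z. \<phi> z $ c) z) x"
      by (rule partial_cong[OF D(1) V1(1) first])
    also have "\<dots> = (\<Sum>c\<in>UNIV. partial c u' (\<phi> x) * partial i (partial j (\<lambda>z. \<phi> z $ c)) x +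
         partial j (\<lambda>z. \<phi> z $ c) x * partial i (\<lambda>z. partial c u' (\<phi> z)) x)"
      by (simp add: partial_sum partial_mult cc cpp)
    also have "\<dots> = (\<Sum>c\<in>UNIV. partial c u' (\<phi> x) * partial i (partial j (\<lambda>z. \<phi> z $ c)) x +
      partial j (\<lambda>z. \<phi> z $ c) x * (\<Sum>d\<in>UNIV. partial d (partial c u') (\<phi> x) * partial i (\<lambda>z. \<phi> z $ d) x))"
      by (simp only: partial_compose[of "partial _ u'" \<phi>, OF holo_funD[OF hp' y] cphi[OF V1(1)]])
    finally show ?thesis .
  qed
  have hu: "hess u x v = hess u' (\<phi> x) (?J *v v) + pairing (differential u x) (quad_form ?G v)" for v
  proof -
    have "hess u x v = (\<Sum>j\<in>UNIV. \<Sum>i\<in>UNIV. \<Sum>c\<in>UNIV. partial c u' (\<phi> x) * (partial i (partial j (\<lambda>z. \<phi> z $ c)) x * v $ i * v $ j))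
       + (\<Sum>j\<in>UNIV. \<Sum>i\<in>UNIV. \<Sum>c\<in>UNIV. \<Sum>d\<in>UNIV. partial d (partial c u') (\<phi> x) * (partial i (\<lambda>z. \<phi> z $ d) x * v $ i) * (partial j (\<lambda>z. \<phi> z $ c) x * v $ j))"
      unfolding hess_def second
      by (simp only: sum.distrib[symmetric]) (intro sum.cong refl, simp add: sum_distrib_left sum_distrib_right sum.distrib algebra_simps)
    also have "(\<Sum>j\<in>UNIV. \<Sum>i\<in>UNIV. \<Sum>c\<in>UNIV. \<Sum>d\<in>UNIV. partial d (partial c u') (\<phi> x) * (partial i (\<lambda>z. \<phi> z $ d) x * v $ i) * (partial j (\<lambda>z. \<phi> z $ c) x * v $ j))
       = (\<Sum>j\<in>UNIV. \<Sum>c\<in>UNIV. \<Sum>i\<in>UNIV. \<Sum>d\<in>UNIV. partial d (partial c u') (\<phi> x) * (partial i (\<lambda>z. \<phi> z $ d) x * v $ i) * (partial j (\<lambda>z. \<phi> z $ c) x * v $ j))"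
      by (intro sum.cong refl sum.swap)
    also have "\<dots> = (\<Sum>c\<in>UNIV. \<Sum>j\<in>UNIV. \<Sum>d\<in>UNIV. \<Sum>i\<in>UNIV. partial d (partial c u') (\<phi> x) * (partial i (\<lambda>z. \<phi> z $ d) x * v $ i) * (partial j (\<lambda>z. \<phi> z $ c) x * v $ j))"
      by (subst sum.swap) (intro sum.cong refl sum.swap)
    also have "\<dots> = (\<Sum>c\<in>UNIV. \<Sum>d\<in>UNIV. \<Sum>j\<in>UNIV. \<Sum>i\<in>UNIV. partial d (partial c u') (\<phi> x) * (partial i (\<lambda>z. \<phi> z $ d) x * v $ i) * (partial j (\<lambda>z. \<phi> z $ c) x * v $ j))"
      by (intro sum.cong refl sum.swap)
    also have "\<dots> = hess u' (\<phi> x) (?J *v v)"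
      unfolding hess_def matrix_vector_mult_def
      by (simp add: sum_distrib_left sum_distrib_right)
    also have "(\<Sum>j\<in>UNIV. \<Sum>i\<in>UNIV. \<Sum>c\<in>UNIV. partial c u' (\<phi> x) * (partial i (partial j (\<lambda>z. \<phi> z $ c)) x * v $ i * v $ j))
       = (\<Sum>j\<in>UNIV. \<Sum>c\<in>UNIV. \<Sum>i\<in>UNIV. partial c u' (\<phi> x) * (partial i (partial j (\<lambda>z. \<phi> z $ c)) x * v $ i * v $ j))"
      by (intro sum.cong refl sum.swap)
    also have "\<dots> = (\<Sum>c\<in>UNIV. \<Sum>j\<in>UNIV. \<Sum>i\<in>UNIV. partial c u' (\<phi> x) * (partial i (partial j (\<lambda>z. \<phi> z $ c)) x * v $ i * v $ j))"
      by (rule sum.swap)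
    also have "\<dots> = (\<Sum>c\<in>UNIV. \<Sum>i\<in>UNIV. \<Sum>j\<in>UNIV. partial c u' (\<phi> x) * (partial i (partial j (\<lambda>z. \<phi> z $ c)) x * v $ i * v $ j))"
      by (intro sum.cong refl sum.swap)
    also have "\<dots> = pairing (differential u' (\<phi> x)) (?J *v quad_form ?G v)"
    proof -
      have "(?J *v quad_form ?G v) $ c = (\<Sum>i\<in>UNIV. \<Sum>j\<in>UNIV. partial i (partial j (\<lambda>z. \<phi> z $ c)) x * v $ i * v $ j)" for c
        by (rule jacobian_quad_form_flat[OF b assms(4)])
      then show ?thesis by (simp add: pairing_def sum_distrib_left)
    qed
    also have "\<dots> = pairing (differential u x) (quad_form ?G v)" by (simp only: du)
    finally show ?thesis by simp
  qed
  have qz: "quad_form (\<lambda>_ _ _. 0) v = (0 :: complex^'n)" for v by (simp add: quad_form_def vec_eq_iff)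
  show ?thesis
  proof
    assume t: "tangency V' ?F (\<phi> x) (\<lambda>_ _ _. 0)"
    show "tangency U F x ?G"
    proof (rule tangencyI[OF d V1(1)])
      fix v assume "pairing (differential u x) v = 0"
      then have "hess u' (\<phi> x) (?J *v v) = 0"
        using t d' y unfolding tangency_def du qz by auto
      then show "hess u x v = pairing (differential u x) (quad_form ?G v)" using hu by simp
    qed
  next
    assume t: "tangency U F x ?G"
    show "tangency V' ?F (\<phi> x) (\<lambda>_ _ _. 0)"
    proof (rule tangencyI[OF d' y])
      fix w assume w: "pairing (differential u' (\<phi> x)) w = 0"
      define v where "v = matrix_inv ?J *v w"
      have "?J ** matrix_inv ?J = mat 1"
        using biholo_jacobian_inverse(2,3)[OF b assms(4)] by simp
      then have v: "?J *v v = w" by (simp add: v_def matrix_vector_mul_assoc)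
      then have "pairing (differential u x) v = 0" using w du by simp
      then have "hess u x v = pairing (differential u x) (quad_form ?G v)"
        using t d V1(1) unfolding tangency_def by blast
      then show "hess u' (\<phi> x) w = pairing (differential u' (\<phi> x)) (quad_form (\<lambda>_ _ _. 0) w)"
        using hu[of v] by (simp add: v qz)
    qed
  qed
qed

section \<open>Linear leaves\<close>

text \<open>Integral curves of the vector field \<open>v - (du(v) / \<partial>\<^sub>p u) e\<^sub>p\<close>, the projection of the constant field \<open>v\<close> to
  the tangent hyperplanes along a coordinate axis transverse to them.\<close>

lemma tangent_curve_exists:
  fixes F :: "'n::finite foliation"
  assumes "foliation U F" "q \<in> U" "v \<in> F q"
  obtains r c w where "r > 0" "c 0 = q" "w 0 = v" "\<And>t. t \<in> ball 0 r \<Longrightarrow> c t \<in> U"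
    "\<And>t. t \<in> ball 0 r \<Longrightarrow> w t \<in> F (c t)"
    "\<And>t k. t \<in> ball 0 r \<Longrightarrow> ((\<lambda>s. c s $ k) has_field_derivative w t $ k) (at t)"
proof -
  obtain V u where V: "q \<in> V" "distinguished U F V u" using assms(1,2) by (auto simp: foliation_def)
  note D = distinguishedD[OF V(2)]
  obtain p where p: "partial p u q \<noteq> 0" using D(4)[OF V(1)] by (auto simp: vec_eq_iff)
  have hp: "holo_fun (partial j u) V" for j by (rule holo_partial[OF D(1,3)])
  define N where "N = {y \<in> V. partial p u y \<noteq> 0}"
  have "open (V \<inter> (partial p u) -` (- {0}))"
    by (rule continuous_open_preimage[OF holo_fun_continuous[OF hp] D(1)]) auto
  then have N: "open N" by (simp add: N_def vimage_def Int_def)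
  have qN: "q \<in> N" using V(1) p by (simp add: N_def)
  define X where "X y = v - axis p (pairing (differential u y) v / partial p u y)" for y
  have NV: "y \<in> V" "partial p u y \<noteq> 0" if "y \<in> N" for y using that by (auto simp: N_def)
  have "holo_fun (\<lambda>y. X y $ k) N" for k
  proof -
    have "cdiff_at (\<lambda>y. v $ k - axis p 1 $ k * ((\<Sum>i\<in>UNIV. partial i u y * v $ i) / partial p u y)) y" if "y \<in> N" for y
      using holo_funD[OF hp NV(1)[OF that]] NV(2)[OF that] by simp
    moreover have "X y $ k = v $ k - axis p 1 $ k * ((\<Sum>i\<in>UNIV. partial i u y * v $ i) / partial p u y)" for y
      by (simp add: X_def axis_def pairing_def)
    ultimately show ?thesis by (simp add: holo_fun_iff)
  qed
  then have "holo_map X N" by (simp add: holo_map_def)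
  from holo_ode_exists[OF N this qN] obtain r c where c: "r > 0" "c 0 = q" "\<And>t. t \<in> ball 0 r \<Longrightarrow> c t \<in> N"
    "\<And>t k. t \<in> ball 0 r \<Longrightarrow> ((\<lambda>s. c s $ k) has_field_derivative X (c t) $ k) (at t)" by blast
  show thesis
  proof (rule that[of r c "\<lambda>t. X (c t)"])
    have "pairing (differential u q) v = 0" using D(5)[OF V(1)] assms(3) by blast
    then show "X (c 0) = v" by (simp add: c(2) X_def)
    fix t :: complex assume t: "t \<in> ball 0 r"
    note n = NV[OF c(3)[OF t]]
    show "c t \<in> U" using n(1) D(2) by blast
    have "pairing (differential u (c t)) (X (c t)) = 0" using n(2) by (simp add: X_def)
    then show "X (c t) \<in> F (c t)" using D(5)[OF n(1)] by blast
  qed (use c in auto)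
qed

text \<open>The line from \<open>x\<close> in direction \<open>v\<close> runs in the leaf, so \<open>du(v)\<close> vanishes along it; its derivative at
  \<open>x\<close> is the Hessian.\<close>

lemma tangency_of_linear_leaves:
  fixes F :: "'n::finite foliation"
  assumes op: "open U" and fol: "foliation U F" and lin: "\<And>L. L \<in> leaves U F \<Longrightarrow>
      \<exists>a b. a \<noteq> 0 \<and> openin (top_of_set {x. (\<Sum>j\<in>UNIV. a $ j * x $ j) = b}) L"
    and x: "x \<in> U"
  shows "tangency U F x (\<lambda>_ _ _. 0)"
proof -
  obtain V u where V: "x \<in> V" "distinguished U F V u" using fol x by (auto simp: foliation_def)
  note D = distinguishedD[OF V(2)]
  obtain L where L: "L \<in> leaves U F" "x \<in> L" using leaf_exists[OF fol x] .
  obtain a b where a: "a \<noteq> 0" and openL: "openin (top_of_set {x. pairing a x = b}) L"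
    using lin[OF L(1)] unfolding pairing_def by blast
  have LH: "pairing a y = b" if "y \<in> L" for y using openin_imp_subset[OF openL] that by blast
  \<comment> \<open>a leaf contains curves in all tangent directions, so its tangent hyperplane is that of the affine hyperplane\<close>
  have tan: "pairing a v = 0" if q: "q \<in> L" and v: "v \<in> F q" for q v
  proof -
    have qU: "q \<in> U" using leaf_subset[OF fol L(1)] q by blast
    obtain r c w where c: "r > 0" "c 0 = q" "w 0 = v" "\<And>t. t \<in> ball 0 r \<Longrightarrow> c t \<in> U"
      "\<And>t. t \<in> ball 0 r \<Longrightarrow> w t \<in> F (c t)"
      "\<And>t k. t \<in> ball 0 r \<Longrightarrow> ((\<lambda>s. c s $ k) has_field_derivative w t $ k) (at t)"
      using tangent_curve_exists[OF fol qU v] by blast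
    have z: "(0::complex) \<in> ball 0 r" using c(1) by simp
    have "c t \<in> L" if "t \<in> ball 0 r" for t
      by (rule tangent_curve_in_leaf[OF fol open_ball convex_connected[OF convex_ball] c(6) c(4) c(5) L(1) z])
         (use c(2) q that in auto)
    then have const: "pairing a (c t) = b" if "t \<in> ball 0 r" for t using LH that by blast
    have "((\<lambda>s. \<Sum>i\<in>UNIV. a $ i * c s $ i) has_field_derivative (\<Sum>i\<in>UNIV. a $ i * w 0 $ i)) (at 0)"
      by (intro DERIV_sum DERIV_cmult c(6)[OF z])
    then have 1: "((\<lambda>s. pairing a (c s)) has_field_derivative pairing a v) (at 0)"
      by (simp add: pairing_def c(3))
    have "((\<lambda>s. b) has_field_derivative 0) (at (0::complex))" by simp
    then have 2: "((\<lambda>s. pairing a (c s)) has_field_derivative 0) (at 0)"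
      by (rule has_field_derivative_transform_within_open[OF _ open_ball z]) (simp add: const)
    show ?thesis by (rule DERIV_unique[OF 1 2])
  qed
  have Fq: "v \<in> F q" if q: "q \<in> L" and v: "pairing a v = 0" for q v
  proof -
    have qU: "q \<in> U" using leaf_subset[OF fol L(1)] q by blast
    obtain V' u' where V': "q \<in> V'" "distinguished U F V' u'" using fol qU by (auto simp: foliation_def)
    note D' = distinguishedD[OF V'(2)]
    have "pairing (differential u' q) v = 0 \<longleftrightarrow> pairing a v = 0"
      by (rule covector_kernel_subset_eq[OF _ D'(4)[OF V'(1)] a]) (use tan[OF q] D'(5)[OF V'(1)] in blast)
    then show ?thesis using v D'(5)[OF V'(1)] by blast
  qed
  obtain e where e: "e > 0" "ball x e \<inter> {x. pairing a x = b} \<subseteq> L"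
    using openL L(2) unfolding openin_contains_ball by blast
  show ?thesis
  proof (rule tangencyI[OF V(2) V(1)])
    fix v assume v0: "pairing (differential u x) v = 0"
    then have "v \<in> F x" using D(5)[OF V(1)] by blast
    then have v: "pairing a v = 0" by (rule tan[OF L(2)])
    define A where "A = (\<lambda>t. x + t *s v) -` (ball x e \<inter> V)"
    have A: "open A" "0 \<in> A"
      unfolding A_def using D(1) e(1) V(1) by (auto intro!: open_vimage continuous_line)
    have "pairing (differential u (x + t *s v)) v = 0" if "t \<in> A" for t
    proof -
      have q: "x + t *s v \<in> L" using that e(2) LH[OF L(2)] v by (auto simp: A_def)
      show ?thesis using Fq[OF q v] D(5)[of "x + t *s v" v] that by (simp add: A_def)
    qed
    note zero = this
    have "((\<lambda>s. 0) has_field_derivative 0) (at (0::complex))" by simp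
    then have 1: "((\<lambda>s. pairing (differential u (x + s *s v)) v) has_field_derivative 0) (at 0)"
      by (rule has_field_derivative_transform_within_open[OF _ A]) (simp only: zero)
    have "((\<lambda>s. pairing (differential u (x + s *s v)) v) has_field_derivative
        (hess u (x + 0 *s v) v + pairing (differential u (x + 0 *s v)) 0)) (at 0)"
      by (rule differential_along_curve[where c = "\<lambda>s. x + s *s v" and w = "\<lambda>s. v" and t = 0, OF D(1,3)])
         (use V(1) in \<open>auto intro!: derivative_eq_intros\<close>)
    then have "hess u x v = 0" using DERIV_unique[OF _ 1] by simp
    moreover have "quad_form (\<lambda>_ _ _. 0) v = 0" by (simp add: quad_form_def vec_eq_iff)
    ultimately show "hess u x v = pairing (differential u x) (quad_form (\<lambda>_ _ _. 0) v)" by simp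
  qed
qed

text \<open>For the flat connection the tangent hyperplane at \<open>q\<close> is, near \<open>q\<close>, contained in the leaf, and
  conversely the plaque through \<open>q\<close> lies in that hyperplane. So the affine tangent hyperplane is
  locally constant for the leaf topology.\<close>

lemma flat_segment:
  fixes F :: "'n::finite foliation"
  assumes fol: "foliation U F" and tg: "\<And>x. x \<in> U \<Longrightarrow> tangency U F x (\<lambda>_ _ _. 0)"
    and d: "distinguished U F V u" and r: "ball q r \<subseteq> V" "r > 0"
    and y: "y \<in> ball q r" "pairing (differential u q) (y - q) = 0"
  shows "u y = u q" and "\<And>L. L \<in> leaves U F \<Longrightarrow> q \<in> L \<Longrightarrow> y \<in> L"
proof -
  note D = distinguishedD[OF d]
  define w where "w = y - q"
  define T where "T = {t. q + t *s w \<in> ball q r}"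
  have qB: "q \<in> ball q r" using r(2) by simp
  note T = line_param[OF convex_ball open_ball qB y(1), folded w_def, folded T_def]
  let ?c = "\<lambda>t. q + t *s w"
  have inV: "?c t \<in> V" "?c t \<in> U" if "t \<in> T" for t using that r(1) D(2) by (auto simp: T_def)
  have dc: "((\<lambda>s. ?c s $ k) has_field_derivative w $ k) (at t)" for t k
    by (auto intro!: derivative_eq_intros)
  have df: "((\<lambda>t. pairing (differential u (?c t)) w) has_field_derivative
      (hess u (?c t) w + pairing (differential u (?c t)) 0)) (at t)" if "t \<in> T" for t
    by (rule differential_along_curve[where c = "?c" and w = "\<lambda>s. w" and t = t, OF D(1,3) inV(1)[OF that] dc]) simp
  have hol: "(\<lambda>t. pairing (differential u (?c t)) w) holomorphic_on T"
    unfolding holomorphic_on_open[OF T(2)] using df by (intro ballI exI)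
  obtain r0 where r0: "r0 > 0" "ball 0 r0 \<subseteq> T" using T(2,3) openE by blast
  have q0: "quad_form (\<lambda>_ _ _. 0) v = (0 :: complex^'n)" for v by (simp add: quad_form_def vec_eq_iff)
  have "\<exists>r'>0. r' \<le> r0 \<and> (\<forall>t\<in>ball 0 r'. pairing (differential u (?c t)) w = 0)"
  proof (rule tangent_near[where \<Gamma> = "\<lambda>_ _ _ _. 0" and w = "\<lambda>s. w" and c = "?c", OF _ tg d r0(1) dc])
    show "affine_connection U (\<lambda>_ _ _ _. 0)" by (simp add: affine_connection_def holo_fun_iff)
    show "?c t \<in> V" if "t \<in> ball 0 r0" for t using inV(1) that r0(2) by blast
    show "pairing (differential u (?c 0)) w = 0" using y(2) by (simp add: w_def)
  qed (simp_all add: q0)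
  then obtain r' where r': "r' > 0" "r' \<le> r0" "\<And>t. t \<in> ball 0 r' \<Longrightarrow> pairing (differential u (?c t)) w = 0" by blast
  have zero: "pairing (differential u (?c t)) w = 0" if t: "t \<in> T" for t
  proof (rule analytic_continuation_open[where s = "ball 0 r'" and s' = T and f = "\<lambda>t. pairing (differential u (?c t)) w" and g = "\<lambda>_. 0"])
    show "connected T" using T(1) by (rule convex_connected)
    show "ball 0 r' \<subseteq> T" using r'(2) r0(2) by auto
    show "ball (0::complex) r' \<noteq> {}" using r'(1) by simp
  qed (use T r' hol t in auto)
  have "\<exists>e. \<forall>t\<in>T. u (?c t) = e"
  proof (rule has_field_derivative_zero_constant[OF T(1)])
    fix t assume t: "t \<in> T"
    have "((\<lambda>s. u (?c s)) has_field_derivative pairing (differential u (?c t)) w) (at t)"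
      by (rule function_along_curve[where c = "?c", OF D(3) inV(1)[OF t] dc])
    then show "((\<lambda>s. u (?c s)) has_field_derivative 0) (at t within T)"
      unfolding zero[OF t] by (rule has_field_derivative_at_within)
  qed
  then obtain e where "u (?c 0) = e" "u (?c 1) = e" using T(3,4) by blast
  then show "u y = u q" by (simp add: w_def)
  fix L assume L: "L \<in> leaves U F" "q \<in> L"
  have tanT: "w \<in> F (?c t)" if "t \<in> T" for t using zero[OF that] D(5)[OF inV(1)[OF that]] by blast
  have "?c 1 \<in> L"
    by (rule tangent_curve_in_leaf[where c = "?c" and w = "\<lambda>t. w", OF fol T(2) convex_connected[OF T(1)] dc inV(2) tanT L(1) T(3) _ T(4)])
       (use L in simp_all)
  then show "y \<in> L" by (simp add: w_def)
qed

text \<open>A point \<open>x\<close> of the plaque is moved parallel to a transverse axis to a point \<open>y\<close> of the hyperplane, where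
  \<open>u\<close> has the same value by \<open>flat_segment\<close>. As \<open>u\<close> is injective along that axis near \<open>q\<close>, \<open>x = y\<close>.\<close>

lemma plaque_in_hyperplane:
  fixes F :: "'n::finite foliation"
  assumes fol: "foliation U F" and tg: "\<And>x. x \<in> U \<Longrightarrow> tangency U F x (\<lambda>_ _ _. 0)"
    and d: "distinguished U F V u" and r: "ball q r \<subseteq> V" "r > 0"
  shows "\<exists>r2>0. r2 \<le> r \<and> (\<forall>x\<in>ball q r2. u x = u q \<longrightarrow> pairing (differential u q) (x - q) = 0)"
proof -
  note D = distinguishedD[OF d]
  have qV: "q \<in> V" using r by auto
  obtain p where p: "partial p u q \<noteq> 0" using D(4)[OF qV] by (auto simp: vec_eq_iff)
  define m where "m = partial p u q"
  have "isCont (partial p u) q" by (rule cdiff_continuous[OF holo_funD[OF holo_partial[OF D(1,3)] qV]])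
  then obtain d0 where d0: "d0 > 0" "\<And>y. dist y q < d0 \<Longrightarrow> dist (partial p u y) m < cmod m / 2"
    unfolding continuous_at_eps_delta using p by (metis m_def zero_less_divide_iff zero_less_norm_iff zero_less_numeral)
  define r1 where "r1 = min d0 r"
  have r1: "r1 > 0" "r1 \<le> r" "r1 \<le> d0" using d0 r by (auto simp: r1_def)
  define Y where "Y x = x - axis p (pairing (differential u q) (x - q) / m)" for x
  have Yq: "Y q = q" by (simp add: Y_def)
  have "continuous_on UNIV (\<lambda>x. \<chi> k. x $ k - axis p 1 $ k * ((\<Sum>i\<in>UNIV. partial i u q * (x $ i - q $ i)) / m))"
    by (intro continuous_intros) (use p in \<open>auto simp: m_def\<close>)
  also have "(\<lambda>x. \<chi> k. x $ k - axis p 1 $ k * ((\<Sum>i\<in>UNIV. partial i u q * (x $ i - q $ i)) / m)) = Y"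
    by (auto simp: fun_eq_iff vec_eq_iff Y_def axis_def pairing_def)
  finally have "open (Y -` ball q r1)" by (rule open_vimage[OF open_ball])
  moreover have "q \<in> Y -` ball q r1" using Yq r1 by simp
  ultimately obtain r3 where r3: "r3 > 0" "ball q r3 \<subseteq> Y -` ball q r1" using openE by blast
  show ?thesis
  proof (intro exI[of _ "min r3 r1"] conjI ballI impI)
    show "min r3 r1 > 0" "min r3 r1 \<le> r" using r3 r1 by auto
    fix x assume x: "x \<in> ball q (min r3 r1)" and ux: "u x = u q"
    define s where "s = pairing (differential u q) (x - q) / m"
    define y where "y = Y x"
    have y: "y \<in> ball q r1" using x r3 by (auto simp: y_def)
    have xy: "x = y + axis p s" by (simp add: y_def Y_def s_def)
    have "pairing (differential u q) (y - q) = 0"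
    proof -
      have "pairing (differential u q) (y - q) = pairing (differential u q) (x - q) - m * s"
        unfolding y_def Y_def s_def[symmetric] by (simp add: m_def)
      then show ?thesis using p by (simp add: s_def m_def)
    qed
    then have uy: "u y = u q"
      using flat_segment(1)[OF fol tg d r, of y] y r1 by simp
    define T where "T = {z. y + z *s (x - y) \<in> ball q r1}"
    have x': "x \<in> ball q r1" using x by auto
    note T = line_param[OF convex_ball open_ball y x', folded T_def]
    let ?g = "\<lambda>z. u (y + z *s (x - y)) - m * s * z"
    have "cmod (?g 1 - ?g 0) \<le> (cmod m / 2 * cmod s) * norm (1 - 0 :: complex)"
    proof (rule field_differentiable_bound[OF T(1)])
      fix z assume z: "z \<in> T"
      have inb: "y + z *s (x - y) \<in> ball q r1" using z by (simp add: T_def)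
      then have inV: "y + z *s (x - y) \<in> V" using r1 r(1) by auto
      have "((\<lambda>z. u (y + z *s (x - y))) has_field_derivative pairing (differential u (y + z *s (x - y))) (x - y)) (at z)"
        by (rule has_grad_line) (use holo_funD[OF D(3) inV] in \<open>simp add: cdiff_at_iff\<close>)
      moreover have "pairing (differential u (y + z *s (x - y))) (x - y) = partial p u (y + z *s (x - y)) * s"
      proof -
        have "x - y = axis p s" using xy by simp
        then show ?thesis by (simp only: pairing_axis differential_nth)
      qed
      ultimately have "((\<lambda>z. u (y + z *s (x - y))) has_field_derivative partial p u (y + z *s (x - y)) * s) (at z)" by simp
      then show "(?g has_field_derivative (partial p u (y + z *s (x - y)) - m) * s) (at z within T)"
        by (intro has_field_derivative_at_within[OF DERIV_cong[OF DERIV_diff[OF _ DERIV_cmult_Id]]]) (auto simp: algebra_simps)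
      have "cmod (partial p u (y + z *s (x - y)) - m) \<le> cmod m / 2"
        using d0(2)[of "y + z *s (x - y)"] inb r1(3) by (simp add: dist_norm norm_minus_commute)
      then show "cmod ((partial p u (y + z *s (x - y)) - m) * s) \<le> cmod m / 2 * cmod s"
        unfolding norm_mult by (rule mult_right_mono) simp
    qed (use T in auto)
    then have "cmod m * cmod s \<le> cmod m / 2 * cmod s" using ux uy by (simp add: norm_mult)
    then have "s = 0" using p by (simp add: m_def mult_le_cancel_right)
    then show "pairing (differential u q) (x - q) = 0" using p by (simp add: s_def m_def)
  qed
qed

lemma connectedin_locally_constant:
  assumes "connectedin X L" and loc: "\<And>q. q \<in> topspace X \<Longrightarrow> \<exists>O'. openin X O' \<and> q \<in> O' \<and> (\<forall>x\<in>O'. h x = h q)"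
    and "x \<in> L" "y \<in> L"
  shows "h x = h y"
proof (rule ccontr)
  assume ne: "h x \<noteq> h y"
  have op: "openin X {z \<in> topspace X. h z \<in> A}" for A
  proof (subst openin_subopen, rule ballI)
    fix q assume q: "q \<in> {z \<in> topspace X. h z \<in> A}"
    then obtain O' where O': "openin X O'" "q \<in> O'" "\<forall>x\<in>O'. h x = h q" using loc[of q] by blast
    have "O' \<subseteq> {z \<in> topspace X. h z \<in> A}"
    proof
      fix z assume z: "z \<in> O'"
      then have "h z = h q" using O'(3) by blast
      moreover have "z \<in> topspace X" using z openin_subset[OF O'(1)] by blast
      ultimately show "z \<in> {z \<in> topspace X. h z \<in> A}" using q by simp
    qed
    then show "\<exists>T. openin X T \<and> q \<in> T \<and> T \<subseteq> {z \<in> topspace X. h z \<in> A}" using O' by blast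
  qed
  have "L \<subseteq> topspace X" using assms(1) connectedin_subset_topspace by blast
  define E1 where "E1 = {z \<in> topspace X. h z \<in> {h x}}"
  define E2 where "E2 = {z \<in> topspace X. h z \<in> - {h x}}"
  have "openin X E1" "openin X E2" unfolding E1_def E2_def by (rule op)+
  moreover have "L \<subseteq> E1 \<union> E2" "E1 \<inter> E2 \<inter> L = {}"
    using \<open>L \<subseteq> topspace X\<close> by (auto simp: E1_def E2_def)
  moreover have "x \<in> E1" "y \<in> E2"
    using assms(3,4) ne \<open>L \<subseteq> topspace X\<close> by (auto simp: E1_def E2_def)
  then have "E1 \<inter> L \<noteq> {}" "E2 \<inter> L \<noteq> {}" using assms(3,4) by blast+
  ultimately have "\<exists>E1 E2. openin X E1 \<and> openin X E2 \<and> L \<subseteq> E1 \<union> E2 \<and> E1 \<inter> E2 \<inter> L = {} \<and> E1 \<inter> L \<noteq> {} \<and> E2 \<inter> L \<noteq> {}"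
    by (intro exI[of _ E1] exI[of _ E2] conjI)
  then show False using assms(1) by (simp add: connectedin)
qed

text \<open>The affine tangent hyperplane \<open>H\<close> is constant on the connected leaf; the leaf is contained in it and,
  again by \<open>flat_segment\<close>, open in it.\<close>

lemma linear_leaves_of_tangency:
  fixes F :: "'n::finite foliation"
  assumes op: "open U" and fol: "foliation U F" and tg: "\<And>x. x \<in> U \<Longrightarrow> tangency U F x (\<lambda>_ _ _. 0)"
    and L: "L \<in> leaves U F"
  shows "\<exists>a b. a \<noteq> 0 \<and> openin (top_of_set {x. (\<Sum>j\<in>UNIV. a $ j * x $ j) = b}) L"
proof -
  let ?X = "leaf_topology U F"
  define H where "H x = {y. y - x \<in> F x}" for x
  have loc: "\<exists>O'. openin ?X O' \<and> q \<in> O' \<and> (\<forall>x\<in>O'. H x = H q)" if q: "q \<in> U" for q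
  proof -
    obtain V u where V: "q \<in> V" "distinguished U F V u" using fol q by (auto simp: foliation_def)
    note D = distinguishedD[OF V(2)]
    obtain r where r: "r > 0" "ball q r \<subseteq> V" using D(1) V(1) openE by blast
    obtain r2 where r2: "r2 > 0" "r2 \<le> r" "\<And>x. x \<in> ball q r2 \<Longrightarrow> u x = u q \<Longrightarrow> pairing (differential u q) (x - q) = 0"
      using plaque_in_hyperplane[OF fol tg V(2) r(2,1)] by blast
    have "H x = H q" if x: "x \<in> ball q r2" "u x = u q" for x
    proof -
      have xB: "x \<in> ball q r" using x r2 by auto
      then have xV: "x \<in> V" using r by blast
      have x0: "pairing (differential u q) (x - q) = 0" by (rule r2(3)[OF x])
      have "pairing (differential u x) v = 0" if v: "pairing (differential u q) v = 0" for v
      proof -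
        define A where "A = (\<lambda>t. x + t *s v) -` ball q r"
        have A: "open A" "0 \<in> A" unfolding A_def using xB by (auto intro!: open_vimage continuous_line)
        have const: "u (x + t *s v) = u q" if "t \<in> A" for t
        proof (rule flat_segment(1)[OF fol tg V(2) r(2,1)])
          show "x + t *s v \<in> ball q r" using that unfolding A_def by blast
          have "pairing (differential u q) (x + t *s v - q) = pairing (differential u q) (x - q) + t * pairing (differential u q) v"
            by simp
          then show "pairing (differential u q) (x + t *s v - q) = 0" using v x0 by (simp only:) simp
        qed
        have 1: "((\<lambda>t. u (x + t *s v)) has_field_derivative pairing (differential u x) v) (at 0)"
          by (rule has_grad_line) (use holo_funD[OF D(3) xV] in \<open>simp add: cdiff_at_iff\<close>)
        have "((\<lambda>t. u q) has_field_derivative 0) (at (0::complex))" by simp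
        then have 2: "((\<lambda>t. u (x + t *s v)) has_field_derivative 0) (at 0)"
          by (rule has_field_derivative_transform_within_open[OF _ A]) (simp add: const)
        show ?thesis by (rule DERIV_unique[OF 1 2])
      qed
      then have eq: "pairing (differential u q) v = 0 \<longleftrightarrow> pairing (differential u x) v = 0" for v
        by (rule covector_kernel_subset_eq[OF _ D(4)[OF V(1)] D(4)[OF xV]])
      have "y \<in> H x \<longleftrightarrow> y \<in> H q" for y
      proof -
        have "y \<in> H x \<longleftrightarrow> pairing (differential u q) (y - x) = 0"
          unfolding H_def mem_Collect_eq D(5)[OF xV] eq ..
        also have "\<dots> \<longleftrightarrow> pairing (differential u q) (y - q) = 0"
          using x0 by simp
        finally show ?thesis unfolding H_def mem_Collect_eq D(5)[OF V(1)] .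
      qed
      then show ?thesis by blast
    qed
    moreover have "openin ?X {x\<in>V \<inter> ball q r2. u x = u q}"
      by (rule openin_plaque[OF distinguished_restrict[OF V(2) open_ball]])
    moreover have "q \<in> {x\<in>V \<inter> ball q r2. u x = u q}" using V(1) r2(1) by simp
    ultimately show ?thesis
      by (intro exI[of _ "{x\<in>V \<inter> ball q r2. u x = u q}"] conjI ballI) blast+
  qed
  have conn: "connectedin ?X L" using connectedin_connected_components_of L by (auto simp: leaves_def)
  have "L \<noteq> {}" using nonempty_connected_components_of L by (auto simp: leaves_def)
  then obtain q0 where q0: "q0 \<in> L" by blast
  have LU: "L \<subseteq> U" by (rule leaf_subset[OF fol L])
  have const: "H x = H q0" if x: "x \<in> L" for x
    by (rule connectedin_locally_constant[OF conn loc x q0]) (simp add: topspace_leaf[OF fol])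
  have "q0 \<in> U" using q0 LU by blast
  then obtain V u where V: "q0 \<in> V" "distinguished U F V u" using fol by (auto simp: foliation_def)
  note D = distinguishedD[OF V(2)]
  define a where "a = differential u q0"
  define b where "b = pairing a q0"
  have Hab: "H q0 = {x. pairing a x = b}"
    by (auto simp: H_def D(5)[OF V(1)] a_def b_def)
  have "openin (top_of_set (H q0)) L"
    unfolding openin_contains_ball
  proof (intro conjI ballI subsetI)
    fix x assume x: "x \<in> L"
    then have xU: "x \<in> U" using LU by blast
    obtain V' u' where V': "x \<in> V'" "distinguished U F V' u'" using fol xU by (auto simp: foliation_def)
    note D' = distinguishedD[OF V'(2)]
    have "x \<in> H x" by (simp add: H_def D'(5)[OF V'(1)])
    then show "x \<in> H q0" using const[OF x] by simp
    obtain r where r: "r > 0" "ball x r \<subseteq> V'" using D'(1) V'(1) openE by blast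
    have "y \<in> L" if "y \<in> ball x r" "y \<in> H q0" for y
    proof (rule flat_segment(2)[OF fol tg V'(2) r(2,1) that(1) _ L x])
      have "y \<in> H x" using that(2) const[OF x] by simp
      then show "pairing (differential u' x) (y - x) = 0" by (simp only: H_def mem_Collect_eq D'(5)[OF V'(1)])
    qed
    then show "\<exists>e>0. ball x e \<inter> H q0 \<subseteq> L" using r(1) by blast
  qed
  then show ?thesis
    using D(4)[OF V(1)] unfolding Hab by (intro exI[of _ a] exI[of _ b]) (simp add: pairing_def a_def)
qed

section \<open>Linear algebra of n + 2 hyperplanes in general position\<close>

text \<open>In a coframe given by \<open>n\<close> of the forms the two remaining ones become \<open>\<mu>\<close> and \<open>\<nu>\<close>. General
  position makes the \<open>2 \<times> 2\<close> determinants of \<open>\<mu>\<close> and \<open>\<nu>\<close> nonzero, so the mixed components are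
  determined by the diagonal ones.\<close>

lemma coord_unique:
  fixes B :: "'n::finite \<Rightarrow> 'n \<Rightarrow> 'n \<Rightarrow> complex"
  assumes sym: "\<And>k i j. B k i j = B k j i"
    and A: "\<And>k x. x $ k = 0 \<Longrightarrow> quad_form B x $ k = 0"
    and M: "\<And>x. pairing \<mu> x = 0 \<Longrightarrow> pairing \<mu> (quad_form B x) = 0"
    and N: "\<And>x. pairing \<nu> x = 0 \<Longrightarrow> pairing \<nu> (quad_form B x) = 0"
    and nz: "\<And>k. \<mu> $ k \<noteq> 0" "\<And>k. \<nu> $ k \<noteq> 0"
    and det: "\<And>k l. k \<noteq> l \<Longrightarrow> \<mu> $ k * \<nu> $ l \<noteq> \<mu> $ l * \<nu> $ k"
  shows "\<exists>s. quad_form B x = s *s x"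
proof -
  have diag: "B k l l = 0" if "k \<noteq> l" for k l
    using A[of "axis l 1" k] that quad_form_axis[of B l k] by (simp add: axis_def)
  have off: "B k l m = 0" if "l \<noteq> m" "k \<noteq> l" "k \<noteq> m" for k l m
    using A[of "axis l 1 + axis m 1" k] that quad_form_two[of B l m 1 k] diag[of k l] diag[of k m] sym[of k m l]
    by (simp add: axis_def)
  have rel: "\<xi> $ m * (B l l l - 2 * B m l m) + \<xi> $ l * (B m m m - 2 * B l l m) = 0"
    if lm: "l \<noteq> m" and X: "\<And>x. pairing \<xi> x = 0 \<Longrightarrow> pairing \<xi> (quad_form B x) = 0" and nz: "\<xi> $ m \<noteq> 0" "\<xi> $ l \<noteq> 0" for \<xi> l m
  proof -
    define t where "t = - \<xi> $ l / \<xi> $ m"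
    have t: "\<xi> $ m * t = - \<xi> $ l" using nz by (simp add: t_def)
    let ?x = "axis l 1 + axis m t"
    have q: "quad_form B ?x $ k = (if k = l then B l l l + 2 * t * B l l m else 0) + (if k = m then 2 * t * B m l m + t\<^sup>2 * B m m m else 0)" for k
      using quad_form_two[of B l m t k] lm off[of l m k] diag[of k l] diag[of k m] sym[of k m l] by auto
    have "pairing \<xi> ?x = 0" using t by (simp add: mult.commute)
    then have "pairing \<xi> (quad_form B ?x) = 0" by (rule X)
    then have "\<xi> $ l * (B l l l + 2 * t * B l l m) + \<xi> $ m * (2 * t * B m l m + t\<^sup>2 * B m m m) = 0"
    proof -
      have "\<xi> $ k * quad_form B ?x $ k = (if k = l then \<xi> $ l * (B l l l + 2 * t * B l l m) else 0)
          + (if k = m then \<xi> $ m * (2 * t * B m l m + t\<^sup>2 * B m m m) else 0)" for k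
        unfolding q using lm by auto
      then have "pairing \<xi> (quad_form B ?x) = \<xi> $ l * (B l l l + 2 * t * B l l m) + \<xi> $ m * (2 * t * B m l m + t\<^sup>2 * B m m m)"
        unfolding pairing_def by (simp only: sum.distrib sum.delta finite if_True UNIV_I)
      then show ?thesis using \<open>pairing \<xi> (quad_form B ?x) = 0\<close> by simp
    qed
    moreover have "\<xi> $ m * (2 * t * B m l m + t\<^sup>2 * B m m m) = (\<xi> $ m * t) * (2 * B m l m + t * B m m m)"
      by (simp add: power2_eq_square algebra_simps)
    ultimately have "\<xi> $ l * (B l l l + 2 * t * B l l m) = \<xi> $ l * (2 * B m l m + t * B m m m)"
      unfolding t by simp
    then have "B l l l + 2 * t * B l l m = 2 * B m l m + t * B m m m" using nz by simp
    then have "\<xi> $ m * (B l l l + 2 * t * B l l m) = \<xi> $ m * (2 * B m l m + t * B m m m)" by simp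
    then have "\<xi> $ m * B l l l + 2 * (\<xi> $ m * t) * B l l m = \<xi> $ m * 2 * B m l m + (\<xi> $ m * t) * B m m m"
      by (simp add: algebra_simps)
    then show ?thesis unfolding t by (simp add: algebra_simps)
  qed
  have mixed: "B l l m = B m m m / 2" if lm: "l \<noteq> m" for l m
  proof -
    define P where "P = B l l l - 2 * B m l m"
    define Q where "Q = B m m m - 2 * B l l m"
    have 1: "\<mu> $ m * P + \<mu> $ l * Q = 0" and 2: "\<nu> $ m * P + \<nu> $ l * Q = 0"
      unfolding P_def Q_def using rel[OF lm M nz(1) nz(1)] rel[OF lm N nz(2) nz(2)] by auto
    have "(\<mu> $ l * \<nu> $ m - \<mu> $ m * \<nu> $ l) * Q = \<nu> $ m * (\<mu> $ m * P + \<mu> $ l * Q) - \<mu> $ m * (\<nu> $ m * P + \<nu> $ l * Q)"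
      by (simp add: algebra_simps)
    also have "\<dots> = 0" unfolding 1 2 by simp
    finally have "Q = 0" using det[OF lm] by simp
    then show ?thesis by (simp add: Q_def)
  qed
  define \<theta> where "\<theta> l = B l l l / 2" for l
  have "B k l m = (if k = l then \<theta> m else 0) + (if k = m then \<theta> l else 0)" for k l m
  proof (cases "l = m")
    case True then show ?thesis using diag[of k l] by (auto simp: \<theta>_def)
  next
    case False
    then show ?thesis using off[OF False, of k] mixed[OF False] mixed[of m l] sym[of m l m] by (auto simp: \<theta>_def)
  qed
  then have "B = (\<lambda>k l m. (if k = l then \<theta> m else 0) + (if k = m then \<theta> l else 0))" by (intro ext)
  then have "quad_form B x = (2 * (\<Sum>i\<in>UNIV. \<theta> i * x $ i)) *s x"
    using quad_form_delta[of \<theta> x] by (simp only:)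
  then show ?thesis by blast
qed

definition sq_form :: "('n::finite \<Rightarrow> 'n \<Rightarrow> complex) \<Rightarrow> complex^'n \<Rightarrow> complex" where
  "sq_form h x = (\<Sum>l\<in>UNIV. \<Sum>m\<in>UNIV. h l m * x $ l * x $ m)"

text \<open>The symbol is sought with vanishing diagonal components \<open>B\<^sup>l\<^sub>l\<^sub>l\<close>. For a further covector \<open>\<mu>\<close>, the
  condition on \<open>ker \<mu>\<close> says that \<open>\<mu>(B(x, x)) - f(x)\<close> is divisible by \<open>\<mu>\<close>, i.e. equal to \<open>\<mu> \<tau>\<close> for a linear form
  \<open>\<tau>\<close>. The squares \<open>x\<^sub>l\<^sup>2\<close> determine \<open>\<tau>\<close>, and the terms \<open>x\<^sub>l x\<^sub>m\<close> then give the equations for the mixed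
  components.\<close>

definition web_tau :: "complex^'n::finite \<Rightarrow> ('n \<Rightarrow> 'n \<Rightarrow> 'n \<Rightarrow> complex) \<Rightarrow> ('n \<Rightarrow> 'n \<Rightarrow> complex) \<Rightarrow> 'n \<Rightarrow> complex" where
  "web_tau \<mu> h f l = ((\<Sum>k\<in>UNIV. if k \<noteq> l then \<mu> $ k * h k l l else 0) - f l l) / \<mu> $ l"

definition web_c :: "complex^'n::finite \<Rightarrow> ('n \<Rightarrow> 'n \<Rightarrow> 'n \<Rightarrow> complex) \<Rightarrow> ('n \<Rightarrow> 'n \<Rightarrow> complex) \<Rightarrow> 'n \<Rightarrow> 'n \<Rightarrow> complex" where
  "web_c \<mu> h f l m = \<mu> $ l * web_tau \<mu> h f m + \<mu> $ m * web_tau \<mu> h f l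
     - 2 * ((\<Sum>k\<in>UNIV. if k \<noteq> l \<and> k \<noteq> m then \<mu> $ k * h k l m else 0) - f l m)"

text \<open>The mixed components, solved from the two equations
  \<open>\<mu>\<^sub>l y\<^sub>l\<^sub>m + \<mu>\<^sub>m y\<^sub>m\<^sub>l = c\<^sub>l\<^sub>m / 2\<close> for \<open>\<mu>\<close> and for \<open>\<nu>\<close>.\<close>

definition web_y :: "complex^'n::finite \<Rightarrow> complex^'n \<Rightarrow> ('n \<Rightarrow> 'n \<Rightarrow> 'n \<Rightarrow> complex) \<Rightarrow> ('n \<Rightarrow> 'n \<Rightarrow> complex) \<Rightarrow> ('n \<Rightarrow> 'n \<Rightarrow> complex) \<Rightarrow> 'n \<Rightarrow> 'n \<Rightarrow> complex" where
  "web_y \<mu> \<nu> h f g l m = (web_c \<mu> h f l m * \<nu> $ m - web_c \<nu> h g l m * \<mu> $ m) / (2 * (\<mu> $ l * \<nu> $ m - \<mu> $ m * \<nu> $ l))"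

definition web_B :: "complex^'n::finite \<Rightarrow> complex^'n \<Rightarrow> ('n \<Rightarrow> 'n \<Rightarrow> 'n \<Rightarrow> complex) \<Rightarrow> ('n \<Rightarrow> 'n \<Rightarrow> complex) \<Rightarrow> ('n \<Rightarrow> 'n \<Rightarrow> complex) \<Rightarrow> 'n \<Rightarrow> 'n \<Rightarrow> 'n \<Rightarrow> complex" where
  "web_B \<mu> \<nu> h f g k l m = (if k \<noteq> l \<and> k \<noteq> m then h k l m else if l = m then 0
     else if k = l then web_y \<mu> \<nu> h f g l m else web_y \<mu> \<nu> h f g m l)"

lemma web_B_coframe:
  assumes "x $ k = 0"
  shows "quad_form (web_B \<mu> \<nu> h f g) x $ k = sq_form (h k) x"
proof -
  have "web_B \<mu> \<nu> h f g k l m * x $ l * x $ m = h k l m * x $ l * x $ m" for l m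
    using assms by (cases "k \<noteq> l \<and> k \<noteq> m") (auto simp: web_B_def)
  then show ?thesis unfolding quad_form_def sq_form_def vec_lambda_beta by (intro sum.cong refl)
qed

lemma web_B_extra_aux:
  fixes B :: "'n::finite \<Rightarrow> 'n \<Rightarrow> 'n \<Rightarrow> complex"
  assumes nz: "\<And>k. \<xi> $ k \<noteq> 0" and x: "pairing \<xi> x = 0"
    and B: "\<And>k l m. B k l m = (if k \<noteq> l \<and> k \<noteq> m then h k l m else if l = m then 0 else if k = l then y l m else y m l)"
    and y: "\<And>l m. l \<noteq> m \<Longrightarrow> \<xi> $ l * y l m + \<xi> $ m * y m l = web_c \<xi> h f l m / 2"
  shows "pairing \<xi> (quad_form B x) = sq_form f x"
proof -
  define \<tau> where "\<tau> = (\<chi> l. web_tau \<xi> h f l)"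
  define q where "q l m = (\<Sum>k\<in>UNIV. \<xi> $ k * B k l m) - f l m" for l m
  have q: "q l m = (\<xi> $ l * \<tau> $ m + \<xi> $ m * \<tau> $ l) / 2" for l m
  proof (cases "l = m")
    case True
    have "\<xi> $ k * B k l l = (if k \<noteq> l then \<xi> $ k * h k l l else 0)" for k by (simp add: B)
    then have "q l l = \<xi> $ l * \<tau> $ l" using nz[of l] by (simp add: q_def \<tau>_def web_tau_def)
    then show ?thesis using True by simp
  next
    case False
    have "\<xi> $ k * B k l m = (if k \<noteq> l \<and> k \<noteq> m then \<xi> $ k * h k l m else 0)
       + ((if k = l then \<xi> $ l * y l m else 0) + (if k = m then \<xi> $ m * y m l else 0))" for k
      using False by (auto simp: B)
    then have "q l m = (\<Sum>k\<in>UNIV. if k \<noteq> l \<and> k \<noteq> m then \<xi> $ k * h k l m else 0) + (\<xi> $ l * y l m + \<xi> $ m * y m l) - f l m"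
      by (simp add: q_def sum.distrib)
    then show ?thesis unfolding y[OF False] web_c_def \<tau>_def by (simp add: field_simps)
  qed
  have "pairing \<xi> (quad_form B x) = (\<Sum>k\<in>UNIV. \<Sum>l\<in>UNIV. \<Sum>m\<in>UNIV. \<xi> $ k * B k l m * x $ l * x $ m)"
    by (simp add: pairing_def quad_form_def sum_distrib_left mult.assoc)
  also have "\<dots> = (\<Sum>l\<in>UNIV. \<Sum>k\<in>UNIV. \<Sum>m\<in>UNIV. \<xi> $ k * B k l m * x $ l * x $ m)" by (rule sum.swap)
  also have "\<dots> = (\<Sum>l\<in>UNIV. \<Sum>m\<in>UNIV. \<Sum>k\<in>UNIV. \<xi> $ k * B k l m * x $ l * x $ m)"
    by (intro sum.cong refl sum.swap)
  finally have "pairing \<xi> (quad_form B x) - sq_form f x = (\<Sum>l\<in>UNIV. \<Sum>m\<in>UNIV. q l m * x $ l * x $ m)"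
    by (simp add: sq_form_def q_def left_diff_distrib sum_subtractf sum_distrib_right)
  also have "\<dots> = (\<Sum>l\<in>UNIV. \<Sum>m\<in>UNIV. (\<xi> $ l * x $ l) * (\<tau> $ m * x $ m)) / 2 + (\<Sum>l\<in>UNIV. \<Sum>m\<in>UNIV. (\<tau> $ l * x $ l) * (\<xi> $ m * x $ m)) / 2"
    unfolding q sum_divide_distrib
    by (simp only: sum.distrib[symmetric]) (intro sum.cong refl, simp add: field_simps)
  also have "\<dots> = pairing \<xi> x * pairing \<tau> x"
    by (simp add: sum_product[symmetric] pairing_def)
  finally show ?thesis using x by simp
qed

text \<open>Each pair \<open>l \<noteq> m\<close> contributes a linear system for the two unknowns \<open>y l m\<close> and \<open>y m l\<close>, with
  determinant a \<open>2 \<times> 2\<close> minor of \<open>\<mu>\<close> and \<open>\<nu>\<close>.\<close>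

lemma web_B_extra:
  fixes \<mu> \<nu> :: "complex^'n::finite"
  assumes sym: "\<And>k l m. h k l m = h k m l" "\<And>l m. f l m = f m l" "\<And>l m. g l m = g m l"
    and nz: "\<And>k. \<mu> $ k \<noteq> 0" "\<And>k. \<nu> $ k \<noteq> 0"
    and det: "\<And>k l. k \<noteq> l \<Longrightarrow> \<mu> $ k * \<nu> $ l \<noteq> \<mu> $ l * \<nu> $ k"
  shows "pairing \<mu> x = 0 \<Longrightarrow> pairing \<mu> (quad_form (web_B \<mu> \<nu> h f g) x) = sq_form f x"
    and "pairing \<nu> x = 0 \<Longrightarrow> pairing \<nu> (quad_form (web_B \<mu> \<nu> h f g) x) = sq_form g x"
proof -
  have c_sym: "web_c \<xi> h f' l m = web_c \<xi> h f' m l" if "\<And>l m. f' l m = f' m l" for \<xi> f' l m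
  proof -
    have "(\<Sum>k\<in>UNIV. if k \<noteq> l \<and> k \<noteq> m then \<xi> $ k * h k l m else 0) = (\<Sum>k\<in>UNIV. if k \<noteq> m \<and> k \<noteq> l then \<xi> $ k * h k m l else 0)"
      by (intro sum.cong refl) (auto simp: sym(1)[of _ l m])
    then show ?thesis unfolding web_c_def using that[of l m] by simp
  qed
  have solve: "p * ((c * n' - c' * p') / (2 * (p * n' - p' * n))) + p' * ((c * n - c' * p) / (2 * (p' * n - p * n'))) = c / 2"
    "n * ((c * n' - c' * p') / (2 * (p * n' - p' * n))) + n' * ((c * n - c' * p) / (2 * (p' * n - p * n'))) = c' / 2"
    if ne: "p * n' \<noteq> p' * n" for c c' p p' n n' :: complex
  proof -
    define D where "D = p * n' - p' * n"
    have D: "D \<noteq> 0" "p' * n - p * n' = - D" "p * n' - p' * n = D" using ne by (simp_all add: D_def)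
    have "p * ((c * n' - c' * p') / (2 * D)) + p' * ((c * n - c' * p) / (2 * - D)) = c * (p * n' - p' * n) / (2 * D)"
      using D(1) by (simp add: field_simps)
    then show "p * ((c * n' - c' * p') / (2 * (p * n' - p' * n))) + p' * ((c * n - c' * p) / (2 * (p' * n - p * n'))) = c / 2"
      unfolding D(2,3) using D(1) by simp
    have "n * ((c * n' - c' * p') / (2 * D)) + n' * ((c * n - c' * p) / (2 * - D)) = c' * (p * n' - p' * n) / (2 * D)"
      using D(1) by (simp add: field_simps)
    then show "n * ((c * n' - c' * p') / (2 * (p * n' - p' * n))) + n' * ((c * n - c' * p) / (2 * (p' * n - p * n'))) = c' / 2"
      unfolding D(2,3) using D(1) by simp
  qed
  show "pairing \<mu> (quad_form (web_B \<mu> \<nu> h f g) x) = sq_form f x" if "pairing \<mu> x = 0"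
  proof (rule web_B_extra_aux[OF nz(1) that web_B_def])
    fix l m :: 'n assume lm: "l \<noteq> m"
    show "\<mu> $ l * web_y \<mu> \<nu> h f g l m + \<mu> $ m * web_y \<mu> \<nu> h f g m l = web_c \<mu> h f l m / 2"
      unfolding web_y_def c_sym[where \<xi> = \<mu> and f' = f and l = m and m = l, OF sym(2)] c_sym[where \<xi> = \<nu> and f' = g and l = m and m = l, OF sym(3)]
      by (rule solve(1)[OF det[OF lm]])
  qed
  show "pairing \<nu> (quad_form (web_B \<mu> \<nu> h f g) x) = sq_form g x" if "pairing \<nu> x = 0"
  proof (rule web_B_extra_aux[OF nz(2) that web_B_def])
    fix l m :: 'n assume lm: "l \<noteq> m"
    show "\<nu> $ l * web_y \<mu> \<nu> h f g l m + \<nu> $ m * web_y \<mu> \<nu> h f g m l = web_c \<nu> h g l m / 2"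
      unfolding web_y_def c_sym[where \<xi> = \<mu> and f' = f and l = m and m = l, OF sym(2)] c_sym[where \<xi> = \<nu> and f' = g and l = m and m = l, OF sym(3)]
      by (rule solve(2)[OF det[OF lm]])
  qed
qed

section \<open>Frames adapted to a web\<close>

definition general_position :: "nat \<Rightarrow> (nat \<Rightarrow> complex^'n::finite) \<Rightarrow> bool" where
  "general_position d \<alpha> \<longleftrightarrow> (\<forall>I\<subseteq>{..<d}. card I = CARD('n) \<longrightarrow> (\<forall>v. (\<forall>i\<in>I. pairing (\<alpha> i) v = 0) \<longrightarrow> v = 0))"

lemma independent_covectors_kernel:
  fixes A :: "(complex^'n::finite) set"
  assumes "vec.independent A" "card A = CARD('n)" "\<And>a. a \<in> A \<Longrightarrow> pairing a v = 0"
  shows "v = 0"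
proof -
  have "vec.dim (UNIV :: (complex^'n) set) = CARD('n)" by (rule vec_dim_card)
  then have "UNIV \<subseteq> vec.span A"
    using vec.card_ge_dim_independent[of A UNIV] assms(1,2) by simp
  moreover have "pairing a v = 0" if "a \<in> vec.span A" for a
    using that by (induction rule: vec.span_induct_alt) (use assms(3) in auto)
  ultimately have "pairing (axis i 1) v = 0" for i by blast
  then show ?thesis by (simp add: vec_eq_iff)
qed

lemma web_general_position:
  fixes U :: "(complex^'n::finite) set"
  assumes "web (CARD('n) + 2) U W" "x \<in> U"
    and "\<And>i. i < CARD('n) + 2 \<Longrightarrow> distinguished U (W i) (V i) (u i) \<and> x \<in> V i"
  shows "general_position (CARD('n) + 2) (\<lambda>i. differential (u i) x)"
  unfolding general_position_def
proof (intro allI impI)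
  fix I :: "nat set" and v
  assume I: "I \<subseteq> {..<CARD('n) + 2}" "card I = CARD('n)" and v: "\<forall>i\<in>I. pairing (differential (u i) x) v = 0"
  let ?\<alpha> = "\<lambda>i. differential (u i) x"
  have "\<forall>i<CARD('n) + 2. ?\<alpha> i \<noteq> 0 \<and> W i x = covector_kernel (?\<alpha> i)"
    using assms(3) by (auto simp: distinguished_def)
  then have "inj_on ?\<alpha> I \<and> vec.independent (?\<alpha> ` I)"
    using assms(1,2) I unfolding web_def by auto
  then show "v = 0"
    using independent_covectors_kernel[of "?\<alpha> ` I" v] v I(2) by (auto simp: card_image)
qed

text \<open>Given by Cramer's rule, which makes the holomorphic dependence on the coframe visible.\<close>

definition dual_frame :: "complex^'n^'n \<Rightarrow> 'n::finite \<Rightarrow> complex^'n" where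
  "dual_frame A k = (\<chi> i. det (\<chi> r s. if s = i then axis k 1 $ r else A $ r $ s) / det A)"

lemma dual_frame:
  fixes A :: "complex^'n^'n::finite"
  assumes inj: "\<And>v. (\<And>k. pairing (A $ k) v = 0) \<Longrightarrow> v = 0"
  shows "det A \<noteq> 0" and "pairing (A $ i) (dual_frame A j) = (if i = j then 1 else 0)"
    and "v = (\<Sum>k\<in>UNIV. pairing (A $ k) v *s dual_frame A k)"
proof -
  have mv: "(A *v v) $ k = pairing (A $ k) v" for k v by (simp add: matrix_vector_mult_def pairing_def)
  have "\<forall>v. A *v v = 0 \<longrightarrow> v = 0" using inj mv by (metis zero_index)
  then have "invertible A"
    by (simp add: invertible_left_inverse matrix_left_invertible_ker)
  then show D: "det A \<noteq> 0" by (simp add: invertible_det_nz)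
  have dual: "A *v dual_frame A j = axis j 1" for j
    using cramer[OF D, of "dual_frame A j" "axis j 1"] by (simp add: dual_frame_def)
  show d: "pairing (A $ i) (dual_frame A j) = (if i = j then 1 else 0)" for i j
    using mv[of "dual_frame A j" i] by (simp add: dual axis_def)
  have "v - (\<Sum>k\<in>UNIV. pairing (A $ k) v *s dual_frame A k) = 0"
  proof (rule inj)
    fix i
    have "pairing (A $ i) (\<Sum>k\<in>UNIV. pairing (A $ k) v *s dual_frame A k) = pairing (A $ i) v"
      by (simp add: pairing_sum_right d if_distrib cong: if_cong)
    then show "pairing (A $ i) (v - (\<Sum>k\<in>UNIV. pairing (A $ k) v *s dual_frame A k)) = 0" by simp
  qed
  then show "v = (\<Sum>k\<in>UNIV. pairing (A $ k) v *s dual_frame A k)" by simp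
qed

text \<open>General position in the dual frame: a vanishing entry of one of the extra covectors, or a vanishing
  minor, would put a nonzero vector into the kernels of \<open>n\<close> of the covectors.\<close>

lemma web_coefficients:
  fixes \<alpha> :: "nat \<Rightarrow> complex^'n::finite" and e :: "'n \<Rightarrow> nat"
  assumes gp: "general_position (CARD('n) + 2) \<alpha>" and e: "bij_betw e UNIV {..<CARD('n)}"
  defines "A \<equiv> (\<chi> k. \<alpha> (e k))"
  shows "\<And>v. (\<And>k. pairing (A $ k) v = 0) \<Longrightarrow> v = 0"
    and "\<And>k. pairing (\<alpha> (CARD('n))) (dual_frame A k) \<noteq> 0" "\<And>k. pairing (\<alpha> (CARD('n) + 1)) (dual_frame A k) \<noteq> 0"
    and "\<And>k l. k \<noteq> l \<Longrightarrow> pairing (\<alpha> (CARD('n))) (dual_frame A k) * pairing (\<alpha> (CARD('n) + 1)) (dual_frame A l)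
        \<noteq> pairing (\<alpha> (CARD('n))) (dual_frame A l) * pairing (\<alpha> (CARD('n) + 1)) (dual_frame A k)"
proof -
  let ?n = "CARD('n)"
  have gp': "v = 0" if "I \<subseteq> {..<?n + 2}" "card I = ?n" "\<And>i. i \<in> I \<Longrightarrow> pairing (\<alpha> i) v = 0" for I v
    using gp that unfolding general_position_def by blast
  have ran: "range e = {..<?n}" and inj: "inj e" using e by (auto simp: bij_betw_def)
  have lt: "e k < ?n" for k using ran by blast
  show inj0: "v = 0" if "\<And>k. pairing (A $ k) v = 0" for v
  proof (rule gp'[of "{..<?n}"])
    fix i assume "i \<in> {..<?n}"
    then obtain k where "i = e k" using ran by blast
    then show "pairing (\<alpha> i) v = 0" using that[of k] by (simp add: A_def)
  qed auto
  let ?E = "dual_frame A"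
  have d: "pairing (\<alpha> (e i)) (?E j) = (if i = j then 1 else 0)" for i j
    using dual_frame(2)[where A = A and i = i and j = j, OF inj0] by (simp add: A_def)
  have E0: "?E k \<noteq> 0" for k using d[of k k] by auto
  have nz: "pairing (\<alpha> N) (?E k) \<noteq> 0" if N: "?n \<le> N" "N < ?n + 2" for N k
  proof
    assume z: "pairing (\<alpha> N) (?E k) = 0"
    let ?I = "insert N (e ` (UNIV - {k}))"
    have "card (e ` (UNIV - {k})) = ?n - 1"
      by (subst card_image) (use inj in \<open>auto intro: inj_on_subset simp: card_Diff_singleton\<close>)
    moreover have "N \<notin> e ` (UNIV - {k})" using lt N by (auto simp: not_less[symmetric])
    ultimately have "card ?I = ?n" by simp
    moreover have "?I \<subseteq> {..<?n + 2}" using lt N by (auto intro: less_trans[OF lt])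
    moreover have "pairing (\<alpha> i) (?E k) = 0" if "i \<in> ?I" for i using that z d by (auto split: if_splits)
    ultimately have "?E k = 0" using gp'[of ?I "?E k"] by blast
    then show False using E0 by blast
  qed
  show "pairing (\<alpha> ?n) (?E k) \<noteq> 0" "pairing (\<alpha> (?n + 1)) (?E k) \<noteq> 0" for k
    by (rule nz; simp)+
  fix k l :: 'n assume kl: "k \<noteq> l"
  show "pairing (\<alpha> ?n) (?E k) * pairing (\<alpha> (?n + 1)) (?E l) \<noteq> pairing (\<alpha> ?n) (?E l) * pairing (\<alpha> (?n + 1)) (?E k)"
  proof
    assume eq: "pairing (\<alpha> ?n) (?E k) * pairing (\<alpha> (?n + 1)) (?E l) = pairing (\<alpha> ?n) (?E l) * pairing (\<alpha> (?n + 1)) (?E k)"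
    define v where "v = pairing (\<alpha> ?n) (?E l) *s ?E k - pairing (\<alpha> ?n) (?E k) *s ?E l"
    let ?I = "{?n, ?n + 1} \<union> e ` (UNIV - {k, l})"
    have "card (e ` (UNIV - {k, l})) = ?n - 2"
      by (subst card_image) (use inj kl in \<open>auto intro: inj_on_subset simp: card_Diff_subset\<close>)
    moreover have "{?n, ?n + 1} \<inter> e ` (UNIV - {k, l}) = {}" using lt by (auto, metis less_irrefl, metis not_less_eq less_Suc_eq less_irrefl)
    moreover have "?n \<ge> 2" using kl card_mono[of UNIV "{k, l}"] by simp
    ultimately have "card ?I = ?n" by (subst card_Un_disjoint) auto
    moreover have "?I \<subseteq> {..<?n + 2}" using lt by (auto intro: less_trans[OF lt])
    moreover have "pairing (\<alpha> i) v = 0" if "i \<in> ?I" for i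
    proof -
      from that consider "i = ?n" | "i = ?n + 1" | j where "i = e j" "j \<noteq> k" "j \<noteq> l" by blast
      then show "pairing (\<alpha> i) v = 0"
      proof cases
        case 2 then show ?thesis using eq by (simp add: v_def)
      next
        case 3 then show ?thesis by (simp add: v_def d)
      qed (simp add: v_def mult.commute)
    qed
    ultimately have "v = 0" using gp'[of ?I v] by blast
    then have "pairing (\<alpha> (e k)) v = 0" by simp
    then have "pairing (\<alpha> ?n) (?E l) = 0" using kl by (simp add: v_def d)
    then show False using nz[of ?n l] by simp
  qed
qed

subsection \<open>Bilinear forms in a frame\<close>

definition bil :: "('n::finite \<Rightarrow> 'n \<Rightarrow> complex) \<Rightarrow> complex^'n \<Rightarrow> complex^'n \<Rightarrow> complex" where
  "bil h v w = (\<Sum>i\<in>UNIV. \<Sum>j\<in>UNIV. h i j * v $ i * w $ j)"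

lemma bil_add_left: "bil h (v + v') w = bil h v w + bil h v' w"
  by (simp add: bil_def distrib_left distrib_right sum.distrib)
lemma bil_add_right: "bil h v (w + w') = bil h v w + bil h v w'"
  by (simp add: bil_def distrib_left distrib_right sum.distrib)
lemma bil_scale: "bil h (c *s v) w = c * bil h v w" "bil h v (c *s w) = c * bil h v w"
  by (simp_all add: bil_def sum_distrib_left mult_ac)
lemma bil_zero: "bil h 0 w = 0" "bil h v 0 = 0" by (simp_all add: bil_def)
lemma bil_sum: "bil h (\<Sum>l\<in>I. f l) w = (\<Sum>l\<in>I. bil h (f l) w)" "bil h v (\<Sum>l\<in>I. f l) = (\<Sum>l\<in>I. bil h v (f l))"
  by (induction I rule: infinite_finite_induct) (simp_all add: bil_add_left bil_add_right bil_zero)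

lemma bil_sym:
  assumes "\<And>i j. h i j = h j i"
  shows "bil h v w = bil h w v"
proof -
  have "bil h v w = (\<Sum>j\<in>UNIV. \<Sum>i\<in>UNIV. h i j * v $ i * w $ j)" unfolding bil_def by (rule sum.swap)
  also have "\<dots> = bil h w v" unfolding bil_def by (intro sum.cong refl) (simp add: assms[of _ _] mult_ac)
  finally show ?thesis .
qed

lemma sq_form_frame:
  assumes "v = (\<Sum>l\<in>UNIV. x $ l *s E l)"
  shows "sq_form h v = sq_form (\<lambda>l m. bil h (E l) (E m)) x"
proof -
  have "sq_form h v = bil h v v" by (simp add: sq_form_def bil_def)
  also have "\<dots> = (\<Sum>m\<in>UNIV. \<Sum>l\<in>UNIV. bil h (E l) (E m) * x $ l * x $ m)"
    unfolding assms by (simp only: bil_sum bil_scale sum_distrib_left) (simp only: mult_ac)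
  also have "\<dots> = (\<Sum>l\<in>UNIV. \<Sum>m\<in>UNIV. bil h (E l) (E m) * x $ l * x $ m)" by (rule sum.swap)
  finally show ?thesis by (simp add: sq_form_def)
qed

lemma pairing_quad_form:
  "pairing c (quad_form R v) = sq_form (\<lambda>i j. \<Sum>k\<in>UNIV. c $ k * R k i j) v"
proof -
  have "pairing c (quad_form R v) = (\<Sum>k\<in>UNIV. \<Sum>i\<in>UNIV. \<Sum>j\<in>UNIV. c $ k * R k i j * v $ i * v $ j)"
    by (simp add: pairing_def quad_form_def sum_distrib_left mult.assoc)
  also have "\<dots> = (\<Sum>i\<in>UNIV. \<Sum>k\<in>UNIV. \<Sum>j\<in>UNIV. c $ k * R k i j * v $ i * v $ j)" by (rule sum.swap)
  also have "\<dots> = (\<Sum>i\<in>UNIV. \<Sum>j\<in>UNIV. \<Sum>k\<in>UNIV. c $ k * R k i j * v $ i * v $ j)"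
    by (intro sum.cong refl sum.swap)
  finally show ?thesis by (simp add: sq_form_def sum_distrib_right)
qed

lemma hess_sq_form: "hess u x v = sq_form (\<lambda>a b. partial a (partial b u) x) v"
  unfolding hess_def sq_form_def by (rule sum.swap)

lemma tangency_similar:
  assumes "tangency U F x S" "\<And>v. \<exists>s. quad_form T v - quad_form S v = s *s v"
  shows "tangency U F x T"
  unfolding tangency_def
proof (intro allI impI, elim conjE)
  fix V u v assume d: "distinguished U F V u" "x \<in> V" and v: "pairing (differential u x) v = 0"
  obtain s where "quad_form T v - quad_form S v = s *s v" using assms(2) by blast
  then have "quad_form T v = quad_form S v + s *s v" by (simp add: algebra_simps)
  then show "hess u x v = pairing (differential u x) (quad_form T v)"
    using assms(1) d v unfolding tangency_def by auto
qed

lemma tangency_normalize: "tangency U F x S \<Longrightarrow> tangency U F x (normalize S)"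
  by (rule tangency_similar[OF _ normalize_similar])

lemma coframe_index: obtains e :: "'n::finite \<Rightarrow> nat" where "bij_betw e UNIV {..<CARD('n)}"
  using ex_bij_betw_finite_nat[of "UNIV :: 'n set"] by (auto simp: atLeast0LessThan)

text \<open>At a point, symbols tangent to all foliations agree up to the projective ambiguity.\<close>

lemma web_tangency_unique:
  fixes U :: "(complex^'n::finite) set"
  assumes web: "web (CARD('n) + 2) U W" and x: "x \<in> U"
    and S: "\<And>i. i < CARD('n) + 2 \<Longrightarrow> tangency U (W i) x S"
    and T: "\<And>i. i < CARD('n) + 2 \<Longrightarrow> tangency U (W i) x T"
  shows "\<exists>s. quad_form S v - quad_form T v = s *s v"
proof -
  let ?n = "CARD('n)"
  have "\<exists>V u. distinguished U (W i) V u \<and> x \<in> V" if "i < ?n + 2" for i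
    using web x that unfolding web_def foliation_def by blast
  then obtain V u where d: "\<And>i. i < ?n + 2 \<Longrightarrow> distinguished U (W i) (V i) (u i) \<and> x \<in> V i" by metis
  define \<alpha> where "\<alpha> i = differential (u i) x" for i
  have gp: "general_position (?n + 2) \<alpha>"
    unfolding \<alpha>_def by (rule web_general_position[OF web x d])
  obtain e :: "'n \<Rightarrow> nat" where e: "bij_betw e UNIV {..<?n}" by (rule coframe_index)
  have elt: "e k < ?n" for k using e by (auto simp: bij_betw_def)
  define A where "A = (\<chi> k. \<alpha> (e k))"
  note wc = web_coefficients[OF gp e, folded A_def]
  let ?E = "dual_frame A"
  note df = dual_frame[of A, OF wc(1)]
  define R where "R k i j = normalize S k i j - normalize T k i j" for k i j
  have Rsym: "R k i j = R k j i" for k i j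
    using normalize_trace_free[of S] normalize_trace_free[of T] by (simp add: R_def trace_free_def)
  have Rq: "quad_form R v = quad_form (normalize S) v - quad_form (normalize T) v" for v
    unfolding R_def[abs_def] by (rule quad_form_diff)
  have R0: "pairing (\<alpha> i) (quad_form R v) = 0" if "i < ?n + 2" "pairing (\<alpha> i) v = 0" for i v
  proof -
    have v: "pairing (differential (u i) x) v = 0" using that(2) by (simp add: \<alpha>_def)
    have "hess (u i) x v = pairing (differential (u i) x) (quad_form (normalize S) v)"
      using tangency_normalize[OF S[OF that(1)]] d[OF that(1)] v unfolding tangency_def by blast
    moreover have "hess (u i) x v = pairing (differential (u i) x) (quad_form (normalize T) v)"
      using tangency_normalize[OF T[OF that(1)]] d[OF that(1)] v unfolding tangency_def by blast
    ultimately show ?thesis by (simp add: Rq \<alpha>_def)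
  qed
  define B where "B k l m = bil (\<lambda>i j. \<Sum>c\<in>UNIV. A $ k $ c * R c i j) (?E l) (?E m)" for k l m
  have BR: "quad_form B y $ k = pairing (A $ k) (quad_form R (\<Sum>l\<in>UNIV. y $ l *s ?E l))" for y k
    unfolding pairing_quad_form sq_form_frame[OF refl] by (simp add: quad_form_def sq_form_def B_def)
  have coord: "pairing (A $ k) (\<Sum>l\<in>UNIV. y $ l *s ?E l) = y $ k" for y k
    by (simp add: pairing_sum_right df(2) if_distrib cong: if_cong)
  have extra: "pairing (\<chi> k. pairing b (?E k)) (\<chi> k. pairing (A $ k) w) = pairing b w" for b w
  proof -
    have "pairing b w = pairing b (\<Sum>k\<in>UNIV. pairing (A $ k) w *s ?E k)" using df(3)[of w] by simp
    then show ?thesis by (simp add: pairing_sum_right pairing_def[of "\<chi> k. pairing b (?E k)"] mult.commute)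
  qed
  have extra': "pairing (\<chi> k. pairing b (?E k)) y = pairing b (\<Sum>l\<in>UNIV. y $ l *s ?E l)" for b y
    using extra[of b "\<Sum>l\<in>UNIV. y $ l *s ?E l"] unfolding coord by (simp add: vec_nth_inverse)
  have ex: "pairing (\<chi> k. pairing (\<alpha> N) (?E k)) (quad_form B y) = 0"
    if N: "N < ?n + 2" and y: "pairing (\<chi> k. pairing (\<alpha> N) (?E k)) y = 0" for N y
  proof -
    have "quad_form B y = (\<chi> k. pairing (A $ k) (quad_form R (\<Sum>l\<in>UNIV. y $ l *s ?E l)))"
      by (simp add: vec_eq_iff BR)
    then show ?thesis using extra R0[OF N, of "\<Sum>l\<in>UNIV. y $ l *s ?E l"] y unfolding extra' by simp
  qed
  have par: "\<exists>s. quad_form B y = s *s y" for y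
  proof (rule coord_unique[where \<mu> = "\<chi> k. pairing (\<alpha> ?n) (?E k)" and \<nu> = "\<chi> k. pairing (\<alpha> (?n + 1)) (?E k)"])
    show "B k i j = B k j i" for k i j
      unfolding B_def by (rule bil_sym) (simp add: Rsym[of _ _ _])
    show "quad_form B y $ k = 0" if "y $ k = 0" for k y
      unfolding BR using R0[of "e k" "\<Sum>l\<in>UNIV. y $ l *s ?E l"] coord[of k y] that elt[of k] by (simp add: A_def)
  qed (use ex[of ?n] ex[of "?n + 1"] wc(2-4) in auto)
  define y where "y = (\<chi> k. pairing (A $ k) v)"
  have vy: "v = (\<Sum>l\<in>UNIV. y $ l *s ?E l)" using df(3)[of v] by (simp add: y_def)
  obtain s where s: "quad_form B y = s *s y" using par by blast
  have "quad_form R v = (\<Sum>k\<in>UNIV. pairing (A $ k) (quad_form R v) *s ?E k)" by (rule df(3))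
  also have "\<dots> = (\<Sum>k\<in>UNIV. (s * y $ k) *s ?E k)"
    using BR[of y] s unfolding vy[symmetric] by (simp add: vec_eq_iff)
  also have "\<dots> = s *s v"
    by (subst vy) (simp add: vec.scale_sum_right)
  finally have "quad_form (normalize S) v - quad_form (normalize T) v = s *s v" unfolding Rq .
  moreover obtain s1 s2 where "quad_form (normalize S) v - quad_form S v = s1 *s v"
    "quad_form (normalize T) v - quad_form T v = s2 *s v" using normalize_similar by metis
  ultimately have "quad_form S v - quad_form T v = (s - s1 + s2) *s v"
    by (simp add: vec_eq_iff algebra_simps)
  then show ?thesis by blast
qed

subsection \<open>Existence of the connection of a web\<close>

lemma cdiff_if [simp]:
  "(P \<Longrightarrow> cdiff_at f x) \<Longrightarrow> (\<not> P \<Longrightarrow> cdiff_at g x) \<Longrightarrow> cdiff_at (\<lambda>x. if P then f x else g x) x"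
  by (cases P) simp_all

lemma cdiff_det:
  fixes M :: "complex^'n \<Rightarrow> complex^'m^'m::finite"
  assumes "\<And>r s. cdiff_at (\<lambda>x. M x $ r $ s) y"
  shows "cdiff_at (\<lambda>x. det (M x)) y"
  unfolding det_def by (intro cdiff_sum cdiff_mult cdiff_const cdiff_prod assms)

lemma cdiff_dual_frame:
  fixes A :: "complex^'m \<Rightarrow> complex^'n^'n::finite"
  assumes A: "\<And>r s. cdiff_at (\<lambda>x. A x $ r $ s) y" and "det (A y) \<noteq> 0"
  shows "cdiff_at (\<lambda>x. dual_frame (A x) k $ i) y"
  unfolding dual_frame_def vec_lambda_beta
  by (intro cdiff_divide cdiff_det assms(2) A) (simp add: A)

lemma cdiff_bil:
  assumes "\<And>i j. cdiff_at (\<lambda>x. h x i j) y" "\<And>i. cdiff_at (\<lambda>x. v x $ i) y" "\<And>i. cdiff_at (\<lambda>x. w x $ i) y"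
  shows "cdiff_at (\<lambda>x. bil (h x) (v x) (w x)) y"
  unfolding bil_def by (intro cdiff_sum cdiff_mult assms)

lemma cdiff_pairing:
  assumes "\<And>i. cdiff_at (\<lambda>x. v x $ i) y" "\<And>i. cdiff_at (\<lambda>x. w x $ i) y"
  shows "cdiff_at (\<lambda>x. pairing (v x) (w x)) y"
  unfolding pairing_def by (intro cdiff_sum cdiff_mult assms)

lemma cdiff_web_c:
  assumes \<xi>: "\<And>i. cdiff_at (\<lambda>x. \<xi> x $ i) y" "\<And>i. \<xi> y $ i \<noteq> 0"
    and h: "\<And>k l m. cdiff_at (\<lambda>x. h x k l m) y" and f: "\<And>l m. cdiff_at (\<lambda>x. f x l m) y"
  shows "cdiff_at (\<lambda>x. web_c (\<xi> x) (h x) (f x) l m) y"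
proof -
  have "cdiff_at (\<lambda>x. web_tau (\<xi> x) (h x) (f x) l) y" for l
    unfolding web_tau_def by (intro cdiff_divide cdiff_diff cdiff_sum cdiff_if cdiff_mult cdiff_const \<xi> h f)
  then show ?thesis
    unfolding web_c_def by (intro cdiff_add cdiff_diff cdiff_sum cdiff_if cdiff_mult cdiff_const \<xi> h f)
qed

lemma cdiff_web_B:
  assumes \<mu>: "\<And>i. cdiff_at (\<lambda>x. \<mu> x $ i) y" "\<And>i. \<mu> y $ i \<noteq> 0"
    and \<nu>: "\<And>i. cdiff_at (\<lambda>x. \<nu> x $ i) y" "\<And>i. \<nu> y $ i \<noteq> 0"
    and det: "\<And>k l. k \<noteq> l \<Longrightarrow> \<mu> y $ k * \<nu> y $ l \<noteq> \<mu> y $ l * \<nu> y $ k"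
    and h: "\<And>k l m. cdiff_at (\<lambda>x. h x k l m) y" and f: "\<And>l m. cdiff_at (\<lambda>x. f x l m) y"
    and g: "\<And>l m. cdiff_at (\<lambda>x. g x l m) y"
  shows "cdiff_at (\<lambda>x. web_B (\<mu> x) (\<nu> x) (h x) (f x) (g x) k l m) y"
proof -
  have "cdiff_at (\<lambda>x. web_y (\<mu> x) (\<nu> x) (h x) (f x) (g x) l m) y" if "l \<noteq> m" for l m
    unfolding web_y_def
    by (intro cdiff_divide cdiff_diff cdiff_mult cdiff_const cdiff_web_c \<mu> \<nu> h f g) (use det[OF that] in simp)
  then show ?thesis
    unfolding web_B_def by (intro cdiff_if cdiff_const h) auto
qed

lemma sum_pull:
  "(\<Sum>i\<in>I. \<Sum>j\<in>J. \<Sum>k\<in>K. f i j k) = (\<Sum>k\<in>K. \<Sum>i\<in>I. \<Sum>j\<in>J. f i j k)"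
proof -
  have "(\<Sum>i\<in>I. \<Sum>j\<in>J. \<Sum>k\<in>K. f i j k) = (\<Sum>i\<in>I. \<Sum>k\<in>K. \<Sum>j\<in>J. f i j k)"
    by (intro sum.cong refl sum.swap)
  also have "\<dots> = (\<Sum>k\<in>K. \<Sum>i\<in>I. \<Sum>j\<in>J. f i j k)" by (rule sum.swap)
  finally show ?thesis .
qed

lemma quad_form_from_frame:
  fixes A :: "complex^'n^'n::finite"
  shows "quad_form (\<lambda>c i j. \<Sum>k\<in>UNIV. \<Sum>l\<in>UNIV. \<Sum>m\<in>UNIV. E k $ c * B k l m * A $ l $ i * A $ m $ j) v
     = (\<Sum>k\<in>UNIV. quad_form B (\<chi> k. pairing (A $ k) v) $ k *s E k)"
proof -
  have "(\<Sum>i\<in>UNIV. \<Sum>j\<in>UNIV. (\<Sum>k\<in>UNIV. \<Sum>l\<in>UNIV. \<Sum>m\<in>UNIV. E k $ c * B k l m * A $ l $ i * A $ m $ j) * v $ i * v $ j)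
    = (\<Sum>k\<in>UNIV. quad_form B (\<chi> k. pairing (A $ k) v) $ k * E k $ c)" for c
  proof -
    have "(\<Sum>i\<in>UNIV. \<Sum>j\<in>UNIV. (\<Sum>k\<in>UNIV. \<Sum>l\<in>UNIV. \<Sum>m\<in>UNIV. E k $ c * B k l m * A $ l $ i * A $ m $ j) * v $ i * v $ j)
      = (\<Sum>i\<in>UNIV. \<Sum>j\<in>UNIV. \<Sum>k\<in>UNIV. \<Sum>l\<in>UNIV. \<Sum>m\<in>UNIV. E k $ c * B k l m * ((A $ l $ i * v $ i) * (A $ m $ j * v $ j)))"
      by (simp only: sum_distrib_right) (simp only: mult_ac)
    also have "\<dots> = (\<Sum>k\<in>UNIV. \<Sum>i\<in>UNIV. \<Sum>j\<in>UNIV. \<Sum>l\<in>UNIV. \<Sum>m\<in>UNIV. E k $ c * B k l m * ((A $ l $ i * v $ i) * (A $ m $ j * v $ j)))"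
      by (rule sum_pull)
    also have "\<dots> = (\<Sum>k\<in>UNIV. \<Sum>l\<in>UNIV. \<Sum>i\<in>UNIV. \<Sum>j\<in>UNIV. \<Sum>m\<in>UNIV. E k $ c * B k l m * ((A $ l $ i * v $ i) * (A $ m $ j * v $ j)))"
      by (intro sum.cong refl sum_pull)
    also have "\<dots> = (\<Sum>k\<in>UNIV. \<Sum>l\<in>UNIV. \<Sum>m\<in>UNIV. \<Sum>i\<in>UNIV. \<Sum>j\<in>UNIV. E k $ c * B k l m * ((A $ l $ i * v $ i) * (A $ m $ j * v $ j)))"
      by (intro sum.cong refl sum_pull)
    also have "\<dots> = (\<Sum>k\<in>UNIV. \<Sum>l\<in>UNIV. \<Sum>m\<in>UNIV. E k $ c * B k l m * (pairing (A $ l) v * pairing (A $ m) v))"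
      by (simp only: pairing_def sum_product) (simp only: sum_distrib_left)
    also have "\<dots> = (\<Sum>k\<in>UNIV. quad_form B (\<chi> k. pairing (A $ k) v) $ k * E k $ c)"
      by (simp only: quad_form_def sum_distrib_right vec_lambda_beta) (simp only: mult_ac)
    finally show ?thesis .
  qed
  then show ?thesis by (simp add: quad_form_def[of "\<lambda>c i j. _ c i j"] vec_eq_iff)
qed

text \<open>The pointwise solution \<open>web_B\<close>, written in the frame dual to the differentials of \<open>n\<close> distinguished
  functions, depends holomorphically on the point.\<close>

lemma web_local_connection:
  fixes U :: "(complex^'n::finite) set"
  assumes web: "web (CARD('n) + 2) U W" and x0: "x0 \<in> U"
  obtains V \<Gamma> where "open V" "x0 \<in> V" "V \<subseteq> U" "affine_connection V \<Gamma>"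
    "\<And>x i. x \<in> V \<Longrightarrow> i < CARD('n) + 2 \<Longrightarrow> tangency U (W i) x (\<Gamma> x)"
proof -
  let ?n = "CARD('n)"
  have "\<exists>V u. distinguished U (W i) V u \<and> x0 \<in> V" if "i < ?n + 2" for i
    using web x0 that unfolding web_def foliation_def by blast
  then obtain V0 u where d0: "\<And>i. i < ?n + 2 \<Longrightarrow> distinguished U (W i) (V0 i) (u i) \<and> x0 \<in> V0 i" by metis
  define V where "V = (\<Inter>i\<in>{..<?n + 2}. V0 i)"
  have oV: "open V" unfolding V_def
  proof (intro open_INT ballI)
    show "open (V0 i)" if "i \<in> {..<?n + 2}" for i
      using distinguishedD(1)[of U "W i" "V0 i" "u i"] d0[of i] that by simp
  qed simp
  have xV: "x0 \<in> V" using d0 by (simp add: V_def)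
  have d: "distinguished U (W i) V (u i)" if "i < ?n + 2" for i
  proof -
    have "V0 i \<inter> V = V" using that by (auto simp: V_def)
    then show ?thesis using distinguished_restrict[of U "W i" "V0 i" "u i" V] d0[OF that] oV by simp
  qed
  have VU: "V \<subseteq> U" using distinguishedD(2)[OF d[of 0]] by simp
  obtain e :: "'n \<Rightarrow> nat" where e: "bij_betw e UNIV {..<?n}" by (rule coframe_index)
  have elt: "e k < ?n + 2" for k
  proof -
    have "e k \<in> {..<?n}" using bij_betwE[OF e] by blast
    then show ?thesis by simp
  qed
  define A where "A y = (\<chi> k. differential (u (e k)) y)" for y
  define E where "E y = dual_frame (A y)" for y
  define \<mu> where "\<mu> y = (\<chi> k. pairing (differential (u ?n) y) (E y k))" for y
  define \<nu> where "\<nu> y = (\<chi> k. pairing (differential (u (?n + 1)) y) (E y k))" for y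
  define H where "H i y a b = partial a (partial b (u i)) y" for i y a b
  define h where "h i y l m = bil (H i y) (E y l) (E y m)" for i y l m
  define B where "B y = web_B (\<mu> y) (\<nu> y) (\<lambda>k. h (e k) y) (h ?n y) (h (?n + 1) y)" for y
  \<comment> \<open>back from the adapted frame to the coordinates\<close>
  define \<Gamma> where "\<Gamma> y c i j = (\<Sum>k\<in>UNIV. \<Sum>l\<in>UNIV. \<Sum>m\<in>UNIV. E y k $ c * B y k l m * A y $ l $ i * A y $ m $ j)" for y c i j
  have gp: "general_position (?n + 2) (\<lambda>i. differential (u i) y)" if "y \<in> V" for y
    by (rule web_general_position[OF web]) (use that VU d in auto)
  note wc = web_coefficients[OF gp e, folded A_def, folded E_def]
  have nz: "\<mu> y $ k \<noteq> 0" "\<nu> y $ k \<noteq> 0" if "y \<in> V" for y k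
    using wc(2,3)[OF that] by (simp_all add: \<mu>_def \<nu>_def)
  have det: "\<mu> y $ k * \<nu> y $ l \<noteq> \<mu> y $ l * \<nu> y $ k" if "y \<in> V" "k \<noteq> l" for y k l
    using wc(4)[OF that] by (simp add: \<mu>_def \<nu>_def)
  have df: "det (A y) \<noteq> 0" "pairing (A y $ i) (E y j) = (if i = j then 1 else 0)"
    "v = (\<Sum>k\<in>UNIV. pairing (A y $ k) v *s E y k)" if y: "y \<in> V" for y v i j
    unfolding E_def by (rule dual_frame[where A = "A y", OF wc(1)[OF y]]; assumption)+
  have hu: "holo_fun (u i) V" if "i < ?n + 2" for i using distinguishedD(3)[OF d[OF that]] .
  have Hsym: "H i y a b = H i y b a" if "y \<in> V" "i < ?n + 2" for i y a b
    unfolding H_def by (rule partial_commute[OF oV hu[OF that(2)] that(1)])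
  show thesis
  proof (rule that[OF oV xV VU])
    show "affine_connection V \<Gamma>"
      unfolding affine_connection_def holo_fun_iff
    proof (intro allI ballI)
      fix c i j y assume y: "y \<in> V"
      have cp: "cdiff_at (partial a (u i)) y" if "i < ?n + 2" for a i
        by (rule holo_funD[OF holo_partial[OF oV hu[OF that]] y])
      have cH: "cdiff_at (\<lambda>y. H i y a b) y" if "i < ?n + 2" for a b i
        unfolding H_def by (rule holo_funD[OF holo_partial[OF oV holo_partial[OF oV hu[OF that]]] y])
      have cA: "cdiff_at (\<lambda>y. A y $ r $ s) y" for r s using cp[OF elt] by (simp add: A_def)
      have cE: "cdiff_at (\<lambda>y. E y k $ r) y" for k r
        unfolding E_def by (rule cdiff_dual_frame[OF cA df(1)[OF y]])
      have c\<mu>: "cdiff_at (\<lambda>y. \<mu> y $ k) y" "cdiff_at (\<lambda>y. \<nu> y $ k) y" for k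
        unfolding \<mu>_def \<nu>_def vec_lambda_beta by (rule cdiff_pairing; simp add: cp cE)+
      have ch: "cdiff_at (\<lambda>y. h i y l m) y" if "i < ?n + 2" for i l m
        unfolding h_def by (rule cdiff_bil[OF cH[OF that] cE cE])
      have "cdiff_at (\<lambda>y. B y k l m) y" for k l m
        unfolding B_def by (rule cdiff_web_B) (use c\<mu> nz[OF y] det[OF y] ch elt in auto)
      then show "cdiff_at (\<lambda>y. \<Gamma> y c i j) y"
        unfolding \<Gamma>_def by (intro cdiff_sum cdiff_mult cE cA)
    qed
    fix y i assume y: "y \<in> V" and i: "i < ?n + 2"
    show "tangency U (W i) y (\<Gamma> y)"
    proof (rule tangencyI[OF d[OF i] y])
      fix v assume v: "pairing (differential (u i) y) v = 0"
      define x where "x = (\<chi> k. pairing (A y $ k) v)"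
      have vx: "v = (\<Sum>k\<in>UNIV. x $ k *s E y k)" using df(3)[OF y, where v = v] by (simp add: x_def)
      have q: "quad_form (\<Gamma> y) v = (\<Sum>k\<in>UNIV. quad_form (B y) x $ k *s E y k)"
        unfolding \<Gamma>_def x_def by (rule quad_form_from_frame)
      have hs: "hess (u i) y v = sq_form (h i y) x" for i
        unfolding hess_sq_form h_def H_def by (rule sq_form_frame[OF vx])
      have hsym: "h i y l m = h i y m l" if "i < ?n + 2" for i l m
        unfolding h_def by (rule bil_sym) (rule Hsym[OF y that])
      have ex: "pairing a (quad_form (\<Gamma> y) v) = pairing (\<chi> k. pairing a (E y k)) (quad_form (B y) x)"
        "pairing a v = pairing (\<chi> k. pairing a (E y k)) x" for a
        unfolding q by (simp add: pairing_sum_right pairing_def[of "\<chi> k. pairing a (E y k)"] mult.commute)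
          (subst vx, simp add: pairing_sum_right pairing_def[of "\<chi> k. pairing a (E y k)"] mult.commute)
      consider k where "i = e k" | "i = ?n" | "i = ?n + 1"
      proof -
        have "i < ?n \<Longrightarrow> \<exists>k. i = e k" using e by (auto simp: bij_betw_def)
        then show thesis using that i by (metis Suc_eq_plus1 add_2_eq_Suc' less_SucE)
      qed
      then show "hess (u i) y v = pairing (differential (u i) y) (quad_form (\<Gamma> y) v)"
      proof cases
        case (1 k)
        have A: "differential (u i) y = A y $ k" using 1 by (simp add: A_def)
        have "x $ k = 0" using v by (simp add: x_def A)
        then have "quad_form (B y) x $ k = sq_form (h i y) x"
          unfolding B_def 1 by (rule web_B_coframe)
        moreover have "pairing (A y $ k) (quad_form (\<Gamma> y) v) = quad_form (B y) x $ k"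
          unfolding q by (simp add: pairing_sum_right df(2)[OF y] if_distrib cong: if_cong)
        ultimately show ?thesis by (simp add: hs A)
      next
        case 2
        have "pairing (\<mu> y) x = 0" using v ex(2)[of "differential (u i) y"] by (simp add: \<mu>_def 2)
        then have "pairing (\<mu> y) (quad_form (B y) x) = sq_form (h ?n y) x"
          unfolding B_def by (intro web_B_extra(1) hsym nz[OF y] det[OF y]) (use elt in simp_all)
        then show ?thesis by (simp add: hs ex(1) \<mu>_def 2)
      next
        case 3
        have "pairing (\<nu> y) x = 0" using v ex(2)[of "differential (u i) y"] by (simp add: \<nu>_def 3)
        then have "pairing (\<nu> y) (quad_form (B y) x) = sq_form (h (?n + 1) y) x"
          unfolding B_def by (intro web_B_extra(2) hsym nz[OF y] det[OF y]) (use elt in simp_all)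
        then show ?thesis by (simp add: hs ex(1) \<nu>_def 3)
      qed
    qed
  qed
qed

definition web_symbol :: "(complex^'n::finite) set \<Rightarrow> (nat \<Rightarrow> 'n foliation) \<Rightarrow> 'n christoffel" where
  "web_symbol U W x = (if x \<in> U then
     THE S. trace_free S \<and> (\<forall>i<CARD('n) + 2. tangency U (W i) x S) else (\<lambda>_ _ _. 0))"

text \<open>The trace-free condition selects one symbol from its projective class, so the local solutions agree on
  overlaps and define a global symbol.\<close>

lemma web_symbol_eq:
  fixes U :: "(complex^'n::finite) set"
  assumes web: "web (CARD('n) + 2) U W" and x: "x \<in> U"
    and S: "\<And>i. i < CARD('n) + 2 \<Longrightarrow> tangency U (W i) x S"
  shows "web_symbol U W x = normalize S"
proof -
  have "(THE S. trace_free S \<and> (\<forall>i<CARD('n) + 2. tangency U (W i) x S)) = normalize S"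
  proof (rule the_equality)
    show "trace_free (normalize S) \<and> (\<forall>i<CARD('n) + 2. tangency U (W i) x (normalize S))"
      using S normalize_trace_free tangency_normalize by blast
    fix T assume T: "trace_free T \<and> (\<forall>i<CARD('n) + 2. tangency U (W i) x T)"
    show "T = normalize S"
    proof (rule trace_free_unique[OF _ normalize_trace_free])
      show "\<exists>s. quad_form T v - quad_form (normalize S) v = s *s v" for v
        by (rule web_tangency_unique[OF web x]) (use T S tangency_normalize in blast)+
    qed (use T in blast)
  qed
  then show ?thesis using x by (simp add: web_symbol_def)
qed

lemma normalize_holo:
  assumes "affine_connection V \<Gamma>"
  shows "affine_connection V (\<lambda>x. normalize (\<Gamma> x))"
proof -
  have c: "cdiff_at (\<lambda>x. \<Gamma> x k i j) y" if "y \<in> V" for y k i j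
    using assms that by (simp add: affine_connection_def holo_fun_iff)
  have n: "(2 * (of_nat CARD('a) + 1) :: complex) \<noteq> 0"
    by (metis mult_eq_0_iff of_nat_Suc of_nat_neq_0 add.commute zero_neq_numeral)
  show ?thesis
    unfolding affine_connection_def holo_fun_iff normalize_def
    by (intro allI ballI cdiff_diff cdiff_add cdiff_divide cdiff_if cdiff_sum cdiff_const c n) simp_all
qed

lemma web_symbol:
  fixes U :: "(complex^'n::finite) set"
  assumes web: "web (CARD('n) + 2) U W"
  shows "affine_connection U (web_symbol U W)"
    and "\<And>x. x \<in> U \<Longrightarrow> trace_free (web_symbol U W x)"
    and "\<And>x i. x \<in> U \<Longrightarrow> i < CARD('n) + 2 \<Longrightarrow> tangency U (W i) x (web_symbol U W x)"
proof -
  have loc: "\<exists>V \<Gamma>. open V \<and> x0 \<in> V \<and> affine_connection V \<Gamma> \<and> (\<forall>x\<in>V. web_symbol U W x = normalize (\<Gamma> x)) \<and>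
      (\<forall>i<CARD('n) + 2. tangency U (W i) x0 (\<Gamma> x0))" if x0: "x0 \<in> U" for x0
  proof -
    obtain V \<Gamma> where V: "open V" "x0 \<in> V" "V \<subseteq> U" "affine_connection V \<Gamma>"
      "\<And>x i. x \<in> V \<Longrightarrow> i < CARD('n) + 2 \<Longrightarrow> tangency U (W i) x (\<Gamma> x)"
      using web_local_connection[OF web x0] by blast
    have "web_symbol U W x = normalize (\<Gamma> x)" if "x \<in> V" for x
      by (rule web_symbol_eq[OF web _ V(5)]) (use that V(3) in auto)
    then show ?thesis using V by blast
  qed
  show "affine_connection U (web_symbol U W)"
    unfolding affine_connection_def holo_fun_iff
  proof (intro allI ballI)
    fix k i j x0 assume "x0 \<in> U"
    then obtain V \<Gamma> where V: "open V" "x0 \<in> V" "affine_connection V \<Gamma>" "\<forall>x\<in>V. web_symbol U W x = normalize (\<Gamma> x)"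
      using loc by blast
    have "cdiff_at (\<lambda>x. normalize (\<Gamma> x) k i j) x0"
      using normalize_holo[OF V(3)] V(2) by (simp add: affine_connection_def holo_fun_iff)
    then show "cdiff_at (\<lambda>x. web_symbol U W x k i j) x0"
      by (rule cdiff_transform[OF _ V(1,2)]) (use V(4) in simp)
  qed
  show "trace_free (web_symbol U W x)" if "x \<in> U" for x
    using loc[OF that] normalize_trace_free by metis
  show "tangency U (W i) x (web_symbol U W x)" if "x \<in> U" "i < CARD('n) + 2" for x i
    using loc[OF that(1)] tangency_normalize that(2) by metis
qed

section \<open>Flatness and the Cartan curvature\<close>

lemma sum_option: "(\<Sum>m\<in>(UNIV::'n::finite option set). f m) = f None + (\<Sum>k\<in>UNIV. f (Some k))"
  by (simp add: UNIV_option_conv sum.reindex)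

text \<open>The system \<open>\<partial>\<^sub>j \<partial>\<^sub>i F = \<Sum>\<^sub>k P\<^sup>k\<^sub>i\<^sub>j \<partial>\<^sub>k F + \<rho>\<^sub>i\<^sub>j F\<close> as a first order system for the vector with entries \<open>F\<close>
  (index \<open>None\<close>) and \<open>\<partial>\<^sub>i F\<close> (index \<open>Some i\<close>). Its matrix is the transpose of the Cartan form when \<open>\<rho>\<close> is
  the normalized tensor \<open>schouten\<close>.\<close>

definition gauge_system :: "('n::finite christoffel) \<Rightarrow> (complex^'n \<Rightarrow> 'n \<Rightarrow> 'n \<Rightarrow> complex) \<Rightarrow>
    'n \<Rightarrow> 'n option \<Rightarrow> 'n option \<Rightarrow> complex^'n \<Rightarrow> complex" where
  "gauge_system P \<rho> j r c x = (case r of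
       None \<Rightarrow> (case c of None \<Rightarrow> 0 | Some k \<Rightarrow> if k = j then 1 else 0)
     | Some i \<Rightarrow> (case c of None \<Rightarrow> \<rho> x i j | Some k \<Rightarrow> P x k i j))"

definition schouten :: "'n::finite christoffel \<Rightarrow> complex^'n \<Rightarrow> 'n \<Rightarrow> 'n \<Rightarrow> complex" where
  "schouten P x i j = 1 / (1 - of_nat CARD('n)) * thomas_ricci P x i j"

lemma gauge_system_simps [simp]:
  "gauge_system P \<rho> j None None x = 0" "gauge_system P \<rho> j None (Some k) x = (if k = j then 1 else 0)"
  "gauge_system P \<rho> j (Some i) None x = \<rho> x i j" "gauge_system P \<rho> j (Some i) (Some k) x = P x k i j"
  by (simp_all add: gauge_system_def)

lemma cartan_form_gauge: "cartan_form P x j $ l $ k = gauge_system P (schouten P) j k l x"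
  by (cases k; cases l) (simp_all add: cartan_form_def schouten_def)

lemma curvature_sys_curv:
  "curvature U \<PP> x i j $ l $ k = sys_curv (gauge_system (thomas U \<PP>) (schouten (thomas U \<PP>))) i j k l x"
  by (simp add: curvature_def sys_curv_def Let_def matrix_matrix_mult_def cartan_form_gauge sum_subtractf mult.commute)

lemma gauge_system_holo:
  assumes "affine_connection U P" "\<And>i j. holo_fun (\<lambda>x. \<rho> x i j) U"
  shows "holo_fun (gauge_system P \<rho> j r c) U"
  using assms by (cases r; cases c)
    (simp_all add: affine_connection_def gauge_system_def[abs_def] holo_fun_iff)

lemma schouten_holo:
  assumes "open U" "affine_connection U P"
  shows "holo_fun (\<lambda>x. schouten P x i j) U"
proof -
  have h: "holo_fun (\<lambda>x. P x k i j) U" for k i j using assms(2) by (simp add: affine_connection_def)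
  show ?thesis
    unfolding schouten_def thomas_ricci_def holo_fun_iff
    by (intro ballI cdiff_mult cdiff_diff cdiff_sum cdiff_const holo_funD[OF h] holo_funD[OF holo_partial[OF assms(1) h]])
qed

text \<open>Flat coordinates are quotients of solutions of the integrable system
  \<open>\<partial>\<^sub>i \<partial>\<^sub>j F = P\<^sup>k\<^sub>i\<^sub>j \<partial>\<^sub>k F + \<rho>\<^sub>i\<^sub>j F\<close>.\<close>

lemma flat_coordinates:
  fixes P :: "'n::finite christoffel"
  assumes op: "open U" and p: "p \<in> U" and aff: "affine_connection U P"
    and sym: "\<And>x k i j. x \<in> U \<Longrightarrow> P x k i j = P x k j i"
    and hr: "\<And>i j. holo_fun (\<lambda>x. \<rho> x i j) U"
    and flat: "\<And>x i j k l. x \<in> U \<Longrightarrow> sys_curv (gauge_system P \<rho>) i j k l x = 0"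
  obtains V \<phi> where "p \<in> V" "V \<subseteq> U" "biholomorphism V \<phi> (\<phi> ` V)"
    "proj_similar V P (pullback_connection \<phi> (\<lambda>_ _ _ _. 0))"
proof -
  let ?A = "gauge_system P \<rho>"
  obtain r where r: "r > 0" "ball p r \<subseteq> U" and sol: "\<And>b :: complex^('n option).
      \<exists>X. holo_map X (ball p r) \<and> X p = b \<and>
       (\<forall>x\<in>ball p r. \<forall>j k. partial j (\<lambda>y. X y $ k) x = (\<Sum>l\<in>UNIV. ?A j k l x * X x $ l))"
    using frobenius_linear[OF op p gauge_system_holo[OF aff hr] flat] by blast
  obtain X where X: "\<And>a. holo_map (X a) (ball p r)" "\<And>a. X a p = axis a 1"
    "\<And>a x j k. x \<in> ball p r \<Longrightarrow> partial j (\<lambda>y. X a y $ k) x = (\<Sum>l\<in>UNIV. ?A j k l x * X a x $ l)"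
  proof -
    have "\<forall>a. \<exists>X. holo_map X (ball p r) \<and> X p = axis a 1 \<and>
       (\<forall>x\<in>ball p r. \<forall>j k. partial j (\<lambda>y. X y $ k) x = (\<Sum>l\<in>UNIV. ?A j k l x * X x $ l))"
      using sol by blast
    from choice[OF this] show thesis using that by blast
  qed
  define F where "F a x = X a x $ None" for a x
  have hF: "holo_fun (F a) (ball p r)" for a using X(1)[of a] by (simp add: holo_map_def F_def[abs_def])
  have d1: "partial j (F a) x = X a x $ Some j" if "x \<in> ball p r" for a j x
    unfolding F_def[abs_def] X(3)[OF that] by (simp add: sum_option if_distribR if_distrib cong: if_cong)
  have d2: "partial i (partial j (F a)) x = \<rho> x j i * F a x + (\<Sum>k\<in>UNIV. P x k j i * partial k (F a) x)"
    if x: "x \<in> ball p r" for a i j x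
  proof -
    have "partial i (partial j (F a)) x = partial i (\<lambda>y. X a y $ Some j) x"
      by (rule partial_cong[OF open_ball x d1])
    also have "\<dots> = \<rho> x j i * F a x + (\<Sum>k\<in>UNIV. P x k j i * X a x $ Some k)"
      unfolding X(3)[OF x] by (simp add: sum_option F_def)
    finally show ?thesis by (simp only: d1[OF x])
  qed
  define F0 where "F0 = F None"
  have hF0: "holo_fun F0 (ball p r)" using hF by (simp add: F0_def)
  define N where "N = {y \<in> ball p r. F0 y \<noteq> 0}"
  have "open (ball p r \<inter> F0 -` (- {0}))"
    by (rule continuous_open_preimage[OF holo_fun_continuous[OF hF0] open_ball]) auto
  then have N: "open N" by (simp add: N_def vimage_def Int_def)
  have pB: "p \<in> ball p r" using r by simp
  have F0p: "F0 p = 1" by (simp add: F0_def F_def X(2) axis_def)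
  have pN: "p \<in> N" using F0p pB by (simp add: N_def)
  have NB: "x \<in> ball p r" "F0 x \<noteq> 0" if "x \<in> N" for x using that by (auto simp: N_def)
  define \<phi> where "\<phi> y = (\<chi> a. F (Some a) y / F0 y)" for y
  have h\<phi>: "holo_map \<phi> N"
    unfolding holo_map_def holo_fun_iff \<phi>_def vec_lambda_beta
    using holo_funD[OF hF NB(1)] holo_funD[OF hF0 NB(1)] NB(2) by simp
  have c: "cdiff_at F0 x" "cdiff_at (partial j F0) x" "cdiff_at (\<lambda>y. \<phi> y $ a) x" "cdiff_at (partial j (\<lambda>y. \<phi> y $ a)) x"
    if "x \<in> N" for x j a
    using holo_funD[OF hF0 NB(1)[OF that]] holo_funD[OF holo_partial[OF open_ball hF0] NB(1)[OF that]]
      holo_mapD[OF h\<phi> that] holo_funD[OF holo_partial[OF N] that, of "\<lambda>y. \<phi> y $ a"] h\<phi>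
    by (auto simp: holo_map_def)
  have Fphi: "F (Some a) x = \<phi> x $ a * F0 x" if "x \<in> N" for a x using NB(2)[OF that] by (simp add: \<phi>_def)
  have e1: "partial j (F (Some a)) x = \<phi> x $ a * partial j F0 x + F0 x * partial j (\<lambda>y. \<phi> y $ a) x" if x: "x \<in> N" for j a x
    using partial_cong[OF N x Fphi, where i = j] partial_mult[OF c(3,1)[OF x]] by simp
  have e2: "partial i (partial j (F (Some a))) x =
      (\<phi> x $ a * partial i (partial j F0) x + partial j F0 x * partial i (\<lambda>y. \<phi> y $ a) x) +
      (F0 x * partial i (partial j (\<lambda>y. \<phi> y $ a)) x + partial j (\<lambda>y. \<phi> y $ a) x * partial i F0 x)" if x: "x \<in> N" for i j a x
    using partial_cong[OF N x e1, where i = i] by (simp add: partial_add partial_mult c[OF x])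
  \<comment> \<open>the projective change is governed by the logarithmic derivative of the denominator\<close>
  define \<sigma> where "\<sigma> x i = partial i F0 x / F0 x" for x i
  have key: "partial i (partial j (\<lambda>y. \<phi> y $ a)) x = (\<Sum>k\<in>UNIV. P x k i j * partial k (\<lambda>y. \<phi> y $ a) x)
      - \<sigma> x j * partial i (\<lambda>y. \<phi> y $ a) x - \<sigma> x i * partial j (\<lambda>y. \<phi> y $ a) x" if x: "x \<in> N" for i j a x
  proof -
    have xU: "x \<in> U" using NB(1)[OF x] r(2) by blast
    let ?\<phi> = "\<phi> x $ a"
    let ?S = "\<Sum>k\<in>UNIV. P x k i j * partial k (\<lambda>y. \<phi> y $ a) x" and ?T = "\<Sum>k\<in>UNIV. P x k i j * partial k F0 x"
    have "(\<Sum>k\<in>UNIV. P x k j i * partial k (F (Some a)) x) = ?\<phi> * ?T + F0 x * ?S"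
      unfolding e1[OF x] sym[OF xU, of _ j i] by (simp add: distrib_left sum.distrib sum_distrib_left mult_ac)
    then have "partial i (partial j (F (Some a))) x = \<rho> x j i * (?\<phi> * F0 x) + (?\<phi> * ?T + F0 x * ?S)"
      unfolding d2[OF NB(1)[OF x]] Fphi[OF x] by simp
    moreover have "partial i (partial j F0) x = \<rho> x j i * F0 x + ?T"
      using d2[OF NB(1)[OF x], of i j None] sym[OF xU, of _ j i] by (simp add: F0_def)
    ultimately have "F0 x * partial i (partial j (\<lambda>y. \<phi> y $ a)) x = F0 x * ?S - partial j F0 x * partial i (\<lambda>y. \<phi> y $ a) x - partial i F0 x * partial j (\<lambda>y. \<phi> y $ a) x"
      unfolding e2[OF x] by (simp add: algebra_simps)
    then have "F0 x * partial i (partial j (\<lambda>y. \<phi> y $ a)) x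
       = F0 x * (?S - \<sigma> x j * partial i (\<lambda>y. \<phi> y $ a) x - \<sigma> x i * partial j (\<lambda>y. \<phi> y $ a) x)"
      using NB(2)[OF x] by (simp add: \<sigma>_def right_diff_distrib)
    then show ?thesis using NB(2)[OF x] by simp
  qed
  have "jacobian \<phi> p = mat 1"
  proof -
    have "partial j (\<lambda>y. \<phi> y $ a) p = (if a = j then 1 else 0)" for a j
    proof -
      have "\<phi> p $ a = 0" by (simp add: \<phi>_def F_def X(2) axis_def)
      then show ?thesis using e1[OF pN, of j a] d1[OF pB, of j "Some a"] F0p by (auto simp: X(2) axis_def)
    qed
    then show ?thesis by (simp add: vec_eq_iff mat_def)
  qed
  then obtain V where V: "p \<in> V" "V \<subseteq> N" "biholomorphism V \<phi> (\<phi> ` V)"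
    using holo_inverse_function[OF N h\<phi> pN] by blast
  show thesis
  proof (rule that[OF V(1) _ V(3)])
    show "V \<subseteq> U" using V(2) NB(1) r(2) by blast
    show "proj_similar V P (pullback_connection \<phi> (\<lambda>_ _ _ _. 0))"
      unfolding proj_similar_def
    proof (intro ballI allI)
      fix x v assume x: "x \<in> V"
      let ?J = "jacobian \<phi> x" and ?G = "pullback_connection \<phi> (\<lambda>_ _ _ _. 0) x"
      define s where "s = (\<Sum>i\<in>UNIV. \<sigma> x i * v $ i)"
      have "(?J *v quad_form ?G v) $ c = (?J *v (quad_form (P x) v - (2 * s) *s v)) $ c" for c
      proof -
        let ?d = "\<lambda>k. partial k (\<lambda>y. \<phi> y $ c) x"
        have "(?J *v quad_form ?G v) $ c = (\<Sum>i\<in>UNIV. \<Sum>j\<in>UNIV. (\<Sum>k\<in>UNIV. P x k i j * ?d k) * v $ i * v $ j)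
          - (\<Sum>i\<in>UNIV. \<Sum>j\<in>UNIV. (?d i * v $ i) * (\<sigma> x j * v $ j)) - (\<Sum>i\<in>UNIV. \<Sum>j\<in>UNIV. (\<sigma> x i * v $ i) * (?d j * v $ j))"
          unfolding jacobian_quad_form_flat[OF V(3) x] key[OF subsetD[OF V(2) x]]
          by (simp only: sum_subtractf[symmetric]) (intro sum.cong refl, simp add: algebra_simps)
        also have "\<dots> = sq_form (\<lambda>i j. \<Sum>k\<in>UNIV. (differential (\<lambda>y. \<phi> y $ c) x) $ k * P x k i j) v - 2 * s * pairing (differential (\<lambda>y. \<phi> y $ c) x) v"
          by (simp add: sum_product[symmetric] s_def pairing_def sq_form_def mult.commute[of "P x _ _ _"])
        also have "\<dots> = (?J *v (quad_form (P x) v - (2 * s) *s v)) $ c"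
          unfolding pairing_quad_form[symmetric] jacobian_mult_nth by simp
        finally show ?thesis .
      qed
      then have "?J *v quad_form ?G v = ?J *v (quad_form (P x) v - (2 * s) *s v)" by (simp add: vec_eq_iff)
      then have "matrix_inv ?J *v (?J *v quad_form ?G v) = matrix_inv ?J *v (?J *v (quad_form (P x) v - (2 * s) *s v))" by simp
      moreover have "matrix_inv ?J ** ?J = mat 1" using biholo_jacobian_inverse(1,3)[OF V(3) x] by simp
      ultimately have "quad_form ?G v = quad_form (P x) v - (2 * s) *s v" by (simp add: matrix_vector_mul_assoc)
      then show "\<exists>s. quad_form (P x) v - quad_form ?G v = s *s v" by (intro exI[of _ "2 * s"]) simp
    qed
  qed
qed

text \<open>A row of the curvature annihilates the values of all solutions, hence vanishes if these span.\<close>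

lemma spanning_curvature_zero:
  fixes A :: "'n::finite \<Rightarrow> 'm::finite \<Rightarrow> 'm \<Rightarrow> complex^'n \<Rightarrow> complex"
  assumes "open N" "x \<in> N" "\<And>j k l. holo_fun (A j k l) N" "\<And>a. holo_map (X a) N"
    and "\<And>a y j k. y \<in> N \<Longrightarrow> partial j (\<lambda>y. X a y $ k) y = (\<Sum>l\<in>UNIV. A j k l y * X a y $ l)"
    and span: "\<And>c :: complex^'m. (\<And>a. (\<Sum>l\<in>UNIV. c $ l * X a x $ l) = 0) \<Longrightarrow> c = 0"
  shows "sys_curv A i j k l x = 0"
proof -
  have "(\<chi> l. sys_curv A i j k l x) = 0"
  proof (rule span)
    fix a
    show "(\<Sum>l\<in>UNIV. (\<chi> l. sys_curv A i j k l x) $ l * X a x $ l) = 0"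
      using linear_system_integrability[where A = A and X = "X a" and i = i and j = j and k = k, OF assms(1-3) assms(4)[of a] assms(5)] by simp
  qed
  then show ?thesis by (metis vec_lambda_beta zero_index)
qed

lemma jacobian_rows_span:
  fixes c :: "complex^'n::finite"
  assumes "biholomorphism V \<phi> V'" "x \<in> V" "\<And>a. (\<Sum>k\<in>UNIV. c $ k * partial k (\<lambda>y. \<phi> y $ a) x) = 0"
  shows "c = 0"
proof -
  have "jacobian \<phi> x *v c = 0"
    using assms(3) by (simp add: vec_eq_iff matrix_vector_mult_def mult.commute)
  then have "matrix_inv (jacobian \<phi> x) *v (jacobian \<phi> x *v c) = 0" by simp
  moreover have "matrix_inv (jacobian \<phi> x) ** jacobian \<phi> x = mat 1"
    using biholo_jacobian_inverse(1,3)[OF assms(1,2)] by simp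
  ultimately show ?thesis by (simp add: matrix_vector_mul_assoc)
qed

text \<open>The trace is the logarithmic derivative of the Jacobian determinant. Closedness is obtained without
  it: the gradients of the components of \<open>\<phi>\<close> solve a linear system with matrix \<open>G\<close>, whose curvature therefore
  vanishes, and the trace of the curvature is the exterior derivative of the trace of \<open>G\<close>.\<close>

lemma pullback_flat_trace_closed:
  assumes b: "biholomorphism V \<phi> V'" and x: "x \<in> V"
  defines "G \<equiv> pullback_connection \<phi> (\<lambda>_ _ _ _. 0)"
  shows "partial i (\<lambda>y. \<Sum>k\<in>UNIV. G y k k j) x = partial j (\<lambda>y. \<Sum>k\<in>UNIV. G y k k i) x"
proof -
  note B = biholo_facts[OF b]
  define A where "A j i k y = G y k i j" for j i k y
  have hG: "holo_fun (\<lambda>y. G y k i j) V" for k i j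
    using pullback_flat_holo[OF b] by (simp add: affine_connection_def G_def)
  have hA: "holo_fun (A j i k) V" for j i k unfolding A_def[abs_def] by (rule hG)
  have h\<phi>: "holo_fun (\<lambda>y. \<phi> y $ c) V" for c using B(3) by (simp add: holo_map_def)
  define X where "X c y = (\<chi> k. partial k (\<lambda>y. \<phi> y $ c) y)" for c y
  have hX: "holo_map (X c) V" for c
    unfolding holo_map_def X_def vec_lambda_beta using holo_partial[OF B(1) h\<phi>] by blast
  have "sys_curv A i j k l x = 0" for k l
  proof (rule spanning_curvature_zero[where X = X, OF B(1) x hA hX])
    fix c y a b assume y: "y \<in> V"
    have "partial a (partial b (\<lambda>y. \<phi> y $ c)) y = (\<Sum>k\<in>UNIV. jacobian \<phi> y $ c $ k * G y k a b)"
      unfolding G_def by (rule pullback_flat_jacobian[OF b y, symmetric])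
    then show "partial a (\<lambda>y. X c y $ b) y = (\<Sum>l\<in>UNIV. A a b l y * X c y $ l)"
      using pullback_flat_symmetric[OF b y] by (simp add: X_def A_def G_def mult.commute)
  next
    fix c :: "complex^'a" assume "\<And>a. (\<Sum>l\<in>UNIV. c $ l * X a x $ l) = 0"
    then show "c = 0" by (intro jacobian_rows_span[OF b x]) (simp add: X_def)
  qed
  then have "(\<Sum>k\<in>UNIV. sys_curv A i j k k x) = 0" by simp
  moreover have "(\<Sum>k\<in>UNIV. \<Sum>m\<in>UNIV. A j k m x * A i m k x) = (\<Sum>k\<in>UNIV. \<Sum>m\<in>UNIV. A i k m x * A j m k x)"
    by (subst sum.swap) (simp add: mult.commute)
  ultimately have "(\<Sum>k\<in>UNIV. partial i (A j k k) x) = (\<Sum>k\<in>UNIV. partial j (A i k k) x)"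
    by (simp add: sys_curv_def sum.distrib sum_subtractf)
  then show ?thesis
    using holo_funD[OF hG x] by (simp add: partial_sum A_def[abs_def])
qed

text \<open>If \<open>f\<close> compensates the trace of the pulled back flat connection \<open>G\<close>, then \<open>f\<close> and \<open>f \<phi>\<^sup>a\<close> solve the second
  order system of \<open>P\<close> with some \<open>\<rho>\<close>. These solutions span, so that system has zero curvature. Contracting
  the curvature gives \<open>(1 - n) \<rho> = thomas_ricci P\<close>, so \<open>\<rho>\<close> is the normalized tensor and the curvature is that of the
  Cartan form.\<close>

lemma curvature_of_flat:
  fixes P :: "'n::finite christoffel"
  assumes card: "CARD('n) \<ge> 2" and b: "biholomorphism V \<phi> V'" and aff: "affine_connection V P"
    and tf: "\<And>x. x \<in> V \<Longrightarrow> trace_free (P x)"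
    and sim: "proj_similar V P (pullback_connection \<phi> (\<lambda>_ _ _ _. 0))" and p: "p \<in> V"
  shows "sys_curv (gauge_system P (schouten P)) i j k l p = 0"
proof -
  let ?n = "of_nat CARD('n) :: complex"
  define G where "G = pullback_connection \<phi> (\<lambda>_ _ _ _. 0)"
  note B = biholo_facts[OF b]
  have n1: "?n + 1 \<noteq> 0" by (metis of_nat_Suc of_nat_neq_0 add.commute)
  have n2: "1 - ?n \<noteq> 0" using card by (metis One_nat_def Suc_1 not_less_eq_eq of_nat_1 of_nat_eq_iff order_refl right_minus_eq)
  have hP: "holo_fun (\<lambda>y. P y k i j) V" and hG: "holo_fun (\<lambda>y. G y k i j) V" for k i j
    using aff pullback_flat_holo[OF b] by (simp_all add: affine_connection_def G_def)
  have h\<phi>: "holo_fun (\<lambda>y. \<phi> y $ a) V" for a using B(3) by (simp add: holo_map_def)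
  have Psym: "P x k i j = P x k j i" and Ptr: "(\<Sum>l\<in>UNIV. P x l l j) = 0" if "x \<in> V" for x k i j
    using tf[OF that] by (auto simp: trace_free_def)
  define \<theta> where "\<theta> j x = (\<Sum>k\<in>UNIV. G x k k j) / (?n + 1)" for j x
  have GP: "G x k i j = P x k i j + (if k = i then \<theta> j x else 0) + (if k = j then \<theta> i x else 0)" if x: "x \<in> V" for x k i j
  proof -
    define R where "R k i j = G x k i j - P x k i j" for k i j
    define \<eta> where "\<eta> j = R j j j / 2" for j
    have R: "R k i j = (if k = i then \<eta> j else 0) + (if k = j then \<eta> i else 0)" for k i j
      unfolding \<eta>_def
    proof (rule symmetric_parallel)
      show "R k i j = R k j i" for k i j
        using pullback_flat_symmetric[OF b x] Psym[OF x] by (simp add: R_def G_def)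
      show "\<exists>s. quad_form R v = s *s v" for v
        using proj_similar_sym[OF sim] x unfolding R_def[abs_def] quad_form_diff G_def proj_similar_def by blast
    qed
    have "(\<Sum>k\<in>UNIV. G x k k j) = (\<Sum>k\<in>UNIV. R k k j)" for j
      by (simp add: R_def sum_subtractf Ptr[OF x])
    then have "\<theta> j x = \<eta> j" for j unfolding \<theta>_def R trace_delta using n1 by simp
    then show ?thesis using R[of k i j] by (simp add: R_def algebra_simps)
  qed
  have h\<theta>: "holo_fun (\<theta> j) V" for j
    unfolding \<theta>_def[abs_def] holo_fun_iff using holo_funD[OF hG] n1 by simp
  have closed: "partial i (\<theta> j) x = partial j (\<theta> i) x" if x: "x \<in> V" for i j x
  proof -
    have e: "(?n + 1) * \<theta> j y = (\<Sum>k\<in>UNIV. G y k k j)" for j y using n1 by (simp add: \<theta>_def)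
    have "partial i (\<lambda>y. (?n + 1) * \<theta> j y) x = partial j (\<lambda>y. (?n + 1) * \<theta> i y) x"
      unfolding e unfolding G_def by (rule pullback_flat_trace_closed[OF b x])
    then show ?thesis using n1 holo_funD[OF h\<theta> x] by (simp add: partial_mult)
  qed
  \<comment> \<open>\<open>f\<close> is the power of the Jacobian determinant with exponent \<open>-1 / (n + 1)\<close>, up to a constant\<close>
  obtain r f where r: "r > 0" "ball p r \<subseteq> V" and hf: "holo_fun f (ball p r)" and fp: "f p = 1"
    and df: "\<And>x j. x \<in> ball p r \<Longrightarrow> partial j f x = - \<theta> j x * f x"
  proof -
    define A where "A j (k::unit) (l::unit) x = - \<theta> j x" for j k l x
    have hA: "holo_fun (A j k l) V" for j k l
      unfolding A_def[abs_def] holo_fun_iff using holo_funD[OF h\<theta>] by simp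
    have "sys_curv A i j k l x = 0" if "x \<in> V" for x i j k l
      unfolding sys_curv_def A_def[abs_def] using closed[OF that, of i j] holo_funD[OF h\<theta> that]
      by (simp add: partial_minus mult.commute)
    from frobenius_linear[OF B(1) p hA this] obtain r where r: "r > 0" "ball p r \<subseteq> V"
      "\<And>b :: complex^unit. \<exists>X. holo_map X (ball p r) \<and> X p = b \<and>
       (\<forall>x\<in>ball p r. \<forall>j k. partial j (\<lambda>y. X y $ k) x = (\<Sum>l\<in>UNIV. A j k l x * X x $ l))" by blast
    obtain X :: "complex^'n \<Rightarrow> complex^unit" where X: "holo_map X (ball p r)" "X p = (\<chi> k. 1)"
       "\<forall>x\<in>ball p r. \<forall>j k. partial j (\<lambda>y. X y $ k) x = (\<Sum>l\<in>UNIV. A j k l x * X x $ l)" using r(3) by blast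
    show thesis
    proof (rule that[OF r(1,2), of "\<lambda>x. X x $ ()"])
      show "holo_fun (\<lambda>x. X x $ ()) (ball p r)" using X(1) by (simp add: holo_map_def)
      show "partial j (\<lambda>x. X x $ ()) x = - \<theta> j x * X x $ ()" if "x \<in> ball p r" for x j
        using X(3) that by (simp add: A_def UNIV_unit)
    qed (simp add: X(2))
  qed
  define N where "N = {y \<in> ball p r. f y \<noteq> 0}"
  have "open (ball p r \<inter> f -` (- {0}))"
    by (rule continuous_open_preimage[OF holo_fun_continuous[OF hf] open_ball]) auto
  then have N: "open N" by (simp add: N_def vimage_def Int_def)
  have pN: "p \<in> N" using fp r by (simp add: N_def)
  have NV: "x \<in> V" "x \<in> ball p r" "f x \<noteq> 0" if "x \<in> N" for x using that r(2) by (auto simp: N_def)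
  define Y where "Y a = (case a of None \<Rightarrow> f | Some c \<Rightarrow> (\<lambda>x. f x * \<phi> x $ c))" for a
  define \<rho> where "\<rho> x i j = (partial j (partial i f) x - (\<Sum>k\<in>UNIV. P x k i j * partial k f x)) / f x" for x i j
  have hfN: "holo_fun f N" using hf by (rule holo_fun_subset) (auto simp: N_def)
  have h\<phi>N: "holo_fun (\<lambda>y. \<phi> y $ a) N" for a using h\<phi> by (rule holo_fun_subset) (use NV in auto)
  have hPN: "holo_fun (\<lambda>y. P y k i j) N" for k i j using hP by (rule holo_fun_subset) (use NV in auto)
  have c: "cdiff_at f x" "cdiff_at (partial i f) x" "cdiff_at (partial j (partial i f)) x" "cdiff_at (\<lambda>y. \<phi> y $ a) x"
    "cdiff_at (partial i (\<lambda>y. \<phi> y $ a)) x" "cdiff_at (\<lambda>y. P y k i j) x" if "x \<in> N" for x i j k a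
    using that hfN h\<phi>N hPN holo_partial[OF N] by (blast intro: holo_funD)+
  have hY: "holo_fun (Y a) N" for a
    using c by (cases a) (simp_all add: Y_def holo_fun_iff)
  have h\<rho>: "holo_fun (\<lambda>x. \<rho> x i j) N" for i j
    unfolding \<rho>_def holo_fun_iff using c NV(3) by simp
  have affN: "affine_connection N P" using hPN by (simp add: affine_connection_def)
  define X where "X a x = (\<chi> m. case m of None \<Rightarrow> Y a x | Some k \<Rightarrow> partial k (Y a) x)" for a x
  have hX: "holo_map (X a) N" for a
    unfolding holo_map_def
  proof
    fix m show "holo_fun (\<lambda>x. X a x $ m) N"
      using hY holo_partial[OF N hY] by (cases m) (simp_all add: X_def)
  qed
  have first: "partial i (\<lambda>x. f x * \<phi> x $ a) x = f x * partial i (\<lambda>y. \<phi> y $ a) x + \<phi> x $ a * partial i f x" if x: "x \<in> N" for i a x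
    by (simp add: partial_mult c[OF x])
  have second: "partial j (partial i (\<lambda>x. f x * \<phi> x $ a)) x =
     (f x * partial j (partial i (\<lambda>y. \<phi> y $ a)) x + partial i (\<lambda>y. \<phi> y $ a) x * partial j f x) +
     (\<phi> x $ a * partial j (partial i f) x + partial i f x * partial j (\<lambda>y. \<phi> y $ a) x)" if x: "x \<in> N" for i j a x
    using partial_cong[OF N x first, where i = j] by (simp add: partial_add partial_mult c[OF x])
  have d\<phi>: "partial j (partial i (\<lambda>y. \<phi> y $ a)) x = (\<Sum>k\<in>UNIV. P x k i j * partial k (\<lambda>y. \<phi> y $ a) x)
       + \<theta> j x * partial i (\<lambda>y. \<phi> y $ a) x + \<theta> i x * partial j (\<lambda>y. \<phi> y $ a) x" if x: "x \<in> N" for i j a x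
  proof -
    have "partial j (partial i (\<lambda>y. \<phi> y $ a)) x = (\<Sum>k\<in>UNIV. jacobian \<phi> x $ a $ k * G x k j i)"
      unfolding G_def by (rule pullback_flat_jacobian[OF b NV(1)[OF x], symmetric])
    also have "\<dots> = (\<Sum>k\<in>UNIV. P x k i j * partial k (\<lambda>y. \<phi> y $ a) x + ((if k = j then \<theta> i x * partial j (\<lambda>y. \<phi> y $ a) x else 0) + (if k = i then \<theta> j x * partial i (\<lambda>y. \<phi> y $ a) x else 0)))"
      unfolding GP[OF NV(1)[OF x]] Psym[OF NV(1)[OF x], of _ j i]
      by (intro sum.cong refl) (auto simp: algebra_simps)
    finally show ?thesis by (simp add: sum.distrib)
  qed
  have eqY: "partial j (partial i (Y a)) x = \<rho> x i j * Y a x + (\<Sum>k\<in>UNIV. P x k i j * partial k (Y a) x)" if x: "x \<in> N" for i j a x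
  proof (cases a)
    case None then show ?thesis using NV(3)[OF x] by (simp add: Y_def \<rho>_def)
  next
    case (Some d)
    let ?T = "\<Sum>k\<in>UNIV. P x k i j * partial k (\<lambda>y. \<phi> y $ d) x" and ?Q = "\<Sum>k\<in>UNIV. P x k i j * partial k f x"
    have 1: "(\<Sum>k\<in>UNIV. P x k i j * partial k (\<lambda>x. f x * \<phi> x $ d) x) = f x * ?T + \<phi> x $ d * ?Q"
      unfolding first[OF x] by (simp add: distrib_left sum.distrib sum_distrib_left mult_ac)
    have 2: "partial j (partial i f) x = \<rho> x i j * f x + ?Q" using NV(3)[OF x] by (simp add: \<rho>_def)
    have "partial j (partial i (\<lambda>x. f x * \<phi> x $ d)) x = \<rho> x i j * (f x * \<phi> x $ d) + (f x * ?T + \<phi> x $ d * ?Q)"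
      unfolding second[OF x] d\<phi>[OF x] 2 df[OF NV(2)[OF x]] by (simp add: algebra_simps)
    then show ?thesis using 1 Some by (simp add: Y_def)
  qed
  have curv0: "sys_curv (gauge_system P \<rho>) i j k l x = 0" if x: "x \<in> N" for i j k l x
  proof (rule spanning_curvature_zero[where X = X, OF N x gauge_system_holo[OF affN h\<rho>] hX])
    show "partial j (\<lambda>y. X a y $ k) y = (\<Sum>l\<in>UNIV. gauge_system P \<rho> j k l y * X a y $ l)" if "y \<in> N" for a y j k
      using eqY[OF that] by (cases k) (simp_all add: X_def sum_option if_distribR if_distrib cong: if_cong)
    fix c :: "complex^('n option)" assume 0: "\<And>a. (\<Sum>l\<in>UNIV. c $ l * X a x $ l) = 0"
    have N0: "c $ None * f x + (\<Sum>k\<in>UNIV. c $ Some k * partial k f x) = 0"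
      using 0[of None] by (simp add: sum_option X_def Y_def)
    have "(\<Sum>k\<in>UNIV. (\<chi> k. c $ Some k) $ k * partial k (\<lambda>y. \<phi> y $ a) x) = 0" for a
    proof -
      have "(\<Sum>k\<in>UNIV. c $ Some k * partial k (\<lambda>x. f x * \<phi> x $ a) x) = f x * (\<Sum>k\<in>UNIV. c $ Some k * partial k (\<lambda>y. \<phi> y $ a) x) + \<phi> x $ a * (\<Sum>k\<in>UNIV. c $ Some k * partial k f x)"
        unfolding first[OF x] by (simp add: distrib_left sum.distrib sum_distrib_left mult_ac)
      then have "\<phi> x $ a * (c $ None * f x + (\<Sum>k\<in>UNIV. c $ Some k * partial k f x)) + f x * (\<Sum>k\<in>UNIV. c $ Some k * partial k (\<lambda>y. \<phi> y $ a) x) = 0"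
        using 0[of "Some a"] by (simp add: sum_option X_def Y_def algebra_simps)
      then show ?thesis using N0 NV(3)[OF x] by simp
    qed
    from jacobian_rows_span[OF b NV(1)[OF x] this] have "c $ Some k = 0" for k by (simp add: vec_eq_iff)
    moreover from this have "c $ None = 0" using N0 NV(3)[OF x] by simp
    ultimately show "c = 0" unfolding vec_eq_iff by (metis option.exhaust zero_index)
  qed
  have normal: "\<rho> x i d = schouten P x i d" if x: "x \<in> N" for i d x
  proof -
    have xV: "x \<in> V" by (rule NV(1)[OF x])
    have cP: "cdiff_at (\<lambda>y. P y k i j) x" for k i j by (rule c(6)[OF x])
    have e: "partial a (\<lambda>y. P y a i d) x - partial d (\<lambda>y. P y a i a) x +
        ((\<rho> x i d - (if a = d then \<rho> x i a else 0)) + ((\<Sum>s\<in>UNIV. P x s i d * P x a s a) - (\<Sum>s\<in>UNIV. P x s i a * P x a s d))) = 0" for a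
      using curv0[OF x, of a d "Some i" "Some a"]
      by (cases "a = d") (simp_all add: sys_curv_def sum_option gauge_system_def[abs_def] sum_subtractf algebra_simps)
    have tr: "(\<Sum>a\<in>UNIV. P y a i a) = 0" if "y \<in> V" for y i using Ptr[OF that, of i] Psym[OF that, of _ i] by simp
    have "(\<Sum>a\<in>UNIV. partial d (\<lambda>y. P y a i a) x) = partial d (\<lambda>y. \<Sum>a\<in>UNIV. P y a i a) x"
      by (simp add: partial_sum cP)
    also have "\<dots> = 0" using partial_cong[OF B(1) xV, of "\<lambda>y. \<Sum>a\<in>UNIV. P y a i a" "\<lambda>_. 0"] tr by simp
    finally have t1: "(\<Sum>a\<in>UNIV. partial d (\<lambda>y. P y a i a) x) = 0" .
    have t2: "(\<Sum>a\<in>UNIV. \<Sum>s\<in>UNIV. P x s i d * P x a s a) = 0"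
      by (subst sum.swap) (simp add: sum_distrib_left[symmetric] tr[OF xV])
    have "(\<Sum>a\<in>UNIV. partial a (\<lambda>y. P y a i d) x - partial d (\<lambda>y. P y a i a) x +
        ((\<rho> x i d - (if a = d then \<rho> x i a else 0)) + ((\<Sum>s\<in>UNIV. P x s i d * P x a s a) - (\<Sum>s\<in>UNIV. P x s i a * P x a s d)))) = 0"
      unfolding e by simp
    then have "(\<Sum>a\<in>UNIV. partial a (\<lambda>y. P y a i d) x) + (?n * \<rho> x i d - \<rho> x i d - (\<Sum>a\<in>UNIV. \<Sum>s\<in>UNIV. P x s i a * P x a s d)) = 0"
      by (simp add: sum.distrib sum_subtractf t1 t2)
    then have "thomas_ricci P x i d + (?n * \<rho> x i d - \<rho> x i d) = 0"
      unfolding thomas_ricci_def by (simp add: algebra_simps)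
    then have "thomas_ricci P x i d = (1 - ?n) * \<rho> x i d" by (simp add: algebra_simps eq_neg_iff_add_eq_0)
    then show ?thesis using n2 by (simp add: schouten_def)
  qed
  have geq: "gauge_system P \<rho> j k l x = gauge_system P (schouten P) j k l x" if "x \<in> N" for j k l x
    by (cases k; cases l) (simp_all add: normal[OF that])
  have "partial i (gauge_system P \<rho> j k l) p = partial i (gauge_system P (schouten P) j k l) p" for i j k l
    by (rule partial_cong[OF N pN geq])
  then show ?thesis using curv0[OF pN, of i j k l] by (simp add: sys_curv_def geq[OF pN])
qed

section \<open>The projective connection of a web\<close>

definition proj_class :: "(complex^'n::finite) set \<Rightarrow> 'n christoffel \<Rightarrow> 'n projective_connection" where
  "proj_class U \<Gamma> = {\<Gamma>'. affine_connection U \<Gamma>' \<and> proj_similar U \<Gamma> \<Gamma>'}"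

lemma projective_connections_iff:
  fixes U :: "(complex^'n::finite) set"
  assumes "open U"
  shows "\<PP> \<in> projective_connections U \<longleftrightarrow> (\<exists>\<Gamma>. affine_connection U \<Gamma> \<and> \<PP> = proj_class U \<Gamma>)"
proof -
  have "proj_rel U `` {\<Gamma>} = proj_class U \<Gamma>" if "affine_connection U \<Gamma>" for \<Gamma>
    using that proj_equivalent_iff_similar[OF assms that] by (auto simp: proj_rel_def proj_class_def)
  then show ?thesis unfolding projective_connections_def quotient_def by auto
qed

lemma proj_class_eq: "proj_similar U \<Gamma> \<Gamma>' \<Longrightarrow> proj_class U \<Gamma> = proj_class U \<Gamma>'"
  unfolding proj_class_def using proj_similar_trans proj_similar_sym by blast

lemma tangency_proj_similar:
  assumes "proj_similar U \<Gamma> \<Gamma>'" "x \<in> U" "tangency U F x (\<Gamma>' x)"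
  shows "tangency U F x (\<Gamma> x)"
  by (rule tangency_similar[OF assms(3)]) (use assms(1,2) in \<open>auto simp: proj_similar_def\<close>)

lemma compatible_class:
  fixes \<Gamma> :: "'n::finite christoffel"
  assumes op: "open U" and aff: "affine_connection U \<Gamma>" and fol: "\<And>i. i < d \<Longrightarrow> foliation U (W i)"
  shows "compatible d U (proj_class U \<Gamma>) W \<longleftrightarrow> (\<forall>i<d. \<forall>x\<in>U. tangency U (W i) x (\<Gamma> x))"
proof
  assume comp: "compatible d U (proj_class U \<Gamma>) W"
  have G: "\<Gamma> \<in> proj_class U \<Gamma>" using aff proj_similar_refl by (simp add: proj_class_def)
  have tot: "totally_geodesic U \<Gamma> (subtopology (leaf_topology U (W i)) L) (W i)" if "i < d" "L \<in> leaves U (W i)" for i L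
    using comp[unfolded compatible_def, rule_format, OF G that] .
  show "\<forall>i<d. \<forall>x\<in>U. tangency U (W i) x (\<Gamma> x)"
  proof (intro allI impI ballI)
    fix i x assume i: "i < d" and x: "x \<in> U"
    show "tangency U (W i) x (\<Gamma> x)"
      by (rule tangency_of_totally_geodesic[OF op fol[OF i] aff tot[OF i] x])
  qed
next
  assume t: "\<forall>i<d. \<forall>x\<in>U. tangency U (W i) x (\<Gamma> x)"
  show "compatible d U (proj_class U \<Gamma>) W"
    unfolding compatible_def
  proof (intro ballI allI impI)
    fix \<Gamma>' i L assume G: "\<Gamma>' \<in> proj_class U \<Gamma>" and i: "i < d" and L: "L \<in> leaves U (W i)"
    have G1: "affine_connection U \<Gamma>'" and "proj_similar U \<Gamma> \<Gamma>'"
      using G by (simp_all add: proj_class_def)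
    then have G2: "proj_similar U \<Gamma>' \<Gamma>" by (metis proj_similar_sym)
    show "totally_geodesic U \<Gamma>' (subtopology (leaf_topology U (W i)) L) (W i)"
    proof (rule totally_geodesic_of_tangency[OF op fol[OF i] G1 _ L])
      fix x assume x: "x \<in> U"
      show "tangency U (W i) x (\<Gamma>' x)"
        by (rule tangency_proj_similar[OF G2 x]) (use t i x in blast)
    qed
  qed
qed

lemma thomas_class:
  fixes P :: "'n::finite christoffel"
  assumes op: "open U" and aff: "affine_connection U P" and tf: "\<And>x. x \<in> U \<Longrightarrow> trace_free (P x)"
    and out: "\<And>x. x \<notin> U \<Longrightarrow> P x = (\<lambda>_ _ _. 0)"
  shows "thomas U (proj_class U P) = P"
  unfolding thomas_def
proof (rule the_equality)
  show "P \<in> proj_class U P \<and> (\<forall>x\<in>U. \<forall>k i j. P x k i j = P x k j i) \<and>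
      (\<forall>x\<in>U. \<forall>j. (\<Sum>l\<in>UNIV. P x l l j) = 0) \<and> (\<forall>x k i j. x \<notin> U \<longrightarrow> P x k i j = 0)"
  proof (intro conjI)
    show "P \<in> proj_class U P" using aff proj_similar_refl by (simp add: proj_class_def)
    show "\<forall>x\<in>U. \<forall>k i j. P x k i j = P x k j i" "\<forall>x\<in>U. \<forall>j. (\<Sum>l\<in>UNIV. P x l l j) = 0"
      using tf unfolding trace_free_def by blast+
    show "\<forall>x k i j. x \<notin> U \<longrightarrow> P x k i j = 0" using out by simp
  qed
  fix \<Gamma> assume G: "\<Gamma> \<in> proj_class U P \<and> (\<forall>x\<in>U. \<forall>k i j. \<Gamma> x k i j = \<Gamma> x k j i) \<and>
      (\<forall>x\<in>U. \<forall>j. (\<Sum>l\<in>UNIV. \<Gamma> x l l j) = 0) \<and> (\<forall>x k i j. x \<notin> U \<longrightarrow> \<Gamma> x k i j = 0)"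
  show "\<Gamma> = P"
  proof
    fix x
    show "\<Gamma> x = P x"
    proof (cases "x \<in> U")
      case True
      have "trace_free (\<Gamma> x)" unfolding trace_free_def using G True by blast
      moreover have "proj_similar U \<Gamma> P" using G proj_similar_sym by (auto simp: proj_class_def)
      ultimately show ?thesis
        using trace_free_unique[of "\<Gamma> x" "P x"] tf[OF True] True by (auto simp: proj_similar_def)
    next
      case False
      then show ?thesis using G out[OF False] by (auto simp: fun_eq_iff)
    qed
  qed
qed

lemma web_foliation: "web d U W \<Longrightarrow> i < d \<Longrightarrow> foliation U (W i)"
  by (simp add: web_def)

lemma affine_connection_subset: "affine_connection U \<Gamma> \<Longrightarrow> V \<subseteq> U \<Longrightarrow> affine_connection V \<Gamma>"
  by (auto simp: affine_connection_def intro: holo_fun_subset)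

lemma web_connection_unique:
  fixes U :: "(complex^'n::finite) set"
  assumes op: "open U" and web: "web (CARD('n) + 2) U W"
  shows "proj_class U (web_symbol U W) \<in> projective_connections U"
    and "compatible (CARD('n) + 2) U (proj_class U (web_symbol U W)) W"
    and "\<And>\<PP>. \<PP> \<in> projective_connections U \<Longrightarrow> compatible (CARD('n) + 2) U \<PP> W \<Longrightarrow> \<PP> = proj_class U (web_symbol U W)"
proof -
  note P = web_symbol[OF web]
  show "proj_class U (web_symbol U W) \<in> projective_connections U"
    using projective_connections_iff[OF op] P(1) by blast
  show "compatible (CARD('n) + 2) U (proj_class U (web_symbol U W)) W"
  proof (subst compatible_class[OF op P(1)])
    show "foliation U (W i)" if "i < CARD('n) + 2" for i by (rule web_foliation[OF web that])
  qed (intro allI impI ballI P(3))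
  fix \<PP> assume PP: "\<PP> \<in> projective_connections U" "compatible (CARD('n) + 2) U \<PP> W"
  obtain \<Gamma> where G: "affine_connection U \<Gamma>" "\<PP> = proj_class U \<Gamma>"
    using PP(1) projective_connections_iff[OF op] by blast
  have t: "\<forall>i<CARD('n) + 2. \<forall>x\<in>U. tangency U (W i) x (\<Gamma> x)"
  proof (subst compatible_class[OF op G(1), symmetric])
    show "foliation U (W i)" if "i < CARD('n) + 2" for i by (rule web_foliation[OF web that])
    show "compatible (CARD('n) + 2) U (proj_class U \<Gamma>) W" using PP(2) by (simp only: G(2))
  qed
  have "proj_similar U \<Gamma> (web_symbol U W)"
    unfolding proj_similar_def
  proof (intro ballI allI)
    fix x v assume x: "x \<in> U"
    show "\<exists>s. quad_form (\<Gamma> x) v - quad_form (web_symbol U W x) v = s *s v"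
      by (rule web_tangency_unique[OF web x]) (use t P(3) x in auto)
  qed
  then show "\<PP> = proj_class U (web_symbol U W)" using proj_class_eq G(2) by blast
qed

lemma proj_flat_class:
  fixes P :: "'n::finite christoffel"
  assumes op: "open U" and aff: "affine_connection U P"
  shows "proj_flat U (proj_class U P) \<longleftrightarrow> (\<forall>p\<in>U. \<exists>V \<phi>. p \<in> V \<and> V \<subseteq> U \<and>
     biholomorphism V \<phi> (\<phi> ` V) \<and> proj_similar V P (pullback_connection \<phi> (\<lambda>_ _ _ _. 0)))"
proof -
  have "(\<forall>\<Gamma>\<in>proj_class U P. proj_equivalent V \<Gamma> (pullback_connection \<phi> (\<lambda>_ _ _ _. 0))) \<longleftrightarrow>
      proj_similar V P (pullback_connection \<phi> (\<lambda>_ _ _ _. 0))" (is "?L \<longleftrightarrow> ?R")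
    if V: "V \<subseteq> U" and b: "biholomorphism V \<phi> (\<phi> ` V)" for V and \<phi> :: "complex^'n \<Rightarrow> complex^'n"
  proof -
    have eq: "proj_equivalent V \<Gamma> (pullback_connection \<phi> (\<lambda>_ _ _ _. 0)) \<longleftrightarrow> proj_similar V \<Gamma> (pullback_connection \<phi> (\<lambda>_ _ _ _. 0))"
      if "affine_connection U \<Gamma>" for \<Gamma>
      by (rule proj_equivalent_iff_similar[OF biholo_facts(1)[OF b] affine_connection_subset[OF that V] pullback_flat_holo[OF b]])
    show ?thesis
    proof
      assume ?L
      moreover have "P \<in> proj_class U P" using aff proj_similar_refl by (simp add: proj_class_def)
      ultimately show ?R using eq[OF aff] by blast
    next
      assume R: ?R
      show ?L
      proof
        fix \<Gamma> assume "\<Gamma> \<in> proj_class U P"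
        then have G: "affine_connection U \<Gamma>" "proj_similar V \<Gamma> P"
          using proj_similar_subset[OF proj_similar_sym V] by (auto simp: proj_class_def)
        show "proj_equivalent V \<Gamma> (pullback_connection \<phi> (\<lambda>_ _ _ _. 0))"
          unfolding eq[OF G(1)] by (rule proj_similar_trans[OF G(2) R])
      qed
    qed
  qed
  then show ?thesis unfolding proj_flat_def by (intro ball_cong refl ex_cong1) blast
qed

text \<open>A web is linear iff the flat connection has all its leaves as totally geodesic submanifolds; this
  condition is pulled back by the chart.\<close>

lemma linear_web_iff_tangency:
  fixes U :: "(complex^'n::finite) set"
  assumes b: "biholomorphism V \<phi> V'" and V: "V \<subseteq> U" and fol: "\<And>i. i < d \<Longrightarrow> foliation U (W i)"
  shows "linear_web d V' (\<lambda>i. push_foliation V \<phi> (W i)) \<longleftrightarrow>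
    (\<forall>i<d. \<forall>x\<in>V. tangency U (W i) x (pullback_connection \<phi> (\<lambda>_ _ _ _. 0) x))"
proof -
  note B = biholo_facts[OF b]
  have fol': "foliation V' (push_foliation V \<phi> (W i))" if "i < d" for i
    by (rule push_foliation_foliation[OF b V fol[OF that]])
  have "(\<forall>L\<in>leaves V' (push_foliation V \<phi> (W i)). \<exists>a b. a \<noteq> 0 \<and> openin (top_of_set {x. (\<Sum>j\<in>UNIV. a $ j * x $ j) = b}) L)
      \<longleftrightarrow> (\<forall>y\<in>V'. tangency V' (push_foliation V \<phi> (W i)) y (\<lambda>_ _ _. 0))" if i: "i < d" for i
    using tangency_of_linear_leaves[OF B(2) fol'[OF i]] linear_leaves_of_tangency[OF B(2) fol'[OF i]] by blast
  moreover have "(\<forall>y\<in>V'. tangency V' (push_foliation V \<phi> (W i)) y (\<lambda>_ _ _. 0)) \<longleftrightarrow>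
      (\<forall>x\<in>V. tangency U (W i) x (pullback_connection \<phi> (\<lambda>_ _ _ _. 0) x))" if i: "i < d" for i
  proof -
    have "(\<forall>y\<in>V'. Q y) \<longleftrightarrow> (\<forall>x\<in>V. Q (\<phi> x))" for Q using B(5,7,8) by metis
    then show ?thesis using tangency_transport[OF b V fol[OF i]] by simp
  qed
  ultimately show ?thesis unfolding linear_web_def by simp
qed

theorem mainTheorem1:
  fixes U :: "(complex^'n) set" and W :: "nat \<Rightarrow> 'n foliation"
  assumes "CARD('n) \<ge> 2"
    and "complex_domain U"
    and "web (CARD('n) + 2) U W"
  shows "(\<exists>!\<PP>. \<PP> \<in> projective_connections U \<and> compatible (CARD('n) + 2) U \<PP> W) \<and>
    (linearizable (CARD('n) + 2) U W \<longleftrightarrow>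
       proj_flat U (web_connection (CARD('n) + 2) U W)) \<and>
    (proj_flat U (web_connection (CARD('n) + 2) U W) \<longleftrightarrow>
       (\<forall>x\<in>U. \<forall>j k. curvature U (web_connection (CARD('n) + 2) U W) x j k = 0))"
proof -
  let ?d = "CARD('n) + 2"
  have op: "open U" and ne: "U \<noteq> {}" and conn: "connected U"
    using assms(2) by (auto simp: complex_domain_def)
  note web = assms(3)
  define P where "P = web_symbol U W"
  note P = web_symbol[OF web, folded P_def] and uniq = web_connection_unique[OF op web, folded P_def]
  have out: "P x = (\<lambda>_ _ _. 0)" if "x \<notin> U" for x using that by (simp add: P_def web_symbol_def)
  have ex1: "\<exists>!\<PP>. \<PP> \<in> projective_connections U \<and> compatible ?d U \<PP> W"
    using uniq by blast
  have wc: "web_connection ?d U W = proj_class U P"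
    unfolding web_connection_def by (rule the_equality) (use uniq in blast)+
  have th: "thomas U (proj_class U P) = P" by (rule thomas_class[OF op P(1,2) out])
  let ?A = "gauge_system P (schouten P)"
  have curv: "(\<forall>x\<in>U. \<forall>j k. curvature U (proj_class U P) x j k = 0) \<longleftrightarrow> (\<forall>x\<in>U. \<forall>i j k l. sys_curv ?A i j k l x = 0)"
    unfolding vec_eq_iff zero_index curvature_sys_curv th by blast
  define flat_at where "flat_at V \<phi> \<longleftrightarrow> V \<subseteq> U \<and> biholomorphism V \<phi> (\<phi> ` V) \<and>
      proj_similar V P (pullback_connection \<phi> (\<lambda>_ _ _ _. 0))" for V and \<phi> :: "complex^'n \<Rightarrow> complex^'n"
  have flat: "proj_flat U (proj_class U P) \<longleftrightarrow> (\<forall>p\<in>U. \<exists>V \<phi>. p \<in> V \<and> flat_at V \<phi>)"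
    unfolding proj_flat_class[OF op P(1)] flat_at_def ..
  have local_zero: "sys_curv ?A i j k l x = 0" if "flat_at V \<phi>" "x \<in> V" for V \<phi> x i j k l
    by (rule curvature_of_flat[OF assms(1) _ affine_connection_subset[OF P(1)] P(2)])
       (use that in \<open>auto simp: flat_at_def\<close>)
  have lin: "linear_web ?d (\<phi> ` V) (\<lambda>i. push_foliation V \<phi> (W i)) \<longleftrightarrow> flat_at V \<phi>"
    if V: "V \<subseteq> U" and b: "biholomorphism V \<phi> (\<phi> ` V)" for V \<phi>
  proof -
    let ?G = "pullback_connection \<phi> (\<lambda>_ _ _ _. 0)"
    have lw: "linear_web ?d (\<phi> ` V) (\<lambda>i. push_foliation V \<phi> (W i)) \<longleftrightarrow> (\<forall>i<?d. \<forall>x\<in>V. tangency U (W i) x (?G x))"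
      by (rule linear_web_iff_tangency[OF b V web_foliation[OF web]])
    show ?thesis
    proof
    assume "linear_web ?d (\<phi> ` V) (\<lambda>i. push_foliation V \<phi> (W i))"
    then have t: "\<forall>i<?d. \<forall>x\<in>V. tangency U (W i) x (?G x)" by (simp only: lw)
    have "proj_similar V P ?G"
      unfolding proj_similar_def
    proof (intro ballI allI)
      fix x v assume x: "x \<in> V"
      show "\<exists>s. quad_form (P x) v - quad_form (?G x) v = s *s v"
        by (rule web_tangency_unique[OF web]) (use t P(3) x V in auto)
    qed
    then show "flat_at V \<phi>" using V b by (simp add: flat_at_def)
  next
    assume f: "flat_at V \<phi>"
    have "tangency U (W i) x (pullback_connection \<phi> (\<lambda>_ _ _ _. 0) x)" if "i < ?d" "x \<in> V" for i x
    proof (rule tangency_similar)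
      show "tangency U (W i) x (P x)" using P(3) that V by blast
      show "\<exists>s. quad_form (pullback_connection \<phi> (\<lambda>_ _ _ _. 0) x) v - quad_form (P x) v = s *s v" for v
        using proj_similar_sym[of V P] f that(2) by (auto simp: flat_at_def proj_similar_def)
    qed
    then show "linear_web ?d (\<phi> ` V) (\<lambda>i. push_foliation V \<phi> (W i))" by (simp only: lw) simp
    qed
  qed
  have lin_iff: "linearizable ?d U W \<longleftrightarrow> (\<exists>m\<in>U. \<exists>V \<phi>. m \<in> V \<and> flat_at V \<phi>)"
  proof -
    have "(m \<in> V \<and> V \<subseteq> U \<and> biholomorphism V \<phi> (\<phi> ` V) \<and>
       linear_web ?d (\<phi> ` V) (\<lambda>i. push_foliation V \<phi> (W i))) \<longleftrightarrow> (m \<in> V \<and> flat_at V \<phi>)" for m V \<phi>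
      using lin[of V \<phi>] flat_at_def[of V \<phi>] by auto
    then show ?thesis unfolding linearizable_def by (simp only:)
  qed
  \<comment> \<open>vanishing of the curvature spreads from a neighbourhood of one point to all of \<open>U\<close>\<close>
  have spread: "sys_curv ?A i j k l x = 0" if m: "m \<in> V" and f: "flat_at V \<phi>" and x: "x \<in> U" for m V \<phi> x i j k l
  proof (rule holo_identity[OF op conn, of _ V])
    have hA: "holo_fun (?A j k l) U" for j k l
      by (rule gauge_system_holo[OF P(1) schouten_holo[OF op P(1)]])
    show "holo_fun (sys_curv ?A i j k l) U"
      unfolding sys_curv_def holo_fun_iff
      by (intro ballI cdiff_add cdiff_diff cdiff_sum cdiff_mult holo_funD[OF hA] holo_funD[OF holo_partial[OF op hA]])
    show "open V" using f biholo_facts(1) by (auto simp: flat_at_def)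
  qed (use m x local_zero[OF f] f in \<open>auto simp: flat_at_def\<close>)
  have to_flat: "\<exists>V \<phi>. p \<in> V \<and> flat_at V \<phi>" if z: "\<forall>x\<in>U. \<forall>i j k l. sys_curv ?A i j k l x = 0" and p: "p \<in> U" for p
  proof -
    have sym: "P x k i j = P x k j i" if "x \<in> U" for x k i j using P(2)[OF that] by (simp add: trace_free_def)
    have z': "sys_curv ?A i j k l x = 0" if "x \<in> U" for x i j k l using z that by blast
    show ?thesis
    proof (rule flat_coordinates[OF op p P(1) sym schouten_holo[OF op P(1)] z'])
      fix V \<phi> assume "p \<in> V" "V \<subseteq> U" "biholomorphism V \<phi> (\<phi> ` V)"
        "proj_similar V P (pullback_connection \<phi> (\<lambda>_ _ _ _. 0))"
      then have "p \<in> V \<and> flat_at V \<phi>" by (simp add: flat_at_def)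
      then show ?thesis by (intro exI)
    qed
  qed
  have ii_iii: "(\<forall>p\<in>U. \<exists>V \<phi>. p \<in> V \<and> flat_at V \<phi>) \<longleftrightarrow> (\<forall>x\<in>U. \<forall>i j k l. sys_curv ?A i j k l x = 0)"
  proof
    assume fl: "\<forall>p\<in>U. \<exists>V \<phi>. p \<in> V \<and> flat_at V \<phi>"
    show "\<forall>x\<in>U. \<forall>i j k l. sys_curv ?A i j k l x = 0"
    proof (intro ballI allI)
      fix x i j k l assume "x \<in> U"
      then obtain V \<phi> where "x \<in> V" "flat_at V \<phi>" using fl by fast
      then show "sys_curv ?A i j k l x = 0" by (intro local_zero)
    qed
  next
    assume "\<forall>x\<in>U. \<forall>i j k l. sys_curv ?A i j k l x = 0"
    then show "\<forall>p\<in>U. \<exists>V \<phi>. p \<in> V \<and> flat_at V \<phi>" by (intro ballI) (rule to_flat)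
  qed
  moreover have "(\<exists>m\<in>U. \<exists>V \<phi>. m \<in> V \<and> flat_at V \<phi>) \<longleftrightarrow> (\<forall>p\<in>U. \<exists>V \<phi>. p \<in> V \<and> flat_at V \<phi>)"
  proof
    assume "\<exists>m\<in>U. \<exists>V \<phi>. m \<in> V \<and> flat_at V \<phi>"
    then obtain m V \<phi> where "m \<in> V" "flat_at V \<phi>" by fast
    then have "\<forall>x\<in>U. \<forall>i j k l. sys_curv ?A i j k l x = 0" by (intro ballI allI spread)
    then show "\<forall>p\<in>U. \<exists>V \<phi>. p \<in> V \<and> flat_at V \<phi>" by (intro ballI) (rule to_flat)
  next
    assume a: "\<forall>p\<in>U. \<exists>V \<phi>. p \<in> V \<and> flat_at V \<phi>"
    obtain p where p: "p \<in> U" using ne by auto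
    show "\<exists>m\<in>U. \<exists>V \<phi>. m \<in> V \<and> flat_at V \<phi>" by (rule bexI[OF _ p]) (rule bspec[OF a p])
  qed
  ultimately show ?thesis unfolding wc curv flat lin_iff using ex1 by blast
qed

end
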